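(* Let $p$ be a prime and let $\mathcal{E}_{\mathrm{st}}^\dagger$ be the stable Barratt–Eccles cochain operad over $\mathbb{F}_p$. The associated monad $\mathbf{E}_{\mathrm{st}}^\dagger$ on cochain complexes over $\mathbb{F}_p$ preserves quasi-isomorphisms: if $f\colon X\to Y$ is a quasi-isomorphism of (unbounded) cochain complexes over $\mathbb{F}_p$, then $\mathbf{E}_{\mathrm{st}}^\dagger(f)\colon \mathbf{E}_{\mathrm{st}}^\dagger X\to\mathbf{E}_{\mathrm{st}}^\dagger Y$ is a quasi-isomorphism.
   Context: Fix a prime $p$; the ground field is $\mathbb{F}_p$. Complexes are unbounded; $X[n]_d=X_{d-n}$ (and $X[n]^d=X^{d-n}$). For a chain complex $X$, $X^\dagger$ is the cochain complex with $(X^\dagger)^d=X_{-d}$; this is applied aritywise to operads. For a chain operad $\mathcal{P}$ the operadic suspension is $\Sigma\mathcal{P}=\mathcal{P}\otimes\mathcal{E}nd_{\mathbb{F}_p[1]}$ (aritywise tensor with the endomorphism operad of $\mathbb{F}_p[1]$), so $(\Sigma\mathcal{P})(n)\cong\mathcal{P}(n)[1-n]$; $\Sigma^k$ is its $k$-fold iterate. Barratt–Eccles chain operad $\mathcal{E}$: $\mathcal{E}(n)=\mathrm{C}_\bullet(E\Sigma_n;\mathbb{F}_p)$ (normalized chains), i.e. $\mathcal{E}(n)_d$ is spanned by tuples $(\rho_0,\dots,\rho_d)\in\Sigma_n^{d+1}$, tuples with $\rho_i=\rho_{i+1}$ for some $i$ being zero, with $\partial$ the alternating sum of deletions. $\Sigma_n$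 acts by $\sigma\cdot(\rho_0,\dots,\rho_d)=(\sigma\rho_0,\dots,\sigma\rho_d)$ (a right action is obtained via inverses). Composition is induced, via the Eilenberg–Zilber shuffle map, from the levelwise substitution of permutations: writing $\rho$ as the sequence $(\rho(1),\dots,\rho(n))$, the composite $u\circ_r v$ ($u\in\Sigma_n$, $v\in\Sigma_m$) replaces the entry $r$ of $u$ by the sequence of $v$ shifted by $r-1$ and raises the entries of $u$ larger than $r$ by $m-1$. Stabilization map $\Psi\colon\Sigma\mathcal{E}\to\mathcal{E}$: for $(\rho_0,\dots,\rho_{d+n-1})\in(\Sigma\mathcal{E})(n)_d=\mathcal{E}(n)_{d+n-1}$, put $\Psi(\rho_0,\dots,\rho_{d+n-1})=0$ if $(\rho_0(1),\dots,\rho_{n-1}(1))$ is not a permutation of $(1,\dots,n)$ (or if $d<0$), and otherwise $\Psi(\rho_0,\dots,\rho_{d+n-1})=\pm(\rho_{n-1},\dots,\rho_{d+n-1})$, with $\pm$ the sign of that permutation. The stable Barratt–Eccles chain operad is $\mathcal{E}_{\mathrm{st}}=\lim(\cdots\xrightarrow{\Sigma^2\Psi}\Sigma^2\mathcal{E}\xrightarrow{\Sigma\Psi}\Sigma\mathcal{E}\xrightarrow{\Psi}\mathcal{E})$, formed aritywise with compositions inherited from positive arities; $\mathcal{E}_{\mathrm{st}}(0)=0$ and $\mathcal{E}_{\mathrm{st}}(1)=\mathbb{F}_p[0]$. The cochain version is $\mathcal{E}_{\mathrm{st}}^\dagger=(\mathcal{E}_{\mathrm{st}})^\dagger$. The associated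 monad (also the free algebra functor) is $\mathbf{E}_{\mathrm{st}}^\dagger X=\bigoplus_{n\ge0}\mathcal{E}_{\mathrm{st}}^\dagger(n)\otimes_{\Sigma_n}X^{\otimes n}$. *)

theory Defs
  imports
    "HOL-Algebra.Module"
    "HOL-Algebra.AbelCoset"
    "HOL-Combinatorics.Permutations"
    "HOL-Number_Theory.Residues"
begin

section \<open>Modules\<close>

text \<open>The ring multiplication that a module record carries is irrelevant for
  \<^locale>\<open>module\<close>; it is left undefined throughout.\<close>

definition linear_map :: "('k, 'm) ring_scheme \<Rightarrow> ('k, 'a) module \<Rightarrow> ('k, 'b) module \<Rightarrow> ('a \<Rightarrow> 'b) \<Rightarrow> bool"
  where
  "linear_map R M N h \<longleftrightarrow>
     (\<forall>x\<in>carrier M. h x \<in> carrier N) \<and>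
     (\<forall>x\<in>carrier M. \<forall>y\<in>carrier M. h (x \<oplus>\<^bsub>M\<^esub> y) = h x \<oplus>\<^bsub>N\<^esub> h y) \<and>
     (\<forall>c\<in>carrier R. \<forall>x\<in>carrier M. h (c \<odot>\<^bsub>M\<^esub> x) = c \<odot>\<^bsub>N\<^esub> h x)"

definition pointwise_module :: "('i \<Rightarrow> ('k, 'a) module) \<Rightarrow> ('i \<Rightarrow> 'a) set \<Rightarrow> ('k, 'i \<Rightarrow> 'a) module"
  where
  "pointwise_module M A =
     \<lparr>carrier = A,
      monoid.mult = undefined,
      one = undefined,
      zero = (\<lambda>i. \<zero>\<^bsub>M i\<^esub>),
      add = (\<lambda>u v i. u i \<oplus>\<^bsub>M i\<^esub> v i),
      smult = (\<lambda>c u i. c \<odot>\<^bsub>M i\<^esub> u i)\<rparr>"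

definition free_module :: "('k, 'm) ring_scheme \<Rightarrow> 's set \<Rightarrow> ('k, 's \<Rightarrow> 'k) module"
  where
  "free_module R S =
     \<lparr>carrier = {u. (\<forall>s. u s \<in> carrier R) \<and> finite {s. u s \<noteq> \<zero>\<^bsub>R\<^esub>} \<and> {s. u s \<noteq> \<zero>\<^bsub>R\<^esub>} \<subseteq> S},
      monoid.mult = undefined,
      one = undefined,
      zero = (\<lambda>s. \<zero>\<^bsub>R\<^esub>),
      add = (\<lambda>u v s. u s \<oplus>\<^bsub>R\<^esub> v s),
      smult = (\<lambda>c u s. c \<otimes>\<^bsub>R\<^esub> u s)\<rparr>"

definition free_gen :: "('k, 'm) ring_scheme \<Rightarrow> 's \<Rightarrow> 's \<Rightarrow> 'k"
  where "free_gen R s = (\<lambda>t. if t = s then \<one>\<^bsub>R\<^esub> else \<zero>\<^bsub>R\<^esub>)"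

text \<open>The linear map from a free module to \<open>M\<close> with values \<open>\<phi>\<close> on the generators.\<close>

definition lin_ext :: "('k, 'm) ring_scheme \<Rightarrow> ('k, 'a) module \<Rightarrow> ('s \<Rightarrow> 'a) \<Rightarrow> ('s \<Rightarrow> 'k) \<Rightarrow> 'a"
  where "lin_ext R M \<phi> u = (\<Oplus>\<^bsub>M\<^esub>s\<in>{s. u s \<noteq> \<zero>\<^bsub>R\<^esub>}. u s \<odot>\<^bsub>M\<^esub> \<phi> s)"

definition module_span :: "('k, 'm) ring_scheme \<Rightarrow> ('k, 'a) module \<Rightarrow> 'a set \<Rightarrow> 'a set"
  where "module_span R M G = \<Inter>{N. submodule N R M \<and> G \<subseteq> N}"

text \<open>Adding \<open>N\<close> in the scalar multiplication matters only for non-invertible scalars.\<close>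

definition quot_module :: "('k, 'a) module \<Rightarrow> 'a set \<Rightarrow> ('k, 'a set) module"
  where
  "quot_module M N =
     \<lparr>carrier = a_rcosets\<^bsub>M\<^esub> N,
      monoid.mult = undefined,
      one = undefined,
      zero = N,
      add = (\<lambda>C D. C <+>\<^bsub>M\<^esub> D),
      smult = (\<lambda>c C. N <+>\<^bsub>M\<^esub> ((\<lambda>x. c \<odot>\<^bsub>M\<^esub> x) ` C))\<rparr>"

text \<open>Modules presented by generators \<open>S\<close> and relations \<open>Q\<close>. A map on generators that kills the
  relations descends to the presented module: \<^term>\<open>lin_ext R M \<phi>\<close> is then constant
  on every coset, and \<open>pres_lift\<close> returns this constant.\<close>

definition pres_module :: "('k, 'm) ring_scheme \<Rightarrow> 's set \<Rightarrow> ('s \<Rightarrow> 'k) set \<Rightarrow> ('k, ('s \<Rightarrow> 'k) set) module"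
  where "pres_module R S Q = quot_module (free_module R S) (module_span R (free_module R S) Q)"

definition pres_gen :: "('k, 'm) ring_scheme \<Rightarrow> 's set \<Rightarrow> ('s \<Rightarrow> 'k) set \<Rightarrow> 's \<Rightarrow> ('s \<Rightarrow> 'k) set"
  where
  "pres_gen R S Q s = module_span R (free_module R S) Q +>\<^bsub>free_module R S\<^esub> free_gen R s"

definition pres_lift :: "('k, 'm) ring_scheme \<Rightarrow> ('k, 'a) module \<Rightarrow> ('s \<Rightarrow> 'a) \<Rightarrow> ('s \<Rightarrow> 'k) set \<Rightarrow> 'a"
  where "pres_lift R M \<phi> C = the_elem (lin_ext R M \<phi> ` C)"


section \<open>Complexes\<close>

text \<open>One record serves for chain complexes (\<open>dif X d\<close> maps degree \<open>d\<close> to degree \<open>d - 1\<close>) and for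
  cochain complexes (\<open>dif X d\<close> maps degree \<open>d\<close> to degree \<open>d + 1\<close>). The graded pieces need not be
  disjoint as sets, so elements of tensor products below carry their degrees explicitly.
  In \<open>sym_complex\<close>, \<open>act P \<sigma> d\<close> is the left action of a permutation \<open>\<sigma>\<close> of \<open>{1..n}\<close> in degree \<open>d\<close>.\<close>

record ('k, 'a) complex_rec =
  obj :: "int \<Rightarrow> ('k, 'a) module"
  dif :: "int \<Rightarrow> 'a \<Rightarrow> 'a"

record ('k, 'a) sym_complex = "('k, 'a) complex_rec" +
  act :: "(nat \<Rightarrow> nat) \<Rightarrow> int \<Rightarrow> 'a \<Rightarrow> 'a"

definition cochain_complex :: "('k, 'm) ring_scheme \<Rightarrow> ('k, 'a, 'z) complex_rec_scheme \<Rightarrow> bool"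
  where
  "cochain_complex R X \<longleftrightarrow>
     (\<forall>d. module R (obj X d)) \<and>
     (\<forall>d. linear_map R (obj X d) (obj X (d + 1)) (dif X d)) \<and>
     (\<forall>d. \<forall>x\<in>carrier (obj X d). dif X (d + 1) (dif X d x) = \<zero>\<^bsub>obj X (d + 2)\<^esub>)"

definition cochain_map ::
  "('k, 'm) ring_scheme \<Rightarrow> ('k, 'a, 'y) complex_rec_scheme \<Rightarrow> ('k, 'b, 'z) complex_rec_scheme \<Rightarrow>
     (int \<Rightarrow> 'a \<Rightarrow> 'b) \<Rightarrow> bool"
  where
  "cochain_map R X Y f \<longleftrightarrow>
     cochain_complex R X \<and> cochain_complex R Y \<and>
     (\<forall>d. linear_map R (obj X d) (obj Y d) (f d)) \<and>
     (\<forall>d. \<forall>x\<in>carrier (obj X d). f (d + 1) (dif X d x) = dif Y d (f d x))"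

definition cocycles :: "('k, 'a, 'z) complex_rec_scheme \<Rightarrow> int \<Rightarrow> ('k, 'a) module"
  where
  "cocycles X d = (obj X d)\<lparr>carrier := {x \<in> carrier (obj X d). dif X d x = \<zero>\<^bsub>obj X (d + 1)\<^esub>}\<rparr>"

definition coboundaries :: "('k, 'a, 'z) complex_rec_scheme \<Rightarrow> int \<Rightarrow> 'a set"
  where "coboundaries X d = dif X (d - 1) ` carrier (obj X (d - 1))"

definition cohomology :: "('k, 'a, 'z) complex_rec_scheme \<Rightarrow> int \<Rightarrow> ('k, 'a set) module"
  where "cohomology X d = quot_module (cocycles X d) (coboundaries X d)"

definition cohomology_map ::
  "('k, 'b, 'z) complex_rec_scheme \<Rightarrow> (int \<Rightarrow> 'a \<Rightarrow> 'b) \<Rightarrow> int \<Rightarrow> 'a set \<Rightarrow> 'b set"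
  where
  "cohomology_map Y f d C =
     the_elem ((\<lambda>x. coboundaries Y d +>\<^bsub>cocycles Y d\<^esub> f d x) ` C)"

definition quasi_isomorphism ::
  "('k, 'm) ring_scheme \<Rightarrow> ('k, 'a, 'y) complex_rec_scheme \<Rightarrow> ('k, 'b, 'z) complex_rec_scheme \<Rightarrow>
     (int \<Rightarrow> 'a \<Rightarrow> 'b) \<Rightarrow> bool"
  where
  "quasi_isomorphism R X Y f \<longleftrightarrow>
     cochain_map R X Y f \<and>
     (\<forall>d. bij_betw (cohomology_map Y f d) (carrier (cohomology X d)) (carrier (cohomology Y d)))"

definition direct_sum :: "(nat \<Rightarrow> ('k, 'a) complex_rec) \<Rightarrow> ('k, nat \<Rightarrow> 'a) complex_rec"
  where
  "direct_sum C =
     \<lparr>obj = (\<lambda>d. pointwise_module (\<lambda>n. obj (C n) d)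
        {u. (\<forall>n. u n \<in> carrier (obj (C n) d)) \<and> finite {n. u n \<noteq> \<zero>\<^bsub>obj (C n) d\<^esub>}}),
      dif = (\<lambda>d u n. dif (C n) d (u n))\<rparr>"


section \<open>Tensor powers\<close>

text \<open>The word \<open>[(j\<^sub>1, x\<^sub>1), \<dots>, (j\<^sub>n, x\<^sub>n)]\<close> stands for the tensor of the homogeneous
  elements \<open>x\<^sub>i\<close> of degree \<open>j\<^sub>i\<close>.\<close>

definition neg_one_pow :: "int \<Rightarrow> int"
  where "neg_one_pow d = (if even d then 1 else - 1)"

definition tensor_words :: "('k, 'a, 'z) complex_rec_scheme \<Rightarrow> nat \<Rightarrow> int \<Rightarrow> (int \<times> 'a) list set"
  where
  "tensor_words X n d =
     {w. length w = n \<and> (\<forall>(j, x)\<in>set w. x \<in> carrier (obj X j)) \<and> sum_list (map fst w) = d}"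

definition multilinear_rels ::
  "('k, 'm) ring_scheme \<Rightarrow> ('k, 'a, 'z) complex_rec_scheme \<Rightarrow> nat \<Rightarrow> int \<Rightarrow> ((int \<times> 'a) list \<Rightarrow> 'k) set"
  where
  "multilinear_rels R X n d = (let F = free_module R (tensor_words X n d) in
     {free_gen R (u @ (j, x \<oplus>\<^bsub>obj X j\<^esub> y) # v)
        \<ominus>\<^bsub>F\<^esub> (free_gen R (u @ (j, x) # v) \<oplus>\<^bsub>F\<^esub> free_gen R (u @ (j, y) # v)) | u v j x y.
        u @ (j, x) # v \<in> tensor_words X n d \<and> y \<in> carrier (obj X j)} \<union>
     {free_gen R (u @ (j, c \<odot>\<^bsub>obj X j\<^esub> x) # v)
        \<ominus>\<^bsub>F\<^esub> (c \<odot>\<^bsub>F\<^esub> free_gen R (u @ (j, x) # v)) | u v j c x.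
        u @ (j, x) # v \<in> tensor_words X n d \<and> c \<in> carrier R})"

definition tensor_module ::
  "('k, 'm) ring_scheme \<Rightarrow> ('k, 'a, 'z) complex_rec_scheme \<Rightarrow> nat \<Rightarrow> int \<Rightarrow>
     ('k, ((int \<times> 'a) list \<Rightarrow> 'k) set) module"
  where
  "tensor_module R X n d = pres_module R (tensor_words X n d) (multilinear_rels R X n d)"

definition pure_tensor ::
  "('k, 'm) ring_scheme \<Rightarrow> ('k, 'a, 'z) complex_rec_scheme \<Rightarrow> nat \<Rightarrow> int \<Rightarrow> (int \<times> 'a) list \<Rightarrow>
     ((int \<times> 'a) list \<Rightarrow> 'k) set"
  where
  "pure_tensor R X n d w = pres_gen R (tensor_words X n d) (multilinear_rels R X n d) w"

text \<open>\<open>\<sigma>\<close> puts the factor in position \<open>i\<close> into position \<open>\<sigma> i\<close>, so position \<open>i\<close> of the result is the old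
  position \<open>\<sigma>\<inverse> i\<close>; the sign counts the transposed pairs of odd factors.
  Positions are \<open>1..n\<close>, list indices \<open>0..n-1\<close>.\<close>

definition permute_word :: "(nat \<Rightarrow> nat) \<Rightarrow> (int \<times> 'a) list \<Rightarrow> (int \<times> 'a) list"
  where "permute_word \<sigma> w = map (\<lambda>i. w ! (inv_into UNIV \<sigma> (Suc i) - 1)) [0..<length w]"

definition permute_sign :: "(nat \<Rightarrow> nat) \<Rightarrow> (int \<times> 'a) list \<Rightarrow> int"
  where
  "permute_sign \<sigma> w =
     (\<Prod>(i, j)\<in>{(i, j). i < j \<and> j < length w \<and> \<sigma> (Suc j) < \<sigma> (Suc i)}.
        neg_one_pow (fst (w ! i) * fst (w ! j)))"

definition tensor_power ::
  "('k, 'm) ring_scheme \<Rightarrow> ('k, 'a, 'z) complex_rec_scheme \<Rightarrow> nat \<Rightarrow>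
     ('k, ((int \<times> 'a) list \<Rightarrow> 'k) set) sym_complex"
  where
  "tensor_power R X n =
     \<lparr>obj = tensor_module R X n,
      dif = (\<lambda>d. pres_lift R (tensor_module R X n (d + 1))
        (\<lambda>w. \<Oplus>\<^bsub>tensor_module R X n (d + 1)\<^esub>i\<in>{..<n}.
           [neg_one_pow (sum_list (map fst (take i w)))] \<cdot>\<^bsub>tensor_module R X n (d + 1)\<^esub>
             pure_tensor R X n (d + 1) (w[i := (fst (w ! i) + 1, dif X (fst (w ! i)) (snd (w ! i)))]))),
      act = (\<lambda>\<sigma> d. pres_lift R (tensor_module R X n d)
        (\<lambda>w. [permute_sign \<sigma> w] \<cdot>\<^bsub>tensor_module R X n d\<^esub> pure_tensor R X n d (permute_word \<sigma> w)))\<rparr>"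

definition tensor_power_map ::
  "('k, 'm) ring_scheme \<Rightarrow> ('k, 'b, 'z) complex_rec_scheme \<Rightarrow> (int \<Rightarrow> 'a \<Rightarrow> 'b) \<Rightarrow> nat \<Rightarrow> int \<Rightarrow>
     ((int \<times> 'a) list \<Rightarrow> 'k) set \<Rightarrow> ((int \<times> 'b) list \<Rightarrow> 'k) set"
  where
  "tensor_power_map R Y f n d =
     pres_lift R (tensor_module R Y n d) (\<lambda>w. pure_tensor R Y n d (map (\<lambda>(j, x). (j, f j x)) w))"


section \<open>Tensor products over the symmetric group\<close>

text \<open>\<open>P \<otimes> M\<close> over the group ring of the permutations of \<open>{1..n}\<close>, for cochain complexes \<open>P\<close> and \<open>M\<close>.
  The triple \<open>(i, a, b)\<close> stands for \<open>a \<otimes> b\<close> with \<open>a\<close> of degree \<open>i\<close> and \<open>b\<close> of degree \<open>d - i\<close>.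
  The right action on \<open>P\<close> is the left action of the inverse, and the last family of relations
  is \<open>a \<cdot> \<sigma> \<otimes> b = a \<otimes> \<sigma> \<cdot> b\<close>.\<close>

definition bal_pairs ::
  "('k, 'a) sym_complex \<Rightarrow> ('k, 'b) sym_complex \<Rightarrow> int \<Rightarrow> (int \<times> 'a \<times> 'b) set"
  where
  "bal_pairs P M d = {(i, a, b). a \<in> carrier (obj P i) \<and> b \<in> carrier (obj M (d - i))}"

definition bal_rels ::
  "('k, 'm) ring_scheme \<Rightarrow> nat \<Rightarrow> ('k, 'a) sym_complex \<Rightarrow> ('k, 'b) sym_complex \<Rightarrow> int \<Rightarrow>
     ((int \<times> 'a \<times> 'b) \<Rightarrow> 'k) set"
  where
  "bal_rels R n P M d = (let F = free_module R (bal_pairs P M d) in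
     {free_gen R (i, a \<oplus>\<^bsub>obj P i\<^esub> a', b) \<ominus>\<^bsub>F\<^esub> (free_gen R (i, a, b) \<oplus>\<^bsub>F\<^esub> free_gen R (i, a', b)) | i a a' b.
        a \<in> carrier (obj P i) \<and> a' \<in> carrier (obj P i) \<and> b \<in> carrier (obj M (d - i))} \<union>
     {free_gen R (i, a, b \<oplus>\<^bsub>obj M (d - i)\<^esub> b') \<ominus>\<^bsub>F\<^esub> (free_gen R (i, a, b) \<oplus>\<^bsub>F\<^esub> free_gen R (i, a, b')) | i a b b'.
        a \<in> carrier (obj P i) \<and> b \<in> carrier (obj M (d - i)) \<and> b' \<in> carrier (obj M (d - i))} \<union>
     {free_gen R (i, c \<odot>\<^bsub>obj P i\<^esub> a, b) \<ominus>\<^bsub>F\<^esub> (c \<odot>\<^bsub>F\<^esub> free_gen R (i, a, b)) | i a b c.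
        a \<in> carrier (obj P i) \<and> b \<in> carrier (obj M (d - i)) \<and> c \<in> carrier R} \<union>
     {free_gen R (i, a, c \<odot>\<^bsub>obj M (d - i)\<^esub> b) \<ominus>\<^bsub>F\<^esub> (c \<odot>\<^bsub>F\<^esub> free_gen R (i, a, b)) | i a b c.
        a \<in> carrier (obj P i) \<and> b \<in> carrier (obj M (d - i)) \<and> c \<in> carrier R} \<union>
     {free_gen R (i, act P (inv_into UNIV \<sigma>) i a, b) \<ominus>\<^bsub>F\<^esub> free_gen R (i, a, act M \<sigma> (d - i) b) | i a b \<sigma>.
        a \<in> carrier (obj P i) \<and> b \<in> carrier (obj M (d - i)) \<and> \<sigma> permutes {1..n}})"

definition bal_module ::
  "('k, 'm) ring_scheme \<Rightarrow> nat \<Rightarrow> ('k, 'a) sym_complex \<Rightarrow> ('k, 'b) sym_complex \<Rightarrow> int \<Rightarrow>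
     ('k, ((int \<times> 'a \<times> 'b) \<Rightarrow> 'k) set) module"
  where "bal_module R n P M d = pres_module R (bal_pairs P M d) (bal_rels R n P M d)"

definition bal_gen ::
  "('k, 'm) ring_scheme \<Rightarrow> nat \<Rightarrow> ('k, 'a) sym_complex \<Rightarrow> ('k, 'b) sym_complex \<Rightarrow> int \<Rightarrow>
     int \<times> 'a \<times> 'b \<Rightarrow> ((int \<times> 'a \<times> 'b) \<Rightarrow> 'k) set"
  where "bal_gen R n P M d = pres_gen R (bal_pairs P M d) (bal_rels R n P M d)"

definition bal_tensor ::
  "('k, 'm) ring_scheme \<Rightarrow> nat \<Rightarrow> ('k, 'a) sym_complex \<Rightarrow> ('k, 'b) sym_complex \<Rightarrow>
     ('k, ((int \<times> 'a \<times> 'b) \<Rightarrow> 'k) set) complex_rec"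
  where
  "bal_tensor R n P M =
     \<lparr>obj = bal_module R n P M,
      dif = (\<lambda>d. pres_lift R (bal_module R n P M (d + 1))
        (\<lambda>(i, a, b). bal_gen R n P M (d + 1) (i + 1, dif P i a, b)
           \<oplus>\<^bsub>bal_module R n P M (d + 1)\<^esub>
           [neg_one_pow i] \<cdot>\<^bsub>bal_module R n P M (d + 1)\<^esub> bal_gen R n P M (d + 1) (i, a, dif M (d - i) b)))\<rparr>"

definition bal_tensor_map ::
  "('k, 'm) ring_scheme \<Rightarrow> nat \<Rightarrow> ('k, 'a) sym_complex \<Rightarrow> ('k, 'c) sym_complex \<Rightarrow>
     (int \<Rightarrow> 'b \<Rightarrow> 'c) \<Rightarrow> int \<Rightarrow> ((int \<times> 'a \<times> 'b) \<Rightarrow> 'k) set \<Rightarrow> ((int \<times> 'a \<times> 'c) \<Rightarrow> 'k) set"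
  where
  "bal_tensor_map R n P N g d =
     pres_lift R (bal_module R n P N d) (\<lambda>(i, a, b). bal_gen R n P N d (i, a, g (d - i) b))"


section \<open>The stable Barratt--Eccles operad\<close>

text \<open>The underlying endofunctor of the monad of an operad depends only on the complexes \<open>P(n)\<close>
  with their actions of the symmetric groups, so an operad is represented by
  \<open>P :: nat \<Rightarrow> ('k, 'a) sym_complex\<close>; composition products are not recorded.\<close>

text \<open>The nondegenerate tuples \<open>(\<rho>\<^sub>0, \<dots>, \<rho>\<^sub>d)\<close> form a basis of \<open>\<E>(n)\<^sub>d\<close>; \<open>be_gen\<close> is zero on the degenerate
  ones (and on the empty tuple, so that the boundary vanishes in degree 0).\<close>

definition be_tuples :: "nat \<Rightarrow> int \<Rightarrow> (nat \<Rightarrow> nat) list set"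
  where
  "be_tuples n d =
     {r. r \<noteq> [] \<and> int (length r) = d + 1 \<and> (\<forall>\<rho>\<in>set r. \<rho> permutes {1..n}) \<and> distinct_adj r}"

definition be_module :: "('k, 'm) ring_scheme \<Rightarrow> nat \<Rightarrow> int \<Rightarrow> ('k, (nat \<Rightarrow> nat) list \<Rightarrow> 'k) module"
  where "be_module R n d = free_module R (be_tuples n d)"

definition be_gen :: "('k, 'm) ring_scheme \<Rightarrow> nat \<Rightarrow> int \<Rightarrow> (nat \<Rightarrow> nat) list \<Rightarrow> (nat \<Rightarrow> nat) list \<Rightarrow> 'k"
  where "be_gen R n d r = (if r \<in> be_tuples n d then free_gen R r else \<zero>\<^bsub>be_module R n d\<^esub>)"

definition barratt_eccles ::
  "('k, 'm) ring_scheme \<Rightarrow> nat \<Rightarrow> ('k, (nat \<Rightarrow> nat) list \<Rightarrow> 'k) sym_complex"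
  where
  "barratt_eccles R n =
     \<lparr>obj = be_module R n,
      dif = (\<lambda>d. lin_ext R (be_module R n (d - 1))
        (\<lambda>r. \<Oplus>\<^bsub>be_module R n (d - 1)\<^esub>i\<in>{..<length r}.
           [neg_one_pow (int i)] \<cdot>\<^bsub>be_module R n (d - 1)\<^esub> be_gen R n (d - 1) (take i r @ drop (Suc i) r))),
      act = (\<lambda>\<sigma> d. lin_ext R (be_module R n d) (\<lambda>r. be_gen R n d (map (\<lambda>\<rho>. \<sigma> \<circ> \<rho>) r)))\<rparr>"

text \<open>\<open>(\<Sigma>P)(n) = P(n)[1 - n]\<close>. The shift by \<open>1 - n\<close> multiplies the differential by
  \<open>(-1)\<^bsup>1 - n\<^esup>\<close>, and the symmetric group acts on the endomorphism operad of a one-dimensional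
  complex in degree 1 through the sign.\<close>

definition suspension :: "(nat \<Rightarrow> ('k, 'a) sym_complex) \<Rightarrow> nat \<Rightarrow> ('k, 'a) sym_complex"
  where
  "suspension P n =
     \<lparr>obj = (\<lambda>d. obj (P n) (d + int n - 1)),
      dif = (\<lambda>d x. [neg_one_pow (1 - int n)] \<cdot>\<^bsub>obj (P n) (d + int n - 2)\<^esub> dif (P n) (d + int n - 1) x),
      act = (\<lambda>\<sigma> d x. [sign \<sigma>] \<cdot>\<^bsub>obj (P n) (d + int n - 1)\<^esub> act (P n) \<sigma> (d + int n - 1) x)\<rparr>"

definition suspension_map :: "(nat \<Rightarrow> int \<Rightarrow> 'a \<Rightarrow> 'b) \<Rightarrow> nat \<Rightarrow> int \<Rightarrow> 'a \<Rightarrow> 'b"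
  where "suspension_map \<phi> n d = \<phi> n (d + int n - 1)"

text \<open>The sequence \<open>(\<rho>\<^sub>0(1), \<dots>, \<rho>\<^bsub>n-1\<^esub>(1))\<close> as a self-map of \<open>{1..n}\<close>, extended by the identity.\<close>

definition first_values :: "nat \<Rightarrow> (nat \<Rightarrow> nat) list \<Rightarrow> nat \<Rightarrow> nat"
  where "first_values n r i = (if i \<in> {1..n} then (r ! (i - 1)) 1 else i)"

text \<open>\<open>stab_map R n d\<close> goes from \<open>(\<Sigma>\<E>)(n)\<^sub>d = \<E>(n)\<^bsub>d+n-1\<^esub>\<close> to \<open>\<E>(n)\<^sub>d\<close>.\<close>

definition stab_map ::
  "('k, 'm) ring_scheme \<Rightarrow> nat \<Rightarrow> int \<Rightarrow> ((nat \<Rightarrow> nat) list \<Rightarrow> 'k) \<Rightarrow> (nat \<Rightarrow> nat) list \<Rightarrow> 'k"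
  where
  "stab_map R n d = lin_ext R (be_module R n d)
     (\<lambda>r. if 0 \<le> d \<and> first_values n r permutes {1..n}
          then [sign (first_values n r)] \<cdot>\<^bsub>be_module R n d\<^esub> be_gen R n d (drop (n - 1) r)
          else \<zero>\<^bsub>be_module R n d\<^esub>)"

definition be_tower ::
  "('k, 'm) ring_scheme \<Rightarrow> nat \<Rightarrow> nat \<Rightarrow> ('k, (nat \<Rightarrow> nat) list \<Rightarrow> 'k) sym_complex"
  where "be_tower R k = (suspension ^^ k) (barratt_eccles R)"

definition be_tower_map ::
  "('k, 'm) ring_scheme \<Rightarrow> nat \<Rightarrow> nat \<Rightarrow> int \<Rightarrow> ((nat \<Rightarrow> nat) list \<Rightarrow> 'k) \<Rightarrow> (nat \<Rightarrow> nat) list \<Rightarrow> 'k"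
  where "be_tower_map R k = (suspension_map ^^ k) (stab_map R)"

text \<open>The inverse limit is formed in arities \<open>n \<ge> 1\<close>; arity 0 is zero by convention.\<close>

definition stable_barratt_eccles ::
  "('k, 'm) ring_scheme \<Rightarrow> nat \<Rightarrow> ('k, nat \<Rightarrow> (nat \<Rightarrow> nat) list \<Rightarrow> 'k) sym_complex"
  where
  "stable_barratt_eccles R n =
     \<lparr>obj = (\<lambda>d. pointwise_module (\<lambda>k. obj (be_tower R k n) d)
        (if n = 0 then {\<lambda>k. \<zero>\<^bsub>obj (be_tower R k n) d\<^esub>}
         else {x. (\<forall>k. x k \<in> carrier (obj (be_tower R k n) d)) \<and>
                  (\<forall>k. be_tower_map R k n d (x (Suc k)) = x k)})),
      dif = (\<lambda>d x k. dif (be_tower R k n) d (x k)),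
      act = (\<lambda>\<sigma> d x k. act (be_tower R k n) \<sigma> d (x k))\<rparr>"

definition dagger :: "(nat \<Rightarrow> ('k, 'a) sym_complex) \<Rightarrow> nat \<Rightarrow> ('k, 'a) sym_complex"
  where
  "dagger P n =
     \<lparr>obj = (\<lambda>d. obj (P n) (- d)),
      dif = (\<lambda>d. dif (P n) (- d)),
      act = (\<lambda>\<sigma> d. act (P n) \<sigma> (- d))\<rparr>"


section \<open>The endofunctor underlying the monad of an operad\<close>

definition operad_monad ::
  "('k, 'm) ring_scheme \<Rightarrow> (nat \<Rightarrow> ('k, 'e) sym_complex) \<Rightarrow> ('k, 'a, 'z) complex_rec_scheme \<Rightarrow>
     ('k, nat \<Rightarrow> ((int \<times> 'e \<times> ((int \<times> 'a) list \<Rightarrow> 'k) set) \<Rightarrow> 'k) set) complex_rec"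
  where
  "operad_monad R P X = direct_sum (\<lambda>n. bal_tensor R n (P n) (tensor_power R X n))"

definition operad_monad_map ::
  "('k, 'm) ring_scheme \<Rightarrow> (nat \<Rightarrow> ('k, 'e) sym_complex) \<Rightarrow>
     ('k, 'b, 'z) complex_rec_scheme \<Rightarrow> (int \<Rightarrow> 'a \<Rightarrow> 'b) \<Rightarrow> int \<Rightarrow>
     (nat \<Rightarrow> ((int \<times> 'e \<times> ((int \<times> 'a) list \<Rightarrow> 'k) set) \<Rightarrow> 'k) set) \<Rightarrow>
     (nat \<Rightarrow> ((int \<times> 'e \<times> ((int \<times> 'b) list \<Rightarrow> 'k) set) \<Rightarrow> 'k) set)"
  where
  "operad_monad_map R P Y f d u =
     (\<lambda>n. bal_tensor_map R n (P n) (tensor_power R Y n) (tensor_power_map R Y f n) d (u n))"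

end

theory Submission
  imports Defs
begin

text \<open>Over a field, every cochain complex \<open>X\<close> carries an idempotent cochain map \<open>e\<close> that vanishes on
  coboundaries and takes values in cocycles, and a homotopy \<open>h\<close> from \<open>id\<close> to \<open>e\<close>. The induced homotopy
  \<open>k\<close> on the \<open>n\<close>-th tensor power is not equivariant. In the stable Barratt--Eccles complex, however, the
  tuples whose last permutation is the identity span a complement that is compatible with the
  stabilization maps and whose translates decompose the complex. If \<open>\<pi>\<close> is the projection onto it, then
  \<open>K (a \<otimes> x) = (\<Sum>\<rho>. \<plusminus> \<pi> (\<rho> a) \<otimes> k (\<rho> x))\<close> descends to the tensor product over the symmetric group. Its
  failure to be a homotopy from \<open>id\<close> to \<open>e\<close> strictly raises the number of tensor factors in the image
  of \<open>h\<close>, hence is nilpotent, so \<open>e\<close> acts as the identity on the cohomology of each extended power.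
  On the images of these projections a quasi-isomorphism is invertible.\<close>

section \<open>Linear maps and presented modules\<close>

text \<open>In arity at least two the stable complex is nonzero in every degree. Freeness over the
  group ring in each degree is then too weak: the tensor product of an acyclic equivariant complex
  with an unbounded complex of free modules can have cohomology, because the successive corrections
  of a non-equivariant homotopy need not stop. Here they stop because a word of \<open>n\<close>
  letters has room for at most \<open>n\<close> letters from the image of \<open>h\<close>, and
  because of the side conditions \<open>e h = 0\<close> and \<open>h h = 0\<close>: such a letter is
  annihilated by both operations, so each summand of \<open>k\<close> either vanishes or contains
  one more of them. An ordinary average over the group would divide by its order, which may be zero
  in characteristic \<open>p\<close>; inserting \<pi> replaces this division by the decomposition of
  \<open>a\<close> into translates of values of \<pi>. That \<pi> is not a chain map is the source
  of the error term. It reads the last permutation because the stabilization discards initial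
  entries, and the decomposition is a finite sum, which the inverse limit respects.\<close>

lemma linear_mapI:
  assumes "\<And>x. x \<in> carrier M \<Longrightarrow> h x \<in> carrier N"
    and "\<And>x y. \<lbrakk>x \<in> carrier M; y \<in> carrier M\<rbrakk> \<Longrightarrow> h (x \<oplus>\<^bsub>M\<^esub> y) = h x \<oplus>\<^bsub>N\<^esub> h y"
    and "\<And>c x. \<lbrakk>c \<in> carrier R; x \<in> carrier M\<rbrakk> \<Longrightarrow> h (c \<odot>\<^bsub>M\<^esub> x) = c \<odot>\<^bsub>N\<^esub> h x"
  shows "linear_map R M N h"
  using assms by (auto simp: linear_map_def)

lemma linear_map_closed: "linear_map R M N h \<Longrightarrow> x \<in> carrier M \<Longrightarrow> h x \<in> carrier N"
  and linear_map_add: "linear_map R M N h \<Longrightarrow> x \<in> carrier M \<Longrightarrow> y \<in> carrier M \<Longrightarrow> h (x \<oplus>\<^bsub>M\<^esub> y) = h x \<oplus>\<^bsub>N\<^esub> h y"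
  and linear_map_smult: "linear_map R M N h \<Longrightarrow> c \<in> carrier R \<Longrightarrow> x \<in> carrier M \<Longrightarrow> h (c \<odot>\<^bsub>M\<^esub> x) = c \<odot>\<^bsub>N\<^esub> h x"
  by (auto simp: linear_map_def)

text \<open>Functions are total but linearity speaks only about the carrier, so a map that agrees
  there with a linear one is linear, whatever its values elsewhere.\<close>

lemma linear_map_cong:
  "(\<And>x. x \<in> carrier M \<Longrightarrow> g x = h x) \<Longrightarrow> module R M \<Longrightarrow> linear_map R M N h \<Longrightarrow> linear_map R M N g"
  by (auto simp: linear_map_def module.smult_closed abelian_monoid.a_closed module_def abelian_group_def)

lemma linear_map_comp:
  "linear_map R L M g \<Longrightarrow> linear_map R M N h \<Longrightarrow> linear_map R L N (\<lambda>x. h (g x))"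
  by (auto simp: linear_map_def)

lemma linear_map_id: "linear_map R M M (\<lambda>x. x)"
  by (auto simp: linear_map_def)

lemma linear_map_abelian_group_hom:
  assumes "module R M" "module R N" "linear_map R M N h"
  shows "abelian_group_hom M N h"
  using assms
  by (intro abelian_group_homI)
     (auto simp: linear_map_def module_def hom_def group_hom_def group_hom_axioms_def abelian_group.a_group)

lemma linear_map_zero:
  "module R M \<Longrightarrow> module R N \<Longrightarrow> linear_map R M N h \<Longrightarrow> h \<zero>\<^bsub>M\<^esub> = \<zero>\<^bsub>N\<^esub>"
  by (rule abelian_group_hom.hom_zero[OF linear_map_abelian_group_hom])

lemma linear_map_neg:
  "module R M \<Longrightarrow> module R N \<Longrightarrow> linear_map R M N h \<Longrightarrow> x \<in> carrier M \<Longrightarrow> h (\<ominus>\<^bsub>M\<^esub> x) = \<ominus>\<^bsub>N\<^esub> h x"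
  by (rule abelian_group_hom.hom_a_inv[OF linear_map_abelian_group_hom])

lemma linear_map_diff:
  assumes "module R M" "module R N" "linear_map R M N h" "x \<in> carrier M" "y \<in> carrier M"
  shows "h (x \<ominus>\<^bsub>M\<^esub> y) = h x \<ominus>\<^bsub>N\<^esub> h y"
proof -
  interpret M: module R M by fact
  show ?thesis
    using assms by (simp add: a_minus_def linear_map_add linear_map_neg)
qed

lemma linear_map_finsum:
  assumes "module R M" "module R N" "linear_map R M N h" "f \<in> A \<rightarrow> carrier M"
  shows "h (\<Oplus>\<^bsub>M\<^esub>i\<in>A. f i) = (\<Oplus>\<^bsub>N\<^esub>i\<in>A. h (f i))"
proof -
  interpret M: module R M by fact
  interpret N: module R N by fact
  show ?thesis
  proof (cases "finite A")
    case True
    then show ?thesis using assms(4)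
    proof (induction A)
      case empty
      show ?case using linear_map_zero[OF assms(1-3)] by simp
    next
      case (insert a A)
      then have f: "f \<in> A \<rightarrow> carrier M" "f a \<in> carrier M" by auto
      then have "(\<lambda>i. h (f i)) \<in> A \<rightarrow> carrier N" "h (f a) \<in> carrier N"
        using linear_map_closed[OF assms(3)] by auto
      then show ?case using f insert
        by (simp add: linear_map_add[OF assms(3)])
    qed
  next
    case False
    \<comment> \<open>A sum over an infinite index set is zero by convention, and \<open>h\<close>
      preserves zero.\<close>
    then show ?thesis
      using linear_map_zero[OF assms(1-3)]
      by (simp add: M.finsum_infinite N.finsum_infinite)
  qed
qed

lemma module_diff_eq_zero:
  assumes "module R M" "x \<in> carrier M" "y \<in> carrier M" "x \<ominus>\<^bsub>M\<^esub> y = \<zero>\<^bsub>M\<^esub>"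
  shows "x = y"
proof -
  interpret M: module R M by fact
  have "x = (x \<ominus>\<^bsub>M\<^esub> y) \<oplus>\<^bsub>M\<^esub> y"
    using assms(2,3) by (simp add: a_minus_def M.a_assoc M.l_neg)
  also have "\<dots> = y"
    unfolding assms(4) using assms(3) by (rule M.l_zero)
  finally show ?thesis .
qed

lemma module_diff_self: "module R M \<Longrightarrow> x \<in> carrier M \<Longrightarrow> x \<ominus>\<^bsub>M\<^esub> x = \<zero>\<^bsub>M\<^esub>"
  by (simp add: a_minus_def module_def abelian_group.r_neg)

lemma linear_map_plus:
  assumes "module R M" "module R N" "linear_map R M N g" "linear_map R M N h"
  shows "linear_map R M N (\<lambda>x. g x \<oplus>\<^bsub>N\<^esub> h x)"
proof -
  interpret M: module R M by fact
  interpret N: module R N by fact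
  note c = linear_map_closed[OF assms(3)] linear_map_closed[OF assms(4)]
  show ?thesis
    by (rule linear_mapI)
       (simp_all add: c linear_map_add[OF assms(3)] linear_map_add[OF assms(4)] N.a_ac
        linear_map_smult[OF assms(3)] linear_map_smult[OF assms(4)] N.smult_r_distr)
qed

lemma linear_map_scale:
  assumes "module R M" "module R N" "linear_map R M N h" "c \<in> carrier R"
  shows "linear_map R M N (\<lambda>x. c \<odot>\<^bsub>N\<^esub> h x)"
proof -
  interpret M: module R M by fact
  interpret N: module R N by fact
  note c = linear_map_closed[OF assms(3)]
  have "c \<odot>\<^bsub>N\<^esub> (a \<odot>\<^bsub>N\<^esub> y) = a \<odot>\<^bsub>N\<^esub> (c \<odot>\<^bsub>N\<^esub> y)"
    if "a \<in> carrier R" "y \<in> carrier N" for a y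
    using that assms(4) by (simp add: N.smult_assoc1[symmetric] M.R.m_comm)
  then show ?thesis
    by (intro linear_mapI)
       (simp_all add: c assms linear_map_add[OF assms(3)] linear_map_smult[OF assms(3)] N.smult_r_distr)
qed

lemma linear_map_const_zero:
  assumes "module R M" "module R N"
  shows "linear_map R M N (\<lambda>x. \<zero>\<^bsub>N\<^esub>)"
proof -
  interpret N: module R N by fact
  show ?thesis by (rule linear_mapI) auto
qed

lemma linear_map_minus:
  assumes "module R M" "module R N" "linear_map R M N g" "linear_map R M N h"
  shows "linear_map R M N (\<lambda>x. g x \<ominus>\<^bsub>N\<^esub> h x)"
proof -
  interpret N: module R N by fact
  have "linear_map R M N (\<lambda>x. g x \<oplus>\<^bsub>N\<^esub> (\<ominus>\<^bsub>R\<^esub> \<one>\<^bsub>R\<^esub>) \<odot>\<^bsub>N\<^esub> h x)"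
    using assms by (intro linear_map_plus linear_map_scale) auto
  then show ?thesis
    using assms by (elim linear_map_cong[rotated 2])
      (simp_all add: a_minus_def N.smult_l_minus linear_map_closed[OF assms(4)])
qed

lemma linear_map_sum:
  assumes "module R M" "module R N" "finite A" "\<And>a. a \<in> A \<Longrightarrow> linear_map R M N (h a)"
  shows "linear_map R M N (\<lambda>x. \<Oplus>\<^bsub>N\<^esub>a\<in>A. h a x)"
proof -
  interpret M: module R M by fact
  interpret N: module R N by fact
  have c: "(\<lambda>a. h a x) \<in> A \<rightarrow> carrier N" if "x \<in> carrier M" for x
    using assms(4) that by (auto dest: linear_map_closed)
  show ?thesis
  proof (rule linear_mapI)
    fix x y assume xy: "x \<in> carrier M" "y \<in> carrier M"
    show "(\<Oplus>\<^bsub>N\<^esub>a\<in>A. h a (x \<oplus>\<^bsub>M\<^esub> y)) = (\<Oplus>\<^bsub>N\<^esub>a\<in>A. h a x) \<oplus>\<^bsub>N\<^esub> (\<Oplus>\<^bsub>N\<^esub>a\<in>A. h a y)"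
      unfolding N.finsum_addf[OF c[OF xy(1)] c[OF xy(2)], symmetric]
      using xy c by (intro N.finsum_cong') (auto simp: linear_map_add[OF assms(4)])
  next
    fix r x assume "r \<in> carrier R" "x \<in> carrier M"
    then show "(\<Oplus>\<^bsub>N\<^esub>a\<in>A. h a (r \<odot>\<^bsub>M\<^esub> x)) = r \<odot>\<^bsub>N\<^esub> (\<Oplus>\<^bsub>N\<^esub>a\<in>A. h a x)"
      using c[of x] assms(3)
      by (subst N.finsum_smult_ldistr) (auto intro!: N.finsum_cong' simp: linear_map_smult[OF assms(4)])
  qed (use c in auto)
qed

subsection \<open>Integer scalars\<close>

text \<open>Signs occur as integer multiples in the additive group. Writing them as multiples by an
  element of the ring shows that every linear map commutes with them.\<close>

definition int_scalar :: "('k, 'm) ring_scheme \<Rightarrow> int \<Rightarrow> 'k"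
  where "int_scalar R k = [k] \<cdot>\<^bsub>R\<^esub> \<one>\<^bsub>R\<^esub>"

lemma int_scalar_closed: "cring R \<Longrightarrow> int_scalar R k \<in> carrier R"
proof -
  assume "cring R"
  then interpret R: cring R .
  show ?thesis by (simp add: int_scalar_def)
qed

lemma int_smult_eq:
  assumes "module R M" "x \<in> carrier M"
  shows "[(k::int)] \<cdot>\<^bsub>M\<^esub> x = int_scalar R k \<odot>\<^bsub>M\<^esub> x"
proof -
  interpret M: module R M by fact
  have nat: "[(n::nat)] \<cdot>\<^bsub>M\<^esub> x = ([n] \<cdot>\<^bsub>R\<^esub> \<one>\<^bsub>R\<^esub>) \<odot>\<^bsub>M\<^esub> x" for n
    using assms(2) by (induction n) (simp_all add: M.smult_l_distr)
  show ?thesis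
  proof (cases "0 \<le> k")
    case True
    then show ?thesis
      by (simp add: int_scalar_def add_pow_int_ge nat)
  next
    case False
    then show ?thesis using assms(2)
      by (simp add: int_scalar_def add_pow_int_lt nat M.smult_l_minus)
  qed
qed

lemma linear_map_int_smult:
  assumes "module R M" "module R N" "linear_map R M N h" "x \<in> carrier M"
  shows "h ([(k::int)] \<cdot>\<^bsub>M\<^esub> x) = [k] \<cdot>\<^bsub>N\<^esub> h x"
proof -
  interpret M: module R M by fact
  show ?thesis
    using assms linear_map_closed[OF assms(3)]
    by (simp add: int_smult_eq linear_map_smult int_scalar_closed M.R.is_cring)
qed

lemma int_smult_closed:
  assumes "module R M" "x \<in> carrier M"
  shows "[(k::int)] \<cdot>\<^bsub>M\<^esub> x \<in> carrier M"
proof -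
  interpret M: module R M by fact
  show ?thesis using assms(2) by simp
qed

lemma linear_map_int_scale:
  assumes "module R M" "module R N" "linear_map R M N h"
  shows "linear_map R M N (\<lambda>x. [(k::int)] \<cdot>\<^bsub>N\<^esub> h x)"
proof -
  interpret M: module R M by fact
  have "linear_map R M N (\<lambda>x. int_scalar R k \<odot>\<^bsub>N\<^esub> h x)"
    using assms int_scalar_closed[OF M.R.is_cring] by (intro linear_map_scale) auto
  then show ?thesis
    using assms by (elim linear_map_cong[rotated 2]) (auto simp: int_smult_eq dest: linear_map_closed)
qed

lemma int_smult_finsum:
  fixes M :: "('k, 'a) module"
  assumes "module R M" "f \<in> A \<rightarrow> carrier M"
  shows "[(k::int)] \<cdot>\<^bsub>M\<^esub> (\<Oplus>\<^bsub>M\<^esub>i\<in>A. f i) = (\<Oplus>\<^bsub>M\<^esub>i\<in>A. [k] \<cdot>\<^bsub>M\<^esub> f i)"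
  using linear_map_finsum[OF assms(1) assms(1) linear_map_int_scale[OF assms(1) assms(1) linear_map_id] assms(2)] .

lemma int_smult_smult:
  assumes "module R M" "x \<in> carrier M"
  shows "[(k::int)] \<cdot>\<^bsub>M\<^esub> ([(l::int)] \<cdot>\<^bsub>M\<^esub> x) = [(k * l)] \<cdot>\<^bsub>M\<^esub> x"
proof -
  interpret M: module R M by fact
  show ?thesis using assms(2) by (simp add: M.add.int_pow_pow mult.commute)
qed

lemma int_smult_add:
  assumes "module R M" "x \<in> carrier M" "y \<in> carrier M"
  shows "[(k::int)] \<cdot>\<^bsub>M\<^esub> (x \<oplus>\<^bsub>M\<^esub> y) = [k] \<cdot>\<^bsub>M\<^esub> x \<oplus>\<^bsub>M\<^esub> [k] \<cdot>\<^bsub>M\<^esub> y"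
proof -
  interpret M: module R M by fact
  show ?thesis using assms(2,3) by (simp add: M.add.int_pow_distrib)
qed

lemma int_smult_1: "module R M \<Longrightarrow> x \<in> carrier M \<Longrightarrow> [(1::int)] \<cdot>\<^bsub>M\<^esub> x = x"
proof -
  assume "module R M" "x \<in> carrier M"
  then interpret M: module R M by simp
  show ?thesis using \<open>x \<in> carrier M\<close> by simp
qed

lemma int_smult_uminus: "module R M \<Longrightarrow> x \<in> carrier M \<Longrightarrow> [(- k::int)] \<cdot>\<^bsub>M\<^esub> x = \<ominus>\<^bsub>M\<^esub> ([k] \<cdot>\<^bsub>M\<^esub> x)"
proof -
  assume "module R M" "x \<in> carrier M"
  then interpret M: module R M by simp
  show ?thesis using \<open>x \<in> carrier M\<close> by (simp add: M.add.int_pow_neg)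
qed

lemma neg_one_pow_add: "neg_one_pow (a + b) = neg_one_pow a * neg_one_pow b"
  by (simp add: neg_one_pow_def)

lemma neg_one_pow_square: "neg_one_pow a * neg_one_pow a = 1"
  by (simp add: neg_one_pow_def)

subsection \<open>Submodules and spans\<close>

lemma submodule_add:
  assumes "submodule N R M" "x \<in> N" "y \<in> N" shows "x \<oplus>\<^bsub>M\<^esub> y \<in> N"
  using subgroup.m_closed[OF submodule.axioms(1)[OF assms(1)] assms(2,3)] by simp

lemma submodule_zero: "submodule N R M \<Longrightarrow> \<zero>\<^bsub>M\<^esub> \<in> N"
  using subgroup.one_closed[OF submodule.axioms(1)] by force

lemma submodule_subset: "submodule N R M \<Longrightarrow> N \<subseteq> carrier M"
  using subgroup.subset[OF submodule.axioms(1)] by force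

lemma submodule_smult: "submodule N R M \<Longrightarrow> c \<in> carrier R \<Longrightarrow> x \<in> N \<Longrightarrow> c \<odot>\<^bsub>M\<^esub> x \<in> N"
  by (rule submodule.smult_closed)

lemma submodule_neg: "submodule N R M \<Longrightarrow> x \<in> N \<Longrightarrow> \<ominus>\<^bsub>M\<^esub> x \<in> N"
  using subgroup.m_inv_closed[OF submodule.axioms(1)] by (fastforce simp: a_inv_def)

lemma submodule_diff: "submodule N R M \<Longrightarrow> x \<in> N \<Longrightarrow> y \<in> N \<Longrightarrow> x \<ominus>\<^bsub>M\<^esub> y \<in> N"
  by (simp add: a_minus_def submodule_add submodule_neg)

lemma submodule_int_smult:
  assumes "module R M" "submodule N R M" "x \<in> N"
  shows "[(k::int)] \<cdot>\<^bsub>M\<^esub> x \<in> N"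
proof -
  interpret M: module R M by fact
  show ?thesis
    using assms submodule_subset[OF assms(2)]
    by (auto simp: int_smult_eq submodule_smult int_scalar_closed M.R.is_cring)
qed

lemma submodule_finsum:
  assumes "module R M" "submodule N R M" "f \<in> A \<rightarrow> N"
  shows "(\<Oplus>\<^bsub>M\<^esub>i\<in>A. f i) \<in> N"
proof -
  interpret M: module R M by fact
  show ?thesis
  proof (cases "finite A")
    case True
    then show ?thesis using assms(3)
    proof (induction A)
      case empty
      show ?case using submodule_zero[OF assms(2)] by simp
    next
      case (insert a A)
      then have "f \<in> A \<rightarrow> carrier M" "f a \<in> carrier M" 
        using submodule_subset[OF assms(2)] by auto
      then show ?case using insert by (simp add: submodule_add[OF assms(2)])
    qed
  qed (simp add: M.finsum_infinite submodule_zero[OF assms(2)])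
qed

text \<open>Closure under negation comes from closure under scalars, since negation is
  multiplication by minus one.\<close>

lemma submoduleI':
  assumes "module R M" "N \<subseteq> carrier M" "\<zero>\<^bsub>M\<^esub> \<in> N"
    "\<And>x y. x \<in> N \<Longrightarrow> y \<in> N \<Longrightarrow> x \<oplus>\<^bsub>M\<^esub> y \<in> N"
    "\<And>c x. c \<in> carrier R \<Longrightarrow> x \<in> N \<Longrightarrow> c \<odot>\<^bsub>M\<^esub> x \<in> N"
  shows "submodule N R M"
proof -
  interpret M: module R M by fact
  have "\<ominus>\<^bsub>M\<^esub> x \<in> N" if "x \<in> N" for x
    using assms(5)[of "\<ominus>\<^bsub>R\<^esub> \<one>\<^bsub>R\<^esub>" x] that assms(2) by (auto simp: M.smult_l_minus)
  then show ?thesis using assms by (intro M.submoduleI) auto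
qed

lemma linear_map_vimage_submodule:
  assumes "module R M" "module R N" "linear_map R M N h" "submodule K R N"
  shows "submodule {x \<in> carrier M. h x \<in> K} R M"
proof -
  interpret M: module R M by fact
  show ?thesis
    by (rule submoduleI'[OF assms(1)])
       (auto simp: linear_map_zero[OF assms(1-3)] linear_map_add[OF assms(3)]
         linear_map_smult[OF assms(3)] submodule_zero[OF assms(4)] submodule_add[OF assms(4)]
         submodule_smult[OF assms(4)])
qed

lemma submodule_trivial: "module R M \<Longrightarrow> submodule {\<zero>\<^bsub>M\<^esub>} R M"
proof -
  assume "module R M"
  then interpret M: module R M .
  show ?thesis by (rule submoduleI'[OF \<open>module R M\<close>]) auto
qed

lemma linear_map_kernel_submodule:
  assumes "module R M" "module R N" "linear_map R M N h"
  shows "submodule {x \<in> carrier M. h x = \<zero>\<^bsub>N\<^esub>} R M"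
  using linear_map_vimage_submodule[OF assms submodule_trivial[OF assms(2)]] by simp

lemma linear_map_image_submodule:
  assumes "module R M" "module R N" "linear_map R M N h"
  shows "submodule (h ` carrier M) R N"
proof -
  interpret M: module R M by fact
  show ?thesis
  proof (rule submoduleI'[OF assms(2)])
    show "\<zero>\<^bsub>N\<^esub> \<in> h ` carrier M" using linear_map_zero[OF assms] M.zero_closed by (metis image_eqI)
  qed (auto simp: linear_map_closed[OF assms(3)] linear_map_add[OF assms(3), symmetric]
         linear_map_smult[OF assms(3), symmetric])
qed

text \<open>The condition on \<open>G\<close> makes the intersected family non-empty: it contains
  the whole carrier.\<close>

lemma module_span_submodule:
  assumes "module R M" "G \<subseteq> carrier M"
  shows "submodule (module_span R M G) R M"
proof -
  interpret M: module R M by fact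
  have "submodule (carrier M) R M" by (rule M.carrier_is_submodule)
  then have "module_span R M G \<subseteq> carrier M" using assms by (auto simp: module_span_def)
  then show ?thesis
    by (intro submoduleI'[OF assms(1)])
       (auto simp: module_span_def submodule_zero submodule_add submodule_smult)
qed

lemma module_span_superset: "G \<subseteq> module_span R M G"
  by (auto simp: module_span_def)

lemma module_span_least: "submodule N R M \<Longrightarrow> G \<subseteq> N \<Longrightarrow> module_span R M G \<subseteq> N"
  by (auto simp: module_span_def)

subsection \<open>Free modules\<close>

lemma free_module_simps:
  "carrier (free_module R S) = {u. (\<forall>s. u s \<in> carrier R) \<and> finite {s. u s \<noteq> \<zero>\<^bsub>R\<^esub>} \<and> {s. u s \<noteq> \<zero>\<^bsub>R\<^esub>} \<subseteq> S}"
  "\<zero>\<^bsub>free_module R S\<^esub> = (\<lambda>s. \<zero>\<^bsub>R\<^esub>)"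
  "u \<oplus>\<^bsub>free_module R S\<^esub> v = (\<lambda>s. u s \<oplus>\<^bsub>R\<^esub> v s)"
  "c \<odot>\<^bsub>free_module R S\<^esub> u = (\<lambda>s. c \<otimes>\<^bsub>R\<^esub> u s)"
  by (simp_all add: free_module_def)

lemma free_module_module:
  assumes "cring R" shows "module R (free_module R S)"
proof -
  interpret R: cring R by fact
  have supp: "finite {s. u s \<oplus>\<^bsub>R\<^esub> v s \<noteq> \<zero>\<^bsub>R\<^esub>} \<and> {s. u s \<oplus>\<^bsub>R\<^esub> v s \<noteq> \<zero>\<^bsub>R\<^esub>} \<subseteq> S"
    if "finite {s. u s \<noteq> \<zero>\<^bsub>R\<^esub>}" "{s. u s \<noteq> \<zero>\<^bsub>R\<^esub>} \<subseteq> S"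
      "finite {s. v s \<noteq> \<zero>\<^bsub>R\<^esub>}" "{s. v s \<noteq> \<zero>\<^bsub>R\<^esub>} \<subseteq> S" "\<And>s. u s \<in> carrier R" "\<And>s. v s \<in> carrier R"
    for u v :: "'c \<Rightarrow> 'a"
  proof -
    have "{s. u s \<oplus>\<^bsub>R\<^esub> v s \<noteq> \<zero>\<^bsub>R\<^esub>} \<subseteq> {s. u s \<noteq> \<zero>\<^bsub>R\<^esub>} \<union> {s. v s \<noteq> \<zero>\<^bsub>R\<^esub>}"
      using that(5,6) by auto
    then show ?thesis using that(1-4) by (auto intro: finite_subset)
  qed
  \<comment> \<open>Used for negation and for scalar multiplication: a function that fixes zero
    cannot enlarge the support.\<close>
  have supp': "finite {s. h (u s) \<noteq> \<zero>\<^bsub>R\<^esub>} \<and> {s. h (u s) \<noteq> \<zero>\<^bsub>R\<^esub>} \<subseteq> S"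
    if "finite {s. u s \<noteq> \<zero>\<^bsub>R\<^esub>}" "{s. u s \<noteq> \<zero>\<^bsub>R\<^esub>} \<subseteq> S" "h \<zero>\<^bsub>R\<^esub> = \<zero>\<^bsub>R\<^esub>"
    for u :: "'c \<Rightarrow> 'a" and h :: "'a \<Rightarrow> 'a"
  proof -
    have "{s. h (u s) \<noteq> \<zero>\<^bsub>R\<^esub>} \<subseteq> {s. u s \<noteq> \<zero>\<^bsub>R\<^esub>}"
      using that(3) by auto
    then show ?thesis using that(1,2) by (auto intro: finite_subset)
  qed
  show ?thesis
  proof (rule moduleI)
    show "abelian_group (free_module R S)"
    proof (rule abelian_groupI)
      fix u v assume "u \<in> carrier (free_module R S)" "v \<in> carrier (free_module R S)"
      then show "u \<oplus>\<^bsub>free_module R S\<^esub> v \<in> carrier (free_module R S)"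
        using supp[of u v] by (simp add: free_module_simps)
    next
      fix u assume "u \<in> carrier (free_module R S)"
      then show "\<exists>v\<in>carrier (free_module R S). v \<oplus>\<^bsub>free_module R S\<^esub> u = \<zero>\<^bsub>free_module R S\<^esub>"
        using supp'[of u "\<lambda>x. \<ominus>\<^bsub>R\<^esub> x"]
        by (intro bexI[of _ "\<lambda>s. \<ominus>\<^bsub>R\<^esub> u s"]) (auto simp: free_module_simps R.l_neg)
    qed (auto simp: free_module_simps R.a_ac)
  next
    fix c u assume "c \<in> carrier R" "u \<in> carrier (free_module R S)"
    then show "c \<odot>\<^bsub>free_module R S\<^esub> u \<in> carrier (free_module R S)"
      using supp'[of u "\<lambda>x. c \<otimes>\<^bsub>R\<^esub> x"] by (simp add: free_module_simps)
  qed (auto simp: free_module_simps R.l_distr R.r_distr R.m_assoc assms)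
qed

lemma free_gen_closed:
  assumes "cring R" "s \<in> S" shows "free_gen R s \<in> carrier (free_module R S)"
proof -
  interpret R: cring R by fact
  have "{t. free_gen R s t \<noteq> \<zero>\<^bsub>R\<^esub>} \<subseteq> {s}" by (auto simp: free_gen_def)
  then show ?thesis using assms(2) by (auto simp: free_module_simps free_gen_def intro: finite_subset)
qed

text \<open>Induction on the size of the support: setting one nonzero coordinate to zero leaves a
  smaller combination, and the removed part is a multiple of a generator.\<close>

lemma free_module_induct:
  assumes "cring R" "submodule N R (free_module R S)" "\<And>s. s \<in> S \<Longrightarrow> free_gen R s \<in> N"
  shows "carrier (free_module R S) \<subseteq> N"
proof
  interpret R: cring R by fact
  fix u assume "u \<in> carrier (free_module R S)"
  then show "u \<in> N"
  proof (induction "card {s. u s \<noteq> \<zero>\<^bsub>R\<^esub>}" arbitrary: u)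
    case 0
    then have "u = \<zero>\<^bsub>free_module R S\<^esub>" by (auto simp: free_module_simps)
    then show ?case using submodule_zero[OF assms(2)] by simp
  next
    case (Suc k)
    have fin: "finite {s. u s \<noteq> \<zero>\<^bsub>R\<^esub>}" and uR: "\<And>s. u s \<in> carrier R"
      using Suc.prems by (auto simp: free_module_simps)
    obtain s where s: "u s \<noteq> \<zero>\<^bsub>R\<^esub>" using Suc.hyps(2) by (cases "{s. u s \<noteq> \<zero>\<^bsub>R\<^esub>} = {}") auto
    define v where "v = u(s := \<zero>\<^bsub>R\<^esub>)"
    have suppv: "{t. v t \<noteq> \<zero>\<^bsub>R\<^esub>} = {s. u s \<noteq> \<zero>\<^bsub>R\<^esub>} - {s}" by (auto simp: v_def)
    have "card {t. v t \<noteq> \<zero>\<^bsub>R\<^esub>} = k" using Suc.hyps(2) fin s by (simp add: suppv)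
    moreover have "v \<in> carrier (free_module R S)"
      using Suc.prems suppv fin by (auto simp: free_module_simps v_def)
    ultimately have v: "v \<in> N" using Suc.hyps(1) by blast
    have "s \<in> S" using s Suc.prems by (auto simp: free_module_simps)
    then have "u s \<odot>\<^bsub>free_module R S\<^esub> free_gen R s \<in> N"
      using assms uR by (intro submodule_smult) auto
    then have "v \<oplus>\<^bsub>free_module R S\<^esub> u s \<odot>\<^bsub>free_module R S\<^esub> free_gen R s \<in> N"
      using v assms(2) by (intro submodule_add)
    moreover have "v \<oplus>\<^bsub>free_module R S\<^esub> u s \<odot>\<^bsub>free_module R S\<^esub> free_gen R s = u"
      using uR by (auto simp: free_module_simps v_def free_gen_def)
    ultimately show ?case by simp
  qed
qed

text \<open>Two elements with different supports can only be added under the sum sign after both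
  sums have been extended to one common finite set.\<close>

lemma lin_ext_superset:
  assumes "module R M" "\<phi> \<in> A \<rightarrow> carrier M" "finite A" "{s. u s \<noteq> \<zero>\<^bsub>R\<^esub>} \<subseteq> A" "\<And>s. u s \<in> carrier R"
  shows "lin_ext R M \<phi> u = (\<Oplus>\<^bsub>M\<^esub>s\<in>A. u s \<odot>\<^bsub>M\<^esub> \<phi> s)"
proof -
  interpret M: module R M by fact
  show ?thesis unfolding lin_ext_def
    using assms by (intro M.add.finprod_mono_neutral_cong_left) (auto simp: Pi_iff)
qed

lemma lin_ext_linear:
  assumes "module R M" "\<And>s. s \<in> S \<Longrightarrow> \<phi> s \<in> carrier M"
  shows "linear_map R (free_module R S) M (lin_ext R M \<phi>)"
proof -
  interpret M: module R M by fact
  interpret F: module R "free_module R S" by (rule free_module_module) (rule M.R.is_cring)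
  show ?thesis
  proof (rule linear_mapI)
    fix u assume u: "u \<in> carrier (free_module R S)"
    then show "lin_ext R M \<phi> u \<in> carrier M"
      using assms(2) unfolding lin_ext_def by (intro M.finsum_closed) (auto simp: free_module_simps)
    fix v assume v: "v \<in> carrier (free_module R S)"
    let ?A = "{s. u s \<noteq> \<zero>\<^bsub>R\<^esub>} \<union> {s. v s \<noteq> \<zero>\<^bsub>R\<^esub>}"
    have A: "finite ?A" "\<phi> \<in> ?A \<rightarrow> carrier M" "\<And>s. u s \<in> carrier R" "\<And>s. v s \<in> carrier R"
      using u v assms(2) by (auto simp: free_module_simps)
    have uv: "{s. (u \<oplus>\<^bsub>free_module R S\<^esub> v) s \<noteq> \<zero>\<^bsub>R\<^esub>} \<subseteq> ?A" "\<And>s. (u \<oplus>\<^bsub>free_module R S\<^esub> v) s \<in> carrier R"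
      using A by (auto simp: free_module_simps)
    have "lin_ext R M \<phi> (u \<oplus>\<^bsub>free_module R S\<^esub> v) = (\<Oplus>\<^bsub>M\<^esub>s\<in>?A. (u \<oplus>\<^bsub>free_module R S\<^esub> v) s \<odot>\<^bsub>M\<^esub> \<phi> s)"
      by (rule lin_ext_superset[OF assms(1) A(2,1) uv])
    also have "\<dots> = (\<Oplus>\<^bsub>M\<^esub>s\<in>?A. u s \<odot>\<^bsub>M\<^esub> \<phi> s \<oplus>\<^bsub>M\<^esub> v s \<odot>\<^bsub>M\<^esub> \<phi> s)"
      using A by (intro M.finsum_cong') (auto simp: free_module_simps M.smult_l_distr Pi_iff)
    also have "\<dots> = (\<Oplus>\<^bsub>M\<^esub>s\<in>?A. u s \<odot>\<^bsub>M\<^esub> \<phi> s) \<oplus>\<^bsub>M\<^esub> (\<Oplus>\<^bsub>M\<^esub>s\<in>?A. v s \<odot>\<^bsub>M\<^esub> \<phi> s)"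
      using A by (intro M.finsum_addf) auto
    also have "\<dots> = lin_ext R M \<phi> u \<oplus>\<^bsub>M\<^esub> lin_ext R M \<phi> v"
      using A by (simp add: lin_ext_superset[OF assms(1) A(2,1)])
    finally show "lin_ext R M \<phi> (u \<oplus>\<^bsub>free_module R S\<^esub> v) = lin_ext R M \<phi> u \<oplus>\<^bsub>M\<^esub> lin_ext R M \<phi> v" .
  next
    fix c u assume c: "c \<in> carrier R" and u: "u \<in> carrier (free_module R S)"
    let ?A = "{s. u s \<noteq> \<zero>\<^bsub>R\<^esub>}"
    have A: "finite ?A" "\<phi> \<in> ?A \<rightarrow> carrier M" "\<And>s. u s \<in> carrier R"
      using u assms(2) by (auto simp: free_module_simps)
    have cu: "{s. (c \<odot>\<^bsub>free_module R S\<^esub> u) s \<noteq> \<zero>\<^bsub>R\<^esub>} \<subseteq> ?A" "\<And>s. (c \<odot>\<^bsub>free_module R S\<^esub> u) s \<in> carrier R"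
      using A c by (auto simp: free_module_simps)
    have "lin_ext R M \<phi> (c \<odot>\<^bsub>free_module R S\<^esub> u) = (\<Oplus>\<^bsub>M\<^esub>s\<in>?A. (c \<odot>\<^bsub>free_module R S\<^esub> u) s \<odot>\<^bsub>M\<^esub> \<phi> s)"
      by (rule lin_ext_superset[OF assms(1) A(2,1) cu])
    also have "\<dots> = (\<Oplus>\<^bsub>M\<^esub>s\<in>?A. c \<odot>\<^bsub>M\<^esub> (u s \<odot>\<^bsub>M\<^esub> \<phi> s))"
      using A c by (intro M.finsum_cong') (auto simp: free_module_simps M.smult_assoc1 Pi_iff)
    also have "\<dots> = c \<odot>\<^bsub>M\<^esub> lin_ext R M \<phi> u"
      using A c unfolding lin_ext_def by (subst M.finsum_smult_ldistr) auto
    finally show "lin_ext R M \<phi> (c \<odot>\<^bsub>free_module R S\<^esub> u) = c \<odot>\<^bsub>M\<^esub> lin_ext R M \<phi> u" .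
  qed
qed

lemma lin_ext_free_gen:
  assumes "module R M" "\<phi> s \<in> carrier M"
  shows "lin_ext R M \<phi> (free_gen R s) = \<phi> s"
proof -
  interpret M: module R M by fact
  have "lin_ext R M \<phi> (free_gen R s) = (\<Oplus>\<^bsub>M\<^esub>t\<in>{s}. free_gen R s t \<odot>\<^bsub>M\<^esub> \<phi> t)"
    using assms by (intro lin_ext_superset) (auto simp: free_gen_def)
  then show ?thesis using assms(2) by (simp add: free_gen_def)
qed

text \<open>The kernel of the difference of the two maps is a submodule; once it contains the
  generators it is everything.\<close>

lemma linear_map_eq_on_free:
  assumes "module R M" "linear_map R (free_module R S) M g" "linear_map R (free_module R S) M h"
    and "\<And>s. s \<in> S \<Longrightarrow> g (free_gen R s) = h (free_gen R s)" and "u \<in> carrier (free_module R S)"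
  shows "g u = h u"
proof -
  interpret M: module R M by fact
  have F: "module R (free_module R S)" by (rule free_module_module) (rule M.R.is_cring)
  interpret F: module R "free_module R S" by (rule F)
  note gh = linear_map_minus[OF F assms(1-3)]
  have "carrier (free_module R S) \<subseteq> {u \<in> carrier (free_module R S). g u \<ominus>\<^bsub>M\<^esub> h u = \<zero>\<^bsub>M\<^esub>}"
    using assms(4) linear_map_closed[OF assms(3)]
    by (intro free_module_induct linear_map_kernel_submodule[OF F assms(1) gh] M.R.is_cring)
       (auto simp: free_gen_closed M.R.is_cring a_minus_def M.r_neg)
  from subsetD[OF this assms(5)] show ?thesis
    by - (rule module_diff_eq_zero[OF assms(1) linear_map_closed[OF assms(2)] linear_map_closed[OF assms(3)]], simp_all)
qed

subsection \<open>Quotient modules\<close>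

lemma submodule_abelian_subgroup: "module R M \<Longrightarrow> submodule N R M \<Longrightarrow> abelian_subgroup N M"
  by (intro abelian_subgroupI3 additive_subgroupI) (auto simp: submodule_def module_def)

lemma coset_mem_iff:
  assumes "module R M" "submodule N R M" "x \<in> carrier M"
  shows "y \<in> N +>\<^bsub>M\<^esub> x \<longleftrightarrow> y \<in> carrier M \<and> y \<ominus>\<^bsub>M\<^esub> x \<in> N"
proof
  interpret M: module R M by fact
  note N = submodule_subset[OF assms(2)]
  show "y \<in> carrier M \<and> y \<ominus>\<^bsub>M\<^esub> x \<in> N" if "y \<in> N +>\<^bsub>M\<^esub> x"
  proof -
    from that obtain n where n: "n \<in> N" "y = n \<oplus>\<^bsub>M\<^esub> x" by (auto simp: a_r_coset_def')
    then have "y \<ominus>\<^bsub>M\<^esub> x = n"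
      using N assms(3) by (simp add: a_minus_def M.a_assoc M.r_neg subset_eq)
    then show ?thesis using n N assms(3) by auto
  qed
  show "y \<in> N +>\<^bsub>M\<^esub> x" if "y \<in> carrier M \<and> y \<ominus>\<^bsub>M\<^esub> x \<in> N"
  proof -
    have "y = (y \<ominus>\<^bsub>M\<^esub> x) \<oplus>\<^bsub>M\<^esub> x"
      using that assms(3) by (simp add: a_minus_def M.a_assoc M.l_neg)
    then show ?thesis using that by (auto simp: a_r_coset_def')
  qed
qed

lemma coset_eq_iff:
  assumes "module R M" "submodule N R M" "x \<in> carrier M" "y \<in> carrier M"
  shows "N +>\<^bsub>M\<^esub> x = N +>\<^bsub>M\<^esub> y \<longleftrightarrow> x \<ominus>\<^bsub>M\<^esub> y \<in> N"
proof -
  interpret N: abelian_subgroup N M using submodule_abelian_subgroup[OF assms(1,2)] .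
  have "N +>\<^bsub>M\<^esub> x = N +>\<^bsub>M\<^esub> y \<longleftrightarrow> x \<in> N +>\<^bsub>M\<^esub> y"
  proof
    assume "N +>\<^bsub>M\<^esub> x = N +>\<^bsub>M\<^esub> y"
    with N.a_rcos_self[OF assms(3)] show "x \<in> N +>\<^bsub>M\<^esub> y" by simp
  next
    assume "x \<in> N +>\<^bsub>M\<^esub> y"
    from N.a_repr_independence[OF this assms(4) N.a_subgroup] show "N +>\<^bsub>M\<^esub> x = N +>\<^bsub>M\<^esub> y" by simp
  qed
  then show ?thesis using coset_mem_iff[OF assms(1,2,4)] assms(3) by simp
qed

lemma coset_smult:
  assumes "module R M" "submodule N R M" "c \<in> carrier R" "x \<in> carrier M"
  shows "N <+>\<^bsub>M\<^esub> ((\<lambda>x. c \<odot>\<^bsub>M\<^esub> x) ` (N +>\<^bsub>M\<^esub> x)) = N +>\<^bsub>M\<^esub> (c \<odot>\<^bsub>M\<^esub> x)" (is "?L = ?R")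
proof -
  interpret M: module R M by fact
  note N = submodule_subset[OF assms(2)]
  show ?thesis
  proof (intro subset_antisym subsetI)
    fix y assume "y \<in> ?L"
    then obtain a b where ab: "a \<in> N" "b \<in> N" "y = a \<oplus>\<^bsub>M\<^esub> c \<odot>\<^bsub>M\<^esub> (b \<oplus>\<^bsub>M\<^esub> x)"
      by (auto simp: set_add_def' a_r_coset_def')
    then have "y = (a \<oplus>\<^bsub>M\<^esub> c \<odot>\<^bsub>M\<^esub> b) \<oplus>\<^bsub>M\<^esub> c \<odot>\<^bsub>M\<^esub> x"
      using assms(3,4) N by (simp add: M.smult_r_distr M.a_assoc subset_eq)
    moreover have "a \<oplus>\<^bsub>M\<^esub> c \<odot>\<^bsub>M\<^esub> b \<in> N"
      using ab assms(2,3) by (simp add: submodule_add submodule_smult)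
    ultimately show "y \<in> ?R" by (auto simp: a_r_coset_def')
  next
    fix y assume "y \<in> ?R"
    then obtain a where a: "a \<in> N" "y = a \<oplus>\<^bsub>M\<^esub> c \<odot>\<^bsub>M\<^esub> x"
      by (auto simp: a_r_coset_def')
    have "\<zero>\<^bsub>M\<^esub> \<oplus>\<^bsub>M\<^esub> x \<in> N +>\<^bsub>M\<^esub> x"
      using submodule_zero[OF assms(2)] by (auto simp: a_r_coset_def')
    then have "x \<in> N +>\<^bsub>M\<^esub> x" using assms(4) by simp
    then show "y \<in> ?L" using a by (auto simp: set_add_def')
  qed
qed

lemma quot_module_simps:
  "carrier (quot_module M N) = (\<lambda>x. N +>\<^bsub>M\<^esub> x) ` carrier M"
  "\<zero>\<^bsub>quot_module M N\<^esub> = N"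
  "C \<oplus>\<^bsub>quot_module M N\<^esub> D = C <+>\<^bsub>M\<^esub> D"
  "c \<odot>\<^bsub>quot_module M N\<^esub> C = N <+>\<^bsub>M\<^esub> ((\<lambda>x. c \<odot>\<^bsub>M\<^esub> x) ` C)"
  by (auto simp: quot_module_def A_RCOSETS_def' a_r_coset_def')

lemma quot_module_module:
  assumes "module R M" "submodule N R M"
  shows "module R (quot_module M N)"
    and "linear_map R M (quot_module M N) (\<lambda>x. N +>\<^bsub>M\<^esub> x)"
proof -
  interpret M: module R M by fact
  interpret N: abelian_subgroup N M using submodule_abelian_subgroup[OF assms] .
  have add: "(N +>\<^bsub>M\<^esub> x) \<oplus>\<^bsub>quot_module M N\<^esub> (N +>\<^bsub>M\<^esub> y) = N +>\<^bsub>M\<^esub> (x \<oplus>\<^bsub>M\<^esub> y)"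
    if "x \<in> carrier M" "y \<in> carrier M" for x y
    using that by (simp add: quot_module_simps N.a_rcos_sum)
  have smult: "c \<odot>\<^bsub>quot_module M N\<^esub> (N +>\<^bsub>M\<^esub> x) = N +>\<^bsub>M\<^esub> (c \<odot>\<^bsub>M\<^esub> x)"
    if "c \<in> carrier R" "x \<in> carrier M" for c x
    using that by (simp add: quot_module_simps coset_smult[OF assms])
  have zero: "\<zero>\<^bsub>quot_module M N\<^esub> = N +>\<^bsub>M\<^esub> \<zero>\<^bsub>M\<^esub>"
    using N.a_subset by (simp add: quot_module_simps)
  show "linear_map R M (quot_module M N) (\<lambda>x. N +>\<^bsub>M\<^esub> x)"
    by (rule linear_mapI) (auto simp: add smult, simp add: quot_module_simps)
  have C: "C \<in> carrier (quot_module M N) \<longleftrightarrow> (\<exists>x\<in>carrier M. C = N +>\<^bsub>M\<^esub> x)" for C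
    by (auto simp: quot_module_simps)
  show "module R (quot_module M N)"
  proof (rule moduleI)
    show "abelian_group (quot_module M N)"
    proof (rule abelian_groupI)
      fix C assume "C \<in> carrier (quot_module M N)"
      then obtain x where "x \<in> carrier M" "C = N +>\<^bsub>M\<^esub> x" by (auto simp: C)
      then show "\<exists>D\<in>carrier (quot_module M N). D \<oplus>\<^bsub>quot_module M N\<^esub> C = \<zero>\<^bsub>quot_module M N\<^esub>"
        by (intro bexI[of _ "N +>\<^bsub>M\<^esub> (\<ominus>\<^bsub>M\<^esub> x)"]) (auto simp: add zero C M.l_neg)
    qed (auto simp: C add zero M.a_ac intro!: M.a_closed M.zero_closed)
  qed (auto simp: C add smult M.smult_l_distr M.smult_r_distr M.smult_assoc1 intro!: M.R.is_cring)
qed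

subsection \<open>Presentations\<close>

lemma pres_span_submodule:
  assumes "cring R" "Q \<subseteq> carrier (free_module R S)"
  shows "submodule (module_span R (free_module R S) Q) R (free_module R S)"
  using assms by (intro module_span_submodule free_module_module)

lemma pres_module_module:
  "cring R \<Longrightarrow> Q \<subseteq> carrier (free_module R S) \<Longrightarrow> module R (pres_module R S Q)"
  unfolding pres_module_def
  by (intro quot_module_module free_module_module pres_span_submodule)

lemma pres_gen_closed:
  "cring R \<Longrightarrow> s \<in> S \<Longrightarrow> pres_gen R S Q s \<in> carrier (pres_module R S Q)"
  by (auto simp: pres_module_def pres_gen_def quot_module_simps free_gen_closed)

lemma pres_proj_linear:
  "cring R \<Longrightarrow> Q \<subseteq> carrier (free_module R S) \<Longrightarrow>
    linear_map R (free_module R S) (pres_module R S Q) (\<lambda>u. module_span R (free_module R S) Q +>\<^bsub>free_module R S\<^esub> u)"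
  unfolding pres_module_def
  by (intro quot_module_module free_module_module pres_span_submodule)

lemma pres_relation:
  assumes "cring R" "Q \<subseteq> carrier (free_module R S)"
    and "u \<in> carrier (free_module R S)" "v \<in> carrier (free_module R S)" "u \<ominus>\<^bsub>free_module R S\<^esub> v \<in> Q"
  shows "module_span R (free_module R S) Q +>\<^bsub>free_module R S\<^esub> u = module_span R (free_module R S) Q +>\<^bsub>free_module R S\<^esub> v"
  using assms(5) module_span_superset[of Q R "free_module R S"]
  by (subst coset_eq_iff[OF free_module_module[OF assms(1)] pres_span_submodule[OF assms(1,2)] assms(3,4)])
     auto

lemma pres_induct:
  assumes "cring R" "Q \<subseteq> carrier (free_module R S)" "submodule N R (pres_module R S Q)"
    and "\<And>s. s \<in> S \<Longrightarrow> pres_gen R S Q s \<in> N"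
  shows "carrier (pres_module R S Q) \<subseteq> N"
proof -
  note pr = pres_proj_linear[OF assms(1,2)]
  let ?p = "\<lambda>u. module_span R (free_module R S) Q +>\<^bsub>free_module R S\<^esub> u"
  have "carrier (free_module R S) \<subseteq> {u \<in> carrier (free_module R S). ?p u \<in> N}"
    using assms(4) unfolding pres_gen_def
    by (intro free_module_induct[OF assms(1)] linear_map_vimage_submodule[OF _ _ pr assms(3)]
        free_module_module pres_module_module assms(1,2)) (auto simp: free_gen_closed assms(1))
  then show ?thesis by (auto simp: pres_module_def quot_module_simps)
qed

lemma pres_lift_eq:
  assumes "module R M" "\<And>s. s \<in> S \<Longrightarrow> \<phi> s \<in> carrier M" "Q \<subseteq> carrier (free_module R S)"
    and "\<And>q. q \<in> Q \<Longrightarrow> lin_ext R M \<phi> q = \<zero>\<^bsub>M\<^esub>" and "u \<in> carrier (free_module R S)"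
  shows "pres_lift R M \<phi> (module_span R (free_module R S) Q +>\<^bsub>free_module R S\<^esub> u) = lin_ext R M \<phi> u"
proof -
  interpret M: module R M by fact
  let ?F = "free_module R S" and ?N = "module_span R (free_module R S) Q"
  note R = M.R.is_cring
  note F = free_module_module[OF R, of S]
  interpret F: module R ?F by (rule F)
  note N = pres_span_submodule[OF R assms(3)]
  interpret N: abelian_subgroup ?N ?F using submodule_abelian_subgroup[OF F N] .
  have lin: "linear_map R ?F M (lin_ext R M \<phi>)"
    using assms(1,2) by (intro lin_ext_linear)
  \<comment> \<open>The kernel of the extension is a submodule, so it contains the span of the
    relations as soon as it contains the relations.\<close>
  have "?N \<subseteq> {u \<in> carrier ?F. lin_ext R M \<phi> u = \<zero>\<^bsub>M\<^esub>}"
    using assms(3,4) by (intro module_span_least linear_map_kernel_submodule[OF F assms(1) lin]) auto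
  then have "lin_ext R M \<phi> v = lin_ext R M \<phi> u" if "v \<in> ?N +>\<^bsub>?F\<^esub> u" for v
  proof -
    from that have "v \<in> carrier ?F" "v \<ominus>\<^bsub>?F\<^esub> u \<in> ?N"
      by (auto simp: coset_mem_iff[OF F N assms(5)])
    moreover have "lin_ext R M \<phi> (v \<ominus>\<^bsub>?F\<^esub> u) = \<zero>\<^bsub>M\<^esub>" using \<open>?N \<subseteq> _\<close> calculation(2) by blast
    ultimately show ?thesis
      using assms(5) linear_map_diff[OF F assms(1) lin, of v u]
      by - (rule module_diff_eq_zero[OF assms(1) linear_map_closed[OF lin] linear_map_closed[OF lin]], simp_all)
  qed
  moreover have "u \<in> ?N +>\<^bsub>?F\<^esub> u" using assms(5) by (rule N.a_rcos_self)
  ultimately have "lin_ext R M \<phi> ` (?N +>\<^bsub>?F\<^esub> u) = {lin_ext R M \<phi> u}" by blast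
  then show ?thesis by (simp add: pres_lift_def)
qed

lemma pres_lift_linear:
  assumes "module R M" "\<And>s. s \<in> S \<Longrightarrow> \<phi> s \<in> carrier M" "Q \<subseteq> carrier (free_module R S)"
    and "\<And>q. q \<in> Q \<Longrightarrow> lin_ext R M \<phi> q = \<zero>\<^bsub>M\<^esub>"
  shows "linear_map R (pres_module R S Q) M (pres_lift R M \<phi>)"
proof -
  interpret M: module R M by fact
  let ?F = "free_module R S" and ?N = "module_span R (free_module R S) Q"
  note R = M.R.is_cring
  note F = free_module_module[OF R, of S]
  interpret F: module R ?F by (rule F)
  note eq = pres_lift_eq[OF assms]
  have lin: "linear_map R ?F M (lin_ext R M \<phi>)"
    using assms(1,2) by (intro lin_ext_linear)
  note pr = pres_proj_linear[OF R assms(3)]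
  have C: "C \<in> carrier (pres_module R S Q) \<longleftrightarrow> (\<exists>u\<in>carrier ?F. C = ?N +>\<^bsub>?F\<^esub> u)" for C
    by (auto simp: pres_module_def quot_module_simps)
  show ?thesis
    by (rule linear_mapI)
       (auto simp: C eq linear_map_closed[OF lin] linear_map_add[OF pr, symmetric] linear_map_add[OF lin]
         linear_map_smult[OF pr, symmetric] linear_map_smult[OF lin])
qed

lemma pres_lift_gen:
  assumes "module R M" "\<And>s. s \<in> S \<Longrightarrow> \<phi> s \<in> carrier M" "Q \<subseteq> carrier (free_module R S)"
    and "\<And>q. q \<in> Q \<Longrightarrow> lin_ext R M \<phi> q = \<zero>\<^bsub>M\<^esub>" and "s \<in> S"
  shows "pres_lift R M \<phi> (pres_gen R S Q s) = \<phi> s"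
proof -
  interpret M: module R M by fact
  show ?thesis
    using assms(2,5) unfolding pres_gen_def
    by (subst pres_lift_eq[OF assms(1-4)]) (auto simp: free_gen_closed[OF M.R.is_cring] lin_ext_free_gen[OF assms(1)])
qed

lemma linear_map_eq_on_pres:
  assumes "module R M" "Q \<subseteq> carrier (free_module R S)"
    and "linear_map R (pres_module R S Q) M g" "linear_map R (pres_module R S Q) M h"
    and "\<And>s. s \<in> S \<Longrightarrow> g (pres_gen R S Q s) = h (pres_gen R S Q s)" and "C \<in> carrier (pres_module R S Q)"
  shows "g C = h C"
proof -
  interpret M: module R M by fact
  note R = M.R.is_cring
  note P = pres_module_module[OF R assms(2)]
  note gh = linear_map_minus[OF P assms(1,3,4)]
  have "carrier (pres_module R S Q) \<subseteq> {u \<in> carrier (pres_module R S Q). g u \<ominus>\<^bsub>M\<^esub> h u = \<zero>\<^bsub>M\<^esub>}"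
    using assms(5) linear_map_closed[OF assms(4)]
    by (intro pres_induct[OF R assms(2)] linear_map_kernel_submodule[OF P assms(1) gh])
       (auto simp: pres_gen_closed R a_minus_def M.r_neg)
  from subsetD[OF this assms(6)] show ?thesis
    by - (rule module_diff_eq_zero[OF assms(1) linear_map_closed[OF assms(3)] linear_map_closed[OF assms(4)]], simp_all)
qed

section \<open>Tensor powers\<close>

definition multilinear ::
  "('k, 'm) ring_scheme \<Rightarrow> ('k, 'a) complex_rec \<Rightarrow> nat \<Rightarrow> int \<Rightarrow> ('k, 'b) module \<Rightarrow>
     ((int \<times> 'a) list \<Rightarrow> 'b) \<Rightarrow> bool"
  where
  "multilinear R X n d M \<phi> \<longleftrightarrow>
     (\<forall>w\<in>tensor_words X n d. \<phi> w \<in> carrier M) \<and>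
     (\<forall>u j x v y. u @ (j, x) # v \<in> tensor_words X n d \<longrightarrow> y \<in> carrier (obj X j) \<longrightarrow>
        \<phi> (u @ (j, x \<oplus>\<^bsub>obj X j\<^esub> y) # v) = \<phi> (u @ (j, x) # v) \<oplus>\<^bsub>M\<^esub> \<phi> (u @ (j, y) # v)) \<and>
     (\<forall>u j x v c. u @ (j, x) # v \<in> tensor_words X n d \<longrightarrow> c \<in> carrier R \<longrightarrow>
        \<phi> (u @ (j, c \<odot>\<^bsub>obj X j\<^esub> x) # v) = c \<odot>\<^bsub>M\<^esub> \<phi> (u @ (j, x) # v))"

lemma multilinearI:
  assumes "\<And>w. w \<in> tensor_words X n d \<Longrightarrow> \<phi> w \<in> carrier M"
    and "\<And>u j x v y. u @ (j, x) # v \<in> tensor_words X n d \<Longrightarrow> y \<in> carrier (obj X j) \<Longrightarrow>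
        \<phi> (u @ (j, x \<oplus>\<^bsub>obj X j\<^esub> y) # v) = \<phi> (u @ (j, x) # v) \<oplus>\<^bsub>M\<^esub> \<phi> (u @ (j, y) # v)"
    and "\<And>u j x v c. u @ (j, x) # v \<in> tensor_words X n d \<Longrightarrow> c \<in> carrier R \<Longrightarrow>
        \<phi> (u @ (j, c \<odot>\<^bsub>obj X j\<^esub> x) # v) = c \<odot>\<^bsub>M\<^esub> \<phi> (u @ (j, x) # v)"
  shows "multilinear R X n d M \<phi>"
  using assms by (auto simp: multilinear_def)

lemma multilinear_closed: "multilinear R X n d M \<phi> \<Longrightarrow> w \<in> tensor_words X n d \<Longrightarrow> \<phi> w \<in> carrier M"
  and multilinear_add: "multilinear R X n d M \<phi> \<Longrightarrow> u @ (j, x) # v \<in> tensor_words X n d \<Longrightarrow> y \<in> carrier (obj X j) \<Longrightarrow>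
        \<phi> (u @ (j, x \<oplus>\<^bsub>obj X j\<^esub> y) # v) = \<phi> (u @ (j, x) # v) \<oplus>\<^bsub>M\<^esub> \<phi> (u @ (j, y) # v)"
  and multilinear_smult: "multilinear R X n d M \<phi> \<Longrightarrow> u @ (j, x) # v \<in> tensor_words X n d \<Longrightarrow> c \<in> carrier R \<Longrightarrow>
        \<phi> (u @ (j, c \<odot>\<^bsub>obj X j\<^esub> x) # v) = c \<odot>\<^bsub>M\<^esub> \<phi> (u @ (j, x) # v)"
  unfolding multilinear_def by blast+

lemma tensor_words_Cons:
  "(j, x) # w \<in> tensor_words X n d \<longleftrightarrow>
     (\<exists>m. n = Suc m \<and> x \<in> carrier (obj X j) \<and> w \<in> tensor_words X m (d - j))"
  by (auto simp: tensor_words_def)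

lemma tensor_words_Nil: "[] \<in> tensor_words X n d \<longleftrightarrow> n = 0 \<and> d = 0"
  by (auto simp: tensor_words_def)

lemma tensor_words_replace:
  "u @ (j, x) # v \<in> tensor_words X n d \<Longrightarrow> y \<in> carrier (obj X j) \<Longrightarrow> u @ (j, y) # v \<in> tensor_words X n d"
  by (auto simp: tensor_words_def)

lemma tensor_words_mid: "u @ (j, x) # v \<in> tensor_words X n d \<Longrightarrow> x \<in> carrier (obj X j)"
  by (auto simp: tensor_words_def)

locale graded_module =
  fixes R :: "('k, 'm) ring_scheme" and X :: "('k, 'a) complex_rec"
  assumes cring: "cring R" and obj_module: "module R (obj X j)"
begin

lemma obj_add_closed: "x \<in> carrier (obj X j) \<Longrightarrow> y \<in> carrier (obj X j) \<Longrightarrow> x \<oplus>\<^bsub>obj X j\<^esub> y \<in> carrier (obj X j)"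
  and obj_smult_closed: "c \<in> carrier R \<Longrightarrow> x \<in> carrier (obj X j) \<Longrightarrow> c \<odot>\<^bsub>obj X j\<^esub> x \<in> carrier (obj X j)"
proof -
  interpret M: module R "obj X j" by (rule obj_module)
  show "x \<in> carrier (obj X j) \<Longrightarrow> y \<in> carrier (obj X j) \<Longrightarrow> x \<oplus>\<^bsub>obj X j\<^esub> y \<in> carrier (obj X j)"
    "c \<in> carrier R \<Longrightarrow> x \<in> carrier (obj X j) \<Longrightarrow> c \<odot>\<^bsub>obj X j\<^esub> x \<in> carrier (obj X j)" by auto
qed

lemma tensor_words_add:
    "u @ (j, x) # v \<in> tensor_words X n d \<Longrightarrow> y \<in> carrier (obj X j) \<Longrightarrow>
      u @ (j, x \<oplus>\<^bsub>obj X j\<^esub> y) # v \<in> tensor_words X n d"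
  and tensor_words_smult:
    "u @ (j, x) # v \<in> tensor_words X n d \<Longrightarrow> c \<in> carrier R \<Longrightarrow>
      u @ (j, c \<odot>\<^bsub>obj X j\<^esub> x) # v \<in> tensor_words X n d"
  by (blast intro: tensor_words_replace obj_add_closed obj_smult_closed tensor_words_mid)+

lemma multilinear_rels_closed:
  "multilinear_rels R X n d \<subseteq> carrier (free_module R (tensor_words X n d))"
proof -
  interpret F: module R "free_module R (tensor_words X n d)" by (rule free_module_module[OF cring])
  show ?thesis
    unfolding multilinear_rels_def Let_def
    by (auto intro!: F.M.minus_closed F.M.a_closed F.smult_closed free_gen_closed[OF cring]
        intro: tensor_words_add tensor_words_smult tensor_words_replace)
qed

lemma tensor_module: "module R (tensor_module R X n d)"
  unfolding tensor_module_def by (rule pres_module_module[OF cring multilinear_rels_closed])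

lemma pure_tensor_closed:
  "w \<in> tensor_words X n d \<Longrightarrow> pure_tensor R X n d w \<in> carrier (tensor_module R X n d)"
  unfolding tensor_module_def pure_tensor_def by (rule pres_gen_closed[OF cring])

lemma multilinear_pure_tensor: "multilinear R X n d (tensor_module R X n d) (pure_tensor R X n d)"
proof (rule multilinearI)
  let ?F = "free_module R (tensor_words X n d)"
  interpret F: module R ?F by (rule free_module_module[OF cring])
  note pr = pres_proj_linear[OF cring multilinear_rels_closed[of n d]]
  note rel = pres_relation[OF cring multilinear_rels_closed[of n d]]
  fix u j x v assume w: "u @ (j, x) # v \<in> tensor_words X n d"
  have gx: "free_gen R (u @ (j, x) # v) \<in> carrier ?F" using w by (rule free_gen_closed[OF cring])
  { fix y assume y: "y \<in> carrier (obj X j)"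
    have g: "free_gen R (u @ (j, x \<oplus>\<^bsub>obj X j\<^esub> y) # v) \<in> carrier ?F" "free_gen R (u @ (j, y) # v) \<in> carrier ?F"
      using w y by (auto intro!: free_gen_closed[OF cring] intro: tensor_words_add tensor_words_replace)
    show "pure_tensor R X n d (u @ (j, x \<oplus>\<^bsub>obj X j\<^esub> y) # v) =
        pure_tensor R X n d (u @ (j, x) # v) \<oplus>\<^bsub>tensor_module R X n d\<^esub> pure_tensor R X n d (u @ (j, y) # v)"
      unfolding pure_tensor_def pres_gen_def tensor_module_def linear_map_add[OF pr gx g(2), symmetric]
      using w y by (intro rel g gx F.M.a_closed) (auto simp: multilinear_rels_def Let_def) }
  { fix c assume c: "c \<in> carrier R"
    have g: "free_gen R (u @ (j, c \<odot>\<^bsub>obj X j\<^esub> x) # v) \<in> carrier ?F"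
      using w c by (auto intro!: free_gen_closed[OF cring] tensor_words_smult)
    show "pure_tensor R X n d (u @ (j, c \<odot>\<^bsub>obj X j\<^esub> x) # v) =
        c \<odot>\<^bsub>tensor_module R X n d\<^esub> pure_tensor R X n d (u @ (j, x) # v)"
      unfolding pure_tensor_def pres_gen_def tensor_module_def linear_map_smult[OF pr c gx, symmetric]
      using w c by (intro rel g gx F.smult_closed) (auto simp: multilinear_rels_def Let_def) }
qed (rule pure_tensor_closed)

lemma multilinear_kills_rels:
  assumes "module R M" "multilinear R X n d M \<phi>" "q \<in> multilinear_rels R X n d"
  shows "lin_ext R M \<phi> q = \<zero>\<^bsub>M\<^esub>"
proof -
  let ?F = "free_module R (tensor_words X n d)"
  have F: "module R ?F" by (rule free_module_module[OF cring])
  interpret F: module R ?F by (rule F)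
  interpret M: module R M by fact
  have lin: "linear_map R ?F M (lin_ext R M \<phi>)"
    by (rule lin_ext_linear[OF assms(1) multilinear_closed[OF assms(2)]])
  have gen: "w \<in> tensor_words X n d \<Longrightarrow> lin_ext R M \<phi> (free_gen R w) = \<phi> w" for w
    by (rule lin_ext_free_gen[where \<phi> = \<phi> and s = w, OF assms(1) multilinear_closed[OF assms(2)]])
  note cl = free_gen_closed[OF cring, of _ "tensor_words X n d"] multilinear_closed[OF assms(2)]
  from assms(3) consider
    (add) u j x y v where "u @ (j, x) # v \<in> tensor_words X n d" "y \<in> carrier (obj X j)"
      "q = free_gen R (u @ (j, x \<oplus>\<^bsub>obj X j\<^esub> y) # v)
        \<ominus>\<^bsub>?F\<^esub> (free_gen R (u @ (j, x) # v) \<oplus>\<^bsub>?F\<^esub> free_gen R (u @ (j, y) # v))"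
  | (smult) u j x c v where "u @ (j, x) # v \<in> tensor_words X n d" "c \<in> carrier R"
      "q = free_gen R (u @ (j, c \<odot>\<^bsub>obj X j\<^esub> x) # v) \<ominus>\<^bsub>?F\<^esub> (c \<odot>\<^bsub>?F\<^esub> free_gen R (u @ (j, x) # v))"
    by (auto simp: multilinear_rels_def Let_def)
  then show ?thesis
  proof cases
    case add
    have w: "u @ (j, y) # v \<in> tensor_words X n d" "u @ (j, x \<oplus>\<^bsub>obj X j\<^esub> y) # v \<in> tensor_words X n d"
      using add by (auto intro: tensor_words_add tensor_words_replace)
    show ?thesis
      using add w multilinear_add[OF assms(2) add(1,2)]
      by (simp add: linear_map_diff[OF F assms(1) lin] linear_map_add[OF lin] cl gen module_diff_self[OF assms(1)])
  next
    case smult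
    have w: "u @ (j, c \<odot>\<^bsub>obj X j\<^esub> x) # v \<in> tensor_words X n d"
      using smult by (auto intro: tensor_words_smult)
    show ?thesis
      using smult w multilinear_smult[OF assms(2) smult(1,2)]
      by (simp add: linear_map_diff[OF F assms(1) lin] linear_map_smult[OF lin] cl gen module_diff_self[OF assms(1)])
  qed
qed

lemma tensor_lift_linear:
  assumes "module R M" "multilinear R X n d M \<phi>"
  shows "linear_map R (tensor_module R X n d) M (pres_lift R M \<phi>)"
  unfolding tensor_module_def
  by (rule pres_lift_linear[OF assms(1) multilinear_closed[OF assms(2)] multilinear_rels_closed
        multilinear_kills_rels[OF assms]])

lemma tensor_lift_pure:
  assumes "module R M" "multilinear R X n d M \<phi>" "w \<in> tensor_words X n d"
  shows "pres_lift R M \<phi> (pure_tensor R X n d w) = \<phi> w"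
  unfolding pure_tensor_def
  by (rule pres_lift_gen[OF assms(1) multilinear_closed[OF assms(2)] multilinear_rels_closed
        multilinear_kills_rels[OF assms(1,2)] assms(3)])

lemma linear_map_eq_on_tensor:
  assumes "module R M" "linear_map R (tensor_module R X n d) M g" "linear_map R (tensor_module R X n d) M h"
    and "\<And>w. w \<in> tensor_words X n d \<Longrightarrow> g (pure_tensor R X n d w) = h (pure_tensor R X n d w)"
    and "t \<in> carrier (tensor_module R X n d)"
  shows "g t = h t"
  by (rule linear_map_eq_on_pres[OF assms(1) multilinear_rels_closed assms(2,3)[unfolded tensor_module_def]
        assms(4)[unfolded pure_tensor_def] assms(5)[unfolded tensor_module_def]])

lemma tensor_induct:
  assumes "submodule N R (tensor_module R X n d)"
    and "\<And>w. w \<in> tensor_words X n d \<Longrightarrow> pure_tensor R X n d w \<in> N"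
  shows "carrier (tensor_module R X n d) \<subseteq> N"
  using pres_induct[OF cring multilinear_rels_closed assms(1)[unfolded tensor_module_def] assms(2)[unfolded pure_tensor_def]]
  by (simp add: tensor_module_def)

text \<open>The differential is defined by a sum over positions but studied by recursion on the
  word, and the two formulas are compared on tensor words only. This transfers multilinearity from
  one to the other.\<close>

lemma multilinear_cong:
  assumes "multilinear R X n d M \<phi>" "\<And>w. w \<in> tensor_words X n d \<Longrightarrow> \<psi> w = \<phi> w"
  shows "multilinear R X n d M \<psi>"
proof (rule multilinearI)
  fix u j x v assume w: "u @ (j, x) # v \<in> tensor_words X n d"
  { fix y assume y: "y \<in> carrier (obj X j)"
    show "\<psi> (u @ (j, x \<oplus>\<^bsub>obj X j\<^esub> y) # v) = \<psi> (u @ (j, x) # v) \<oplus>\<^bsub>M\<^esub> \<psi> (u @ (j, y) # v)"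
      using multilinear_add[OF assms(1) w y] w y
        assms(2)[OF tensor_words_replace[OF w]] assms(2)[OF w] obj_add_closed tensor_words_mid[OF w]
      by simp }
  { fix c assume c: "c \<in> carrier R"
    show "\<psi> (u @ (j, c \<odot>\<^bsub>obj X j\<^esub> x) # v) = c \<odot>\<^bsub>M\<^esub> \<psi> (u @ (j, x) # v)"
      using multilinear_smult[OF assms(1) w c] w c
        assms(2)[OF tensor_words_replace[OF w]] assms(2)[OF w] obj_smult_closed tensor_words_mid[OF w]
      by simp }
qed (simp add: assms(2) multilinear_closed[OF assms(1)])

subsection \<open>Splitting off the first factor\<close>

text \<open>Left multiplication by a homogeneous element of degree \<open>j\<close>. The arity and
  the degree that it carries are those of the target; the source has one factor less and degree
  \<open>d - j\<close>.\<close>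

definition tensor_cons :: "nat \<Rightarrow> int \<Rightarrow> int \<Rightarrow> 'a \<Rightarrow> ((int \<times> 'a) list \<Rightarrow> 'k) set \<Rightarrow> ((int \<times> 'a) list \<Rightarrow> 'k) set"
  where "tensor_cons n d j x = pres_lift R (tensor_module R X n d) (\<lambda>w. pure_tensor R X n d ((j, x) # w))"

lemma multilinear_Cons:
  assumes "x \<in> carrier (obj X j)"
  shows "multilinear R X n (d - j) (tensor_module R X (Suc n) d) (\<lambda>w. pure_tensor R X (Suc n) d ((j, x) # w))"
proof (rule multilinearI)
  note m = multilinear_pure_tensor[of "Suc n" d]
  fix u i y v assume w: "u @ (i, y) # v \<in> tensor_words X n (d - j)"
  then have w': "((j, x) # u) @ (i, y) # v \<in> tensor_words X (Suc n) d"
    using assms by (simp add: tensor_words_Cons)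
  note multilinear_add[OF m w'] multilinear_smult[OF m w']
  then show "z \<in> carrier (obj X i) \<Longrightarrow>
      pure_tensor R X (Suc n) d ((j, x) # u @ (i, y \<oplus>\<^bsub>obj X i\<^esub> z) # v) =
      pure_tensor R X (Suc n) d ((j, x) # u @ (i, y) # v) \<oplus>\<^bsub>tensor_module R X (Suc n) d\<^esub>
      pure_tensor R X (Suc n) d ((j, x) # u @ (i, z) # v)"
    "c \<in> carrier R \<Longrightarrow>
      pure_tensor R X (Suc n) d ((j, x) # u @ (i, c \<odot>\<^bsub>obj X i\<^esub> y) # v) =
      c \<odot>\<^bsub>tensor_module R X (Suc n) d\<^esub> pure_tensor R X (Suc n) d ((j, x) # u @ (i, y) # v)" for z c
    by simp_all
qed (use assms in \<open>auto intro!: pure_tensor_closed simp: tensor_words_Cons\<close>)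

text \<open>The degree of the source is tied to \<open>d - j\<close> by an equation, so that
  expressions such as \<open>d + 1 - (j + 1)\<close> and \<open>d - j\<close> can be identified by
  arithmetic whenever the lemma is applied.\<close>

lemma tensor_cons_linear:
  "x \<in> carrier (obj X j) \<Longrightarrow> e = d - j \<Longrightarrow>
    linear_map R (tensor_module R X n e) (tensor_module R X (Suc n) d) (tensor_cons (Suc n) d j x)"
  unfolding tensor_cons_def by (simp add: tensor_lift_linear[OF tensor_module multilinear_Cons])

lemma tensor_cons_pure:
  "x \<in> carrier (obj X j) \<Longrightarrow> e = d - j \<Longrightarrow> w \<in> tensor_words X n e \<Longrightarrow>
    tensor_cons (Suc n) d j x (pure_tensor R X n e w) = pure_tensor R X (Suc n) d ((j, x) # w)"
  unfolding tensor_cons_def by (simp add: tensor_lift_pure[OF tensor_module multilinear_Cons])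

lemmas tensor_cons_closed = linear_map_closed[OF tensor_cons_linear]

lemma tensor_cons_factor_linear:
  assumes "t \<in> carrier (tensor_module R X n (d - j))"
  shows "linear_map R (obj X j) (tensor_module R X (Suc n) d) (\<lambda>x. tensor_cons (Suc n) d j x t)"
proof (rule linear_mapI)
  note m = multilinear_pure_tensor[of "Suc n" d]
  fix x assume x: "x \<in> carrier (obj X j)"
  show "tensor_cons (Suc n) d j x t \<in> carrier (tensor_module R X (Suc n) d)"
    using x assms by (simp add: tensor_cons_closed[OF _ refl])
  { fix y assume y: "y \<in> carrier (obj X j)"
    show "tensor_cons (Suc n) d j (x \<oplus>\<^bsub>obj X j\<^esub> y) t =
      tensor_cons (Suc n) d j x t \<oplus>\<^bsub>tensor_module R X (Suc n) d\<^esub> tensor_cons (Suc n) d j y t"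
    proof (rule linear_map_eq_on_tensor[OF tensor_module[of "Suc n" d] _ _ _ assms])
      fix w assume w: "w \<in> tensor_words X n (d - j)"
      then have "[] @ (j, x) # w \<in> tensor_words X (Suc n) d" using x by (simp add: tensor_words_Cons)
      from multilinear_add[OF m this y] w
      show "tensor_cons (Suc n) d j (x \<oplus>\<^bsub>obj X j\<^esub> y) (pure_tensor R X n (d - j) w) =
        tensor_cons (Suc n) d j x (pure_tensor R X n (d - j) w) \<oplus>\<^bsub>tensor_module R X (Suc n) d\<^esub>
        tensor_cons (Suc n) d j y (pure_tensor R X n (d - j) w)"
        by (simp add: tensor_cons_pure x y obj_add_closed)
    qed (intro linear_map_plus tensor_module tensor_cons_linear x y obj_add_closed refl)+ }
  { fix c assume c: "c \<in> carrier R"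
    show "tensor_cons (Suc n) d j (c \<odot>\<^bsub>obj X j\<^esub> x) t =
      c \<odot>\<^bsub>tensor_module R X (Suc n) d\<^esub> tensor_cons (Suc n) d j x t"
    proof (rule linear_map_eq_on_tensor[OF tensor_module[of "Suc n" d] _ _ _ assms])
      fix w assume w: "w \<in> tensor_words X n (d - j)"
      then have "[] @ (j, x) # w \<in> tensor_words X (Suc n) d" using x by (simp add: tensor_words_Cons)
      from multilinear_smult[OF m this c] w
      show "tensor_cons (Suc n) d j (c \<odot>\<^bsub>obj X j\<^esub> x) (pure_tensor R X n (d - j) w) =
        c \<odot>\<^bsub>tensor_module R X (Suc n) d\<^esub> tensor_cons (Suc n) d j x (pure_tensor R X n (d - j) w)"
        by (simp add: tensor_cons_pure x c obj_smult_closed)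
    qed (intro linear_map_scale tensor_module tensor_cons_linear x c obj_smult_closed refl)+ }
qed

text \<open>This is what drives inductions on the arity: every word of positive length is a letter
  followed by a tail. The tail \<open>t\<close> is an arbitrary tensor, not only a pure one, so that
  an induction hypothesis about tensors applies to it.\<close>

lemma tensor_Suc_eq:
  assumes "module R M" "linear_map R (tensor_module R X (Suc n) d) M g" "linear_map R (tensor_module R X (Suc n) d) M h"
    and "\<And>j x t. x \<in> carrier (obj X j) \<Longrightarrow> t \<in> carrier (tensor_module R X n (d - j)) \<Longrightarrow>
      g (tensor_cons (Suc n) d j x t) = h (tensor_cons (Suc n) d j x t)"
    and "t \<in> carrier (tensor_module R X (Suc n) d)"
  shows "g t = h t"
proof (rule linear_map_eq_on_tensor[OF assms(1-3) _ assms(5)])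
  fix w assume "w \<in> tensor_words X (Suc n) d"
  then obtain j x v where "w = (j, x) # v" "x \<in> carrier (obj X j)" "v \<in> tensor_words X n (d - j)"
    by (cases w) (auto simp: tensor_words_Cons tensor_words_Nil)
  then show "g (pure_tensor R X (Suc n) d w) = h (pure_tensor R X (Suc n) d w)"
    using assms(4)[of x j "pure_tensor R X n (d - j) v"] by (simp add: tensor_cons_pure pure_tensor_closed)
qed

subsection \<open>Twisted derivations\<close>

text \<open>\<open>\<delta>\<close> is applied to one factor, \<open>\<eta>\<close> to all factors before it. The differential is the case
  \<open>\<eta> = id\<close>, and the tensor power of a homotopy between the identity and \<open>e\<close> is the case \<open>\<eta> = e\<close>.\<close>

fun twisted_word :: "(int \<Rightarrow> 'a \<Rightarrow> 'a) \<Rightarrow> (int \<Rightarrow> 'a \<Rightarrow> 'a) \<Rightarrow> int \<Rightarrow> int \<Rightarrow> (int \<times> 'a) list \<Rightarrow> ((int \<times> 'a) list \<Rightarrow> 'k) set"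
  where
  "twisted_word \<delta> \<eta> s d [] = \<zero>\<^bsub>tensor_module R X 0 d\<^esub>"
| "twisted_word \<delta> \<eta> s d ((j, x) # w) =
     pure_tensor R X (Suc (length w)) d ((j + s, \<delta> j x) # w) \<oplus>\<^bsub>tensor_module R X (Suc (length w)) d\<^esub>
     [neg_one_pow j] \<cdot>\<^bsub>tensor_module R X (Suc (length w)) d\<^esub>
       tensor_cons (Suc (length w)) d j (\<eta> j x) (twisted_word \<delta> \<eta> s (d - j) w)"

lemma length_tensor_words: "w \<in> tensor_words X n d \<Longrightarrow> length w = n"
  by (simp add: tensor_words_def)

text \<open>In every summand the varying letter occurs exactly once, under \<open>\<delta>\<close>,
  under \<open>\<eta>\<close> or unchanged. The degree argument of \<open>twisted_word\<close> is
  the degree of the value, hence \<open>d + s\<close>.\<close>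

lemma multilinear_twisted_word:
  assumes d: "\<And>j. linear_map R (obj X j) (obj X (j + s)) (\<delta> j)"
    and e: "\<And>j. linear_map R (obj X j) (obj X j) (\<eta> j)"
  shows "multilinear R X n d (tensor_module R X n (d + s)) (twisted_word \<delta> \<eta> s (d + s))"
proof (rule multilinearI)
  show closed: "twisted_word \<delta> \<eta> s (d + s) w \<in> carrier (tensor_module R X n (d + s))"
    if "w \<in> tensor_words X n d" for w n d
    using that
  proof (induction w arbitrary: n d)
    case Nil
    interpret T: module R "tensor_module R X 0 s" by (rule tensor_module)
    show ?case using Nil by (simp add: tensor_words_Nil)
  next
    case (Cons a w)
    obtain j x where a: "a = (j, x)" by (cases a)
    from Cons.prems a obtain m where m: "n = Suc m" "x \<in> carrier (obj X j)" "w \<in> tensor_words X m (d - j)"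
      by (auto simp: tensor_words_Cons)
    interpret T: module R "tensor_module R X (Suc m) (d + s)" by (rule tensor_module)
    have t: "twisted_word \<delta> \<eta> s (d + s - j) w \<in> carrier (tensor_module R X m (d + s - j))"
      using Cons.IH[OF m(3)] by (simp add: algebra_simps)
    have p: "(j + s, \<delta> j x) # w \<in> tensor_words X (Suc m) (d + s)"
      using m linear_map_closed[OF d m(2)] by (simp add: tensor_words_Cons)
    show ?case
      using tensor_cons_closed[OF linear_map_closed[OF e m(2)] refl t] pure_tensor_closed[OF p]
      by (simp add: a m(1) length_tensor_words[OF m(3)])
  qed
  have main: "(\<forall>y\<in>carrier (obj X j).
      twisted_word \<delta> \<eta> s (d + s) (u @ (j, x \<oplus>\<^bsub>obj X j\<^esub> y) # v) =
      twisted_word \<delta> \<eta> s (d + s) (u @ (j, x) # v) \<oplus>\<^bsub>tensor_module R X n (d + s)\<^esub>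
      twisted_word \<delta> \<eta> s (d + s) (u @ (j, y) # v)) \<and>
    (\<forall>c\<in>carrier R.
      twisted_word \<delta> \<eta> s (d + s) (u @ (j, c \<odot>\<^bsub>obj X j\<^esub> x) # v) =
      c \<odot>\<^bsub>tensor_module R X n (d + s)\<^esub> twisted_word \<delta> \<eta> s (d + s) (u @ (j, x) # v))"
    if "u @ (j, x) # v \<in> tensor_words X n d" for u j x v
    using that
  proof (induction u arbitrary: n d)
    \<comment> \<open>The varying letter is the head: it occurs under \<open>\<delta>\<close> with
      the tail unchanged, and under \<open>\<eta>\<close> with the tail already transformed. Both
      are linear because multiplication by a fixed tail is.\<close>
    case Nil
    then obtain m where m: "n = Suc m" "x \<in> carrier (obj X j)" "v \<in> tensor_words X m (d - j)"
      by (auto simp: tensor_words_Cons)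
    have len: "length v = m" using length_tensor_words[OF m(3)] .
    let ?t = "twisted_word \<delta> \<eta> s (d + s - j) v"
    have t: "?t \<in> carrier (tensor_module R X m (d + s - j))"
      using closed[OF m(3)] by (simp add: algebra_simps)
    have p: "pure_tensor R X m (d - j) v \<in> carrier (tensor_module R X m (d + s - (j + s)))"
      using pure_tensor_closed[OF m(3)] by simp
    have M: "module R (tensor_module R X (Suc m) (d + s))" by (rule tensor_module)
    have lin: "linear_map R (obj X j) (tensor_module R X (Suc m) (d + s))
      (\<lambda>x. tensor_cons (Suc m) (d + s) (j + s) (\<delta> j x) (pure_tensor R X m (d - j) v)
        \<oplus>\<^bsub>tensor_module R X (Suc m) (d + s)\<^esub>
       [neg_one_pow j] \<cdot>\<^bsub>tensor_module R X (Suc m) (d + s)\<^esub> tensor_cons (Suc m) (d + s) j (\<eta> j x) ?t)"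
      by (intro linear_map_plus linear_map_int_scale M obj_module linear_map_comp[OF d tensor_cons_factor_linear]
          linear_map_comp[OF e tensor_cons_factor_linear] t p)
    have eq: "twisted_word \<delta> \<eta> s (d + s) ((j, x) # v) =
        tensor_cons (Suc m) (d + s) (j + s) (\<delta> j x) (pure_tensor R X m (d - j) v)
        \<oplus>\<^bsub>tensor_module R X (Suc m) (d + s)\<^esub>
       [neg_one_pow j] \<cdot>\<^bsub>tensor_module R X (Suc m) (d + s)\<^esub> tensor_cons (Suc m) (d + s) j (\<eta> j x) ?t"
      if "x \<in> carrier (obj X j)" for x
      using m by (simp add: len tensor_cons_pure linear_map_closed[OF d that])
    show ?case
      using linear_map_add[OF lin m(2)] linear_map_smult[OF lin _ m(2)]
      by (simp add: eq m obj_add_closed obj_smult_closed del: twisted_word.simps)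
  next
    \<comment> \<open>The varying letter lies in the tail, which enters the first summand as a pure
      tensor and the second one through the induction hypothesis.\<close>
    case (Cons a u)
    obtain i z where a: "a = (i, z)" by (cases a)
    from Cons.prems a obtain m where m: "n = Suc m" "z \<in> carrier (obj X i)" "u @ (j, x) # v \<in> tensor_words X m (d - i)"
      by (auto simp: tensor_words_Cons)
    have len: "length u + Suc (length v) = m" using length_tensor_words[OF m(3)] by simp
    have x: "x \<in> carrier (obj X j)" using tensor_words_mid[OF m(3)] .
    let ?M = "tensor_module R X (Suc m) (d + s)"
    interpret M: module R ?M by (rule tensor_module)
    let ?f = "\<lambda>t. [neg_one_pow i] \<cdot>\<^bsub>?M\<^esub> tensor_cons (Suc m) (d + s) i (\<eta> i z) t"
    have lin: "linear_map R (tensor_module R X m (d - i + s)) ?M ?f"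
      by (intro linear_map_int_scale tensor_module tensor_cons_linear linear_map_closed[OF e m(2)]) simp
    have eq: "twisted_word \<delta> \<eta> s (d + s) (((i, z) # u) @ (j, y) # v) =
      pure_tensor R X (Suc m) (d + s) (((i + s, \<delta> i z) # u) @ (j, y) # v)
      \<oplus>\<^bsub>?M\<^esub> ?f (twisted_word \<delta> \<eta> s (d - i + s) (u @ (j, y) # v))" for y
      using len by (simp add: algebra_simps)
    have w: "((i + s, \<delta> i z) # u) @ (j, x) # v \<in> tensor_words X (Suc m) (d + s)"
      using m linear_map_closed[OF d m(2)] by (auto simp: tensor_words_Cons)
    note mp = multilinear_pure_tensor[of "Suc m" "d + s"]
    have c: "twisted_word \<delta> \<eta> s (d - i + s) (u @ (j, x) # v) \<in> carrier (tensor_module R X m (d - i + s))"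
      by (rule closed[OF m(3)])
    note c' = linear_map_closed[OF lin c] pure_tensor_closed[OF w]
    show ?case
    proof (intro conjI ballI)
      fix y assume y: "y \<in> carrier (obj X j)"
      have cy: "twisted_word \<delta> \<eta> s (d - i + s) (u @ (j, y) # v) \<in> carrier (tensor_module R X m (d - i + s))"
        by (rule closed[OF tensor_words_replace[OF m(3) y]])
      note c'' = linear_map_closed[OF lin cy] pure_tensor_closed[OF tensor_words_replace[OF w y]]
      show "twisted_word \<delta> \<eta> s (d + s) ((a # u) @ (j, x \<oplus>\<^bsub>obj X j\<^esub> y) # v) =
          twisted_word \<delta> \<eta> s (d + s) ((a # u) @ (j, x) # v) \<oplus>\<^bsub>tensor_module R X n (d + s)\<^esub>
          twisted_word \<delta> \<eta> s (d + s) ((a # u) @ (j, y) # v)"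
        unfolding m a eq multilinear_add[OF mp w y] bspec[OF conjunct1[OF Cons.IH[OF m(3)]] y] linear_map_add[OF lin c cy]
        using c' c'' by (simp only: M.a_ac M.M.a_closed)
    next
      fix r assume r: "r \<in> carrier R"
      show "twisted_word \<delta> \<eta> s (d + s) ((a # u) @ (j, r \<odot>\<^bsub>obj X j\<^esub> x) # v) =
          r \<odot>\<^bsub>tensor_module R X n (d + s)\<^esub> twisted_word \<delta> \<eta> s (d + s) ((a # u) @ (j, x) # v)"
        unfolding m a eq multilinear_smult[OF mp w r] bspec[OF conjunct2[OF Cons.IH[OF m(3)]] r] linear_map_smult[OF lin r c]
        using c' r by (simp only: M.smult_r_distr)
    qed
  qed
  fix u j x v assume w: "u @ (j, x) # v \<in> tensor_words X n d"
  { fix y assume "y \<in> carrier (obj X j)"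
    then show "twisted_word \<delta> \<eta> s (d + s) (u @ (j, x \<oplus>\<^bsub>obj X j\<^esub> y) # v) =
        twisted_word \<delta> \<eta> s (d + s) (u @ (j, x) # v) \<oplus>\<^bsub>tensor_module R X n (d + s)\<^esub>
        twisted_word \<delta> \<eta> s (d + s) (u @ (j, y) # v)"
      using main[OF w] by blast }
  { fix c assume "c \<in> carrier R"
    then show "twisted_word \<delta> \<eta> s (d + s) (u @ (j, c \<odot>\<^bsub>obj X j\<^esub> x) # v) =
        c \<odot>\<^bsub>tensor_module R X n (d + s)\<^esub> twisted_word \<delta> \<eta> s (d + s) (u @ (j, x) # v)"
      using main[OF w] by blast }
qed

definition twisted_derivation ::
  "(int \<Rightarrow> 'a \<Rightarrow> 'a) \<Rightarrow> (int \<Rightarrow> 'a \<Rightarrow> 'a) \<Rightarrow> int \<Rightarrow> nat \<Rightarrow> int \<Rightarrow> ((int \<times> 'a) list \<Rightarrow> 'k) set \<Rightarrow> ((int \<times> 'a) list \<Rightarrow> 'k) set"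
  where "twisted_derivation \<delta> \<eta> s n d = pres_lift R (tensor_module R X n (d + s)) (twisted_word \<delta> \<eta> s (d + s))"

context
  fixes \<delta> \<eta> s
  assumes \<delta>: "\<And>j. linear_map R (obj X j) (obj X (j + s)) (\<delta> j)"
    and \<eta>: "\<And>j. linear_map R (obj X j) (obj X j) (\<eta> j)"
begin

lemma twisted_derivation_linear:
  "e = d + s \<Longrightarrow> linear_map R (tensor_module R X n d) (tensor_module R X n e) (twisted_derivation \<delta> \<eta> s n d)"
  unfolding twisted_derivation_def
  by (simp add: tensor_lift_linear[OF tensor_module multilinear_twisted_word[OF \<delta> \<eta>]])

lemma twisted_derivation_pure:
  "w \<in> tensor_words X n d \<Longrightarrow> twisted_derivation \<delta> \<eta> s n d (pure_tensor R X n d w) = twisted_word \<delta> \<eta> s (d + s) w"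
  unfolding twisted_derivation_def
  by (rule tensor_lift_pure[OF tensor_module multilinear_twisted_word[OF \<delta> \<eta>]])

lemma twisted_derivation_0:
  assumes "t \<in> carrier (tensor_module R X 0 d)"
  shows "twisted_derivation \<delta> \<eta> s 0 d t = \<zero>\<^bsub>tensor_module R X 0 (d + s)\<^esub>"
proof -
  have "twisted_derivation \<delta> \<eta> s 0 d t = (\<lambda>t. \<zero>\<^bsub>tensor_module R X 0 (d + s)\<^esub>) t"
  proof (rule linear_map_eq_on_tensor[OF tensor_module[of 0 "d + s"] _ _ _ assms])
    fix w assume w: "w \<in> tensor_words X 0 d"
    then have "w = []" by (simp add: tensor_words_def)
    then show "twisted_derivation \<delta> \<eta> s 0 d (pure_tensor R X 0 d w) = \<zero>\<^bsub>tensor_module R X 0 (d + s)\<^esub>"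
      using twisted_derivation_pure[OF w] by simp
  qed (intro twisted_derivation_linear refl linear_map_const_zero tensor_module)+
  then show ?thesis .
qed

text \<open>A Leibniz rule in which the factor that is passed is also hit by \<open>\<eta>\<close>.
  The sign depends on \<open>j\<close> alone, as is right for operators of odd degree; the two that
  are used have degree 1 and degree -1.\<close>

lemma twisted_derivation_cons:
  assumes "x \<in> carrier (obj X j)" "t \<in> carrier (tensor_module R X n (d - j))"
  shows "twisted_derivation \<delta> \<eta> s (Suc n) d (tensor_cons (Suc n) d j x t) =
    tensor_cons (Suc n) (d + s) (j + s) (\<delta> j x) t \<oplus>\<^bsub>tensor_module R X (Suc n) (d + s)\<^esub>
    [neg_one_pow j] \<cdot>\<^bsub>tensor_module R X (Suc n) (d + s)\<^esub>
      tensor_cons (Suc n) (d + s) j (\<eta> j x) (twisted_derivation \<delta> \<eta> s n (d - j) t)"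
proof (rule linear_map_eq_on_tensor[OF tensor_module _ _ _ assms(2)])
  note c = linear_map_closed[OF \<delta> assms(1)] linear_map_closed[OF \<eta> assms(1)]
  show "linear_map R (tensor_module R X n (d - j)) (tensor_module R X (Suc n) (d + s))
     (\<lambda>a. twisted_derivation \<delta> \<eta> s (Suc n) d (tensor_cons (Suc n) d j x a))"
    by (rule linear_map_comp[OF tensor_cons_linear[OF assms(1) refl] twisted_derivation_linear[OF refl]])
  show "linear_map R (tensor_module R X n (d - j)) (tensor_module R X (Suc n) (d + s))
     (\<lambda>a. tensor_cons (Suc n) (d + s) (j + s) (\<delta> j x) a \<oplus>\<^bsub>tensor_module R X (Suc n) (d + s)\<^esub>
          [neg_one_pow j] \<cdot>\<^bsub>tensor_module R X (Suc n) (d + s)\<^esub>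
          tensor_cons (Suc n) (d + s) j (\<eta> j x) (twisted_derivation \<delta> \<eta> s n (d - j) a))"
    by (intro linear_map_plus linear_map_int_scale tensor_module tensor_cons_linear
        linear_map_comp[OF twisted_derivation_linear[OF refl] tensor_cons_linear] c) simp_all
  fix w assume w: "w \<in> tensor_words X n (d - j)"
  then have w': "(j, x) # w \<in> tensor_words X (Suc n) d" using assms(1) by (simp add: tensor_words_Cons)
  show "twisted_derivation \<delta> \<eta> s (Suc n) d (tensor_cons (Suc n) d j x (pure_tensor R X n (d - j) w)) =
    tensor_cons (Suc n) (d + s) (j + s) (\<delta> j x) (pure_tensor R X n (d - j) w) \<oplus>\<^bsub>tensor_module R X (Suc n) (d + s)\<^esub>
    [neg_one_pow j] \<cdot>\<^bsub>tensor_module R X (Suc n) (d + s)\<^esub>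
      tensor_cons (Suc n) (d + s) j (\<eta> j x) (twisted_derivation \<delta> \<eta> s n (d - j) (pure_tensor R X n (d - j) w))"
    using w by (simp add: tensor_cons_pure assms(1) twisted_derivation_pure[OF w'] twisted_derivation_pure[OF w] c
        length_tensor_words algebra_simps)
qed

end

end

lemma neg_one_pow_pred: "neg_one_pow (j - 1) = - neg_one_pow j"
  and neg_one_pow_succ: "neg_one_pow (j + 1) = - neg_one_pow j"
  by (auto simp: neg_one_pow_def)

text \<open>In the application \<open>b\<close> and \<open>c\<close> are the terms where the two
  operators act on different factors. Each occurs twice with opposite signs. What survives are the
  terms with both operators on the head and those with both on the tail.\<close>

lemma signed_homotopy_sum:
  assumes "module R M" "a1 \<in> carrier M" "a2 \<in> carrier M" "b \<in> carrier M" "c \<in> carrier M"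
    "f1 \<in> carrier M" "f2 \<in> carrier M"
  shows "((a1 \<oplus>\<^bsub>M\<^esub> [neg_one_pow (j - 1)] \<cdot>\<^bsub>M\<^esub> b) \<oplus>\<^bsub>M\<^esub> [neg_one_pow j] \<cdot>\<^bsub>M\<^esub> (c \<oplus>\<^bsub>M\<^esub> [neg_one_pow j] \<cdot>\<^bsub>M\<^esub> f1))
     \<oplus>\<^bsub>M\<^esub> ((a2 \<oplus>\<^bsub>M\<^esub> [neg_one_pow (j + 1)] \<cdot>\<^bsub>M\<^esub> c) \<oplus>\<^bsub>M\<^esub> [neg_one_pow j] \<cdot>\<^bsub>M\<^esub> (b \<oplus>\<^bsub>M\<^esub> [neg_one_pow j] \<cdot>\<^bsub>M\<^esub> f2))
     = (a1 \<oplus>\<^bsub>M\<^esub> a2) \<oplus>\<^bsub>M\<^esub> (f1 \<oplus>\<^bsub>M\<^esub> f2)"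
proof -
  interpret M: module R M by fact
  define B C where "B = [neg_one_pow j] \<cdot>\<^bsub>M\<^esub> b" and "C = [neg_one_pow j] \<cdot>\<^bsub>M\<^esub> c"
  have BC: "B \<in> carrier M" "C \<in> carrier M" using assms by (simp_all add: B_def C_def)
  have e: "[neg_one_pow (j - 1)] \<cdot>\<^bsub>M\<^esub> b = \<ominus>\<^bsub>M\<^esub> B" "[neg_one_pow (j + 1)] \<cdot>\<^bsub>M\<^esub> c = \<ominus>\<^bsub>M\<^esub> C"
    "[neg_one_pow j] \<cdot>\<^bsub>M\<^esub> (c \<oplus>\<^bsub>M\<^esub> [neg_one_pow j] \<cdot>\<^bsub>M\<^esub> f1) = C \<oplus>\<^bsub>M\<^esub> f1"
    "[neg_one_pow j] \<cdot>\<^bsub>M\<^esub> (b \<oplus>\<^bsub>M\<^esub> [neg_one_pow j] \<cdot>\<^bsub>M\<^esub> f2) = B \<oplus>\<^bsub>M\<^esub> f2"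
    using assms by (simp_all add: B_def C_def neg_one_pow_pred neg_one_pow_succ int_smult_uminus[OF assms(1)]
        int_smult_add[OF assms(1)] int_smult_smult[OF assms(1)] neg_one_pow_square)
  have "((a1 \<oplus>\<^bsub>M\<^esub> \<ominus>\<^bsub>M\<^esub> B) \<oplus>\<^bsub>M\<^esub> (C \<oplus>\<^bsub>M\<^esub> f1)) \<oplus>\<^bsub>M\<^esub> ((a2 \<oplus>\<^bsub>M\<^esub> \<ominus>\<^bsub>M\<^esub> C) \<oplus>\<^bsub>M\<^esub> (B \<oplus>\<^bsub>M\<^esub> f2))
     = ((a1 \<oplus>\<^bsub>M\<^esub> a2) \<oplus>\<^bsub>M\<^esub> (f1 \<oplus>\<^bsub>M\<^esub> f2)) \<oplus>\<^bsub>M\<^esub> ((B \<oplus>\<^bsub>M\<^esub> \<ominus>\<^bsub>M\<^esub> B) \<oplus>\<^bsub>M\<^esub> (C \<oplus>\<^bsub>M\<^esub> \<ominus>\<^bsub>M\<^esub> C))"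
    using assms BC by (simp only: M.a_ac M.a_closed M.a_inv_closed)
  then show ?thesis using assms BC by (simp add: e M.r_neg)
qed

lemma cochain_complexD:
  assumes "cochain_complex R X"
  shows "module R (obj X d)" "linear_map R (obj X d) (obj X (d + 1)) (dif X d)"
    "x \<in> carrier (obj X d) \<Longrightarrow> dif X (d + 1) (dif X d x) = \<zero>\<^bsub>obj X (d + 2)\<^esub>"
  using assms by (auto simp: cochain_complex_def)

lemma graded_module_cochain_complex: "cochain_complex R X \<Longrightarrow> graded_module R X"
  by (rule graded_module.intro[OF module.axioms(1)[OF cochain_complexD(1)] cochain_complexD(1)])

lemma (in abelian_monoid) finsum_lessThan_Suc_shift:
  assumes "f \<in> {..<Suc n} \<rightarrow> carrier G"
  shows "(\<Oplus>i\<in>{..<Suc n}. f i) = f 0 \<oplus> (\<Oplus>i\<in>{..<n}. f (Suc i))"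
proof -
  have "(\<Oplus>i\<in>{..<Suc n}. f i) = f 0 \<oplus> (\<Oplus>i\<in>Suc ` {..<n}. f i)"
    using assms by (subst lessThan_Suc_eq_insert_0, subst finsum_insert) (auto simp: Pi_iff)
  also have "(\<Oplus>i\<in>Suc ` {..<n}. f i) = (\<Oplus>i\<in>{..<n}. f (Suc i))"
    using assms by (subst finsum_reindex) (auto simp: Pi_iff)
  finally show ?thesis .
qed

lemma sum_list_update_diff:
  "i < length xs \<Longrightarrow> sum_list (xs[i := y]) = sum_list xs - xs ! i + (y :: int)"
  by (induction xs arbitrary: i) (auto split: nat.split)

subsection \<open>The differential and induced maps\<close>

lemma linear_map_word:
  assumes "\<And>j. linear_map R (obj X j) (obj Y j) (f j)" "w \<in> tensor_words X n d"
  shows "map (\<lambda>(j, x). (j, f j x)) w \<in> tensor_words Y n d"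
proof -
  have "map fst (map (\<lambda>(j, x). (j, f j x)) w) = map fst w" by auto
  moreover have "y \<in> carrier (obj Y i)" if "(i, y) \<in> set (map (\<lambda>(j, x). (j, f j x)) w)" for i y
    using that assms(2) linear_map_closed[OF assms(1)] by (auto simp: tensor_words_def)
  ultimately show ?thesis
    using assms(2) unfolding tensor_words_def by (simp del: map_map add: Ball_def)
qed

lemma
  assumes X: "graded_module R X" and Y: "graded_module R Y"
    and f: "\<And>j. linear_map R (obj X j) (obj Y j) (f j)"
  shows tensor_power_map_linear:
      "linear_map R (tensor_module R X n d) (tensor_module R Y n d) (tensor_power_map R Y f n d)"
    and tensor_power_map_pure: "w \<in> tensor_words X n d \<Longrightarrow>
      tensor_power_map R Y f n d (pure_tensor R X n d w) = pure_tensor R Y n d (map (\<lambda>(j, x). (j, f j x)) w)"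
    and tensor_power_map_cons: "x \<in> carrier (obj X j) \<Longrightarrow> t \<in> carrier (tensor_module R X n (d - j)) \<Longrightarrow>
      tensor_power_map R Y f (Suc n) d (graded_module.tensor_cons R X (Suc n) d j x t) =
      graded_module.tensor_cons R Y (Suc n) d j (f j x) (tensor_power_map R Y f n (d - j) t)"
proof -
  interpret X: graded_module R X by (rule X)
  interpret Y: graded_module R Y by (rule Y)
  have m: "multilinear R X n d (tensor_module R Y n d) (\<lambda>w. pure_tensor R Y n d (map (\<lambda>(j, x). (j, f j x)) w))" for n d
  proof (rule multilinearI)
    fix u j x v assume w: "u @ (j, x) # v \<in> tensor_words X n d"
    note mp = Y.multilinear_pure_tensor[of n d]
    let ?m = "map (\<lambda>(j, x). (j, f j x))"
    have w': "?m u @ (j, f j x) # ?m v \<in> tensor_words Y n d" using linear_map_word[OF f w] by simp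
    { fix y assume y: "y \<in> carrier (obj X j)"
      show "pure_tensor R Y n d (?m (u @ (j, x \<oplus>\<^bsub>obj X j\<^esub> y) # v)) =
        pure_tensor R Y n d (?m (u @ (j, x) # v)) \<oplus>\<^bsub>tensor_module R Y n d\<^esub> pure_tensor R Y n d (?m (u @ (j, y) # v))"
        using multilinear_add[OF mp w' linear_map_closed[OF f y]]
        by (simp add: linear_map_add[OF f tensor_words_mid[OF w] y]) }
    { fix c assume c: "c \<in> carrier R"
      show "pure_tensor R Y n d (?m (u @ (j, c \<odot>\<^bsub>obj X j\<^esub> x) # v)) =
        c \<odot>\<^bsub>tensor_module R Y n d\<^esub> pure_tensor R Y n d (?m (u @ (j, x) # v))"
        using multilinear_smult[OF mp w' c]
        by (simp add: linear_map_smult[OF f c tensor_words_mid[OF w]]) }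
  qed (intro Y.pure_tensor_closed linear_map_word[OF f])
  show lin: "linear_map R (tensor_module R X n d) (tensor_module R Y n d) (tensor_power_map R Y f n d)" for n d
    unfolding tensor_power_map_def by (rule X.tensor_lift_linear[OF Y.tensor_module m])
  show pure: "w \<in> tensor_words X n d \<Longrightarrow>
      tensor_power_map R Y f n d (pure_tensor R X n d w) = pure_tensor R Y n d (map (\<lambda>(j, x). (j, f j x)) w)" for w n d
    unfolding tensor_power_map_def by (rule X.tensor_lift_pure[OF Y.tensor_module m])
  assume x: "x \<in> carrier (obj X j)" and t: "t \<in> carrier (tensor_module R X n (d - j))"
  show "tensor_power_map R Y f (Suc n) d (X.tensor_cons (Suc n) d j x t) =
    Y.tensor_cons (Suc n) d j (f j x) (tensor_power_map R Y f n (d - j) t)"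
  proof (rule X.linear_map_eq_on_tensor[OF Y.tensor_module[of "Suc n" d] _ _ _ t])
    fix w assume w: "w \<in> tensor_words X n (d - j)"
    then have "(j, x) # w \<in> tensor_words X (Suc n) d" using x by (simp add: tensor_words_Cons)
    then show "tensor_power_map R Y f (Suc n) d (X.tensor_cons (Suc n) d j x (pure_tensor R X n (d - j) w)) =
       Y.tensor_cons (Suc n) d j (f j x) (tensor_power_map R Y f n (d - j) (pure_tensor R X n (d - j) w))"
      using w x by (simp add: X.tensor_cons_pure Y.tensor_cons_pure pure linear_map_closed[OF f] linear_map_word[OF f])
  qed (rule linear_map_comp[OF X.tensor_cons_linear[OF x refl] lin]
     linear_map_comp[OF lin Y.tensor_cons_linear[OF linear_map_closed[OF f x] refl]])+
qed

lemma tensor_power_map_comp: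
  assumes "graded_module R X" "graded_module R Y" "graded_module R Z"
    and f: "\<And>j. linear_map R (obj X j) (obj Y j) (f j)" and g: "\<And>j. linear_map R (obj Y j) (obj Z j) (g j)"
    and t: "t \<in> carrier (tensor_module R X n d)"
  shows "tensor_power_map R Z g n d (tensor_power_map R Y f n d t) = tensor_power_map R Z (\<lambda>j x. g j (f j x)) n d t"
proof (rule graded_module.linear_map_eq_on_tensor[OF assms(1) graded_module.tensor_module[OF assms(3), of n d] _ _ _ t])
  note gf = linear_map_comp[OF f g]
  show "linear_map R (tensor_module R X n d) (tensor_module R Z n d) (tensor_power_map R Z (\<lambda>j x. g j (f j x)) n d)"
    by (rule tensor_power_map_linear[OF assms(1,3) gf])
  show "linear_map R (tensor_module R X n d) (tensor_module R Z n d)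
      (\<lambda>t. tensor_power_map R Z g n d (tensor_power_map R Y f n d t))"
    by (rule linear_map_comp[OF tensor_power_map_linear[OF assms(1,2) f] tensor_power_map_linear[OF assms(2,3) g]])
  fix w assume w: "w \<in> tensor_words X n d"
  have "(\<lambda>(j, x). (j, g j x)) \<circ> (\<lambda>(j, x). (j, f j x)) = (\<lambda>(j, x). (j, g j (f j x)))" by auto
  then show "tensor_power_map R Z g n d (tensor_power_map R Y f n d (pure_tensor R X n d w)) =
      tensor_power_map R Z (\<lambda>j x. g j (f j x)) n d (pure_tensor R X n d w)"
    using w by (simp add: tensor_power_map_pure[OF assms(1,2) f] tensor_power_map_pure[OF assms(2,3) g]
        tensor_power_map_pure[OF assms(1,3) gf] linear_map_word[OF f])
qed

lemma tensor_power_map_cong: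
  assumes "graded_module R X" "graded_module R Y"
    and "\<And>j. linear_map R (obj X j) (obj Y j) (f j)" "\<And>j x. x \<in> carrier (obj X j) \<Longrightarrow> g j x = f j x"
    and t: "t \<in> carrier (tensor_module R X n d)"
  shows "tensor_power_map R Y g n d t = tensor_power_map R Y f n d t"
proof (rule graded_module.linear_map_eq_on_tensor[OF assms(1) graded_module.tensor_module[OF assms(2), of n d] _ _ _ t])
  have g: "linear_map R (obj X j) (obj Y j) (g j)" for j
    by (rule linear_map_cong[OF assms(4) graded_module.obj_module[OF assms(1)] assms(3)])
  show "linear_map R (tensor_module R X n d) (tensor_module R Y n d) (tensor_power_map R Y g n d)"
    "linear_map R (tensor_module R X n d) (tensor_module R Y n d) (tensor_power_map R Y f n d)"
    by (rule tensor_power_map_linear[OF assms(1,2) g] tensor_power_map_linear[OF assms(1-3)])+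
  fix w assume w: "w \<in> tensor_words X n d"
  then have "map (\<lambda>(j, x). (j, g j x)) w = map (\<lambda>(j, x). (j, f j x)) w"
    using assms(4) by (intro map_cong refl) (auto simp: tensor_words_def)
  then show "tensor_power_map R Y g n d (pure_tensor R X n d w) = tensor_power_map R Y f n d (pure_tensor R X n d w)"
    using w by (simp add: tensor_power_map_pure[OF assms(1,2) g] tensor_power_map_pure[OF assms(1-3)] del: map_eq_conv)
qed

lemma tensor_power_map_0:
  assumes X: "graded_module R X" and f: "\<And>j. linear_map R (obj X j) (obj X j) (f j)"
    and t: "t \<in> carrier (tensor_module R X 0 d)"
  shows "tensor_power_map R X f 0 d t = t"
proof (rule graded_module.linear_map_eq_on_tensor[OF X graded_module.tensor_module[OF X, of 0 d] _ _ _ t])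
  fix w assume w: "w \<in> tensor_words X 0 d"
  then have "w = []" by (simp add: tensor_words_def)
  then show "tensor_power_map R X f 0 d (pure_tensor R X 0 d w) = pure_tensor R X 0 d w"
    using w by (simp add: tensor_power_map_pure[OF X X f])
qed (rule tensor_power_map_linear[OF X X f] linear_map_id)+

locale cochain =
  fixes R :: "('k, 'm) ring_scheme" and X :: "('k, 'a) complex_rec"
  assumes complex: "cochain_complex R X"
begin

sublocale graded_module R X by (rule graded_module_cochain_complex[OF complex])

lemmas dif_linear = cochain_complexD(2)[OF complex]
lemmas dif_dif = cochain_complexD(3)[OF complex]
lemmas dif_closed = linear_map_closed[OF dif_linear]

abbreviation tdif where "tdif \<equiv> twisted_derivation (dif X) (\<lambda>j x. x) 1"

text \<open>Each letter that the recursion passes contributes the sign of its degree; accumulated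
  over a prefix, this is the sign of the sum of the degrees before position
  \<open>i\<close>.\<close>

lemma twisted_word_dif:
  assumes "w \<in> tensor_words X n d" "e = d + 1"
  shows "twisted_word (dif X) (\<lambda>j x. x) 1 e w = (\<Oplus>\<^bsub>tensor_module R X n e\<^esub>i\<in>{..<n}.
     [neg_one_pow (sum_list (map fst (take i w)))] \<cdot>\<^bsub>tensor_module R X n e\<^esub>
       pure_tensor R X n e (w[i := (fst (w ! i) + 1, dif X (fst (w ! i)) (snd (w ! i)))]))"
  using assms
proof (induction w arbitrary: n d e)
  case Nil
  interpret T: module R "tensor_module R X 0 1" by (rule tensor_module)
  show ?case using Nil by (simp add: tensor_words_Nil)
next
  case (Cons a w)
  obtain j x where a: "a = (j, x)" by (cases a)
  from Cons.prems a obtain m where m: "n = Suc m" "x \<in> carrier (obj X j)" "w \<in> tensor_words X m (d - j)"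
    by (auto simp: tensor_words_Cons)
  let ?s = "\<lambda>w i. neg_one_pow (sum_list (map fst (take i w)))"
  let ?d = "\<lambda>w i. w[i := (fst (w ! i) + 1, dif X (fst (w ! i)) (snd (w ! i)))]"
  let ?M = "tensor_module R X (Suc m) e" and ?N = "tensor_module R X m (e - j)"
  interpret M: module R ?M by (rule tensor_module)
  have len: "length w = m" using length_tensor_words[OF m(3)] .
  have dw: "?d w i \<in> tensor_words X m (d + 1 - j)" if "i < m" for i
  proof -
    obtain k y where k: "w ! i = (k, y)" by (cases "w ! i")
    have "(k, y) \<in> set w" using that k len by (metis nth_mem)
    then have "dif X k y \<in> carrier (obj X (k + 1))"
      using m(3) dif_closed by (auto simp: tensor_words_def)
    moreover have "sum_list (map fst (?d w i)) = d - j + 1"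
      using that len m(3) k by (auto simp: map_update sum_list_update_diff tensor_words_def)
    ultimately show ?thesis
      using m(3) len k by (auto simp: tensor_words_def dest!: set_update_subset_insert[THEN subsetD])
  qed
  have p: "pure_tensor R X m (e - j) (?d w i) \<in> carrier ?N" if "i < m" for i
    using dw[OF that] pure_tensor_closed Cons.prems(2) by simp
  interpret N: module R ?N by (rule tensor_module)
  note lin = tensor_cons_linear[OF m(2) refl, of m e]
  have "[neg_one_pow j] \<cdot>\<^bsub>?M\<^esub> tensor_cons (Suc m) e j x (twisted_word (dif X) (\<lambda>j x. x) 1 (e - j) w)
    = [neg_one_pow j] \<cdot>\<^bsub>?M\<^esub> (\<Oplus>\<^bsub>?M\<^esub>i\<in>{..<m}. tensor_cons (Suc m) e j x
        ([?s w i] \<cdot>\<^bsub>?N\<^esub> pure_tensor R X m (e - j) (?d w i)))"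
  proof -
    have ej: "e - j = d - j + 1" using Cons.prems(2) by simp
    have "(\<lambda>i. [?s w i] \<cdot>\<^bsub>?N\<^esub> pure_tensor R X m (e - j) (?d w i)) \<in> {..<m} \<rightarrow> carrier ?N"
      using p by (auto intro!: N.add.int_pow_closed)
    then show ?thesis
      unfolding Cons.IH[OF m(3) ej] by (simp add: linear_map_finsum[OF tensor_module tensor_module lin])
  qed
  also have "\<dots> = (\<Oplus>\<^bsub>?M\<^esub>i\<in>{..<m}. [neg_one_pow j] \<cdot>\<^bsub>?M\<^esub> tensor_cons (Suc m) e j x
        ([?s w i] \<cdot>\<^bsub>?N\<^esub> pure_tensor R X m (e - j) (?d w i)))"
    using p by (intro int_smult_finsum[OF tensor_module]) (auto intro!: linear_map_closed[OF lin])
  also have "\<dots> = (\<Oplus>\<^bsub>?M\<^esub>i\<in>{..<m}. [?s (a # w) (Suc i)] \<cdot>\<^bsub>?M\<^esub> pure_tensor R X (Suc m) e (?d (a # w) (Suc i)))"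
  proof (rule M.finsum_cong'[OF refl])
    show "(\<lambda>i. [?s (a # w) (Suc i)] \<cdot>\<^bsub>?M\<^esub> pure_tensor R X (Suc m) e (?d (a # w) (Suc i))) \<in> {..<m} \<rightarrow> carrier ?M"
    proof -
      have "?d (a # w) (Suc i) \<in> tensor_words X (Suc m) e" if "i < m" for i
        using dw[OF that] m(2) Cons.prems(2) by (simp add: a tensor_words_Cons)
      then show ?thesis by (intro Pi_I M.add.int_pow_closed pure_tensor_closed) simp
    qed
    fix i assume i: "i \<in> {..<m}"
    have "tensor_cons (Suc m) e j x (pure_tensor R X m (e - j) (?d w i)) = pure_tensor R X (Suc m) e ((j, x) # ?d w i)"
      using dw i Cons.prems(2) by (intro tensor_cons_pure m(2)) auto
    moreover have "(j, x) # ?d w i \<in> tensor_words X (Suc m) e"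
      using dw i m(2) Cons.prems(2) by (auto simp: tensor_words_Cons)
    ultimately show "[neg_one_pow j] \<cdot>\<^bsub>?M\<^esub> tensor_cons (Suc m) e j x ([?s w i] \<cdot>\<^bsub>?N\<^esub> pure_tensor R X m (e - j) (?d w i))
      = [?s (a # w) (Suc i)] \<cdot>\<^bsub>?M\<^esub> pure_tensor R X (Suc m) e (?d (a # w) (Suc i))"
      using p i by (simp add: a linear_map_int_smult[OF tensor_module tensor_module lin]
          int_smult_smult[OF tensor_module] pure_tensor_closed neg_one_pow_add)
  qed
  finally have eq: "[neg_one_pow j] \<cdot>\<^bsub>?M\<^esub> tensor_cons (Suc m) e j x (twisted_word (dif X) (\<lambda>j x. x) 1 (e - j) w) = \<dots>" .
  have dx: "(j + 1, dif X j x) # w \<in> tensor_words X (Suc m) e"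
    using m dif_closed Cons.prems(2) by (auto simp: tensor_words_Cons)
  have "(\<Oplus>\<^bsub>?M\<^esub>i\<in>{..<Suc m}. [?s (a # w) i] \<cdot>\<^bsub>?M\<^esub> pure_tensor R X (Suc m) e (?d (a # w) i)) =
     [?s (a # w) 0] \<cdot>\<^bsub>?M\<^esub> pure_tensor R X (Suc m) e (?d (a # w) 0) \<oplus>\<^bsub>?M\<^esub>
     (\<Oplus>\<^bsub>?M\<^esub>i\<in>{..<m}. [?s (a # w) (Suc i)] \<cdot>\<^bsub>?M\<^esub> pure_tensor R X (Suc m) e (?d (a # w) (Suc i)))"
  proof (rule M.finsum_lessThan_Suc_shift)
    have "?d (a # w) i \<in> tensor_words X (Suc m) e" if "i < Suc m" for i
      using that dx dw m(2) Cons.prems(2) by (cases i) (auto simp: a tensor_words_Cons)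
    then show "(\<lambda>i. [?s (a # w) i] \<cdot>\<^bsub>?M\<^esub> pure_tensor R X (Suc m) e (?d (a # w) i)) \<in> {..<Suc m} \<rightarrow> carrier ?M"
      by (auto intro!: M.add.int_pow_closed pure_tensor_closed)
  qed
  then show ?case
    using pure_tensor_closed[OF dx] eq by (simp add: a m(1) len neg_one_pow_def)
qed

lemma tensor_dif:
  assumes "t \<in> carrier (tensor_module R X n d)"
  shows "dif (tensor_power R X n) d t = tdif n d t"
proof -
  let ?\<phi> = "\<lambda>w. \<Oplus>\<^bsub>tensor_module R X n (d + 1)\<^esub>i\<in>{..<n}.
     [neg_one_pow (sum_list (map fst (take i w)))] \<cdot>\<^bsub>tensor_module R X n (d + 1)\<^esub>
       pure_tensor R X n (d + 1) (w[i := (fst (w ! i) + 1, dif X (fst (w ! i)) (snd (w ! i)))])"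
  have m: "multilinear R X n d (tensor_module R X n (d + 1)) ?\<phi>"
    by (rule multilinear_cong[OF multilinear_twisted_word[OF dif_linear linear_map_id]])
       (simp add: twisted_word_dif)
  have "pres_lift R (tensor_module R X n (d + 1)) ?\<phi> t = tdif n d t"
    by (rule linear_map_eq_on_tensor[OF tensor_module tensor_lift_linear[OF tensor_module m]
          twisted_derivation_linear[OF dif_linear linear_map_id refl] _ assms])
       (simp add: tensor_lift_pure[OF tensor_module m] twisted_derivation_pure[OF dif_linear linear_map_id] twisted_word_dif)
  then show ?thesis by (simp add: tensor_power_def)
qed

lemmas tdif_linear = twisted_derivation_linear[where \<eta> = "\<lambda>j x. x" and s = 1, OF dif_linear linear_map_id]
lemmas tdif_cons = twisted_derivation_cons[where \<eta> = "\<lambda>j x. x" and s = 1, OF dif_linear linear_map_id]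
lemmas tdif_0 = twisted_derivation_0[where \<eta> = "\<lambda>j x. x" and s = 1, OF dif_linear linear_map_id]
lemmas tdif_closed = linear_map_closed[OF tdif_linear]

lemma tensor_cons_zero:
  "t \<in> carrier (tensor_module R X n (d - j)) \<Longrightarrow>
     tensor_cons (Suc n) d j \<zero>\<^bsub>obj X j\<^esub> t = \<zero>\<^bsub>tensor_module R X (Suc n) d\<^esub>"
  by (rule linear_map_zero[OF obj_module tensor_module tensor_cons_factor_linear])

text \<open>Induction on the arity. The product of \<open>dif X j x\<close> with the differential of
  the tail arises twice, once with the sign of \<open>j + 1\<close> and once with that of
  \<open>j\<close>; the other two terms vanish because the differential squares to zero on the head
  and, inductively, on the tail.\<close>

lemma tdif_tdif:
  assumes "t \<in> carrier (tensor_module R X n d)"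
  shows "tdif n (d + 1) (tdif n d t) = \<zero>\<^bsub>tensor_module R X n (d + 2)\<^esub>"
  using assms
proof (induction n arbitrary: d t)
  case 0
  then show ?case using tdif_0[of "tdif 0 d t" "d + 1"] tdif_closed[OF refl, of t 0 d] by (simp add: ac_simps)
next
  case (Suc n)
  have "(\<lambda>t. tdif (Suc n) (d + 1) (tdif (Suc n) d t)) t = (\<lambda>t. \<zero>\<^bsub>tensor_module R X (Suc n) (d + 2)\<^esub>) t"
  proof (rule tensor_Suc_eq[OF tensor_module _ _ _ Suc.prems])
    show "linear_map R (tensor_module R X (Suc n) d) (tensor_module R X (Suc n) (d + 2))
      (\<lambda>t. tdif (Suc n) (d + 1) (tdif (Suc n) d t))"
      by (rule linear_map_comp[OF tdif_linear[OF refl] tdif_linear]) simp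
    show "linear_map R (tensor_module R X (Suc n) d) (tensor_module R X (Suc n) (d + 2))
      (\<lambda>t. \<zero>\<^bsub>tensor_module R X (Suc n) (d + 2)\<^esub>)"
      by (rule linear_map_const_zero[OF tensor_module tensor_module])
    fix j x t assume x: "x \<in> carrier (obj X j)" and t: "t \<in> carrier (tensor_module R X n (d - j))"
    let ?M = "tensor_module R X (Suc n) (d + 2)"
    interpret M: module R ?M by (rule tensor_module)
    have t': "t \<in> carrier (tensor_module R X n (d + 1 - (j + 1)))" using t by simp
    have Dt: "tdif n (d - j) t \<in> carrier (tensor_module R X n (d + 1 - j))"
      by (rule tdif_closed[OF _ t]) simp
    have DDt: "tdif n (d + 1 - j) (tdif n (d - j) t) = \<zero>\<^bsub>tensor_module R X n (d + 2 - j)\<^esub>"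
      using Suc.IH[OF t] by (simp add: algebra_simps)
    note dx = dif_closed[OF x]
    have c: "tensor_cons (Suc n) (d + 1) (j + 1) (dif X j x) t \<in> carrier (tensor_module R X (Suc n) (d + 1))"
      "tensor_cons (Suc n) (d + 1) j x (tdif n (d - j) t) \<in> carrier (tensor_module R X (Suc n) (d + 1))"
      using dx x t' Dt by (auto intro: tensor_cons_closed)
    have b: "tensor_cons (Suc n) (d + 2) (j + 1) (dif X j x) (tdif n (d - j) t) \<in> carrier ?M"
      by (rule tensor_cons_closed[OF dx _ Dt]) simp
    have lin: "linear_map R (tensor_module R X (Suc n) (d + 1)) ?M (tdif (Suc n) (d + 1))"
      by (rule tdif_linear) simp
    have D1: "tdif (Suc n) (d + 1) (tensor_cons (Suc n) (d + 1) (j + 1) (dif X j x) t) =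
      \<ominus>\<^bsub>?M\<^esub> ([neg_one_pow j] \<cdot>\<^bsub>?M\<^esub> tensor_cons (Suc n) (d + 2) (j + 1) (dif X j x) (tdif n (d - j) t))"
      using tdif_cons[OF dx t', unfolded add.assoc one_add_one] b tensor_cons_zero[of t n "d + 2" "j + 2"] t
      by (simp add: dif_dif x int_smult_uminus[OF tensor_module] neg_one_pow_succ)
    have D2: "tdif (Suc n) (d + 1) (tensor_cons (Suc n) (d + 1) j x (tdif n (d - j) t)) =
      tensor_cons (Suc n) (d + 2) (j + 1) (dif X j x) (tdif n (d - j) t)"
      using tdif_cons[OF x Dt, unfolded add.assoc one_add_one] b linear_map_zero[OF tensor_module tensor_module tensor_cons_linear[OF x refl, of n "d + 2"]]
      by (simp add: DDt)
    show "tdif (Suc n) (d + 1) (tdif (Suc n) d (tensor_cons (Suc n) d j x t)) = \<zero>\<^bsub>?M\<^esub>"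
      using c b linear_map_add[OF lin c(1) int_smult_closed[OF tensor_module c(2)], of "neg_one_pow j"]
        linear_map_int_smult[OF tensor_module tensor_module lin c(2)]
      by (simp add: tdif_cons[OF x t] D1 D2 M.l_neg)
  qed
  then show ?case by simp
qed

end

lemma cochain_mapD:
  assumes "cochain_map R X Y f"
  shows "cochain_complex R X" "cochain_complex R Y" "linear_map R (obj X d) (obj Y d) (f d)"
    "x \<in> carrier (obj X d) \<Longrightarrow> f (d + 1) (dif X d x) = dif Y d (f d x)"
  using assms by (auto simp: cochain_map_def)

lemma tensor_power_map_tdif:
  fixes X :: "('k, 'a) complex_rec" and Y :: "('k, 'b) complex_rec"
  assumes f: "cochain_map R X Y f" and t: "t \<in> carrier (tensor_module R X n d)"
  shows "tensor_power_map R Y f n (d + 1) (graded_module.twisted_derivation R X (dif X) (\<lambda>j x. x) 1 n d t) =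
    graded_module.twisted_derivation R Y (dif Y) (\<lambda>j x. x) 1 n d (tensor_power_map R Y f n d t)"
proof -
  interpret X: cochain R X by (rule cochain.intro[OF cochain_mapD(1)[OF f]])
  interpret Y: cochain R Y by (rule cochain.intro[OF cochain_mapD(2)[OF f]])
  note fl = cochain_mapD(3)[OF f]
  note F = tensor_power_map_linear[OF X.graded_module_axioms Y.graded_module_axioms fl]
  note Fc = tensor_power_map_cons[OF X.graded_module_axioms Y.graded_module_axioms fl]
  note Fcl = linear_map_closed[OF F]
  show ?thesis using t
  proof (induction n arbitrary: d t)
    case 0
    then show ?case
      by (simp add: X.tdif_0 Y.tdif_0 Fcl linear_map_zero[OF X.tensor_module Y.tensor_module F])
  next
    case (Suc n)
    show ?case
    proof (rule X.tensor_Suc_eq[OF Y.tensor_module[of "Suc n" "d + 1"] _ _ _ Suc.prems])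
      fix j x t assume x: "x \<in> carrier (obj X j)" and t: "t \<in> carrier (tensor_module R X n (d - j))"
      have t': "t \<in> carrier (tensor_module R X n (d + 1 - (j + 1)))" using t by simp
      have Dt: "X.tdif n (d - j) t \<in> carrier (tensor_module R X n (d + 1 - j))"
        by (rule X.tdif_closed[OF _ t]) simp
      have IH: "tensor_power_map R Y f n (d + 1 - j) (X.tdif n (d - j) t) =
          Y.tdif n (d - j) (tensor_power_map R Y f n (d - j) t)"
        using Suc.IH[OF t] by (simp add: algebra_simps)
      note dx = X.dif_closed[OF x]
      have c: "X.tensor_cons (Suc n) (d + 1) (j + 1) (dif X j x) t \<in> carrier (tensor_module R X (Suc n) (d + 1))"
        "X.tensor_cons (Suc n) (d + 1) j x (X.tdif n (d - j) t) \<in> carrier (tensor_module R X (Suc n) (d + 1))"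
        using dx x t' Dt by (auto intro: X.tensor_cons_closed)
      show "tensor_power_map R Y f (Suc n) (d + 1) (X.tdif (Suc n) d (X.tensor_cons (Suc n) d j x t)) =
        Y.tdif (Suc n) d (tensor_power_map R Y f (Suc n) d (X.tensor_cons (Suc n) d j x t))"
        using Fc[OF dx t'] Fc[OF x Dt] 
          linear_map_int_smult[OF X.tensor_module Y.tensor_module F c(2)]
          linear_map_add[OF F c(1) int_smult_closed[OF X.tensor_module c(2)]]
        by (simp add: X.tdif_cons[OF x t] Fc[OF x t] Y.tdif_cons linear_map_closed[OF fl x] Fcl t
            cochain_mapD(4)[OF f x] IH)
    qed (rule linear_map_comp[OF X.tdif_linear[OF refl] F] linear_map_comp[OF F Y.tdif_linear[OF refl]])+
  qed
qed

section \<open>Retractions up to homotopy\<close>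

text \<open>The data of a deformation retraction onto the image of \<open>e\<close>, which is
  recorded by its projector. Of the usual side conditions, \<open>e_h\<close> and \<open>h_h\<close>
  say that elements in the image of \<open>h\<close> are annihilated by \<open>e\<close> and by
  \<open>h\<close>.\<close>

locale retraction = cochain R X for R :: "('k, 'm) ring_scheme" and X :: "('k, 'a) complex_rec" +
  fixes e :: "int \<Rightarrow> 'a \<Rightarrow> 'a" and h :: "int \<Rightarrow> 'a \<Rightarrow> 'a"
  assumes e_linear: "linear_map R (obj X j) (obj X j) (e j)"
    and e_dif: "x \<in> carrier (obj X j) \<Longrightarrow> e (j + 1) (dif X j x) = dif X j (e j x)"
    and e_e: "x \<in> carrier (obj X j) \<Longrightarrow> e j (e j x) = e j x"
    and h_linear: "linear_map R (obj X j) (obj X (j - 1)) (h j)"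
    and e_h: "x \<in> carrier (obj X j) \<Longrightarrow> e (j - 1) (h j x) = \<zero>\<^bsub>obj X (j - 1)\<^esub>"
    and h_h: "x \<in> carrier (obj X j) \<Longrightarrow> h (j - 1) (h j x) = \<zero>\<^bsub>obj X (j - 2)\<^esub>"
    and homotopy: "x \<in> carrier (obj X j) \<Longrightarrow>
      dif X (j - 1) (h j x) \<oplus>\<^bsub>obj X j\<^esub> h (j + 1) (dif X j x) = x \<ominus>\<^bsub>obj X j\<^esub> e j x"
begin

lemma e_cochain_map: "cochain_map R X X e"
  using complex e_linear e_dif by (simp add: cochain_map_def)

lemma h_linear': "linear_map R (obj X j) (obj X (j + - 1)) (h j)"
  using h_linear by simp

section \<open>The induced homotopy on tensor powers\<close>

abbreviation thom where "thom \<equiv> twisted_derivation h e (- 1)"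

lemmas thom_linear = twisted_derivation_linear[where \<eta> = e and s = "- 1", OF h_linear' e_linear]
lemmas thom_cons = twisted_derivation_cons[where \<eta> = e and s = "- 1", OF h_linear' e_linear]
lemmas thom_0 = twisted_derivation_0[where \<eta> = e and s = "- 1", OF h_linear' e_linear]
lemmas thom_pure = twisted_derivation_pure[where \<eta> = e and s = "- 1", OF h_linear' e_linear]
lemmas thom_closed = linear_map_closed[OF thom_linear]

abbreviation tproj where "tproj \<equiv> tensor_power_map R X e"

lemmas tproj_linear = tensor_power_map_linear[OF graded_module_axioms graded_module_axioms e_linear]
lemmas tproj_cons = tensor_power_map_cons[OF graded_module_axioms graded_module_axioms e_linear]
lemmas tproj_closed = linear_map_closed[OF tproj_linear]

text \<open>Every summand of the homotopy has a factor in the image of \<open>h\<close>, and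
  \<open>e\<close> annihilates that factor.\<close>

lemma tproj_thom:
  assumes "t \<in> carrier (tensor_module R X n d)"
  shows "tproj n (d - 1) (thom n d t) = \<zero>\<^bsub>tensor_module R X n (d - 1)\<^esub>"
  using assms
proof (induction n arbitrary: d t)
  case 0
  then show ?case
    by (simp add: thom_0 linear_map_zero[OF tensor_module tensor_module tproj_linear])
next
  case (Suc n)
  have "(\<lambda>t. tproj (Suc n) (d - 1) (thom (Suc n) d t)) t = (\<lambda>t. \<zero>\<^bsub>tensor_module R X (Suc n) (d - 1)\<^esub>) t"
  proof (rule tensor_Suc_eq[OF tensor_module[of "Suc n" "d - 1"] _ _ _ Suc.prems])
    show "linear_map R (tensor_module R X (Suc n) d) (tensor_module R X (Suc n) (d - 1))
      (\<lambda>t. tproj (Suc n) (d - 1) (thom (Suc n) d t))"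
      by (rule linear_map_comp[OF thom_linear tproj_linear]) simp
    show "linear_map R (tensor_module R X (Suc n) d) (tensor_module R X (Suc n) (d - 1))
      (\<lambda>t. \<zero>\<^bsub>tensor_module R X (Suc n) (d - 1)\<^esub>)"
      by (rule linear_map_const_zero[OF tensor_module tensor_module])
    fix j x t assume x: "x \<in> carrier (obj X j)" and t: "t \<in> carrier (tensor_module R X n (d - j))"
    let ?M = "tensor_module R X (Suc n) (d - 1)"
    interpret M: module R ?M by (rule tensor_module)
    note hx = linear_map_closed[OF h_linear x] and ex = linear_map_closed[OF e_linear x]
    have t': "t \<in> carrier (tensor_module R X n (d - 1 - (j - 1)))" using t by simp
    have kt: "thom n (d - j) t \<in> carrier (tensor_module R X n (d - 1 - j))"
      by (rule thom_closed[OF _ t]) simp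
    have c: "tensor_cons (Suc n) (d - 1) (j - 1) (h j x) t \<in> carrier ?M"
      "tensor_cons (Suc n) (d - 1) j (e j x) (thom n (d - j) t) \<in> carrier ?M"
      using hx ex t' kt by (auto intro: tensor_cons_closed)
    have IH: "tproj n (d - 1 - j) (thom n (d - j) t) = \<zero>\<^bsub>tensor_module R X n (d - 1 - j)\<^esub>"
      using Suc.IH[OF t] by (simp add: algebra_simps)
    have 1: "tproj (Suc n) (d - 1) (tensor_cons (Suc n) (d - 1) (j - 1) (h j x) t) = \<zero>\<^bsub>?M\<^esub>"
      using tproj_cons[OF hx t'] tensor_cons_zero[of "tproj n (d - j) t" n "d - 1" "j - 1"] tproj_closed[OF t]
      by (simp add: e_h x)
    have 2: "tproj (Suc n) (d - 1) (tensor_cons (Suc n) (d - 1) j (e j x) (thom n (d - j) t)) = \<zero>\<^bsub>?M\<^esub>"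
      using tproj_cons[OF ex kt] linear_map_zero[OF tensor_module tensor_module tensor_cons_linear[OF ex refl]]
      by (simp add: e_e x IH)
    show "tproj (Suc n) (d - 1) (thom (Suc n) d (tensor_cons (Suc n) d j x t)) = \<zero>\<^bsub>?M\<^esub>"
      using c linear_map_add[OF tproj_linear c(1) int_smult_closed[OF tensor_module c(2)]]
        linear_map_int_smult[OF tensor_module tensor_module tproj_linear c(2)]
      by (simp add: thom_cons[OF x t] 1 2)
  qed
  then show ?case by simp
qed

text \<open>A telescoping sum. On a head and a tail the two surviving parts are (1 - e) tensor 1 and
  e tensor (1 - E), where E is the projection on the tail, and they add up to 1 - (e tensor E). The
  second part has this form because the factors before \<open>h\<close> are hit by
  \<open>e\<close>.\<close>

lemma tensor_homotopy:
  assumes "t \<in> carrier (tensor_module R X n d)"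
  shows "tdif n (d - 1) (thom n d t) \<oplus>\<^bsub>tensor_module R X n d\<^esub> thom n (d + 1) (tdif n d t) =
    t \<ominus>\<^bsub>tensor_module R X n d\<^esub> tproj n d t"
  using assms
proof (induction n arbitrary: d t)
  case 0
  interpret M: module R "tensor_module R X 0 d" by (rule tensor_module)
  have "thom 0 d t \<in> carrier (tensor_module R X 0 (d - 1))" "tdif 0 d t \<in> carrier (tensor_module R X 0 (d + 1))"
    using thom_closed[OF _ 0] tdif_closed[OF _ 0] by auto
  then show ?case
    using tdif_0[of _ "d - 1"] thom_0[of _ "d + 1"] 0 tensor_power_map_0[OF graded_module_axioms e_linear 0]
    by (simp add: module_diff_self[OF tensor_module])
next
  case (Suc n)
  let ?M = "tensor_module R X (Suc n) d"
  have "(\<lambda>t. tdif (Suc n) (d - 1) (thom (Suc n) d t) \<oplus>\<^bsub>?M\<^esub> thom (Suc n) (d + 1) (tdif (Suc n) d t)) t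
    = (\<lambda>t. t \<ominus>\<^bsub>?M\<^esub> tproj (Suc n) d t) t"
  proof (rule tensor_Suc_eq[OF tensor_module[of "Suc n" d] _ _ _ Suc.prems])
    have linD: "linear_map R (tensor_module R X (Suc n) (d - 1)) ?M (tdif (Suc n) (d - 1))"
      by (rule tdif_linear) simp
    have link: "linear_map R (tensor_module R X (Suc n) (d + 1)) ?M (thom (Suc n) (d + 1))"
      by (rule thom_linear) simp
    have link': "linear_map R ?M (tensor_module R X (Suc n) (d - 1)) (thom (Suc n) d)"
      by (rule thom_linear) simp
    show "linear_map R ?M ?M (\<lambda>t. tdif (Suc n) (d - 1) (thom (Suc n) d t) \<oplus>\<^bsub>?M\<^esub> thom (Suc n) (d + 1) (tdif (Suc n) d t))"
      by (intro linear_map_plus tensor_module linear_map_comp[OF link' linD]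
          linear_map_comp[OF tdif_linear[OF refl] link])
    show "linear_map R ?M ?M (\<lambda>t. t \<ominus>\<^bsub>?M\<^esub> tproj (Suc n) d t)"
      by (intro linear_map_minus tensor_module tproj_linear linear_map_id)
    fix j x t assume x: "x \<in> carrier (obj X j)" and t: "t \<in> carrier (tensor_module R X n (d - j))"
    interpret M: module R ?M by (rule tensor_module)
    let ?N = "tensor_module R X n (d - j)"
    interpret N: module R ?N by (rule tensor_module)
    interpret X: module R "obj X j" by (rule obj_module)
    note hx = linear_map_closed[OF h_linear x] and ex = linear_map_closed[OF e_linear x] and dx = dif_closed[OF x]
    note dex = dif_closed[OF ex]
    have hdx: "h (j + 1) (dif X j x) \<in> carrier (obj X j)" using linear_map_closed[OF h_linear dx] by simp
    have dhx: "dif X (j - 1) (h j x) \<in> carrier (obj X j)" using dif_closed[OF hx] by simp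
    have th: "t \<in> carrier (tensor_module R X n (d - 1 - (j - 1)))" using t by simp
    have td: "t \<in> carrier (tensor_module R X n (d + 1 - (j + 1)))" using t by simp
    have kt: "thom n (d - j) t \<in> carrier (tensor_module R X n (d - 1 - j))"
      by (rule thom_closed[OF _ t]) simp
    have kt': "thom n (d - j) t \<in> carrier (tensor_module R X n (d - (j + 1)))"
      using kt by (simp add: algebra_simps)
    have Dt: "tdif n (d - j) t \<in> carrier (tensor_module R X n (d + 1 - j))"
      by (rule tdif_closed[OF _ t]) simp
    have Dt': "tdif n (d - j) t \<in> carrier (tensor_module R X n (d - (j - 1)))"
      using Dt by (simp add: algebra_simps)
    have Dkt: "tdif n (d - 1 - j) (thom n (d - j) t) \<in> carrier ?N"
      by (rule tdif_closed[OF _ kt]) simp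
    have kDt: "thom n (d + 1 - j) (tdif n (d - j) t) \<in> carrier ?N"
      by (rule thom_closed[OF _ Dt]) simp
    have IH: "tdif n (d - 1 - j) (thom n (d - j) t) \<oplus>\<^bsub>?N\<^esub> thom n (d + 1 - j) (tdif n (d - j) t) = t \<ominus>\<^bsub>?N\<^esub> tproj n (d - j) t"
      using Suc.IH[OF t] by (simp add: algebra_simps)
    \<comment> \<open>\<open>a1\<close> and \<open>a2\<close> have both operators on the head,
      \<open>f1\<close> and \<open>f2\<close> both on the tail, \<open>b\<close> and
      \<open>c\<close> one on each. That \<open>c\<close> arises from both composites uses that
      \<open>e\<close> commutes with the differential.\<close>
    define a1 a2 b c f1 f2 where
      "a1 = tensor_cons (Suc n) d j (dif X (j - 1) (h j x)) t" and
      "a2 = tensor_cons (Suc n) d j (h (j + 1) (dif X j x)) t" and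
      "b = tensor_cons (Suc n) d (j - 1) (h j x) (tdif n (d - j) t)" and
      "c = tensor_cons (Suc n) d (j + 1) (dif X j (e j x)) (thom n (d - j) t)" and
      "f1 = tensor_cons (Suc n) d j (e j x) (tdif n (d - 1 - j) (thom n (d - j) t))" and
      "f2 = tensor_cons (Suc n) d j (e j x) (thom n (d + 1 - j) (tdif n (d - j) t))"
    note defs = a1_def a2_def b_def c_def f1_def f2_def
    have cl: "a1 \<in> carrier ?M" "a2 \<in> carrier ?M" "b \<in> carrier ?M" "c \<in> carrier ?M" "f1 \<in> carrier ?M" "f2 \<in> carrier ?M"
      unfolding defs by (intro tensor_cons_closed[OF _ refl] hx dex ex hdx dhx t Dt' kt' Dkt kDt)+
    have D1: "tdif (Suc n) (d - 1) (tensor_cons (Suc n) (d - 1) (j - 1) (h j x) t) =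
        a1 \<oplus>\<^bsub>?M\<^esub> [neg_one_pow (j - 1)] \<cdot>\<^bsub>?M\<^esub> b"
      using tdif_cons[OF hx th] by (simp add: defs)
    have D2: "tdif (Suc n) (d - 1) (tensor_cons (Suc n) (d - 1) j (e j x) (thom n (d - j) t)) =
        c \<oplus>\<^bsub>?M\<^esub> [neg_one_pow j] \<cdot>\<^bsub>?M\<^esub> f1"
      using tdif_cons[OF ex kt] by (simp add: defs)
    have K1: "thom (Suc n) (d + 1) (tensor_cons (Suc n) (d + 1) (j + 1) (dif X j x) t) =
        a2 \<oplus>\<^bsub>?M\<^esub> [neg_one_pow (j + 1)] \<cdot>\<^bsub>?M\<^esub> c"
      using thom_cons[OF dx td] by (simp add: defs e_dif x)
    have K2: "thom (Suc n) (d + 1) (tensor_cons (Suc n) (d + 1) j x (tdif n (d - j) t)) =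
        b \<oplus>\<^bsub>?M\<^esub> [neg_one_pow j] \<cdot>\<^bsub>?M\<^esub> f2"
      using thom_cons[OF x Dt] by (simp add: defs)
    have ck: "tensor_cons (Suc n) (d - 1) (j - 1) (h j x) t \<in> carrier (tensor_module R X (Suc n) (d - 1))"
      "tensor_cons (Suc n) (d - 1) j (e j x) (thom n (d - j) t) \<in> carrier (tensor_module R X (Suc n) (d - 1))"
      using hx ex th kt by (auto intro: tensor_cons_closed)
    have cd: "tensor_cons (Suc n) (d + 1) (j + 1) (dif X j x) t \<in> carrier (tensor_module R X (Suc n) (d + 1))"
      "tensor_cons (Suc n) (d + 1) j x (tdif n (d - j) t) \<in> carrier (tensor_module R X (Suc n) (d + 1))"
      using dx x td Dt by (auto intro: tensor_cons_closed)
    have Dk: "tdif (Suc n) (d - 1) (thom (Suc n) d (tensor_cons (Suc n) d j x t)) =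
        (a1 \<oplus>\<^bsub>?M\<^esub> [neg_one_pow (j - 1)] \<cdot>\<^bsub>?M\<^esub> b) \<oplus>\<^bsub>?M\<^esub> [neg_one_pow j] \<cdot>\<^bsub>?M\<^esub> (c \<oplus>\<^bsub>?M\<^esub> [neg_one_pow j] \<cdot>\<^bsub>?M\<^esub> f1)"
      using linear_map_add[OF linD ck(1) int_smult_closed[OF tensor_module ck(2)]]
        linear_map_int_smult[OF tensor_module tensor_module linD ck(2)]
      by (simp add: thom_cons[OF x t] D1 D2)
    have kD: "thom (Suc n) (d + 1) (tdif (Suc n) d (tensor_cons (Suc n) d j x t)) =
        (a2 \<oplus>\<^bsub>?M\<^esub> [neg_one_pow (j + 1)] \<cdot>\<^bsub>?M\<^esub> c) \<oplus>\<^bsub>?M\<^esub> [neg_one_pow j] \<cdot>\<^bsub>?M\<^esub> (b \<oplus>\<^bsub>?M\<^esub> [neg_one_pow j] \<cdot>\<^bsub>?M\<^esub> f2)"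
      using linear_map_add[OF link cd(1) int_smult_closed[OF tensor_module cd(2)]]
        linear_map_int_smult[OF tensor_module tensor_module link cd(2)]
      by (simp add: tdif_cons[OF x t] K1 K2)
    note lt = tensor_cons_factor_linear[OF t] and lx = tensor_cons_linear[OF ex refl]
    have "a1 \<oplus>\<^bsub>?M\<^esub> a2 = tensor_cons (Suc n) d j x t \<ominus>\<^bsub>?M\<^esub> tensor_cons (Suc n) d j (e j x) t"
      unfolding a1_def a2_def linear_map_add[OF lt dhx hdx, symmetric] homotopy[OF x]
      by (rule linear_map_diff[OF obj_module tensor_module lt x ex])
    moreover have "f1 \<oplus>\<^bsub>?M\<^esub> f2 = tensor_cons (Suc n) d j (e j x) t \<ominus>\<^bsub>?M\<^esub> tensor_cons (Suc n) d j (e j x) (tproj n (d - j) t)"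
      unfolding f1_def f2_def linear_map_add[OF lx Dkt kDt, symmetric] IH
      by (rule linear_map_diff[OF tensor_module tensor_module lx t tproj_closed[OF t]])
    moreover have "tensor_cons (Suc n) d j x t \<in> carrier ?M" "tensor_cons (Suc n) d j (e j x) t \<in> carrier ?M"
      "tensor_cons (Suc n) d j (e j x) (tproj n (d - j) t) \<in> carrier ?M"
      by (intro tensor_cons_closed[OF _ refl] x ex t tproj_closed)+
    ultimately show "tdif (Suc n) (d - 1) (thom (Suc n) d (tensor_cons (Suc n) d j x t)) \<oplus>\<^bsub>?M\<^esub>
        thom (Suc n) (d + 1) (tdif (Suc n) d (tensor_cons (Suc n) d j x t)) =
        tensor_cons (Suc n) d j x t \<ominus>\<^bsub>?M\<^esub> tproj (Suc n) d (tensor_cons (Suc n) d j x t)"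
      unfolding Dk kD signed_homotopy_sum[OF tensor_module cl]
      by (simp add: tproj_cons[OF x t] a_minus_def M.a_assoc M.r_neg2 M.r_neg1)
  qed
  then show ?case by simp
qed

subsection \<open>The filtration by letters in the image of the homotopy\<close>

text \<open>The zero element also counts as such a letter; a word containing it represents the zero
  tensor anyway.\<close>

definition hom_letter :: "int \<times> 'a \<Rightarrow> bool"
  where "hom_letter = (\<lambda>(j, x). x \<in> h (j + 1) ` carrier (obj X (j + 1)))"

definition hom_filtration :: "nat \<Rightarrow> nat \<Rightarrow> int \<Rightarrow> ((int \<times> 'a) list \<Rightarrow> 'k) set set"
  where "hom_filtration N n d = module_span R (tensor_module R X n d)
    (pure_tensor R X n d ` {w \<in> tensor_words X n d. N \<le> length (filter hom_letter w)})"

lemma hom_filtration_submodule: "submodule (hom_filtration N n d) R (tensor_module R X n d)"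
  unfolding hom_filtration_def
  by (rule module_span_submodule[OF tensor_module]) (auto intro: pure_tensor_closed)

lemma hom_filtration_pure:
  "w \<in> tensor_words X n d \<Longrightarrow> N \<le> length (filter hom_letter w) \<Longrightarrow> pure_tensor R X n d w \<in> hom_filtration N n d"
  unfolding hom_filtration_def by (rule module_span_superset[THEN subsetD]) auto

lemma hom_filtration_least:
  assumes "module R M" "linear_map R (tensor_module R X n d) M g" "submodule K R M"
    and "\<And>w. w \<in> tensor_words X n d \<Longrightarrow> N \<le> length (filter hom_letter w) \<Longrightarrow> g (pure_tensor R X n d w) \<in> K"
    and "t \<in> hom_filtration N n d"
  shows "g t \<in> K"
proof -
  have "hom_filtration N n d \<subseteq> {t \<in> carrier (tensor_module R X n d). g t \<in> K}"
    unfolding hom_filtration_def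
    using assms(4) by (intro module_span_least linear_map_vimage_submodule[OF tensor_module assms(1-3)])
      (auto intro: pure_tensor_closed)
  then show ?thesis using assms(5) by auto
qed

lemma hom_filtration_0: "hom_filtration 0 n d = carrier (tensor_module R X n d)"
  using tensor_induct[OF hom_filtration_submodule[where N = 0]] hom_filtration_pure[of _ n d 0]
    submodule_subset[OF hom_filtration_submodule[where N = 0 and n = n and d = d]] by auto

text \<open>No word of \<open>n\<close> letters has more than \<open>n\<close> letters of a given
  kind, so the generating set is empty. The nilpotence of the error term rests on this
  bound.\<close>

lemma hom_filtration_gt:
  assumes "n < N" shows "hom_filtration N n d \<subseteq> {\<zero>\<^bsub>tensor_module R X n d\<^esub>}"
proof -
  have "\<not> N \<le> length (filter hom_letter w)" if "w \<in> tensor_words X n d" for w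
    using assms length_tensor_words[OF that] length_filter_le[of hom_letter w] by simp
  then show ?thesis unfolding hom_filtration_def
    by (intro module_span_least submodule_trivial tensor_module) auto
qed

lemma tensor_cons_hom_filtration:
  assumes "x \<in> carrier (obj X j)" "t \<in> hom_filtration N n (d - j)"
  shows "tensor_cons (Suc n) d j x t \<in> hom_filtration N (Suc n) d"
  by (rule hom_filtration_least[OF tensor_module tensor_cons_linear[OF assms(1) refl] hom_filtration_submodule _ assms(2)])
     (auto simp: tensor_cons_pure assms(1) tensor_words_Cons intro!: hom_filtration_pure)

text \<open>A letter from the image of \<open>h\<close> is killed by both \<open>h\<close> and
  \<open>e\<close>. A summand in which it is touched therefore vanishes, and in the others
  \<open>h\<close> is applied to a letter that was not yet counted, while all counted letters
  survive.\<close>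

lemma twisted_word_hom_filtration:
  assumes "w \<in> tensor_words X n d" "N \<le> length (filter hom_letter w)"
  shows "twisted_word h e (- 1) (d - 1) w \<in> hom_filtration (Suc N) n (d - 1)"
  using assms
proof (induction w arbitrary: n d N)
  case Nil
  then show ?case using submodule_zero[OF hom_filtration_submodule[where N = "Suc N" and n = 0 and d = "d - 1"]] by (simp add: tensor_words_Nil)
next
  case (Cons a w)
  obtain j x where a: "a = (j, x)" by (cases a)
  from Cons.prems a obtain m where m: "n = Suc m" "x \<in> carrier (obj X j)" "w \<in> tensor_words X m (d - j)"
    by (auto simp: tensor_words_Cons)
  let ?M = "tensor_module R X (Suc m) (d - 1)"
  interpret M: module R ?M by (rule tensor_module)
  note len = length_tensor_words[OF m(3)]
  note hx = linear_map_closed[OF h_linear m(2)] and ex = linear_map_closed[OF e_linear m(2)]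
  have w': "(j - 1, h j x) # w \<in> tensor_words X (Suc m) (d - 1)" using hx m(3) by (simp add: tensor_words_Cons)
  have eq: "twisted_word h e (- 1) (d - 1) (a # w) = pure_tensor R X (Suc m) (d - 1) ((j - 1, h j x) # w)
      \<oplus>\<^bsub>?M\<^esub> [neg_one_pow j] \<cdot>\<^bsub>?M\<^esub> tensor_cons (Suc m) (d - 1) j (e j x) (twisted_word h e (- 1) (d - 1 - j) w)"
    by (simp add: a len)
  have tw: "twisted_word h e (- 1) (d - 1 - j) w \<in> carrier (tensor_module R X m (d - 1 - j))"
    using multilinear_closed[OF multilinear_twisted_word[OF h_linear' e_linear] m(3)] by (simp add: algebra_simps)
  show ?case
  proof (cases "hom_letter a")
    case True
    then obtain y where y: "y \<in> carrier (obj X (j + 1))" "x = h (j + 1) y" by (auto simp: a hom_letter_def)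
    have "h j x = \<zero>\<^bsub>obj X (j - 1)\<^esub>" "e j x = \<zero>\<^bsub>obj X j\<^esub>"
      using h_h[OF y(1)] e_h[OF y(1)] y by simp_all
    moreover have "pure_tensor R X (Suc m) (d - 1) ((j - 1, \<zero>\<^bsub>obj X (j - 1)\<^esub>) # w) = \<zero>\<^bsub>?M\<^esub>"
    proof -
      interpret O: module R "obj X (j - 1)" by (rule obj_module)
      have "w \<in> tensor_words X m (d - 1 - (j - 1))" using m(3) by simp
      from tensor_cons_pure[OF O.zero_closed refl this] tensor_cons_zero[OF pure_tensor_closed[OF this]]
      show ?thesis by simp
    qed
    ultimately show ?thesis
      using submodule_zero[OF hom_filtration_submodule[where N = "Suc N" and n = "Suc m" and d = "d - 1"]] tensor_cons_zero[OF tw]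
      unfolding eq m(1) by simp
  next
    \<comment> \<open>The head is not counted, so at least \<open>N\<close> counted letters lie in
      the tail. Applying \<open>h\<close> to the head adds a new one; replacing the head by its
      image under \<open>e\<close> loses none.\<close>
    case False
    have hl: "hom_letter (j - 1, h j x)" using m(2) by (simp add: hom_letter_def)
    have N: "N \<le> length (filter hom_letter w)" using Cons.prems False by simp
    have "pure_tensor R X (Suc m) (d - 1) ((j - 1, h j x) # w) \<in> hom_filtration (Suc N) (Suc m) (d - 1)"
      using N hl by (intro hom_filtration_pure[OF w']) simp
    moreover have "tensor_cons (Suc m) (d - 1) j (e j x) (twisted_word h e (- 1) (d - 1 - j) w) \<in> hom_filtration (Suc N) (Suc m) (d - 1)"
      using Cons.IH[OF m(3) N] by (intro tensor_cons_hom_filtration[OF ex]) (simp add: algebra_simps)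
    ultimately show ?thesis
      unfolding eq m(1)
      by (intro submodule_add[OF hom_filtration_submodule] submodule_int_smult[OF tensor_module hom_filtration_submodule])
  qed
qed

lemma thom_hom_filtration:
  assumes "t \<in> hom_filtration N n d"
  shows "thom n d t \<in> hom_filtration (Suc N) n (d - 1)"
proof (rule hom_filtration_least[OF tensor_module thom_linear hom_filtration_submodule _ assms])
  fix w assume "w \<in> tensor_words X n d" "N \<le> length (filter hom_letter w)"
  then show "thom n d (pure_tensor R X n d w) \<in> hom_filtration (Suc N) n (d - 1)"
    using twisted_word_hom_filtration by (simp add: thom_pure)
qed simp

end

section \<open>The action of the symmetric groups on tensor powers\<close>

subsection \<open>Koszul signs\<close>

text \<open>The sign of reordering homogeneous factors along \<open>s\<close>, with positions
  counted from zero and with the degrees \<open>a\<close> listed in the order before the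
  reordering.\<close>

definition koszul_sign :: "nat \<Rightarrow> (nat \<Rightarrow> nat) \<Rightarrow> (nat \<Rightarrow> int) \<Rightarrow> int"
  where "koszul_sign n s a = (\<Prod>(i, j)\<in>{(i, j). i < j \<and> j < n \<and> s j < s i}. neg_one_pow (a i * a j))"

lemma finite_index_pairs: "finite {(i, j). i < j \<and> j < (n::nat) \<and> P i j}"
  by (rule finite_subset[of _ "{..<n} \<times> {..<n}"]) auto

text \<open>The condition \<open>(i < j) = (s i < s j)\<close> is symmetric in the two positions. In
  this form the product can be reindexed along a permutation that may itself reverse the
  pair.\<close>

lemma koszul_sign_all_pairs:
  assumes "inj s"
  shows "koszul_sign n s a =
    (\<Prod>(i, j)\<in>{(i, j). i < j \<and> j < n}. if (i < j) = (s i < s j) then 1 else neg_one_pow (a i * a j))"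
proof -
  have ne: "s j < s i" if "i < j" "\<not> s i < s j" for i j
    using that injD[OF assms, of i j] by (cases "s i = s j") auto
  have "finite {(i, j). i < j \<and> j < n}" using finite_index_pairs[of n "\<lambda>_ _. True"] by simp
  then have "(\<Prod>(i, j)\<in>{(i, j). i < j \<and> j < n}. if (i < j) = (s i < s j) then 1 else neg_one_pow (a i * a j))
    = (\<Prod>(i, j)\<in>{(i, j). i < j \<and> j < n \<and> s j < s i}. if (i < j) = (s i < s j) then 1 else neg_one_pow (a i * a j))"
    by (intro prod.mono_neutral_right) (auto split: if_splits intro: ne)
  also have "\<dots> = koszul_sign n s a"
    unfolding koszul_sign_def by (rule prod.cong) auto
  finally show ?thesis by simp
qed

text \<open>A pair is inverted by the composite exactly when one of the two permutations inverts it
  and the other does not; if both do, its sign is squared and disappears.\<close>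

lemma koszul_sign_comp:
  assumes s: "s permutes {..<n}" and t: "t permutes {..<n}"
  shows "koszul_sign n (s \<circ> t) a = koszul_sign n s (\<lambda>i. a (inv_into UNIV t i)) * koszul_sign n t a"
proof -
  have inj: "inj s" "inj t" "inj (s \<circ> t)" and bt: "bij t"
    using permutes_inj[OF s] permutes_inj[OF t] permutes_bij[OF t] by (auto intro: inj_compose)
  let ?D = "{(i, j). i < j \<and> j < n}" and ?t = "inv_into UNIV t"
  have lt: "t i < n \<longleftrightarrow> i < n" "inv_into UNIV t i < n \<longleftrightarrow> i < n" for i
    using permutes_in_image[OF t, of i] permutes_in_image[OF permutes_inv[OF t], of i] by auto
  have tt: "inv_into UNIV t (t i) = i" "t (inv_into UNIV t i) = i" for i
    using permutes_inverses[OF t] by auto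
  have "koszul_sign n s (\<lambda>i. a (inv_into UNIV t i)) =
    (\<Prod>(i, j)\<in>?D. if (i < j) = (s i < s j) then 1 else neg_one_pow (a (inv_into UNIV t i) * a (inv_into UNIV t j)))"
    by (rule koszul_sign_all_pairs[OF inj(1)])
  also have "\<dots> = (\<Prod>(i, j)\<in>?D. if (t i < t j) = (s (t i) < s (t j)) then 1 else neg_one_pow (a i * a j))"
  \<comment> \<open>The reindexing is along \<open>t\<close> on unordered pairs, so the image of a
    pair has to be put back into increasing order.\<close>
  proof (rule prod.reindex_bij_witness[where
        i = "\<lambda>(i, j). if t i < t j then (t i, t j) else (t j, t i)" and
        j = "\<lambda>(i, j). if ?t i < ?t j then (?t i, ?t j) else (?t j, ?t i)"])
    fix p assume "p \<in> ?D"
    then obtain i j where p: "p = (i, j)" "i < j" "j < n" by auto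
    have ne: "t i \<noteq> t j" "?t i \<noteq> ?t j" "s i \<noteq> s j"
      using p(2) inj(1,2) permutes_inj[OF permutes_inv[OF t]] by (auto dest: injD)
    have "i < n" using p by simp
    show "(case (case p of (i, j) \<Rightarrow> if ?t i < ?t j then (?t i, ?t j) else (?t j, ?t i)) of
        (i, j) \<Rightarrow> if t i < t j then (t i, t j) else (t j, t i)) = p"
      using p by (simp add: tt)
    show "(case (case p of (i, j) \<Rightarrow> if t i < t j then (t i, t j) else (t j, t i)) of
        (i, j) \<Rightarrow> if ?t i < ?t j then (?t i, ?t j) else (?t j, ?t i)) = p"
      using p by (simp add: tt)
    show "(case p of (i, j) \<Rightarrow> if ?t i < ?t j then (?t i, ?t j) else (?t j, ?t i)) \<in> ?D"
      using p ne(2) \<open>i < n\<close> by (simp add: lt)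
    show "(case p of (i, j) \<Rightarrow> if t i < t j then (t i, t j) else (t j, t i)) \<in> ?D"
      using p ne(1) \<open>i < n\<close> by (simp add: lt)
    show "(case (case p of (i, j) \<Rightarrow> if ?t i < ?t j then (?t i, ?t j) else (?t j, ?t i)) of
        (i, j) \<Rightarrow> if (t i < t j) = (s (t i) < s (t j)) then 1 else neg_one_pow (a i * a j)) =
      (case p of (i, j) \<Rightarrow> if (i < j) = (s i < s j) then 1 else neg_one_pow (a (?t i) * a (?t j)))"
      using p ne(3) by (cases "s i < s j") (simp_all add: tt mult.commute)
  qed
  finally show ?thesis
    unfolding koszul_sign_all_pairs[OF inj(2)] koszul_sign_all_pairs[OF inj(3)]
    by (auto simp: prod.distrib[symmetric] neg_one_pow_square intro!: prod.cong)
qed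

lemma neg_one_pow_sum: "neg_one_pow (sum f A) = (\<Prod>i\<in>A. neg_one_pow (f i))"
  by (induction A rule: infinite_finite_induct) (simp_all add: neg_one_pow_add, simp_all add: neg_one_pow_def)

text \<open>Raising the degree of factor \<open>m\<close> by one brings in the sign of
  \<open>a i\<close> for each factor \<open>i\<close> whose order relative to \<open>m\<close>
  changes. Together with the factors originally before \<open>m\<close>, and up to squares, these
  are the factors that come before \<open>m\<close> after the reordering.\<close>

lemma koszul_sign_update:
  assumes s: "s permutes {..<n}" and m: "m < n"
  shows "neg_one_pow (sum a {..<m}) * koszul_sign n s (a(m := a m + 1)) =
    koszul_sign n s a * neg_one_pow (sum a {i. i < n \<and> s i < s m})"
proof -
  have inj: "s i = s j \<longleftrightarrow> i = j" for i j using permutes_inj[OF s] by (auto dest: injD)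
  let ?V = "{(i, j). i < j \<and> j < n \<and> s j < s i}"
  let ?I = "{i. i < n \<and> (i < m) \<noteq> (s i < s m)}"
  \<comment> \<open>The factor by which one inversion changes when \<open>a m\<close> is raised:
    only pairs that contain \<open>m\<close> are affected, through the degree of the other
    member.\<close>
  let ?g = "\<lambda>(i, j). if i = m then neg_one_pow (a j) else if j = m then neg_one_pow (a i) else 1"
  let ?q = "\<lambda>i. (min i m, max i m)"
  note fin = finite_index_pairs[of n "\<lambda>i j. s j < s i"]
  have "koszul_sign n s (a(m := a m + 1)) = (\<Prod>p\<in>?V. (case p of (i, j) \<Rightarrow> neg_one_pow (a i * a j)) * ?g p)"
    unfolding koszul_sign_def
    by (intro prod.cong refl) (auto simp: neg_one_pow_add[symmetric] algebra_simps)
  also have "\<dots> = koszul_sign n s a * prod ?g ?V"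
    unfolding koszul_sign_def prod.distrib ..
  also have "prod ?g ?V = prod ?g {(i, j)\<in>?V. i = m \<or> j = m}"
    by (intro prod.mono_neutral_right fin) (auto split: if_splits)
  also have "{(i, j)\<in>?V. i = m \<or> j = m} = ?q ` ?I"
  proof (intro subset_antisym subsetI)
    fix p assume "p \<in> {(i, j)\<in>?V. i = m \<or> j = m}"
    then obtain i j where p: "p = (i, j)" "i < j" "j < n" "s j < s i" "i = m \<or> j = m" by auto
    then show "p \<in> ?q ` ?I"
      by (intro image_eqI[of _ _ "if i = m then j else i"]) auto
  next
    fix p assume "p \<in> ?q ` ?I"
    then obtain i where i: "p = ?q i" "i < n" "(i < m) \<noteq> (s i < s m)" by auto
    then have "i \<noteq> m" by auto
    then have "s i \<noteq> s m" by (simp add: inj)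
    then show "p \<in> {(i, j)\<in>?V. i = m \<or> j = m}"
      using i \<open>i \<noteq> m\<close> m by (cases "i < m") (auto simp: min_def max_def)
  qed
  also have "prod ?g (?q ` ?I) = (\<Prod>i\<in>?I. neg_one_pow (a i))"
    by (subst prod.reindex) (auto simp: inj_on_def min_def max_def split: if_splits intro!: prod.cong)
  finally have 1: "koszul_sign n s (a(m := a m + 1)) = koszul_sign n s a * (\<Prod>i\<in>?I. neg_one_pow (a i))" .
  have all: "prod f {i. i < n \<and> P i} = (\<Prod>i<n. if P i then f i else 1)" for f :: "nat \<Rightarrow> int" and P
    by (subst prod.inter_filter[symmetric]) (auto intro: prod.cong)
  let ?A = "{i. i < n \<and> i < m}" and ?B = "{i. i < n \<and> s i < s m}"
  have A: "{..<m} = ?A" using m by auto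
  have "(\<Prod>i\<in>?A. neg_one_pow (a i)) * (\<Prod>i\<in>?I. neg_one_pow (a i)) = (\<Prod>i\<in>?B. neg_one_pow (a i))"
    unfolding all prod.distrib[symmetric] by (rule prod.cong) (auto simp: neg_one_pow_square)
  moreover have "x * (k * y) = k * z" if "x * y = z" for x y z k :: int
    using that by (simp add: mult.left_commute)
  ultimately show ?thesis
    unfolding 1 neg_one_pow_sum A by blast
qed

subsection \<open>Permuting words\<close>

text \<open>Conjugation by the successor: permutations act on \<open>{1..n}\<close>, whereas list
  positions start at 0.\<close>

definition shift_perm :: "(nat \<Rightarrow> nat) \<Rightarrow> nat \<Rightarrow> nat"
  where "shift_perm \<sigma> j = \<sigma> (Suc j) - 1"

text \<open>Truncated subtraction loses nothing here: \<open>\<sigma>\<close> fixes 0 and is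
  injective, so it is positive at positive arguments.\<close>

lemma Suc_shift_perm:
  assumes "\<sigma> permutes {1..n}" shows "Suc (shift_perm \<sigma> j) = \<sigma> (Suc j)"
proof -
  have "\<sigma> 0 = 0" using assms by (simp add: permutes_not_in)
  then have "\<sigma> (Suc j) \<noteq> 0" using permutes_inj[OF assms] by (metis injD nat.distinct(1))
  then show ?thesis by (simp add: shift_perm_def)
qed

lemma shift_perm_comp:
  assumes "\<tau> permutes {1..n}" shows "shift_perm (\<sigma> \<circ> \<tau>) = shift_perm \<sigma> \<circ> shift_perm \<tau>"
  by (rule ext) (simp add: shift_perm_def[of "\<sigma> \<circ> \<tau>"] shift_perm_def[of \<sigma>] Suc_shift_perm[OF assms])

lemma shift_perm_id: "shift_perm id = id"
  by (auto simp: shift_perm_def)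

lemma
  assumes "\<sigma> permutes {1..n}"
  shows shift_perm_permutes: "shift_perm \<sigma> permutes {..<n}"
    and shift_perm_inv: "shift_perm (inv_into UNIV \<sigma>) = inv_into UNIV (shift_perm \<sigma>)"
proof -
  note i = permutes_inv[OF assms]
  have c: "shift_perm \<sigma> \<circ> shift_perm (inv_into UNIV \<sigma>) = id" "shift_perm (inv_into UNIV \<sigma>) \<circ> shift_perm \<sigma> = id"
    unfolding shift_perm_comp[OF i, symmetric] shift_perm_comp[OF assms, symmetric]
    by (simp_all add: permutes_inv_o[OF assms] shift_perm_id)
  then have "bij (shift_perm \<sigma>)" by (auto intro: o_bij)
  moreover have "shift_perm \<sigma> j = j" if "j \<notin> {..<n}" for j
    using that assms by (simp add: shift_perm_def permutes_not_in)
  ultimately show "shift_perm \<sigma> permutes {..<n}"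
    by (auto simp: permutes_def bij_iff)
  show "shift_perm (inv_into UNIV \<sigma>) = inv_into UNIV (shift_perm \<sigma>)"
    using c by (metis inv_unique_comp)
qed

lemma permute_word_conv: "permute_word \<sigma> w = map (\<lambda>i. w ! shift_perm (inv_into UNIV \<sigma>) i) [0..<length w]"
  by (simp add: permute_word_def shift_perm_def)

lemma length_permute_word: "length (permute_word \<sigma> w) = length w"
  by (simp add: permute_word_def)

lemma permute_word_nth:
  assumes "\<sigma> permutes {1..length w}" "i < length w"
  shows "permute_word \<sigma> w ! i = w ! inv_into UNIV (shift_perm \<sigma>) i"
  using assms by (simp add: permute_word_conv shift_perm_inv)

lemma permute_word_nth_shift:
  assumes "\<sigma> permutes {1..length w}" "i < length w"
  shows "permute_word \<sigma> w ! shift_perm \<sigma> i = w ! i"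
  using assms permutes_in_image[OF shift_perm_permutes[OF assms(1)], of i]
    permutes_inverses[OF shift_perm_permutes[OF assms(1)]]
  by (simp add: permute_word_nth)

lemma map_permute_word:
  assumes "\<sigma> permutes {1..length w}"
  shows "map f (permute_word \<sigma> w) = permute_word \<sigma> (map f w)"
  using assms permutes_in_image[OF permutes_inv[OF shift_perm_permutes[OF assms]]]
  by (intro nth_equalityI) (auto simp: length_permute_word permute_word_nth)

lemma mset_permute_word:
  assumes "\<sigma> permutes {1..length w}"
  shows "mset (permute_word \<sigma> w) = mset w"
proof -
  have "permute_list (inv_into UNIV (shift_perm \<sigma>)) w = permute_word \<sigma> w"
    using assms by (simp add: permute_list_def permute_word_conv shift_perm_inv)
  then show ?thesis
    using mset_permute_list[OF permutes_inv[OF shift_perm_permutes[OF assms]]] by metis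
qed

lemma permute_word_comp:
  assumes "\<sigma> permutes {1..length w}" "\<tau> permutes {1..length w}"
  shows "permute_word (\<sigma> \<circ> \<tau>) w = permute_word \<sigma> (permute_word \<tau> w)"
proof (rule nth_equalityI)
  fix i assume i: "i < length (permute_word (\<sigma> \<circ> \<tau>) w)"
  note s = shift_perm_permutes[OF assms(1)] and t = shift_perm_permutes[OF assms(2)]
  have "inv_into UNIV (shift_perm \<sigma>) i < length w"
    using i permutes_in_image[OF permutes_inv[OF s]] by (simp add: length_permute_word)
  moreover have "inv_into UNIV (shift_perm (\<sigma> \<circ> \<tau>)) = inv_into UNIV (shift_perm \<tau>) \<circ> inv_into UNIV (shift_perm \<sigma>)"
    unfolding shift_perm_comp[OF assms(2)]
    using permutes_bij[OF s] permutes_bij[OF t] by (rule o_inv_distrib)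
  ultimately show "permute_word (\<sigma> \<circ> \<tau>) w ! i = permute_word \<sigma> (permute_word \<tau> w) ! i"
    using i assms permutes_compose[OF assms(2,1)]
    by (simp add: length_permute_word permute_word_nth)
qed (simp add: length_permute_word)

lemma permute_word_id: "permute_word id w = w"
  by (rule nth_equalityI) (simp_all add: permute_word_conv shift_perm_id)

lemma permute_word_update:
  assumes "\<sigma> permutes {1..length w}" "i < length w"
  shows "permute_word \<sigma> (w[i := b]) = (permute_word \<sigma> w)[shift_perm \<sigma> i := b]"
proof (rule nth_equalityI)
  note s = shift_perm_permutes[OF assms(1)]
  fix k assume k: "k < length (permute_word \<sigma> (w[i := b]))"
  then have "inv_into UNIV (shift_perm \<sigma>) k < length w"
    using permutes_in_image[OF permutes_inv[OF s]] by (simp add: length_permute_word)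
  moreover have "inv_into UNIV (shift_perm \<sigma>) k = i \<longleftrightarrow> k = shift_perm \<sigma> i"
    using permutes_inverses[OF s] by metis
  ultimately show "permute_word \<sigma> (w[i := b]) ! k = (permute_word \<sigma> w)[shift_perm \<sigma> i := b] ! k"
    using k assms by (auto simp: length_permute_word permute_word_nth nth_list_update)
qed (simp add: length_permute_word)

lemma permute_sign_conv:
  assumes "\<sigma> permutes {1..n}"
  shows "permute_sign \<sigma> w = koszul_sign (length w) (shift_perm \<sigma>) (\<lambda>i. fst (w ! i))"
proof -
  have "\<sigma> (Suc j) < \<sigma> (Suc i) \<longleftrightarrow> shift_perm \<sigma> j < shift_perm \<sigma> i" for i j
    unfolding Suc_shift_perm[OF assms, symmetric] by simp
  then show ?thesis by (simp add: permute_sign_def koszul_sign_def)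
qed

lemma permute_sign_cong:
  assumes "map fst w = map fst v" shows "permute_sign \<sigma> w = permute_sign \<sigma> v"
proof -
  have len: "length w = length v" using assms by (rule map_eq_imp_length_eq)
  have "fst (w ! i) = fst (v ! i)" if "i < length w" for i
    using that assms len by (metis nth_map)
  then show ?thesis unfolding permute_sign_def len[symmetric] by (intro prod.cong) auto
qed

lemma permute_sign_comp:
  assumes "\<sigma> permutes {1..length w}" "\<tau> permutes {1..length w}"
  shows "permute_sign (\<sigma> \<circ> \<tau>) w = permute_sign \<sigma> (permute_word \<tau> w) * permute_sign \<tau> w"
proof -
  note t = shift_perm_permutes[OF assms(2)]
  have eq: "koszul_sign (length w) (shift_perm \<sigma>) (\<lambda>i. fst (permute_word \<tau> w ! i)) =
     koszul_sign (length w) (shift_perm \<sigma>) (\<lambda>i. fst (w ! inv_into UNIV (shift_perm \<tau>) i))"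
    unfolding koszul_sign_def using assms by (intro prod.cong) (auto simp: permute_word_nth)
  show ?thesis
    unfolding permute_sign_conv[OF assms(1)] permute_sign_conv[OF assms(2)]
      permute_sign_conv[OF permutes_compose[OF assms(2,1)]] shift_perm_comp[OF assms(2)] length_permute_word
      koszul_sign_comp[OF shift_perm_permutes[OF assms(1)] t] eq ..
qed

lemma permute_sign_id: "permute_sign id w = 1"
  unfolding permute_sign_def by (rule prod.neutral) auto

lemma permute_word_in_tensor_words:
  assumes "w \<in> tensor_words X n d" "\<sigma> permutes {1..n}"
  shows "permute_word \<sigma> w \<in> tensor_words X n d"
proof -
  have len: "length w = n" using assms(1) by (simp add: tensor_words_def)
  have "mset (permute_word \<sigma> w) = mset w" using assms(2) len by (intro mset_permute_word) simp
  moreover from this have "sum_list (map fst (permute_word \<sigma> w)) = sum_list (map fst w)"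
    by (metis mset_map sum_mset_sum_list)
  ultimately show ?thesis
    using assms(1) mset_eq_setD[of "permute_word \<sigma> w" w] by (simp add: tensor_words_def length_permute_word)
qed

text \<open>The sign identity behind the equivariance of the differential: differentiating at
  position \<open>m\<close> and then permuting gives the same sign as permuting and then
  differentiating at the new position.\<close>

lemma permute_sign_update:
  assumes s: "\<sigma> permutes {1..length w}" and m: "m < length w"
  shows "neg_one_pow (sum_list (map fst (take m w))) * permute_sign \<sigma> (w[m := (fst (w ! m) + 1, y)]) =
    permute_sign \<sigma> w * neg_one_pow (sum_list (map fst (take (shift_perm \<sigma> m) (permute_word \<sigma> w))))"
proof -
  let ?s = "shift_perm \<sigma>" and ?a = "\<lambda>i. fst (w ! i)"
  note p = shift_perm_permutes[OF s]
  have sm: "?s m < length w" using m permutes_in_image[OF p] by simp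
  have upd: "koszul_sign (length w) ?s (\<lambda>i. fst (w[m := (fst (w ! m) + 1, y)] ! i)) = koszul_sign (length w) ?s (?a(m := ?a m + 1))"
    unfolding koszul_sign_def using m by (intro prod.cong) (auto simp: nth_list_update)
  have take: "sum_list (map fst (take k v)) = (\<Sum>i<k. fst (v ! i))" if "k \<le> length v" for k and v :: "(int \<times> 'a) list"
    using that by (subst sum_list_sum_nth) (auto simp: atLeast0LessThan intro!: sum.cong)
  have "(\<Sum>i<?s m. fst (permute_word \<sigma> w ! i)) = sum ?a {i. i < length w \<and> ?s i < ?s m}"
  proof (rule sum.reindex_bij_witness[where i = ?s and j = "inv_into UNIV ?s"])
    fix i assume i: "i \<in> {..<?s m}"
    then have "i < length w" using sm by simp
    then show "inv_into UNIV ?s i \<in> {i. i < length w \<and> ?s i < ?s m}"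
      using i permutes_in_image[OF permutes_inv[OF p], of i] permutes_inverses[OF p] by simp
    show "?a (inv_into UNIV ?s i) = fst (permute_word \<sigma> w ! i)"
      using \<open>i < length w\<close> s by (simp add: permute_word_nth)
  qed (auto simp: permutes_inverses[OF p])
  then show ?thesis
    using m sm koszul_sign_update[OF p m, of ?a]
    by (simp add: permute_sign_conv[OF s] upd take length_permute_word)
qed

text \<open>This serves the multilinearity of the action: one varying letter is carried to one
  varying position, and the rest of the permuted word does not depend on it.\<close>

lemma permute_word_split:
  assumes "\<sigma> permutes {1..length u + Suc (length v)}"
  obtains u' v' where "\<And>b. permute_word \<sigma> (u @ b # v) = u' @ b # v'"
proof -
  \<comment> \<open>The undefined letter is a placeholder; all the words considered differ from
    \<open>?w\<close> at this position only.\<close>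
  let ?i = "length u" and ?w = "u @ undefined # v"
  let ?k = "shift_perm \<sigma> ?i"
  have p: "\<sigma> permutes {1..length ?w}" using assms by simp
  have k: "?k < length ?w" using permutes_in_image[OF shift_perm_permutes[OF p], of ?i] by simp
  have "permute_word \<sigma> (u @ b # v) = take ?k (permute_word \<sigma> ?w) @ b # drop (Suc ?k) (permute_word \<sigma> ?w)" for b
  proof -
    have "u @ b # v = ?w[?i := b]" by simp
    then have "permute_word \<sigma> (u @ b # v) = (permute_word \<sigma> ?w)[?k := b]"
      using permute_word_update[OF p, of ?i b] by simp
    then show ?thesis using k by (simp add: upd_conv_take_nth_drop length_permute_word)
  qed
  then show thesis by (rule that)
qed

subsection \<open>Complexes with an action\<close>

definition sym_cochain :: "('k, 'm) ring_scheme \<Rightarrow> nat \<Rightarrow> ('k, 'a) sym_complex \<Rightarrow> bool"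
  where
  "sym_cochain R n P \<longleftrightarrow>
     cochain_complex R P \<and>
     (\<forall>\<sigma> d. \<sigma> permutes {1..n} \<longrightarrow> linear_map R (obj P d) (obj P d) (act P \<sigma> d)) \<and>
     (\<forall>\<sigma> \<tau> d. \<sigma> permutes {1..n} \<longrightarrow> \<tau> permutes {1..n} \<longrightarrow>
        (\<forall>x\<in>carrier (obj P d). act P (\<sigma> \<circ> \<tau>) d x = act P \<sigma> d (act P \<tau> d x))) \<and>
     (\<forall>d. \<forall>x\<in>carrier (obj P d). act P id d x = x) \<and>
     (\<forall>\<sigma> d. \<sigma> permutes {1..n} \<longrightarrow>
        (\<forall>x\<in>carrier (obj P d). dif P d (act P \<sigma> d x) = act P \<sigma> (d + 1) (dif P d x)))"

lemma sym_cochainD: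
  assumes "sym_cochain R n P"
  shows "cochain_complex R P"
    and "\<sigma> permutes {1..n} \<Longrightarrow> linear_map R (obj P d) (obj P d) (act P \<sigma> d)"
    and "\<sigma> permutes {1..n} \<Longrightarrow> \<tau> permutes {1..n} \<Longrightarrow> x \<in> carrier (obj P d) \<Longrightarrow>
        act P (\<sigma> \<circ> \<tau>) d x = act P \<sigma> d (act P \<tau> d x)"
    and "x \<in> carrier (obj P d) \<Longrightarrow> act P id d x = x"
    and "\<sigma> permutes {1..n} \<Longrightarrow> x \<in> carrier (obj P d) \<Longrightarrow> dif P d (act P \<sigma> d x) = act P \<sigma> (d + 1) (dif P d x)"
  using assms by (auto simp: sym_cochain_def)

context graded_module
begin

lemma multilinear_permute:
  assumes "\<sigma> permutes {1..n}"
  shows "multilinear R X n d (tensor_module R X n d)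
    (\<lambda>w. [permute_sign \<sigma> w] \<cdot>\<^bsub>tensor_module R X n d\<^esub> pure_tensor R X n d (permute_word \<sigma> w))"
proof (rule multilinearI)
  let ?T = "tensor_module R X n d"
  show "w \<in> tensor_words X n d \<Longrightarrow> [permute_sign \<sigma> w] \<cdot>\<^bsub>?T\<^esub> pure_tensor R X n d (permute_word \<sigma> w) \<in> carrier ?T" for w
    by (intro int_smult_closed[OF tensor_module] pure_tensor_closed permute_word_in_tensor_words assms)
  interpret T: module R ?T by (rule tensor_module)
  fix u j x v assume w: "u @ (j, x) # v \<in> tensor_words X n d"
  from length_tensor_words[OF w] assms have "\<sigma> permutes {1..length u + Suc (length v)}" by simp
  then obtain u' v' where uv: "\<And>b. permute_word \<sigma> (u @ b # v) = u' @ b # v'" using permute_word_split by blast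
  \<comment> \<open>The sign sees only the degrees of the letters, and these stay fixed while the
    letter varies.\<close>
  have sgn: "permute_sign \<sigma> (u @ (j, y) # v) = permute_sign \<sigma> (u @ (j, x) # v)" for y
    by (rule permute_sign_cong) simp
  have w': "u' @ (j, x) # v' \<in> tensor_words X n d"
    using permute_word_in_tensor_words[OF w assms] by (simp add: uv)
  note mp = multilinear_pure_tensor[of n d]
  have c: "pure_tensor R X n d (u' @ (j, y) # v') \<in> carrier ?T" if "y \<in> carrier (obj X j)" for y
    by (rule pure_tensor_closed[OF tensor_words_replace[OF w' that]])
  have x: "x \<in> carrier (obj X j)" by (rule tensor_words_mid[OF w])
  { fix y assume y: "y \<in> carrier (obj X j)"
    show "[permute_sign \<sigma> (u @ (j, x \<oplus>\<^bsub>obj X j\<^esub> y) # v)] \<cdot>\<^bsub>?T\<^esub> pure_tensor R X n d (permute_word \<sigma> (u @ (j, x \<oplus>\<^bsub>obj X j\<^esub> y) # v)) =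
      [permute_sign \<sigma> (u @ (j, x) # v)] \<cdot>\<^bsub>?T\<^esub> pure_tensor R X n d (permute_word \<sigma> (u @ (j, x) # v)) \<oplus>\<^bsub>?T\<^esub>
      [permute_sign \<sigma> (u @ (j, y) # v)] \<cdot>\<^bsub>?T\<^esub> pure_tensor R X n d (permute_word \<sigma> (u @ (j, y) # v))"
      unfolding uv sgn[of y] sgn[of "x \<oplus>\<^bsub>obj X j\<^esub> y"] multilinear_add[OF mp w' y]
      by (rule int_smult_add[OF tensor_module c[OF x] c[OF y]]) }
  { fix r assume r: "r \<in> carrier R"
    show "[permute_sign \<sigma> (u @ (j, r \<odot>\<^bsub>obj X j\<^esub> x) # v)] \<cdot>\<^bsub>?T\<^esub> pure_tensor R X n d (permute_word \<sigma> (u @ (j, r \<odot>\<^bsub>obj X j\<^esub> x) # v)) =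
      r \<odot>\<^bsub>?T\<^esub> ([permute_sign \<sigma> (u @ (j, x) # v)] \<cdot>\<^bsub>?T\<^esub> pure_tensor R X n d (permute_word \<sigma> (u @ (j, x) # v)))"
      unfolding uv sgn[of "r \<odot>\<^bsub>obj X j\<^esub> x"] multilinear_smult[OF mp w' r]
      by (rule linear_map_smult[OF linear_map_int_scale[OF tensor_module tensor_module linear_map_id] r c[OF x]]) }
qed

abbreviation tact where "tact n \<equiv> act (tensor_power R X n)"

lemma tact_linear:
  "\<sigma> permutes {1..n} \<Longrightarrow> linear_map R (tensor_module R X n d) (tensor_module R X n d) (tact n \<sigma> d)"
  by (simp add: tensor_power_def tensor_lift_linear[OF tensor_module multilinear_permute])

lemma tact_pure:
  "\<sigma> permutes {1..n} \<Longrightarrow> w \<in> tensor_words X n d \<Longrightarrow> tact n \<sigma> d (pure_tensor R X n d w) =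
     [permute_sign \<sigma> w] \<cdot>\<^bsub>tensor_module R X n d\<^esub> pure_tensor R X n d (permute_word \<sigma> w)"
  by (simp add: tensor_power_def tensor_lift_pure[OF tensor_module multilinear_permute])

lemma tact_comp:
  assumes s: "\<sigma> permutes {1..n}" and t: "\<tau> permutes {1..n}" and "x \<in> carrier (tensor_module R X n d)"
  shows "tact n (\<sigma> \<circ> \<tau>) d x = tact n \<sigma> d (tact n \<tau> d x)"
proof (rule linear_map_eq_on_tensor[OF tensor_module[of n d] _ _ _ assms(3)])
  fix w assume w: "w \<in> tensor_words X n d"
  note len = length_tensor_words[OF w]
  have w': "permute_word \<tau> w \<in> tensor_words X n d" by (rule permute_word_in_tensor_words[OF w t])
  have w'': "permute_word \<sigma> (permute_word \<tau> w) \<in> tensor_words X n d" by (rule permute_word_in_tensor_words[OF w' s])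
  have p: "\<sigma> permutes {1..length w}" "\<tau> permutes {1..length w}" using s t len by auto
  show "tact n (\<sigma> \<circ> \<tau>) d (pure_tensor R X n d w) = tact n \<sigma> d (tact n \<tau> d (pure_tensor R X n d w))"
    using pure_tensor_closed[OF w''] pure_tensor_closed[OF w']
    by (simp add: tact_pure[OF s w'] tact_pure[OF t w] tact_pure[OF permutes_compose[OF t s] w] permute_word_comp[OF p] permute_sign_comp[OF p]
        linear_map_int_smult[OF tensor_module tensor_module tact_linear[OF s]] int_smult_smult[OF tensor_module] mult.commute)
qed (rule tact_linear[OF permutes_compose[OF t s]] linear_map_comp[OF tact_linear[OF t] tact_linear[OF s]])+

lemma tact_id:
  assumes "x \<in> carrier (tensor_module R X n d)"
  shows "tact n id d x = x"
  by (rule linear_map_eq_on_tensor[OF tensor_module[of n d] tact_linear[OF permutes_id] linear_map_id _ assms])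
     (simp add: tact_pure[OF permutes_id] permute_word_id permute_sign_id int_smult_1[OF tensor_module] pure_tensor_closed)

end

lemma tensor_power_map_act:
  assumes X: "graded_module R X" and Y: "graded_module R Y"
    and f: "\<And>j. linear_map R (obj X j) (obj Y j) (f j)"
    and s: "\<sigma> permutes {1..n}" and t: "t \<in> carrier (tensor_module R X n d)"
  shows "tensor_power_map R Y f n d (act (tensor_power R X n) \<sigma> d t) =
    act (tensor_power R Y n) \<sigma> d (tensor_power_map R Y f n d t)"
proof -
  interpret X: graded_module R X by (rule X)
  interpret Y: graded_module R Y by (rule Y)
  note F = tensor_power_map_linear[OF X Y f]
  show ?thesis
  proof (rule X.linear_map_eq_on_tensor[OF Y.tensor_module[of n d] _ _ _ t])
    fix w assume w: "w \<in> tensor_words X n d"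
    let ?m = "map (\<lambda>(j, x). (j, f j x))"
    have "permute_sign \<sigma> (?m w) = permute_sign \<sigma> w" by (rule permute_sign_cong) auto
    moreover have "permute_word \<sigma> (?m w) = ?m (permute_word \<sigma> w)"
      using s X.length_tensor_words[OF w] by (simp add: map_permute_word)
    ultimately show "tensor_power_map R Y f n d (X.tact n \<sigma> d (pure_tensor R X n d w)) =
      Y.tact n \<sigma> d (tensor_power_map R Y f n d (pure_tensor R X n d w))"
      using w by (simp add: X.tact_pure[OF s] Y.tact_pure[OF s] tensor_power_map_pure[OF X Y f] linear_map_word[OF f]
          permute_word_in_tensor_words[OF w s] X.pure_tensor_closed linear_map_int_smult[OF X.tensor_module Y.tensor_module F])
  qed (rule linear_map_comp[OF X.tact_linear[OF s] F] linear_map_comp[OF F Y.tact_linear[OF s]])+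
qed

context cochain
begin

lemma tdif_pure:
  "w \<in> tensor_words X n d \<Longrightarrow> tdif n d (pure_tensor R X n d w) = (\<Oplus>\<^bsub>tensor_module R X n (d + 1)\<^esub>i\<in>{..<n}.
     [neg_one_pow (sum_list (map fst (take i w)))] \<cdot>\<^bsub>tensor_module R X n (d + 1)\<^esub>
       pure_tensor R X n (d + 1) (w[i := (fst (w ! i) + 1, dif X (fst (w ! i)) (snd (w ! i)))]))"
  by (simp add: twisted_derivation_pure[OF dif_linear linear_map_id] twisted_word_dif)

lemma dif_word:
  assumes w: "w \<in> tensor_words X n d" and i: "i < n"
  shows "w[i := (fst (w ! i) + 1, dif X (fst (w ! i)) (snd (w ! i)))] \<in> tensor_words X n (d + 1)"
proof -
  obtain k y where k: "w ! i = (k, y)" by (cases "w ! i")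
  have len: "length w = n" using w by (rule length_tensor_words)
  then have "(k, y) \<in> set w" using k i by (metis nth_mem)
  then have "dif X k y \<in> carrier (obj X (k + 1))"
    using w dif_closed by (auto simp: tensor_words_def)
  moreover have "sum_list (map fst (w[i := (k + 1, dif X k y)])) = d + 1"
    using i len w k by (auto simp: map_update sum_list_update_diff tensor_words_def)
  ultimately show ?thesis
    using w len k by (auto simp: tensor_words_def dest!: set_update_subset_insert[THEN subsetD])
qed

text \<open>Permuting a word differentiated at position \<open>i\<close> is the same as
  differentiating the permuted word at the image of \<open>i\<close>. Reindexing the sum over
  positions along the permutation matches the terms, and \<open>permute_sign_update\<close> matches
  their signs.\<close>

lemma tdif_tact:
  assumes s: "\<sigma> permutes {1..n}" and t: "t \<in> carrier (tensor_module R X n d)"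
  shows "tdif n d (tact n \<sigma> d t) = tact n \<sigma> (d + 1) (tdif n d t)"
proof (rule linear_map_eq_on_tensor[OF tensor_module[of n "d + 1"] _ _ _ t])
  fix w assume w: "w \<in> tensor_words X n d"
  let ?T = "tensor_module R X n (d + 1)"
  interpret T: module R ?T by (rule tensor_module)
  let ?d = "\<lambda>w i. w[i := (fst (w ! i) + 1, dif X (fst (w ! i)) (snd (w ! i)))]"
  let ?e = "\<lambda>w i. neg_one_pow (sum_list (map fst (take i w)))"
  let ?v = "permute_word \<sigma> w"
  note len = length_tensor_words[OF w]
  have p: "\<sigma> permutes {1..length w}" using s len by simp
  note v = permute_word_in_tensor_words[OF w s]
  note sp = shift_perm_permutes[OF s]
  have lt: "shift_perm \<sigma> i < n" if "i < n" for i using that permutes_in_image[OF sp, of i] by simp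
  have "tdif n d (tact n \<sigma> d (pure_tensor R X n d w)) =
      [permute_sign \<sigma> w] \<cdot>\<^bsub>?T\<^esub> (\<Oplus>\<^bsub>?T\<^esub>i\<in>{..<n}. [?e ?v i] \<cdot>\<^bsub>?T\<^esub> pure_tensor R X n (d + 1) (?d ?v i))"
    using v by (simp add: tact_pure[OF s w] tdif_pure pure_tensor_closed
        linear_map_int_smult[OF tensor_module tensor_module tdif_linear[OF refl]])
  also have "\<dots> = (\<Oplus>\<^bsub>?T\<^esub>i\<in>{..<n}. [permute_sign \<sigma> w] \<cdot>\<^bsub>?T\<^esub> ([?e ?v i] \<cdot>\<^bsub>?T\<^esub> pure_tensor R X n (d + 1) (?d ?v i)))"
    using dif_word[OF v] by (intro int_smult_finsum[OF tensor_module] Pi_I int_smult_closed[OF tensor_module] pure_tensor_closed) simp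
  also have "\<dots> = (\<Oplus>\<^bsub>?T\<^esub>i\<in>shift_perm \<sigma> ` {..<n}. [permute_sign \<sigma> w] \<cdot>\<^bsub>?T\<^esub> ([?e ?v i] \<cdot>\<^bsub>?T\<^esub> pure_tensor R X n (d + 1) (?d ?v i)))"
    using permutes_image[OF sp] by simp
  also have "\<dots> = (\<Oplus>\<^bsub>?T\<^esub>i\<in>{..<n}. [permute_sign \<sigma> w] \<cdot>\<^bsub>?T\<^esub>
      ([?e ?v (shift_perm \<sigma> i)] \<cdot>\<^bsub>?T\<^esub> pure_tensor R X n (d + 1) (?d ?v (shift_perm \<sigma> i))))"
    using dif_word[OF v] lt permutes_inj_on[OF sp]
    by (intro T.finsum_reindex) (auto intro!: int_smult_closed[OF tensor_module] pure_tensor_closed)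
  also have "\<dots> = (\<Oplus>\<^bsub>?T\<^esub>i\<in>{..<n}. tact n \<sigma> (d + 1) ([?e w i] \<cdot>\<^bsub>?T\<^esub> pure_tensor R X n (d + 1) (?d w i)))"
  proof (rule T.finsum_cong'[OF refl])
    fix i assume "i \<in> {..<n}"
    then have i: "i < n" by simp
    note dw = dif_word[OF w i] and dv = dif_word[OF v lt[OF i]]
    have "?v ! shift_perm \<sigma> i = w ! i"
      using permute_word_nth_shift[OF p] i len by simp
    then have eq: "permute_word \<sigma> (?d w i) = ?d ?v (shift_perm \<sigma> i)"
      using permute_word_update[OF p] i len by simp
    show "[permute_sign \<sigma> w] \<cdot>\<^bsub>?T\<^esub> ([?e ?v (shift_perm \<sigma> i)] \<cdot>\<^bsub>?T\<^esub> pure_tensor R X n (d + 1) (?d ?v (shift_perm \<sigma> i)))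
      = tact n \<sigma> (d + 1) ([?e w i] \<cdot>\<^bsub>?T\<^esub> pure_tensor R X n (d + 1) (?d w i))"
      using permute_sign_update[OF p, of i "dif X (fst (w ! i)) (snd (w ! i))"] i len pure_tensor_closed[OF dw] pure_tensor_closed[OF dv]
      by (simp add: linear_map_int_smult[OF tensor_module tensor_module tact_linear[OF s]] tact_pure[OF s dw] eq
          int_smult_smult[OF tensor_module])
  qed (use dif_word[OF w] in \<open>auto intro!: linear_map_closed[OF tact_linear[OF s]] int_smult_closed[OF tensor_module] pure_tensor_closed\<close>)
  also have "\<dots> = tact n \<sigma> (d + 1) (tdif n d (pure_tensor R X n d w))"
    unfolding tdif_pure[OF w]
    using dif_word[OF w]
    by (intro linear_map_finsum[OF tensor_module tensor_module tact_linear[OF s], symmetric])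
       (auto intro!: int_smult_closed[OF tensor_module] pure_tensor_closed)
  finally show "tdif n d (tact n \<sigma> d (pure_tensor R X n d w)) = tact n \<sigma> (d + 1) (tdif n d (pure_tensor R X n d w))" .
qed (rule linear_map_comp[OF tact_linear[OF s] tdif_linear[OF refl]] linear_map_comp[OF tdif_linear[OF refl] tact_linear[OF s]])+

lemma obj_tensor_power: "obj (tensor_power R X n) = tensor_module R X n"
  by (simp add: tensor_power_def)

lemma tensor_power_sym_cochain: "sym_cochain R n (tensor_power R X n)"
  unfolding sym_cochain_def cochain_complex_def obj_tensor_power
proof (intro conjI allI impI ballI)
  fix d
  show "module R (tensor_module R X n d)" by (rule tensor_module)
  show "linear_map R (tensor_module R X n d) (tensor_module R X n (d + 1)) (dif (tensor_power R X n) d)"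
    by (rule linear_map_cong[OF tensor_dif tensor_module tdif_linear[OF refl]])
  fix t assume t: "t \<in> carrier (tensor_module R X n d)"
  then show "dif (tensor_power R X n) (d + 1) (dif (tensor_power R X n) d t) = \<zero>\<^bsub>tensor_module R X n (d + 2)\<^esub>"
    using tdif_tdif[OF t] tdif_closed[OF refl t] by (simp add: tensor_dif)
  show "tact n id d t = t" by (rule tact_id[OF t])
  fix \<sigma> assume s: "\<sigma> permutes {1..n}"
  show "dif (tensor_power R X n) d (tact n \<sigma> d t) = tact n \<sigma> (d + 1) (dif (tensor_power R X n) d t)"
    using t linear_map_closed[OF tact_linear[OF s] t] by (simp add: tensor_dif tdif_tact[OF s])
  fix \<tau> assume "\<tau> permutes {1..n}"
  then show "tact n (\<sigma> \<circ> \<tau>) d t = tact n \<sigma> d (tact n \<tau> d t)" by (rule tact_comp[OF s _ t])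
qed (rule tact_linear)

end

text \<open>A permutation does not change the multiset of letters, hence not the number of letters
  that are counted.\<close>

lemma (in retraction) tact_hom_filtration:
  assumes s: "\<sigma> permutes {1..n}" and t: "t \<in> hom_filtration N n d"
  shows "tact n \<sigma> d t \<in> hom_filtration N n d"
proof (rule hom_filtration_least[OF tensor_module tact_linear[OF s] hom_filtration_submodule _ t])
  fix w assume w: "w \<in> tensor_words X n d" "N \<le> length (filter hom_letter w)"
  have "mset (permute_word \<sigma> w) = mset w"
    using s length_tensor_words[OF w(1)] by (intro mset_permute_word) simp
  then have "length (filter hom_letter (permute_word \<sigma> w)) = length (filter hom_letter w)"
    by (metis mset_filter size_mset)
  then show "tact n \<sigma> d (pure_tensor R X n d w) \<in> hom_filtration N n d"
    unfolding tact_pure[OF s w(1)] using w(2)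
    by (intro submodule_int_smult[OF tensor_module hom_filtration_submodule] hom_filtration_pure
        permute_word_in_tensor_words[OF w(1) s]) simp
qed

section \<open>Tensor products over the symmetric group\<close>

definition balanced ::
  "('k, 'm) ring_scheme \<Rightarrow> nat \<Rightarrow> ('k, 'a) sym_complex \<Rightarrow> ('k, 'b) sym_complex \<Rightarrow> int \<Rightarrow> ('k, 'c) module \<Rightarrow>
    (int \<times> 'a \<times> 'b \<Rightarrow> 'c) \<Rightarrow> bool"
  where
  "balanced R n P M d N \<phi> \<longleftrightarrow>
     (\<forall>i. \<forall>b\<in>carrier (obj M (d - i)). linear_map R (obj P i) N (\<lambda>a. \<phi> (i, a, b))) \<and>
     (\<forall>i. \<forall>a\<in>carrier (obj P i). linear_map R (obj M (d - i)) N (\<lambda>b. \<phi> (i, a, b))) \<and>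
     (\<forall>i \<sigma>. \<forall>a\<in>carrier (obj P i). \<forall>b\<in>carrier (obj M (d - i)). \<sigma> permutes {1..n} \<longrightarrow>
        \<phi> (i, act P (inv_into UNIV \<sigma>) i a, b) = \<phi> (i, a, act M \<sigma> (d - i) b))"

lemma balancedI:
  assumes "\<And>i b. b \<in> carrier (obj M (d - i)) \<Longrightarrow> linear_map R (obj P i) N (\<lambda>a. \<phi> (i, a, b))"
    and "\<And>i a. a \<in> carrier (obj P i) \<Longrightarrow> linear_map R (obj M (d - i)) N (\<lambda>b. \<phi> (i, a, b))"
    and "\<And>i \<sigma> a b. a \<in> carrier (obj P i) \<Longrightarrow> b \<in> carrier (obj M (d - i)) \<Longrightarrow> \<sigma> permutes {1..n} \<Longrightarrow>
        \<phi> (i, act P (inv_into UNIV \<sigma>) i a, b) = \<phi> (i, a, act M \<sigma> (d - i) b)"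
  shows "balanced R n P M d N \<phi>"
  using assms by (simp add: balanced_def)

lemma balancedD:
  assumes "balanced R n P M d N \<phi>"
  shows "b \<in> carrier (obj M (d - i)) \<Longrightarrow> linear_map R (obj P i) N (\<lambda>a. \<phi> (i, a, b))"
    and "a \<in> carrier (obj P i) \<Longrightarrow> linear_map R (obj M (d - i)) N (\<lambda>b. \<phi> (i, a, b))"
    and "a \<in> carrier (obj P i) \<Longrightarrow> b \<in> carrier (obj M (d - i)) \<Longrightarrow> \<sigma> permutes {1..n} \<Longrightarrow>
        \<phi> (i, act P (inv_into UNIV \<sigma>) i a, b) = \<phi> (i, a, act M \<sigma> (d - i) b)"
  using assms unfolding balanced_def by blast+

lemma mem_bal_pairs: "(i, a, b) \<in> bal_pairs P M d \<longleftrightarrow> a \<in> carrier (obj P i) \<and> b \<in> carrier (obj M (d - i))"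
  by (simp add: bal_pairs_def)

locale balanced_pair =
  fixes R :: "('k, 'm) ring_scheme" and n :: nat and P :: "('k, 'a) sym_complex" and M :: "('k, 'b) sym_complex"
  assumes P: "sym_cochain R n P" and M: "sym_cochain R n M"
begin

lemmas P_module = cochain_complexD(1)[OF sym_cochainD(1)[OF P]]
lemmas P_dif = cochain_complexD(2)[OF sym_cochainD(1)[OF P]]
lemmas P_dif_dif = cochain_complexD(3)[OF sym_cochainD(1)[OF P]]
lemmas P_act = sym_cochainD(2)[OF P]
lemmas P_act_comp = sym_cochainD(3)[OF P]
lemmas P_act_dif = sym_cochainD(5)[OF P]
lemmas M_module = cochain_complexD(1)[OF sym_cochainD(1)[OF M]]
lemmas M_dif = cochain_complexD(2)[OF sym_cochainD(1)[OF M]]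
lemmas M_dif_dif = cochain_complexD(3)[OF sym_cochainD(1)[OF M]]
lemmas M_act = sym_cochainD(2)[OF M]
lemmas M_act_comp = sym_cochainD(3)[OF M]
lemmas M_act_dif = sym_cochainD(5)[OF M]
lemmas P_dif_closed = linear_map_closed[OF P_dif]
lemmas M_dif_closed = linear_map_closed[OF M_dif]
lemmas P_act_closed = linear_map_closed[OF P_act]
lemmas M_act_closed = linear_map_closed[OF M_act]

lemma cring: "cring R"
  using module.axioms(1)[OF P_module] .

lemma bal_rels_closed: "bal_rels R n P M d \<subseteq> carrier (free_module R (bal_pairs P M d))"
proof -
  interpret F: module R "free_module R (bal_pairs P M d)" by (rule free_module_module[OF cring])
  have Pm: "abelian_monoid (obj P i)" "module R (obj P i)" "abelian_monoid (obj M i)" "module R (obj M i)" for i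
    using P_module[of i] M_module[of i] by (auto simp: module_def abelian_group_def)
  show ?thesis
    unfolding bal_rels_def Let_def
    by (auto intro!: F.M.minus_closed F.M.a_closed F.smult_closed free_gen_closed[OF cring]
        simp: mem_bal_pairs abelian_monoid.a_closed[OF Pm(1)] abelian_monoid.a_closed[OF Pm(3)]
          module.smult_closed[OF Pm(2)] module.smult_closed[OF Pm(4)]
        simp del: One_nat_def intro: P_act_closed[OF permutes_inv] M_act_closed)
qed

lemma bal_module: "module R (bal_module R n P M d)"
  unfolding bal_module_def by (rule pres_module_module[OF cring bal_rels_closed])

abbreviation gen where "gen \<equiv> bal_gen R n P M"

lemma gen_closed:
  "a \<in> carrier (obj P i) \<Longrightarrow> e = d - i \<Longrightarrow> b \<in> carrier (obj M e) \<Longrightarrow> gen d (i, a, b) \<in> carrier (bal_module R n P M d)"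
  unfolding bal_module_def bal_gen_def by (rule pres_gen_closed[OF cring]) (simp add: mem_bal_pairs)

lemma gen_relation:
  assumes "s \<in> bal_pairs P M d" "u \<in> carrier (free_module R (bal_pairs P M d))"
    and "free_gen R s \<ominus>\<^bsub>free_module R (bal_pairs P M d)\<^esub> u \<in> bal_rels R n P M d"
  shows "gen d s = module_span R (free_module R (bal_pairs P M d)) (bal_rels R n P M d) +>\<^bsub>free_module R (bal_pairs P M d)\<^esub> u"
  unfolding bal_gen_def pres_gen_def
  by (rule pres_relation[OF cring bal_rels_closed free_gen_closed[OF cring assms(1)] assms(2,3)])

lemma gen_balanced: "balanced R n P M d (bal_module R n P M d) (gen d)"
proof (rule balancedI)
  let ?F = "free_module R (bal_pairs P M d)"
  interpret F: module R ?F by (rule free_module_module[OF cring])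
  note pr = pres_proj_linear[OF cring bal_rels_closed[of d]]
  note fg = free_gen_closed[OF cring, of _ "bal_pairs P M d"]
  have defs: "gen d s = module_span R ?F (bal_rels R n P M d) +>\<^bsub>?F\<^esub> free_gen R s" for s
    by (simp add: bal_gen_def pres_gen_def)
  { fix i b assume b: "b \<in> carrier (obj M (d - i))"
    interpret Pi: module R "obj P i" by (rule P_module)
    have mem: "a \<in> carrier (obj P i) \<Longrightarrow> (i, a, b) \<in> bal_pairs P M d" for a using b by (simp add: mem_bal_pairs)
    show "linear_map R (obj P i) (bal_module R n P M d) (\<lambda>a. gen d (i, a, b))"
    proof (rule linear_mapI)
      fix a assume a: "a \<in> carrier (obj P i)"
      show "gen d (i, a, b) \<in> carrier (bal_module R n P M d)" using a b by (rule gen_closed[OF _ refl])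
      { fix a' assume a': "a' \<in> carrier (obj P i)"
        show "gen d (i, a \<oplus>\<^bsub>obj P i\<^esub> a', b) = gen d (i, a, b) \<oplus>\<^bsub>bal_module R n P M d\<^esub> gen d (i, a', b)"
          unfolding defs[of "(i, a, b)"] defs[of "(i, a', b)"] bal_module_def linear_map_add[OF pr fg[OF mem[OF a]] fg[OF mem[OF a']], symmetric]
          by (rule gen_relation, rule mem) (use a a' b in \<open>auto simp: bal_rels_def Let_def intro!: fg mem\<close>) }
      { fix c assume c: "c \<in> carrier R"
        show "gen d (i, c \<odot>\<^bsub>obj P i\<^esub> a, b) = c \<odot>\<^bsub>bal_module R n P M d\<^esub> gen d (i, a, b)"
          unfolding defs[of "(i, a, b)"] bal_module_def linear_map_smult[OF pr c fg[OF mem[OF a]], symmetric]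
          by (rule gen_relation, rule mem) (use a c b in \<open>auto simp: bal_rels_def Let_def intro!: fg mem\<close>) }
    qed }
  { fix i a assume a: "a \<in> carrier (obj P i)"
    interpret Mi: module R "obj M (d - i)" by (rule M_module)
    have mem: "b \<in> carrier (obj M (d - i)) \<Longrightarrow> (i, a, b) \<in> bal_pairs P M d" for b using a by (simp add: mem_bal_pairs)
    show "linear_map R (obj M (d - i)) (bal_module R n P M d) (\<lambda>b. gen d (i, a, b))"
    proof (rule linear_mapI)
      fix b assume b: "b \<in> carrier (obj M (d - i))"
      show "gen d (i, a, b) \<in> carrier (bal_module R n P M d)" using a b by (rule gen_closed[OF _ refl])
      { fix b' assume b': "b' \<in> carrier (obj M (d - i))"
        show "gen d (i, a, b \<oplus>\<^bsub>obj M (d - i)\<^esub> b') = gen d (i, a, b) \<oplus>\<^bsub>bal_module R n P M d\<^esub> gen d (i, a, b')"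
          unfolding defs[of "(i, a, b)"] defs[of "(i, a, b')"] bal_module_def linear_map_add[OF pr fg[OF mem[OF b]] fg[OF mem[OF b']], symmetric]
          by (rule gen_relation, rule mem) (use a b b' in \<open>auto simp: bal_rels_def Let_def intro!: fg mem\<close>) }
      { fix c assume c: "c \<in> carrier R"
        show "gen d (i, a, c \<odot>\<^bsub>obj M (d - i)\<^esub> b) = c \<odot>\<^bsub>bal_module R n P M d\<^esub> gen d (i, a, b)"
          unfolding defs[of "(i, a, b)"] bal_module_def linear_map_smult[OF pr c fg[OF mem[OF b]], symmetric]
          by (rule gen_relation, rule mem) (use a c b in \<open>auto simp: bal_rels_def Let_def intro!: fg mem\<close>) }
    qed }
  fix i \<sigma> a b assume h: "a \<in> carrier (obj P i)" "b \<in> carrier (obj M (d - i))" "\<sigma> permutes {1..n}"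
  show "gen d (i, act P (inv_into UNIV \<sigma>) i a, b) = gen d (i, a, act M \<sigma> (d - i) b)"
    unfolding defs[of "(i, a, act M \<sigma> (d - i) b)"]
  proof (rule gen_relation)
    show "(i, act P (inv_into UNIV \<sigma>) i a, b) \<in> bal_pairs P M d"
      using h(2) P_act_closed[OF permutes_inv[OF h(3)] h(1)] by (simp add: mem_bal_pairs)
    show "free_gen R (i, a, act M \<sigma> (d - i) b) \<in> carrier ?F"
      using h(1) M_act_closed[OF h(3,2)] by (intro fg) (simp add: mem_bal_pairs)
    show "free_gen R (i, act P (inv_into UNIV \<sigma>) i a, b) \<ominus>\<^bsub>?F\<^esub> free_gen R (i, a, act M \<sigma> (d - i) b) \<in> bal_rels R n P M d"
      unfolding bal_rels_def Let_def
      by (rule UnI2, rule CollectI, rule exI[of _ i], rule exI[of _ a], rule exI[of _ b], rule exI[of _ \<sigma>]) (use h in simp)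
  qed
qed

lemma gen_linear_left: "e = d - i \<Longrightarrow> b \<in> carrier (obj M e) \<Longrightarrow> linear_map R (obj P i) (bal_module R n P M d) (\<lambda>a. gen d (i, a, b))"
  and gen_linear_right: "e = d - i \<Longrightarrow> a \<in> carrier (obj P i) \<Longrightarrow> linear_map R (obj M e) (bal_module R n P M d) (\<lambda>b. gen d (i, a, b))"
  and gen_act: "e = d - i \<Longrightarrow> a \<in> carrier (obj P i) \<Longrightarrow> b \<in> carrier (obj M e) \<Longrightarrow> \<sigma> permutes {1..n} \<Longrightarrow>
      gen d (i, act P (inv_into UNIV \<sigma>) i a, b) = gen d (i, a, act M \<sigma> e b)"
  using balancedD[OF gen_balanced] by simp_all

lemma balanced_closed:
  "balanced R n P M d N \<phi> \<Longrightarrow> a \<in> carrier (obj P i) \<Longrightarrow> b \<in> carrier (obj M (d - i)) \<Longrightarrow> \<phi> (i, a, b) \<in> carrier N"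
  by (rule linear_map_closed[OF balancedD(1)])

lemma balanced_kills_rels:
  assumes N: "module R N" and b: "balanced R n P M d N \<phi>" and q: "q \<in> bal_rels R n P M d"
  shows "lin_ext R N \<phi> q = \<zero>\<^bsub>N\<^esub>"
proof -
  let ?F = "free_module R (bal_pairs P M d)"
  have F: "module R ?F" by (rule free_module_module[OF cring])
  interpret F: module R ?F by (rule F)
  interpret N: module R N by (rule N)
  have cl: "s \<in> bal_pairs P M d \<Longrightarrow> \<phi> s \<in> carrier N" for s
    using balanced_closed[OF b] by (cases s) (auto simp: mem_bal_pairs)
  have lin: "linear_map R ?F N (lin_ext R N \<phi>)" by (rule lin_ext_linear[OF N cl])
  have gen: "s \<in> bal_pairs P M d \<Longrightarrow> lin_ext R N \<phi> (free_gen R s) = \<phi> s" for s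
    by (rule lin_ext_free_gen[where \<phi> = \<phi> and s = s, OF N cl])
  have diff: "lin_ext R N \<phi> (free_gen R s \<ominus>\<^bsub>?F\<^esub> u) = \<zero>\<^bsub>N\<^esub>"
    if "s \<in> bal_pairs P M d" "u \<in> carrier ?F" "lin_ext R N \<phi> u = \<phi> s" for s u
    using that by (simp add: linear_map_diff[OF F N lin] free_gen_closed[OF cring] gen module_diff_self[OF N] cl)
  have add: "lin_ext R N \<phi> (free_gen R s \<ominus>\<^bsub>?F\<^esub> (free_gen R s1 \<oplus>\<^bsub>?F\<^esub> free_gen R s2)) = \<zero>\<^bsub>N\<^esub>"
    if "s \<in> bal_pairs P M d" "s1 \<in> bal_pairs P M d" "s2 \<in> bal_pairs P M d" "\<phi> s = \<phi> s1 \<oplus>\<^bsub>N\<^esub> \<phi> s2" for s s1 s2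
    using that by (intro diff) (simp_all add: linear_map_add[OF lin] free_gen_closed[OF cring] gen)
  have smult: "lin_ext R N \<phi> (free_gen R s \<ominus>\<^bsub>?F\<^esub> (c \<odot>\<^bsub>?F\<^esub> free_gen R s1)) = \<zero>\<^bsub>N\<^esub>"
    if "s \<in> bal_pairs P M d" "s1 \<in> bal_pairs P M d" "c \<in> carrier R" "\<phi> s = c \<odot>\<^bsub>N\<^esub> \<phi> s1" for s s1 c
    using that by (intro diff) (simp_all add: linear_map_smult[OF lin] free_gen_closed[OF cring] gen)
  have bl: "b \<in> carrier (obj M (d - i)) \<Longrightarrow> linear_map R (obj P i) N (\<lambda>a. \<phi> (i, a, b))"
    and br: "a \<in> carrier (obj P i) \<Longrightarrow> linear_map R (obj M (d - i)) N (\<lambda>b. \<phi> (i, a, b))" for i a b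
    by (rule balancedD[OF b], assumption)+
  have Pm: "abelian_monoid (obj P i)" "module R (obj P i)" "abelian_monoid (obj M i)" "module R (obj M i)" for i
    using P_module[of i] M_module[of i] by (auto simp: module_def abelian_group_def)
  note pc = abelian_monoid.a_closed[OF Pm(1)] abelian_monoid.a_closed[OF Pm(3)] module.smult_closed[OF Pm(2)] module.smult_closed[OF Pm(4)]
  from q show ?thesis
    unfolding bal_rels_def Let_def
  proof (elim UnE CollectE exE conjE, goal_cases)
    case (1 i a a' b)
    show ?case unfolding 1(1) using 1(2-4) linear_map_add[OF bl[OF 1(4)] 1(2,3)]
      by (intro add) (simp_all add: mem_bal_pairs pc)
  next
    case (2 i a b b')
    show ?case unfolding 2(1) using 2(2-4) linear_map_add[OF br[OF 2(2)] 2(3,4)]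
      by (intro add) (simp_all add: mem_bal_pairs pc)
  next
    case (3 i a b c)
    show ?case unfolding 3(1) using 3(2-4) linear_map_smult[OF bl[OF 3(3)] 3(4,2)]
      by (intro smult) (simp_all add: mem_bal_pairs pc)
  next
    case (4 i a b c)
    show ?case unfolding 4(1) using 4(2-4) linear_map_smult[OF br[OF 4(2)] 4(4,3)]
      by (intro smult) (simp_all add: mem_bal_pairs pc)
  next
    case (5 i a b \<sigma>)
    have p: "(i, act P (inv_into UNIV \<sigma>) i a, b) \<in> bal_pairs P M d" "(i, a, act M \<sigma> (d - i) b) \<in> bal_pairs P M d"
      using 5 P_act_closed[OF permutes_inv[OF 5(4)] 5(2)] M_act_closed[OF 5(4,3)] by (simp_all add: mem_bal_pairs)
    show ?case unfolding 5(1) using p balancedD(3)[OF b 5(2-4)]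
      by (intro diff free_gen_closed[OF cring]) (simp_all add: gen)
  qed
qed

lemma bal_lift_linear:
  assumes "module R N" "balanced R n P M d N \<phi>"
  shows "linear_map R (bal_module R n P M d) N (pres_lift R N \<phi>)"
  unfolding bal_module_def
  by (rule pres_lift_linear[OF assms(1) _ bal_rels_closed balanced_kills_rels[OF assms]])
     (auto simp: mem_bal_pairs balanced_closed[OF assms(2)])

lemma bal_lift_gen:
  assumes "module R N" "balanced R n P M d N \<phi>" "a \<in> carrier (obj P i)" "e = d - i" "b \<in> carrier (obj M e)"
  shows "pres_lift R N \<phi> (gen d (i, a, b)) = \<phi> (i, a, b)"
  unfolding bal_gen_def
  by (rule pres_lift_gen[OF assms(1) _ bal_rels_closed balanced_kills_rels[OF assms(1,2)]])
     (use assms in \<open>auto simp: mem_bal_pairs balanced_closed[OF assms(2)]\<close>)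

lemma bal_induct:
  assumes "submodule N R (bal_module R n P M d)"
    and "\<And>i a b. a \<in> carrier (obj P i) \<Longrightarrow> b \<in> carrier (obj M (d - i)) \<Longrightarrow> gen d (i, a, b) \<in> N"
  shows "carrier (bal_module R n P M d) \<subseteq> N"
  using pres_induct[OF cring bal_rels_closed assms(1)[unfolded bal_module_def]] assms(2)
  by (auto simp: bal_module_def bal_gen_def mem_bal_pairs)

lemma linear_map_eq_on_bal:
  assumes "module R N" "linear_map R (bal_module R n P M d) N g" "linear_map R (bal_module R n P M d) N h"
    and "\<And>i a b. a \<in> carrier (obj P i) \<Longrightarrow> b \<in> carrier (obj M (d - i)) \<Longrightarrow> g (gen d (i, a, b)) = h (gen d (i, a, b))"
    and "z \<in> carrier (bal_module R n P M d)"
  shows "g z = h z"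
  by (rule linear_map_eq_on_pres[OF assms(1) bal_rels_closed assms(2,3)[unfolded bal_module_def] _ assms(5)[unfolded bal_module_def]])
     (auto simp: mem_bal_pairs assms(4)[unfolded bal_gen_def])

subsection \<open>The differential\<close>

text \<open>Each of the two summands is balanced by itself, since the differentials of both factors
  commute with the action.\<close>

lemma balanced_dif:
  "balanced R n P M d (bal_module R n P M (d + 1))
     (\<lambda>(i, a, b). gen (d + 1) (i + 1, dif P i a, b) \<oplus>\<^bsub>bal_module R n P M (d + 1)\<^esub>
        [neg_one_pow i] \<cdot>\<^bsub>bal_module R n P M (d + 1)\<^esub> gen (d + 1) (i, a, dif M (d - i) b))"
proof (rule balancedI, goal_cases)
  case (1 i b)
  have "dif M (d - i) b \<in> carrier (obj M (d + 1 - i))" using M_dif_closed[OF 1] by (simp add: algebra_simps)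
  then show ?case using 1 unfolding prod.case
    by (intro linear_map_plus linear_map_int_scale bal_module P_module gen_linear_left[OF refl]
        linear_map_comp[OF P_dif gen_linear_left[OF _ 1]]) simp_all
next
  case (2 i a)
  have l: "linear_map R (obj M (d - i)) (obj M (d + 1 - i)) (dif M (d - i))"
    using M_dif[of "d - i"] by (simp add: algebra_simps)
  show ?case unfolding prod.case
    by (intro linear_map_plus linear_map_int_scale bal_module M_module gen_linear_right P_dif_closed[OF 2]
        linear_map_comp[OF l gen_linear_right[OF refl 2]]) simp_all
next
  case (3 i \<sigma> a b)
  have b': "dif M (d - i) b \<in> carrier (obj M (d + 1 - i))" using M_dif_closed[OF 3(2)] by (simp add: algebra_simps)
  note i = permutes_inv[OF 3(3)]
  have s: "act M \<sigma> (d + 1 - i) (dif M (d - i) b) = dif M (d - i) (act M \<sigma> (d - i) b)"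
    using M_act_dif[OF 3(3,2)] by (simp add: algebra_simps)
  show ?case
    using gen_act[OF _ P_dif_closed[OF 3(1)] 3(2,3), of "d + 1"] gen_act[OF refl 3(1) b' 3(3)]
    by (simp add: P_act_dif[OF i 3(1)] s)
qed

abbreviation bdif where "bdif \<equiv> dif (bal_tensor R n P M)"

lemma bdif_linear: "e = d + 1 \<Longrightarrow> linear_map R (bal_module R n P M d) (bal_module R n P M e) (bdif d)"
  by (simp add: bal_tensor_def bal_lift_linear[OF bal_module balanced_dif])

lemma bdif_gen:
  assumes "a \<in> carrier (obj P i)" "j = d - i" "b \<in> carrier (obj M j)"
  shows "bdif d (gen d (i, a, b)) = gen (d + 1) (i + 1, dif P i a, b) \<oplus>\<^bsub>bal_module R n P M (d + 1)\<^esub>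
        [neg_one_pow i] \<cdot>\<^bsub>bal_module R n P M (d + 1)\<^esub> gen (d + 1) (i, a, dif M j b)"
  using bal_lift_gen[OF bal_module balanced_dif assms] assms(2) by (simp add: bal_tensor_def)

lemma gen_zero_left: "e = d - i \<Longrightarrow> b \<in> carrier (obj M e) \<Longrightarrow> gen d (i, \<zero>\<^bsub>obj P i\<^esub>, b) = \<zero>\<^bsub>bal_module R n P M d\<^esub>"
  and gen_zero_right: "e = d - i \<Longrightarrow> a \<in> carrier (obj P i) \<Longrightarrow> gen d (i, a, \<zero>\<^bsub>obj M e\<^esub>) = \<zero>\<^bsub>bal_module R n P M d\<^esub>"
  using linear_map_zero[OF P_module bal_module gen_linear_left] linear_map_zero[OF M_module bal_module gen_linear_right]
  by auto

lemma bdif_bdif: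
  assumes "z \<in> carrier (bal_module R n P M d)"
  shows "bdif (d + 1) (bdif d z) = \<zero>\<^bsub>bal_module R n P M (d + 2)\<^esub>"
proof -
  let ?B = "bal_module R n P M (d + 2)"
  interpret B: module R ?B by (rule bal_module)
  have lin: "linear_map R (bal_module R n P M (d + 1)) ?B (bdif (d + 1))" by (rule bdif_linear) simp
  have "(\<lambda>z. bdif (d + 1) (bdif d z)) z = (\<lambda>z. \<zero>\<^bsub>?B\<^esub>) z"
  proof (rule linear_map_eq_on_bal[OF bal_module _ _ _ assms])
    show "linear_map R (bal_module R n P M d) ?B (\<lambda>z. bdif (d + 1) (bdif d z))"
      by (rule linear_map_comp[OF bdif_linear[OF refl] lin])
    show "linear_map R (bal_module R n P M d) ?B (\<lambda>z. \<zero>\<^bsub>?B\<^esub>)"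
      by (rule linear_map_const_zero[OF bal_module bal_module])
    fix i a b assume a: "a \<in> carrier (obj P i)" and b: "b \<in> carrier (obj M (d - i))"
    note da = P_dif_closed[OF a]
    have db: "dif M (d - i) b \<in> carrier (obj M (d + 1 - i))" using M_dif_closed[OF b] by (simp add: algebra_simps)
    have ddb: "dif M (d + 1 - i) (dif M (d - i) b) = \<zero>\<^bsub>obj M (d + 2 - i)\<^esub>"
      using M_dif_dif[OF b] by (simp add: algebra_simps)
    have c: "gen (d + 1) (i + 1, dif P i a, b) \<in> carrier (bal_module R n P M (d + 1))"
      "gen (d + 1) (i, a, dif M (d - i) b) \<in> carrier (bal_module R n P M (d + 1))"
      by (rule gen_closed[OF da _ b], simp) (rule gen_closed[OF a refl db])
    have m: "gen (d + 2) (i + 1, dif P i a, dif M (d - i) b) \<in> carrier ?B"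
      by (rule gen_closed[OF da _ db]) simp
    have z1: "gen (d + 2) (i + 2, \<zero>\<^bsub>obj P (i + 2)\<^esub>, b) = \<zero>\<^bsub>?B\<^esub>"
      by (rule gen_zero_left[OF _ b]) simp
    have z2: "gen (d + 2) (i, a, \<zero>\<^bsub>obj M (d + 2 - i)\<^esub>) = \<zero>\<^bsub>?B\<^esub>"
      by (rule gen_zero_right[OF refl a])
    have 1: "bdif (d + 1) (gen (d + 1) (i + 1, dif P i a, b)) =
        \<ominus>\<^bsub>?B\<^esub> ([neg_one_pow i] \<cdot>\<^bsub>?B\<^esub> gen (d + 2) (i + 1, dif P i a, dif M (d - i) b))"
      using bdif_gen[OF da _ b, of "d + 1", unfolded add.assoc one_add_one] m
      by (simp add: P_dif_dif[OF a] z1 neg_one_pow_succ int_smult_uminus[OF bal_module])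
    have 2: "bdif (d + 1) (gen (d + 1) (i, a, dif M (d - i) b)) = gen (d + 2) (i + 1, dif P i a, dif M (d - i) b)"
      using bdif_gen[OF a refl db, unfolded add.assoc one_add_one] m
      by (simp add: ddb z2)
    show "bdif (d + 1) (bdif d (gen d (i, a, b))) = \<zero>\<^bsub>?B\<^esub>"
      unfolding bdif_gen[OF a refl b] linear_map_add[OF lin c(1) int_smult_closed[OF bal_module c(2)]]
        linear_map_int_smult[OF bal_module bal_module lin c(2)] 1 2
      using m by (simp add: B.l_neg)
  qed
  then show ?thesis by simp
qed

lemma bal_tensor_complex: "cochain_complex R (bal_tensor R n P M)"
  using bal_module bdif_linear bdif_bdif by (simp add: cochain_complex_def bal_tensor_def)

end

subsection \<open>Induced maps\<close>

definition equivariant :: "('k, 'm) ring_scheme \<Rightarrow> nat \<Rightarrow> ('k, 'b) sym_complex \<Rightarrow> ('k, 'c) sym_complex \<Rightarrow> (int \<Rightarrow> 'b \<Rightarrow> 'c) \<Rightarrow> bool"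
  where "equivariant R n M N g \<longleftrightarrow>
    (\<forall>d. linear_map R (obj M d) (obj N d) (g d)) \<and>
    (\<forall>\<sigma> d. \<sigma> permutes {1..n} \<longrightarrow> (\<forall>x\<in>carrier (obj M d). g d (act M \<sigma> d x) = act N \<sigma> d (g d x))) \<and>
    (\<forall>d. \<forall>x\<in>carrier (obj M d). g (d + 1) (dif M d x) = dif N d (g d x))"

lemma equivariantD:
  assumes "equivariant R n M N g"
  shows "linear_map R (obj M d) (obj N d) (g d)"
    and "\<sigma> permutes {1..n} \<Longrightarrow> x \<in> carrier (obj M d) \<Longrightarrow> g d (act M \<sigma> d x) = act N \<sigma> d (g d x)"
    and "x \<in> carrier (obj M d) \<Longrightarrow> g (d + 1) (dif M d x) = dif N d (g d x)"
  using assms by (auto simp: equivariant_def)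

context
  fixes R :: "('k, 'm) ring_scheme" and n :: nat and P :: "('k, 'a) sym_complex"
    and M :: "('k, 'b) sym_complex" and N :: "('k, 'c) sym_complex" and g
  assumes P: "sym_cochain R n P" and M: "sym_cochain R n M" and N: "sym_cochain R n N"
    and g: "equivariant R n M N g"
begin

interpretation PM: balanced_pair R n P M using P M by (rule balanced_pair.intro)
interpretation PN: balanced_pair R n P N using P N by (rule balanced_pair.intro)

lemma balanced_map: "balanced R n P M d (bal_module R n P N d) (\<lambda>(i, a, b). bal_gen R n P N d (i, a, g (d - i) b))"
proof (rule balancedI, goal_cases)
  case (1 i b)
  then show ?case using PN.gen_linear_left[OF refl linear_map_closed[OF equivariantD(1)[OF g] 1]] by simp
next
  case (2 i a)
  then show ?case using linear_map_comp[OF equivariantD(1)[OF g] PN.gen_linear_right[OF refl 2]] by simp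
next
  case (3 i \<sigma> a b)
  then show ?case using PN.gen_act[OF refl 3(1) linear_map_closed[OF equivariantD(1)[OF g] 3(2)] 3(3)]
    by (simp add: equivariantD(2)[OF g 3(3,2)])
qed

lemma bal_tensor_map_linear:
  "linear_map R (bal_module R n P M d) (bal_module R n P N d) (bal_tensor_map R n P N g d)"
  unfolding bal_tensor_map_def by (rule PM.bal_lift_linear[OF PN.bal_module balanced_map])

lemma bal_tensor_map_gen:
  "a \<in> carrier (obj P i) \<Longrightarrow> e = d - i \<Longrightarrow> b \<in> carrier (obj M e) \<Longrightarrow>
    bal_tensor_map R n P N g d (bal_gen R n P M d (i, a, b)) = bal_gen R n P N d (i, a, g e b)"
  unfolding bal_tensor_map_def by (simp add: PM.bal_lift_gen[OF PN.bal_module balanced_map])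

lemma bal_tensor_map_dif:
  assumes "z \<in> carrier (bal_module R n P M d)"
  shows "bal_tensor_map R n P N g (d + 1) (dif (bal_tensor R n P M) d z) = dif (bal_tensor R n P N) d (bal_tensor_map R n P N g d z)"
proof (rule PM.linear_map_eq_on_bal[OF PN.bal_module[of "d + 1"] _ _ _ assms])
  fix i a b assume a: "a \<in> carrier (obj P i)" and b: "b \<in> carrier (obj M (d - i))"
  note da = PM.P_dif_closed[OF a]
  have db: "dif M (d - i) b \<in> carrier (obj M (d + 1 - i))" using PM.M_dif_closed[OF b] by (simp add: algebra_simps)
  have c: "bal_gen R n P M (d + 1) (i + 1, dif P i a, b) \<in> carrier (bal_module R n P M (d + 1))"
    "bal_gen R n P M (d + 1) (i, a, dif M (d - i) b) \<in> carrier (bal_module R n P M (d + 1))"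
    by (rule PM.gen_closed[OF da _ b], simp) (rule PM.gen_closed[OF a refl db])
  have gd: "g (d + 1 - i) (dif M (d - i) b) = dif N (d - i) (g (d - i) b)"
    using equivariantD(3)[OF g b] by (simp add: algebra_simps)
  have e: "d - i = d + 1 - (i + 1)" by simp
  show "bal_tensor_map R n P N g (d + 1) (dif (bal_tensor R n P M) d (bal_gen R n P M d (i, a, b))) =
    dif (bal_tensor R n P N) d (bal_tensor_map R n P N g d (bal_gen R n P M d (i, a, b)))"
    unfolding PM.bdif_gen[OF a refl b] linear_map_add[OF bal_tensor_map_linear c(1) int_smult_closed[OF PM.bal_module c(2)]]
      linear_map_int_smult[OF PM.bal_module PN.bal_module bal_tensor_map_linear c(2)]
      bal_tensor_map_gen[OF da e b] bal_tensor_map_gen[OF a refl db] bal_tensor_map_gen[OF a refl b] gd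
      PN.bdif_gen[OF a refl linear_map_closed[OF equivariantD(1)[OF g] b]] ..
qed (rule linear_map_comp[OF PM.bdif_linear[OF refl] bal_tensor_map_linear] linear_map_comp[OF bal_tensor_map_linear PN.bdif_linear[OF refl]])+

lemma bal_tensor_map_cochain: "cochain_map R (bal_tensor R n P M) (bal_tensor R n P N) (bal_tensor_map R n P N g)"
  unfolding cochain_map_def
  using PM.bal_tensor_complex PN.bal_tensor_complex bal_tensor_map_linear bal_tensor_map_dif
  by (simp add: bal_tensor_def)

end

text \<open>The composite is compared with a third map \<open>h\<close> that agrees with it on
  carriers, so that identities such as \<open>e e = e\<close>, which hold only there, can be
  transported.\<close>

lemma bal_tensor_map_comp:
  assumes "sym_cochain R n P" "sym_cochain R n L" "sym_cochain R n M" "sym_cochain R n N"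
    and f: "equivariant R n L M f" and g: "equivariant R n M N g" and h: "equivariant R n L N h"
    and gf: "\<And>d x. x \<in> carrier (obj L d) \<Longrightarrow> g d (f d x) = h d x"
    and z: "z \<in> carrier (bal_module R n P L d)"
  shows "bal_tensor_map R n P N g d (bal_tensor_map R n P M f d z) = bal_tensor_map R n P N h d z"
proof -
  interpret PL: balanced_pair R n P L using assms(1,2) by (rule balanced_pair.intro)
  interpret PN: balanced_pair R n P N using assms(1,4) by (rule balanced_pair.intro)
  note F = bal_tensor_map_linear[OF assms(1,2,3) f] and G = bal_tensor_map_linear[OF assms(1,3,4) g]
    and H = bal_tensor_map_linear[OF assms(1,2,4) h]
  show ?thesis
    by (rule PL.linear_map_eq_on_bal[OF PN.bal_module linear_map_comp[OF F G] H _ z])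
       (simp add: bal_tensor_map_gen[OF assms(1,2,3) f] bal_tensor_map_gen[OF assms(1,3,4) g]
         bal_tensor_map_gen[OF assms(1,2,4) h] linear_map_closed[OF equivariantD(1)[OF f]] gf)
qed

declare One_nat_def [simp del]

subsection \<open>Non-equivariant homotopies\<close>

text \<open>Here \<open>proj\<close> and \<open>k\<close> are merely linear in each degree; neither
  is assumed to commute with the action, nor \<open>proj\<close> with the differential. The sets
  \<open>G N\<close> are invariant, \<open>k\<close> climbs them one step at a time, and level
  \<open>L\<close> is zero, so that any composite of group elements with \<open>L\<close>
  applications of \<open>k\<close> vanishes.\<close>

locale balanced_retraction = balanced_pair R n P M
  for R :: "('k, 'm) ring_scheme" and n :: nat and P :: "('k, 'a) sym_complex" and M :: "('k, 'b) sym_complex" +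
  fixes proj :: "int \<Rightarrow> 'a \<Rightarrow> 'a" and e k :: "int \<Rightarrow> 'b \<Rightarrow> 'b" and G :: "nat \<Rightarrow> int \<Rightarrow> 'b set" and L :: nat
  assumes proj_linear: "linear_map R (obj P i) (obj P i) (proj i)"
    and proj_sum: "a \<in> carrier (obj P i) \<Longrightarrow>
      (\<Oplus>\<^bsub>obj P i\<^esub>\<rho>\<in>{\<rho>. \<rho> permutes {1..n}}. act P (inv_into UNIV \<rho>) i (proj i (act P \<rho> i a))) = a"
    and e_equivariant: "equivariant R n M M e"
    and e_e: "x \<in> carrier (obj M j) \<Longrightarrow> e j (e j x) = e j x"
    and k_linear: "linear_map R (obj M j) (obj M (j - 1)) (k j)"
    and e_k: "x \<in> carrier (obj M j) \<Longrightarrow> e (j - 1) (k j x) = \<zero>\<^bsub>obj M (j - 1)\<^esub>"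
    and k_homotopy: "x \<in> carrier (obj M j) \<Longrightarrow>
      dif M (j - 1) (k j x) \<oplus>\<^bsub>obj M j\<^esub> k (j + 1) (dif M j x) = x \<ominus>\<^bsub>obj M j\<^esub> e j x"
    and G_subset: "G N j \<subseteq> carrier (obj M j)"
    and G_act: "\<sigma> permutes {1..n} \<Longrightarrow> x \<in> G N j \<Longrightarrow> act M \<sigma> j x \<in> G N j"
    and G_k: "x \<in> G N j \<Longrightarrow> k j x \<in> G (Suc N) (j - 1)"
    and G_0: "G 0 j = carrier (obj M j)"
    and G_L: "G L j \<subseteq> {\<zero>\<^bsub>obj M j\<^esub>}"
begin

abbreviation perms where "perms \<equiv> {\<rho>. \<rho> permutes {1..n}}"
abbreviation bal where "bal \<equiv> bal_module R n P M"

lemma finite_perms: "finite perms"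
  by (rule finite_permutations) simp

section \<open>The averaged homotopy\<close>

definition avg_term :: "int \<Rightarrow> (nat \<Rightarrow> nat) \<Rightarrow> int \<times> 'a \<times> 'b \<Rightarrow> ((int \<times> 'a \<times> 'b) \<Rightarrow> 'k) set"
  where "avg_term d \<rho> = (\<lambda>(i, a, b). gen (d - 1) (i, proj i (act P \<rho> i a), k (d - i) (act M \<rho> (d - i) b)))"

text \<open>The sum over the group takes the place of an average, with \<open>proj\<close> standing
  in for the division by the group order. The sign is that of moving \<open>k\<close>, which has
  degree -1, past \<open>a\<close>.\<close>

definition avg_hom :: "int \<Rightarrow> ((int \<times> 'a \<times> 'b) \<Rightarrow> 'k) set \<Rightarrow> ((int \<times> 'a \<times> 'b) \<Rightarrow> 'k) set"
  where "avg_hom d = pres_lift R (bal (d - 1)) (\<lambda>(i, a, b). [neg_one_pow i] \<cdot>\<^bsub>bal (d - 1)\<^esub>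
     (\<Oplus>\<^bsub>bal (d - 1)\<^esub>\<rho>\<in>perms. avg_term d \<rho> (i, a, b)))"

lemma pa_closed: "\<rho> permutes {1..n} \<Longrightarrow> a \<in> carrier (obj P i) \<Longrightarrow> proj i (act P \<rho> i a) \<in> carrier (obj P i)"
  by (intro linear_map_closed[OF proj_linear] P_act_closed)

lemma kb_closed: "\<rho> permutes {1..n} \<Longrightarrow> b \<in> carrier (obj M j) \<Longrightarrow> k j (act M \<rho> j b) \<in> carrier (obj M (j - 1))"
  by (intro linear_map_closed[OF k_linear] M_act_closed)

lemma avg_term_linear_left:
  assumes "\<rho> permutes {1..n}" "b \<in> carrier (obj M (d - i))"
  shows "linear_map R (obj P i) (bal (d - 1)) (\<lambda>a. avg_term d \<rho> (i, a, b))"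
  unfolding avg_term_def prod.case
  by (rule linear_map_comp[OF linear_map_comp[OF P_act[OF assms(1)] proj_linear]
        gen_linear_left[OF _ kb_closed[OF assms]]]) simp

lemma avg_term_linear_right:
  assumes "\<rho> permutes {1..n}" "a \<in> carrier (obj P i)"
  shows "linear_map R (obj M (d - i)) (bal (d - 1)) (\<lambda>b. avg_term d \<rho> (i, a, b))"
  unfolding avg_term_def prod.case
  by (rule linear_map_comp[OF linear_map_comp[OF M_act[OF assms(1)] k_linear]
        gen_linear_right[OF _ pa_closed[OF assms]]]) simp

text \<open>Moving \<open>\<tau>\<close> from one factor to the other amounts to replacing the
  summation index \<open>\<rho>\<close> by its composite with the inverse of \<open>\<tau>\<close>,
  which does not change a sum over the whole group.\<close>

lemma balanced_avg:
  "balanced R n P M d (bal (d - 1)) (\<lambda>(i, a, b). [neg_one_pow i] \<cdot>\<^bsub>bal (d - 1)\<^esub>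
     (\<Oplus>\<^bsub>bal (d - 1)\<^esub>\<rho>\<in>perms. avg_term d \<rho> (i, a, b)))"
proof (rule balancedI, goal_cases)
  case (1 i b)
  show ?case unfolding prod.case
    by (intro linear_map_int_scale linear_map_sum P_module bal_module finite_perms avg_term_linear_left[OF _ 1]) simp
next
  case (2 i a)
  show ?case unfolding prod.case
    by (intro linear_map_int_scale linear_map_sum M_module bal_module finite_perms avg_term_linear_right[OF _ 2]) simp
next
  case (3 i \<tau> a b)
  interpret B: module R "bal (d - 1)" by (rule bal_module)
  note t = 3(3) and t' = permutes_inv[OF 3(3)]
  have bij: "(\<lambda>\<rho>. \<rho> \<circ> inv_into UNIV \<tau>) ` perms = perms"
  proof (intro subset_antisym subsetI)
    fix \<rho> assume "\<rho> \<in> perms"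
    then have "\<rho> \<circ> \<tau> \<in> perms" using permutes_compose[OF t] by simp
    moreover have "\<rho> = (\<rho> \<circ> \<tau>) \<circ> inv_into UNIV \<tau>" using permutes_inv_o[OF t] by (simp add: comp_assoc)
    ultimately show "\<rho> \<in> (\<lambda>\<rho>. \<rho> \<circ> inv_into UNIV \<tau>) ` perms" by blast
  qed (use permutes_compose[OF t'] in auto)
  have inj: "inj_on (\<lambda>\<rho>. \<rho> \<circ> inv_into UNIV \<tau>) perms"
    by (rule inj_on_inverseI[where g = "\<lambda>\<rho>. \<rho> \<circ> \<tau>"]) (simp add: comp_assoc permutes_inv_o[OF t])
  have cl: "avg_term d \<rho> (i, a, act M \<tau> (d - i) b) \<in> carrier (bal (d - 1))" if "\<rho> \<in> perms" for \<rho>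
    using that by (intro linear_map_closed[OF avg_term_linear_left] M_act_closed t 3) auto
  have "(\<Oplus>\<^bsub>bal (d - 1)\<^esub>\<rho>\<in>perms. avg_term d \<rho> (i, a, act M \<tau> (d - i) b)) =
      (\<Oplus>\<^bsub>bal (d - 1)\<^esub>\<rho>\<in>(\<lambda>\<rho>. \<rho> \<circ> inv_into UNIV \<tau>) ` perms. avg_term d \<rho> (i, a, act M \<tau> (d - i) b))"
    by (simp add: bij)
  also have "\<dots> = (\<Oplus>\<^bsub>bal (d - 1)\<^esub>\<rho>\<in>perms. avg_term d (\<rho> \<circ> inv_into UNIV \<tau>) (i, a, act M \<tau> (d - i) b))"
    using cl by (intro B.finsum_reindex inj) (auto simp: bij)
  also have "\<dots> = (\<Oplus>\<^bsub>bal (d - 1)\<^esub>\<rho>\<in>perms. avg_term d \<rho> (i, act P (inv_into UNIV \<tau>) i a, b))"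
  proof (rule B.finsum_cong'[OF refl])
    show "(\<lambda>\<rho>. avg_term d \<rho> (i, act P (inv_into UNIV \<tau>) i a, b)) \<in> perms \<rightarrow> carrier (bal (d - 1))"
      using 3 by (auto intro!: linear_map_closed[OF avg_term_linear_left] P_act_closed[OF t'])
    fix \<rho> assume "\<rho> \<in> perms"
    then have r: "\<rho> permutes {1..n}" by simp
    have "act M (\<rho> \<circ> inv_into UNIV \<tau>) (d - i) (act M \<tau> (d - i) b) = act M (\<rho> \<circ> inv_into UNIV \<tau> \<circ> \<tau>) (d - i) b"
      by (rule M_act_comp[OF permutes_compose[OF t' r] t 3(2), symmetric])
    also have "\<rho> \<circ> inv_into UNIV \<tau> \<circ> \<tau> = \<rho>" by (simp add: comp_assoc permutes_inv_o[OF t])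
    finally have "act M (\<rho> \<circ> inv_into UNIV \<tau>) (d - i) (act M \<tau> (d - i) b) = act M \<rho> (d - i) b" .
    then show "avg_term d (\<rho> \<circ> inv_into UNIV \<tau>) (i, a, act M \<tau> (d - i) b) =
        avg_term d \<rho> (i, act P (inv_into UNIV \<tau>) i a, b)"
      unfolding avg_term_def prod.case P_act_comp[OF r t' 3(1)] by (rule arg_cong)
  qed
  finally show ?case by simp
qed

lemma avg_hom_linear: "e' = d - 1 \<Longrightarrow> linear_map R (bal d) (bal e') (avg_hom d)"
  unfolding avg_hom_def by (simp add: bal_lift_linear[OF bal_module balanced_avg])

lemma avg_hom_gen:
  assumes "a \<in> carrier (obj P i)" "j = d - i" "b \<in> carrier (obj M j)"
  shows "avg_hom d (gen d (i, a, b)) = [neg_one_pow i] \<cdot>\<^bsub>bal (d - 1)\<^esub>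
     (\<Oplus>\<^bsub>bal (d - 1)\<^esub>\<rho>\<in>perms. gen (d - 1) (i, proj i (act P \<rho> i a), k j (act M \<rho> j b)))"
  using bal_lift_gen[OF bal_module balanced_avg assms] assms(2) by (simp add: avg_hom_def avg_term_def)

lemmas avg_hom_closed = linear_map_closed[OF avg_hom_linear]

abbreviation E where "E \<equiv> bal_tensor_map R n P M e"

lemmas E_linear = bal_tensor_map_linear[OF P M M e_equivariant]
lemmas E_gen = bal_tensor_map_gen[OF P M M e_equivariant]
lemmas E_closed = linear_map_closed[OF E_linear]
lemmas E_dif = bal_tensor_map_dif[OF P M M e_equivariant]
lemmas e_linear = equivariantD(1)[OF e_equivariant]

lemma E_E: "z \<in> carrier (bal d) \<Longrightarrow> E d (E d z) = E d z"
  by (rule bal_tensor_map_comp[OF P M M M e_equivariant e_equivariant e_equivariant e_e])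

lemma E_avg_hom:
  assumes "z \<in> carrier (bal d)"
  shows "E (d - 1) (avg_hom d z) = \<zero>\<^bsub>bal (d - 1)\<^esub>"
proof -
  let ?B = "bal (d - 1)"
  interpret B: module R ?B by (rule bal_module)
  have "(\<lambda>z. E (d - 1) (avg_hom d z)) z = (\<lambda>z. \<zero>\<^bsub>?B\<^esub>) z"
  proof (rule linear_map_eq_on_bal[OF bal_module[of "d - 1"] linear_map_comp[OF avg_hom_linear[OF refl] E_linear]
        linear_map_const_zero[OF bal_module bal_module] _ assms])
    fix i a b assume a: "a \<in> carrier (obj P i)" and b: "b \<in> carrier (obj M (d - i))"
    have kb: "k (d - i) (act M \<rho> (d - i) b) \<in> carrier (obj M (d - 1 - i))" if "\<rho> \<in> perms" for \<rho>
      using kb_closed[OF _ b, of \<rho>] that by (simp add: algebra_simps)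
    have g: "gen (d - 1) (i, proj i (act P \<rho> i a), k (d - i) (act M \<rho> (d - i) b)) \<in> carrier ?B" if "\<rho> \<in> perms" for \<rho>
      using that by (intro gen_closed[OF _ refl kb[OF that]] pa_closed a) simp
    have z: "E (d - 1) (gen (d - 1) (i, proj i (act P \<rho> i a), k (d - i) (act M \<rho> (d - i) b))) = \<zero>\<^bsub>?B\<^esub>" if "\<rho> \<in> perms" for \<rho>
    proof -
      have p: "proj i (act P \<rho> i a) \<in> carrier (obj P i)" using that by (intro pa_closed a) simp
      have "act M \<rho> (d - i) b \<in> carrier (obj M (d - i))" using that by (intro M_act_closed b) simp
      from e_k[OF this] have "e (d - 1 - i) (k (d - i) (act M \<rho> (d - i) b)) = \<zero>\<^bsub>obj M (d - 1 - i)\<^esub>"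
        by (simp add: algebra_simps)
      then show ?thesis by (simp only: E_gen[OF p refl kb[OF that]] gen_zero_right[OF refl p])
    qed
    have "(\<Oplus>\<^bsub>?B\<^esub>\<rho>\<in>perms. gen (d - 1) (i, proj i (act P \<rho> i a), k (d - i) (act M \<rho> (d - i) b))) \<in> carrier ?B"
      using g by (intro B.finsum_closed) auto
    moreover have "E (d - 1) (\<Oplus>\<^bsub>?B\<^esub>\<rho>\<in>perms. gen (d - 1) (i, proj i (act P \<rho> i a), k (d - i) (act M \<rho> (d - i) b))) = \<zero>\<^bsub>?B\<^esub>"
    proof -
      have "E (d - 1) (\<Oplus>\<^bsub>?B\<^esub>\<rho>\<in>perms. gen (d - 1) (i, proj i (act P \<rho> i a), k (d - i) (act M \<rho> (d - i) b))) =
          (\<Oplus>\<^bsub>?B\<^esub>\<rho>\<in>perms. E (d - 1) (gen (d - 1) (i, proj i (act P \<rho> i a), k (d - i) (act M \<rho> (d - i) b))))"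
        using g by (intro linear_map_finsum[OF bal_module bal_module E_linear] Pi_I)
      also have "\<dots> = (\<Oplus>\<^bsub>?B\<^esub>\<rho>\<in>perms. \<zero>\<^bsub>?B\<^esub>)"
        by (intro B.finsum_cong'[OF refl] z) simp
      finally show ?thesis by simp
    qed
    ultimately show "E (d - 1) (avg_hom d (gen d (i, a, b))) = \<zero>\<^bsub>?B\<^esub>"
      unfolding avg_hom_gen[OF a refl b]
      by (simp add: linear_map_int_smult[OF bal_module bal_module E_linear])
  qed
  then show ?thesis by simp
qed

section \<open>The induced filtration and the nilpotence of the error term\<close>

definition filt :: "nat \<Rightarrow> int \<Rightarrow> ((int \<times> 'a \<times> 'b) \<Rightarrow> 'k) set set"
  where "filt N d = module_span R (bal d) {gen d (i, a, b) | i a b. a \<in> carrier (obj P i) \<and> b \<in> G N (d - i)}"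

lemma filt_submodule: "submodule (filt N d) R (bal d)"
  unfolding filt_def using G_subset
  by (intro module_span_submodule bal_module) (auto intro!: gen_closed[OF _ refl])

lemma filt_gen: "a \<in> carrier (obj P i) \<Longrightarrow> j = d - i \<Longrightarrow> b \<in> G N j \<Longrightarrow> gen d (i, a, b) \<in> filt N d"
  unfolding filt_def by (rule module_span_superset[THEN subsetD]) auto

lemma filt_0: "filt 0 d = carrier (bal d)"
proof
  show "filt 0 d \<subseteq> carrier (bal d)" by (rule submodule_subset[OF filt_submodule])
  show "carrier (bal d) \<subseteq> filt 0 d"
    by (rule bal_induct[OF filt_submodule]) (simp add: filt_gen G_0)
qed

lemma filt_L: "filt L d \<subseteq> {\<zero>\<^bsub>bal d\<^esub>}"
proof -
  have "gen d (i, a, b) = \<zero>\<^bsub>bal d\<^esub>" if "a \<in> carrier (obj P i)" "b \<in> G L (d - i)" for i a b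
  proof -
    have "b = \<zero>\<^bsub>obj M (d - i)\<^esub>" using G_L that(2) by auto
    then show ?thesis using gen_zero_right[OF refl that(1)] by simp
  qed
  then show ?thesis unfolding filt_def
    by (intro module_span_least submodule_trivial bal_module) auto
qed

text \<open>In \<open>A\<close> plus \<open>C\<close> the homotopy relation for \<open>k\<close>
  turns the right factor into \<open>\<rho>\<close> applied to \<open>b - e b\<close>; moving
  \<open>\<rho>\<close> to the left factor and summing leaves \<open>a\<close>, by
  \<open>proj_sum\<close>. The terms \<open>U\<close> and \<open>V\<close> would cancel if
  \<open>proj\<close> commuted with the differential. In general they do not, but each contains
  \<open>k\<close> applied to a translate of \<open>b\<close> and so lies one step higher.\<close>

lemma avg_homotopy_gen:
  assumes a: "a \<in> carrier (obj P i)" and bG: "b \<in> G N (d - i)"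
  shows "(bdif (d - 1) (avg_hom d (gen d (i, a, b))) \<oplus>\<^bsub>bal d\<^esub> avg_hom (d + 1) (bdif d (gen d (i, a, b)))) \<ominus>\<^bsub>bal d\<^esub>
    (gen d (i, a, b) \<ominus>\<^bsub>bal d\<^esub> E d (gen d (i, a, b))) \<in> filt (Suc N) d"
proof -
  interpret B: module R "bal d" by (rule bal_module)
  interpret B1: module R "bal (d - 1)" by (rule bal_module)
  interpret Mj: module R "obj M (d - i)" by (rule M_module)
  define j where "j = d - i"
  have b: "b \<in> carrier (obj M j)" using bG G_subset by (auto simp: j_def)
  note da = P_dif_closed[OF a] and db = M_dif_closed[OF b]
  have db': "dif M j b \<in> carrier (obj M (d + 1 - i))" using db by (simp add: j_def algebra_simps)
  let ?a = "\<lambda>\<rho>. proj i (act P \<rho> i a)"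
  let ?c = "\<lambda>\<rho>. proj (i + 1) (act P \<rho> (i + 1) (dif P i a))"
  let ?b = "\<lambda>\<rho>. k j (act M \<rho> j b)"
  have pa: "?a \<rho> \<in> carrier (obj P i)" and pc: "?c \<rho> \<in> carrier (obj P (i + 1))" and kb: "?b \<rho> \<in> carrier (obj M (j - 1))"
    and rb: "act M \<rho> j b \<in> carrier (obj M j)"
    if "\<rho> \<in> perms" for \<rho>
    using that by (auto intro: pa_closed a da kb_closed b M_act_closed)
  \<comment> \<open>In \<open>U\<close> and \<open>V\<close> the differential falls on the left
    factor, after or before \<open>proj\<close>; in \<open>A\<close> and \<open>C\<close> it falls
    on the right factor, after or before \<open>k\<close>.\<close>
  define U V A C where
    "U = (\<Oplus>\<^bsub>bal d\<^esub>\<rho>\<in>perms. gen d (i + 1, dif P i (?a \<rho>), ?b \<rho>))" and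
    "V = (\<Oplus>\<^bsub>bal d\<^esub>\<rho>\<in>perms. gen d (i + 1, ?c \<rho>, ?b \<rho>))" and
    "A = (\<Oplus>\<^bsub>bal d\<^esub>\<rho>\<in>perms. gen d (i, ?a \<rho>, dif M (j - 1) (?b \<rho>)))" and
    "C = (\<Oplus>\<^bsub>bal d\<^esub>\<rho>\<in>perms. gen d (i, ?a \<rho>, k (j + 1) (dif M j (act M \<rho> j b))))"
  have j1: "j - 1 = d - (i + 1)" "j - 1 = d - 1 - i" "j + 1 = d + 1 - i" "j = d - i" "j = d + 1 - (i + 1)"
    by (simp_all add: j_def)
  have dkb: "dif M (j - 1) (?b \<rho>) \<in> carrier (obj M j)" if "\<rho> \<in> perms" for \<rho>
    using M_dif_closed[OF kb[OF that]] by simp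
  have kdb: "k (j + 1) (dif M j (act M \<rho> j b)) \<in> carrier (obj M j)" if "\<rho> \<in> perms" for \<rho>
    using linear_map_closed[OF k_linear M_dif_closed[OF rb[OF that]]] by simp
  have gU: "gen d (i + 1, dif P i (?a \<rho>), ?b \<rho>) \<in> carrier (bal d)" if "\<rho> \<in> perms" for \<rho>
    by (rule gen_closed[OF P_dif_closed[OF pa[OF that]] j1(1) kb[OF that]])
  have gV: "gen d (i + 1, ?c \<rho>, ?b \<rho>) \<in> carrier (bal d)" if "\<rho> \<in> perms" for \<rho>
    by (rule gen_closed[OF pc[OF that] j1(1) kb[OF that]])
  have gA: "gen d (i, ?a \<rho>, dif M (j - 1) (?b \<rho>)) \<in> carrier (bal d)" if "\<rho> \<in> perms" for \<rho>
    by (rule gen_closed[OF pa[OF that] j1(4) dkb[OF that]])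
  have gC: "gen d (i, ?a \<rho>, k (j + 1) (dif M j (act M \<rho> j b))) \<in> carrier (bal d)" if "\<rho> \<in> perms" for \<rho>
    by (rule gen_closed[OF pa[OF that] j1(4) kdb[OF that]])
  have cl: "U \<in> carrier (bal d)" "V \<in> carrier (bal d)" "A \<in> carrier (bal d)" "C \<in> carrier (bal d)"
    unfolding U_def V_def A_def C_def using gU gV gA gC by (auto intro!: B.finsum_closed)
  have kG: "?b \<rho> \<in> G (Suc N) (j - 1)" if "\<rho> \<in> perms" for \<rho>
    using that bG by (intro G_k G_act) (simp_all add: j_def)
  have UV: "U \<in> filt (Suc N) d" "V \<in> filt (Suc N) d"
    unfolding U_def V_def
    by (intro submodule_finsum[OF bal_module filt_submodule] Pi_I filt_gen[OF P_dif_closed[OF pa] j1(1) kG]; assumption)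
       (intro submodule_finsum[OF bal_module filt_submodule] Pi_I filt_gen[OF pc j1(1) kG]; assumption)
  have linD: "linear_map R (bal (d - 1)) (bal d) (bdif (d - 1))" by (rule bdif_linear) simp
  have linK: "linear_map R (bal (d + 1)) (bal d) (avg_hom (d + 1))" by (rule avg_hom_linear) simp
  have g1: "gen (d - 1) (i, ?a \<rho>, ?b \<rho>) \<in> carrier (bal (d - 1))" if "\<rho> \<in> perms" for \<rho>
    by (rule gen_closed[OF pa[OF that] j1(2) kb[OF that]])
  have "bdif (d - 1) (avg_hom d (gen d (i, a, b))) =
      [neg_one_pow i] \<cdot>\<^bsub>bal d\<^esub> (\<Oplus>\<^bsub>bal d\<^esub>\<rho>\<in>perms. bdif (d - 1) (gen (d - 1) (i, ?a \<rho>, ?b \<rho>)))"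
    unfolding avg_hom_gen[OF a j1(4) b] using g1
    by (subst linear_map_int_smult[OF bal_module bal_module linD])
       (auto intro!: B1.finsum_closed simp: linear_map_finsum[OF bal_module bal_module linD])
  also have "(\<Oplus>\<^bsub>bal d\<^esub>\<rho>\<in>perms. bdif (d - 1) (gen (d - 1) (i, ?a \<rho>, ?b \<rho>))) =
      (\<Oplus>\<^bsub>bal d\<^esub>\<rho>\<in>perms. gen d (i + 1, dif P i (?a \<rho>), ?b \<rho>) \<oplus>\<^bsub>bal d\<^esub> [neg_one_pow i] \<cdot>\<^bsub>bal d\<^esub> gen d (i, ?a \<rho>, dif M (j - 1) (?b \<rho>)))"
  proof (rule B.finsum_cong'[OF refl])
    fix \<rho> assume r: "\<rho> \<in> perms"
    show "bdif (d - 1) (gen (d - 1) (i, ?a \<rho>, ?b \<rho>)) =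
      gen d (i + 1, dif P i (?a \<rho>), ?b \<rho>) \<oplus>\<^bsub>bal d\<^esub> [neg_one_pow i] \<cdot>\<^bsub>bal d\<^esub> gen d (i, ?a \<rho>, dif M (j - 1) (?b \<rho>))"
      using bdif_gen[OF pa[OF r] j1(2) kb[OF r]] by simp
  qed (use gU gA in \<open>auto\<close>)
  also have "\<dots> = U \<oplus>\<^bsub>bal d\<^esub> [neg_one_pow i] \<cdot>\<^bsub>bal d\<^esub> A"
    unfolding U_def A_def using gU gA
    by (subst B.finsum_addf) (auto simp: int_smult_finsum[OF bal_module])
  \<comment> \<open>The sign of the homotopy equals the sign of the differential on the right
    factor, so the two cancel in front of \<open>A\<close>.\<close>
  finally have DK: "bdif (d - 1) (avg_hom d (gen d (i, a, b))) = [neg_one_pow i] \<cdot>\<^bsub>bal d\<^esub> U \<oplus>\<^bsub>bal d\<^esub> A"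
    using cl by (simp add: int_smult_add[OF bal_module] int_smult_smult[OF bal_module] neg_one_pow_square)
  have c1: "gen (d + 1) (i + 1, dif P i a, b) \<in> carrier (bal (d + 1))" "gen (d + 1) (i, a, dif M j b) \<in> carrier (bal (d + 1))"
    by (rule gen_closed[OF da j1(5) b]) (rule gen_closed[OF a j1(3) db])
  have K1: "avg_hom (d + 1) (gen (d + 1) (i + 1, dif P i a, b)) = [neg_one_pow (i + 1)] \<cdot>\<^bsub>bal d\<^esub> V"
    using avg_hom_gen[OF da j1(5) b] by (simp add: V_def)
  have "avg_hom (d + 1) (gen (d + 1) (i, a, dif M j b)) = [neg_one_pow i] \<cdot>\<^bsub>bal d\<^esub>
      (\<Oplus>\<^bsub>bal d\<^esub>\<rho>\<in>perms. gen d (i, ?a \<rho>, k (j + 1) (act M \<rho> (j + 1) (dif M j b))))"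
    using avg_hom_gen[OF a j1(3) db] by simp
  also have "(\<Oplus>\<^bsub>bal d\<^esub>\<rho>\<in>perms. gen d (i, ?a \<rho>, k (j + 1) (act M \<rho> (j + 1) (dif M j b)))) = C"
    unfolding C_def using gC by (intro B.finsum_cong'[OF refl]) (auto simp: M_act_dif[OF _ b])
  finally have K2: "avg_hom (d + 1) (gen (d + 1) (i, a, dif M j b)) = [neg_one_pow i] \<cdot>\<^bsub>bal d\<^esub> C" .
  have KD: "avg_hom (d + 1) (bdif d (gen d (i, a, b))) = [neg_one_pow (i + 1)] \<cdot>\<^bsub>bal d\<^esub> V \<oplus>\<^bsub>bal d\<^esub> C"
    unfolding bdif_gen[OF a j1(4) b] linear_map_add[OF linK c1(1) int_smult_closed[OF bal_module c1(2)]]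
      linear_map_int_smult[OF bal_module bal_module linK c1(2)] K1 K2
    using cl by (simp add: int_smult_smult[OF bal_module] neg_one_pow_square)
  have eb: "e j b \<in> carrier (obj M j)" by (rule linear_map_closed[OF e_linear b])
  have bd: "b \<ominus>\<^bsub>obj M j\<^esub> e j b \<in> carrier (obj M j)" using b eb by (simp add: j_def)
  have "A \<oplus>\<^bsub>bal d\<^esub> C = (\<Oplus>\<^bsub>bal d\<^esub>\<rho>\<in>perms. gen d (i, ?a \<rho>, dif M (j - 1) (?b \<rho>)) \<oplus>\<^bsub>bal d\<^esub>
      gen d (i, ?a \<rho>, k (j + 1) (dif M j (act M \<rho> j b))))"
    unfolding A_def C_def using gA gC by (intro B.finsum_addf[symmetric]) auto
  also have "\<dots> = (\<Oplus>\<^bsub>bal d\<^esub>\<rho>\<in>perms. gen d (i, act P (inv_into UNIV \<rho>) i (?a \<rho>), b \<ominus>\<^bsub>obj M j\<^esub> e j b))"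
  proof (rule B.finsum_cong'[OF refl])
    show "(\<lambda>\<rho>. gen d (i, act P (inv_into UNIV \<rho>) i (?a \<rho>), b \<ominus>\<^bsub>obj M j\<^esub> e j b)) \<in> perms \<rightarrow> carrier (bal d)"
      by (intro Pi_I gen_closed[OF P_act_closed[OF permutes_inv pa] j1(4) bd]) auto
    fix \<rho> assume r: "\<rho> \<in> perms"
    then have r': "\<rho> permutes {1..n}" by simp
    have "gen d (i, ?a \<rho>, dif M (j - 1) (?b \<rho>)) \<oplus>\<^bsub>bal d\<^esub> gen d (i, ?a \<rho>, k (j + 1) (dif M j (act M \<rho> j b))) =
      gen d (i, ?a \<rho>, act M \<rho> j b \<ominus>\<^bsub>obj M j\<^esub> e j (act M \<rho> j b))"
      unfolding linear_map_add[OF gen_linear_right[OF j1(4) pa[OF r]] dkb[OF r] kdb[OF r], symmetric] k_homotopy[OF rb[OF r]] ..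
    also have "act M \<rho> j b \<ominus>\<^bsub>obj M j\<^esub> e j (act M \<rho> j b) = act M \<rho> j (b \<ominus>\<^bsub>obj M j\<^esub> e j b)"
      unfolding equivariantD(2)[OF e_equivariant r' b] linear_map_diff[OF M_module M_module M_act[OF r'] b eb] ..
    \<comment> \<open>Balancing moves \<open>\<rho>\<close> to the left factor, where it acts
      through its inverse; this produces the summand of \<open>proj_sum\<close>.\<close>
    also have "gen d (i, ?a \<rho>, act M \<rho> j (b \<ominus>\<^bsub>obj M j\<^esub> e j b)) = gen d (i, act P (inv_into UNIV \<rho>) i (?a \<rho>), b \<ominus>\<^bsub>obj M j\<^esub> e j b)"
      by (rule gen_act[OF j1(4) pa[OF r] bd r', symmetric])
    finally show "gen d (i, ?a \<rho>, dif M (j - 1) (?b \<rho>)) \<oplus>\<^bsub>bal d\<^esub> gen d (i, ?a \<rho>, k (j + 1) (dif M j (act M \<rho> j b))) =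
      gen d (i, act P (inv_into UNIV \<rho>) i (?a \<rho>), b \<ominus>\<^bsub>obj M j\<^esub> e j b)" .
  qed
  also have "\<dots> = gen d (i, (\<Oplus>\<^bsub>obj P i\<^esub>\<rho>\<in>perms. act P (inv_into UNIV \<rho>) i (?a \<rho>)), b \<ominus>\<^bsub>obj M j\<^esub> e j b)"
    by (intro linear_map_finsum[OF P_module bal_module gen_linear_left[OF j1(4) bd], symmetric] Pi_I P_act_closed[OF permutes_inv pa]) auto
  also have "\<dots> = gen d (i, a, b) \<ominus>\<^bsub>bal d\<^esub> E d (gen d (i, a, b))"
    unfolding proj_sum[OF a] E_gen[OF a j1(4) b]
    by (rule linear_map_diff[OF M_module bal_module gen_linear_right[OF j1(4) a] b eb])
  finally have AC: "A \<oplus>\<^bsub>bal d\<^esub> C = gen d (i, a, b) \<ominus>\<^bsub>bal d\<^esub> E d (gen d (i, a, b))" .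
  have sU: "[neg_one_pow i] \<cdot>\<^bsub>bal d\<^esub> U \<in> carrier (bal d)" and sV: "[neg_one_pow (i + 1)] \<cdot>\<^bsub>bal d\<^esub> V \<in> carrier (bal d)"
    using cl by simp_all
  have "([neg_one_pow i] \<cdot>\<^bsub>bal d\<^esub> U \<oplus>\<^bsub>bal d\<^esub> A) \<oplus>\<^bsub>bal d\<^esub> ([neg_one_pow (i + 1)] \<cdot>\<^bsub>bal d\<^esub> V \<oplus>\<^bsub>bal d\<^esub> C) =
     ([neg_one_pow i] \<cdot>\<^bsub>bal d\<^esub> U \<oplus>\<^bsub>bal d\<^esub> [neg_one_pow (i + 1)] \<cdot>\<^bsub>bal d\<^esub> V) \<oplus>\<^bsub>bal d\<^esub> (A \<oplus>\<^bsub>bal d\<^esub> C)"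
    using cl(3,4) sU sV by (simp only: B.a_ac B.M.a_closed)
  then have "(bdif (d - 1) (avg_hom d (gen d (i, a, b))) \<oplus>\<^bsub>bal d\<^esub> avg_hom (d + 1) (bdif d (gen d (i, a, b)))) \<ominus>\<^bsub>bal d\<^esub>
      (A \<oplus>\<^bsub>bal d\<^esub> C) = [neg_one_pow i] \<cdot>\<^bsub>bal d\<^esub> U \<oplus>\<^bsub>bal d\<^esub> [neg_one_pow (i + 1)] \<cdot>\<^bsub>bal d\<^esub> V"
    unfolding DK KD using cl(3,4) sU sV by (simp add: a_minus_def B.a_assoc B.r_neg)
  then show ?thesis unfolding AC[symmetric]
    using UV by (simp add: submodule_add[OF filt_submodule] submodule_int_smult[OF bal_module filt_submodule])
qed

lemma avg_homotopy:
  assumes "z \<in> filt N d"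
  shows "(bdif (d - 1) (avg_hom d z) \<oplus>\<^bsub>bal d\<^esub> avg_hom (d + 1) (bdif d z)) \<ominus>\<^bsub>bal d\<^esub>
    (z \<ominus>\<^bsub>bal d\<^esub> E d z) \<in> filt (Suc N) d"
proof -
  let ?h = "\<lambda>z. (bdif (d - 1) (avg_hom d z) \<oplus>\<^bsub>bal d\<^esub> avg_hom (d + 1) (bdif d z)) \<ominus>\<^bsub>bal d\<^esub> (z \<ominus>\<^bsub>bal d\<^esub> E d z)"
  have linD: "linear_map R (bal (d - 1)) (bal d) (bdif (d - 1))" by (rule bdif_linear) simp
  have linK: "linear_map R (bal (d + 1)) (bal d) (avg_hom (d + 1))" by (rule avg_hom_linear) simp
  have lin: "linear_map R (bal d) (bal d) ?h"
    by (intro linear_map_minus linear_map_plus bal_module linear_map_id E_linear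
        linear_map_comp[OF avg_hom_linear[OF refl] linD] linear_map_comp[OF bdif_linear[OF refl] linK])
  have "filt N d \<subseteq> {z \<in> carrier (bal d). ?h z \<in> filt (Suc N) d}"
    unfolding filt_def[of N]
    using avg_homotopy_gen gen_closed[OF _ refl] G_subset
    by (intro module_span_least linear_map_vimage_submodule[OF bal_module bal_module lin filt_submodule]) blast
  then show ?thesis using assms by blast
qed

text \<open>Downward induction on the filtration level. For the averaged homotopy K, the element
  \<open>d K z - z\<close> lies one level higher and satisfies the same two equations, the second
  one because \<open>E\<close> commutes with the differential and kills the image of K. At level
  \<open>L\<close> the element is zero.\<close>

lemma cocycle_in_kernel_is_coboundary:
  assumes "z \<in> filt N d" "N \<le> L" "bdif d z = \<zero>\<^bsub>bal (d + 1)\<^esub>" "E d z = \<zero>\<^bsub>bal d\<^esub>"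
  shows "\<exists>v\<in>carrier (bal (d - 1)). z = bdif (d - 1) v"
  using assms(2,1,3,4)
proof (induction N arbitrary: z rule: inc_induct)
  case base
  interpret B1: module R "bal (d - 1)" by (rule bal_module)
  have linD: "linear_map R (bal (d - 1)) (bal d) (bdif (d - 1))" by (rule bdif_linear) simp
  show ?case using filt_L base(1) linear_map_zero[OF bal_module bal_module linD]
    by (intro bexI[of _ "\<zero>\<^bsub>bal (d - 1)\<^esub>"]) auto
next
  case (step N)
  interpret B: module R "bal d" by (rule bal_module)
  interpret B1: module R "bal (d - 1)" by (rule bal_module)
  interpret B2: module R "bal (d + 1)" by (rule bal_module)
  have linD: "linear_map R (bal (d - 1)) (bal d) (bdif (d - 1))" by (rule bdif_linear) simp
  have linK: "linear_map R (bal (d + 1)) (bal d) (avg_hom (d + 1))" by (rule avg_hom_linear) simp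
  have z: "z \<in> carrier (bal d)" using submodule_subset[OF filt_submodule] step.prems(1) by blast
  have Kz: "avg_hom d z \<in> carrier (bal (d - 1))" by (rule avg_hom_closed[OF refl z])
  have DKz: "bdif (d - 1) (avg_hom d z) \<in> carrier (bal d)" by (rule linear_map_closed[OF linD Kz])
  let ?w = "bdif (d - 1) (avg_hom d z) \<ominus>\<^bsub>bal d\<^esub> z"
  \<comment> \<open>With \<open>z\<close> closed and killed by \<open>E\<close>, the error term of
    the homotopy formula reduces to this element.\<close>
  have w: "?w \<in> filt (Suc N) d"
    using avg_homotopy[OF step.prems(1)] B.minus_equality[of "\<zero>\<^bsub>bal d\<^esub>" "\<zero>\<^bsub>bal d\<^esub>"] linear_map_zero[OF bal_module bal_module linK] z DKz
    by (simp add: step.prems(2,3) a_minus_def)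
  have "bdif d (bdif (d - 1) (avg_hom d z)) = \<zero>\<^bsub>bal (d + 1)\<^esub>"
    using bdif_bdif[OF Kz] by (simp add: add.commute)
  then have "bdif d ?w = \<zero>\<^bsub>bal (d + 1)\<^esub>"
    using linear_map_diff[OF bal_module bal_module bdif_linear[OF refl] DKz z]
    by (simp add: step.prems(2) module_diff_self[OF bal_module B2.zero_closed])
  moreover have "E d (bdif (d - 1) (avg_hom d z)) = \<zero>\<^bsub>bal d\<^esub>"
    using E_dif[OF Kz] E_avg_hom[OF z] linear_map_zero[OF bal_module bal_module linD] by simp
  then have "E d ?w = \<zero>\<^bsub>bal d\<^esub>"
    using linear_map_diff[OF bal_module bal_module E_linear DKz z] by (simp add: step.prems(3) a_minus_def)
  ultimately obtain v where v: "v \<in> carrier (bal (d - 1))" "?w = bdif (d - 1) v"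
    using step.IH[OF w] by blast
  have "bdif (d - 1) (avg_hom d z \<ominus>\<^bsub>bal (d - 1)\<^esub> v) = bdif (d - 1) (avg_hom d z) \<ominus>\<^bsub>bal d\<^esub> ?w"
    unfolding v(2) by (rule linear_map_diff[OF bal_module bal_module linD Kz v(1)])
  also have "\<dots> = z" using DKz z by (simp add: a_minus_def B.minus_add B.a_assoc[symmetric] B.r_neg)
  finally show ?case using Kz v(1) by (intro bexI[of _ "avg_hom d z \<ominus>\<^bsub>bal (d - 1)\<^esub> v"]) auto
qed

text \<open>The previous lemma at level 0, applied to \<open>z - E z\<close>, which \<open>E\<close>
  kills because it is idempotent.\<close>

theorem cocycle_homologous_to_projection:
  assumes z: "z \<in> carrier (bal d)" and dz: "bdif d z = \<zero>\<^bsub>bal (d + 1)\<^esub>"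
  shows "\<exists>v\<in>carrier (bal (d - 1)). z \<ominus>\<^bsub>bal d\<^esub> E d z = bdif (d - 1) v"
proof -
  interpret B: module R "bal d" by (rule bal_module)
  interpret B1: module R "bal (d + 1)" by (rule bal_module)
  have Ez: "E d z \<in> carrier (bal d)" by (rule E_closed[OF z])
  have "bdif d (E d z) = \<zero>\<^bsub>bal (d + 1)\<^esub>"
    using E_dif[OF z] dz linear_map_zero[OF bal_module bal_module E_linear] by simp
  then have "bdif d (z \<ominus>\<^bsub>bal d\<^esub> E d z) = \<zero>\<^bsub>bal (d + 1)\<^esub>"
    using linear_map_diff[OF bal_module bal_module bdif_linear[OF refl] z Ez] dz by (simp add: a_minus_def)
  moreover have "E d (z \<ominus>\<^bsub>bal d\<^esub> E d z) = \<zero>\<^bsub>bal d\<^esub>"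
    using linear_map_diff[OF bal_module bal_module E_linear z Ez] E_E[OF z] Ez
    by (simp add: module_diff_self[OF bal_module])
  ultimately show ?thesis
    using z Ez by (intro cocycle_in_kernel_is_coboundary[of _ 0]) (simp_all add: filt_0)
qed

end

section \<open>The Barratt--Eccles complexes\<close>

abbreviation omit :: "nat \<Rightarrow> 'c list \<Rightarrow> 'c list"
  where "omit i r \<equiv> take i r @ drop (Suc i) r"

lemma nth_omit: "i < length r \<Longrightarrow> k < length r - 1 \<Longrightarrow> omit i r ! k = r ! (if k < i then k else Suc k)"
  by (auto simp: nth_append min_def)

lemma set_omit: "set (omit i r) \<subseteq> set r"
  using set_take_subset[of i r] set_drop_subset[of "Suc i" r] by auto

text \<open>The simplicial identity for faces, in the form needed to pair the terms of the squared
  boundary.\<close>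

lemma omit_omit:
  assumes "i \<le> j" "Suc j < length r" shows "omit j (omit i r) = omit i (omit (Suc j) r)"
proof (rule nth_equalityI)
  show "length (omit j (omit i r)) = length (omit i (omit (Suc j) r))"
    using assms by (auto simp: min_def)
  fix k assume "k < length (omit j (omit i r))"
  then have k: "k < length r - 2" using assms by (auto simp: min_def split: if_splits)
  have l: "length (omit i r) = length r - 1" "length (omit (Suc j) r) = length r - 1"
    using assms by (auto simp: min_def)
  have "omit j (omit i r) ! k = omit i r ! (if k < j then k else Suc k)"
    using k assms l by (intro nth_omit) auto
  also have "\<dots> = r ! (let k' = (if k < j then k else Suc k) in if k' < i then k' else Suc k')"
    using k assms by (subst nth_omit) (auto simp: Let_def)
  also have "\<dots> = r ! (let k' = (if k < i then k else Suc k) in if k' < Suc j then k' else Suc k')"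
    using assms(1) by (auto simp: Let_def)
  also have "\<dots> = omit (Suc j) r ! (if k < i then k else Suc k)"
    using k assms by (subst nth_omit) (auto simp: Let_def)
  also have "\<dots> = omit i (omit (Suc j) r) ! k"
    using k assms l by (intro nth_omit[symmetric]) auto
  finally show "omit j (omit i r) ! k = omit i (omit (Suc j) r) ! k" .
qed

lemma map_omit: "map f (omit i r) = omit i (map f r)"
  by (simp add: take_map drop_map)

lemma (in abelian_monoid) finsum_pair:
  "a \<noteq> b \<Longrightarrow> f a \<in> carrier G \<Longrightarrow> f b \<in> carrier G \<Longrightarrow> (\<Oplus>i\<in>{a, b}. f i) = f a \<oplus> f b"
  by simp

text \<open>Induction on the size of the rectangle. Its new last row and its new last column have
  equally many entries and cancel pairwise.\<close>

lemma (in abelian_group) alternating_double_sum: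
  assumes "\<And>i j. f i j \<in> carrier G" "\<And>i j. i \<le> j \<Longrightarrow> j < m \<Longrightarrow> f (Suc j) i = \<ominus> f i j"
  shows "(\<Oplus>i\<in>{..<Suc m}. \<Oplus>j\<in>{..<m}. f i j) = \<zero>"
  using assms(2)
proof (induction m)
  case 0
  show ?case by (simp add: lessThan_Suc)
next
  case (Suc m)
  note c = assms(1)
  have c': "(\<Oplus>j\<in>A. f i j) \<in> carrier G" "(\<Oplus>i\<in>A. f i j) \<in> carrier G" for A i j
    using c by (auto intro: finsum_closed)
  have "(\<Oplus>i\<in>{..<Suc (Suc m)}. \<Oplus>j\<in>{..<Suc m}. f i j) =
    (\<Oplus>j\<in>{..<Suc m}. f (Suc m) j) \<oplus> (\<Oplus>i\<in>{..<Suc m}. f i m \<oplus> (\<Oplus>j\<in>{..<m}. f i j))"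
  proof -
    have S: "(\<Oplus>i\<in>{..<Suc k}. g i) = g k \<oplus> (\<Oplus>i\<in>{..<k}. g i)" if "\<And>i. g i \<in> carrier G" for g k
      using that by (simp add: lessThan_Suc)
    have "(\<Oplus>i\<in>{..<Suc m}. \<Oplus>j\<in>{..<Suc m}. f i j) = (\<Oplus>i\<in>{..<Suc m}. f i m \<oplus> (\<Oplus>j\<in>{..<m}. f i j))"
      using c c' by (intro finsum_cong'[OF refl] S) auto
    then show ?thesis using c' by (simp only: S)
  qed
  also have "(\<Oplus>i\<in>{..<Suc m}. f i m \<oplus> (\<Oplus>j\<in>{..<m}. f i j)) = (\<Oplus>i\<in>{..<Suc m}. f i m) \<oplus> (\<Oplus>i\<in>{..<Suc m}. \<Oplus>j\<in>{..<m}. f i j)"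
    using c c' by (intro finsum_addf) auto
  also have "(\<Oplus>i\<in>{..<Suc m}. \<Oplus>j\<in>{..<m}. f i j) = \<zero>"
    using Suc by simp
  also have "(\<Oplus>j\<in>{..<Suc m}. f (Suc m) j) \<oplus> ((\<Oplus>i\<in>{..<Suc m}. f i m) \<oplus> \<zero>) =
      (\<Oplus>j\<in>{..<Suc m}. f (Suc m) j \<oplus> f j m)"
    using c c' by (subst finsum_addf) auto
  also have "\<dots> = (\<Oplus>j\<in>{..<Suc m}. \<zero>)"
    using c Suc.prems by (intro finsum_cong'[OF refl]) (auto simp: l_neg)
  finally show ?case by simp
qed

subsection \<open>Signs of sequences\<close>

definition seq_map :: "nat \<Rightarrow> nat list \<Rightarrow> nat \<Rightarrow> nat"
  where "seq_map n v i = (if i \<in> {1..n} then v ! (i - 1) else i)"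

text \<open>The sign, extended by zero to sequences that are not permutations. For entries in
  \<open>{1..n}\<close> this is the determinant of the matrix whose rows are the unit vectors named
  by the sequence. It turns the case distinction in the stabilization into a coefficient.\<close>

definition seq_sign :: "nat \<Rightarrow> nat list \<Rightarrow> int"
  where "seq_sign n v = (if seq_map n v permutes {1..n} then sign (seq_map n v) else 0)"

lemma seq_sign_distinct:
  assumes "seq_sign n v \<noteq> 0" "length v = n" shows "distinct v"
proof -
  have p: "seq_map n v permutes {1..n}" using assms(1) by (auto simp: seq_sign_def split: if_splits)
  have "v ! i \<noteq> v ! j" if "i < n" "j < n" "i \<noteq> j" for i j
  proof -
    have "seq_map n v (Suc i) \<noteq> seq_map n v (Suc j)"
      using permutes_inj[OF p] that(3) by (auto dest: injD)
    then show ?thesis using that by (simp add: seq_map_def One_nat_def)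
  qed
  then show ?thesis using assms(2) by (auto simp: distinct_conv_nth)
qed

lemma seq_sign_swap:
  assumes "length p + length q + 2 = n"
  shows "seq_sign n (p @ a # c # q) = - seq_sign n (p @ c # a # q)"
proof -
  let ?t = "transpose (Suc (length p)) (Suc (Suc (length p)))"
  have t: "?t permutes {1..n}" using assms by (intro permutes_swap_id) auto
  have eq: "seq_map n (p @ x # y # q) = seq_map n (p @ y # x # q) \<circ> ?t" for x y
  proof
    fix i
    show "seq_map n (p @ x # y # q) i = (seq_map n (p @ y # x # q) \<circ> ?t) i"
      using assms
      by (cases i) (auto simp: seq_map_def nth_append nth_Cons' Transposition.transpose_def One_nat_def split: if_splits)
  qed
  have iff: "seq_map n (p @ a # c # q) permutes {1..n} \<longleftrightarrow> seq_map n (p @ c # a # q) permutes {1..n}"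
    using permutes_compose[OF t] eq by metis
  show ?thesis
  proof (cases "seq_map n (p @ c # a # q) permutes {1..n}")
    case True
    have "sign (seq_map n (p @ a # c # q)) = sign (seq_map n (p @ c # a # q)) * sign ?t"
      unfolding eq[of a c] using permutes_imp_permutation[OF _ True] permutes_imp_permutation[OF _ t]
      by (intro sign_compose) auto
    then show ?thesis using True iff by (simp add: seq_sign_def sign_swap_id)
  qed (use iff in \<open>simp add: seq_sign_def\<close>)
qed

text \<open>Moving an entry past \<open>m\<close> takes \<open>length m\<close> adjacent
  swaps.\<close>

lemma seq_sign_move:
  assumes "length p + length m + length q + 1 = n"
  shows "seq_sign n (p @ c # m @ q) = neg_one_pow (int (length m)) * seq_sign n (p @ m @ c # q)"
  using assms
proof (induction m arbitrary: p)
  case Nil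
  then show ?case by (simp add: neg_one_pow_def)
next
  case (Cons a m)
  have "seq_sign n (p @ c # (a # m) @ q) = - seq_sign n ((p @ [a]) @ c # m @ q)"
    using Cons.prems seq_sign_swap[of p "m @ q" n c a] by simp
  also have "\<dots> = - (neg_one_pow (int (length m)) * seq_sign n ((p @ [a]) @ m @ c # q))"
    using Cons.prems by (subst Cons.IH) auto
  finally show ?case by (simp add: neg_one_pow_def)
qed

text \<open>This is the expansion of a determinant with two equal rows; it makes the stabilization a chain map.\<close>

lemma seq_sign_omit_sum:
  assumes "length v = Suc n" "set v \<subseteq> {1..n}"
  shows "(\<Sum>i<Suc n. neg_one_pow (int i) * seq_sign n (omit i v)) = 0"
proof -
  \<comment> \<open>Pigeonhole: \<open>n + 1\<close> entries take at most \<open>n\<close>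
    values.\<close>
  have "card (set v) \<le> n" using card_mono[OF _ assms(2)] by simp
  then have "\<not> distinct v" using assms(1) distinct_card[of v] by auto
  then obtain p c m q where v: "v = p @ [c] @ m @ [c] @ q" using not_distinct_decomp by blast
  let ?a = "length p" and ?b = "length p + Suc (length m)"
  have len: "length p + length m + length q + 1 = n" using assms(1) v by simp
  \<comment> \<open>Deleting any other entry leaves both copies of \<open>c\<close>, hence a
    sequence that is not a permutation. The map \<open>?k\<close> computes the position of an entry
    after the deletion.\<close>
  have z: "seq_sign n (omit i v) = 0" if i: "i < Suc n" "i \<noteq> ?a" "i \<noteq> ?b" for i
  proof (rule ccontr)
    assume "seq_sign n (omit i v) \<noteq> 0"
    then have d: "distinct (omit i v)" using assms(1) i by (intro seq_sign_distinct) auto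
    let ?k = "\<lambda>x. if x < i then x else x - 1"
    have k: "omit i v ! ?k x = v ! x \<and> ?k x < length (omit i v)" if "x < Suc n" "x \<noteq> i" for x
      using that i assms(1) by (subst nth_omit) (auto simp: min_def)
    have "v ! ?a = c" "v ! ?b = c" unfolding v by (auto simp: nth_append)
    then have "omit i v ! ?k ?a = omit i v ! ?k ?b" "?k ?a < length (omit i v)" "?k ?b < length (omit i v)"
      using k[of ?a] k[of ?b] i len by auto
    then have "?k ?a = ?k ?b" using nth_eq_iff_index_eq[OF d] by blast
    then show False using i by (auto split: if_splits)
  qed
  \<comment> \<open>The two remaining sequences differ by moving \<open>c\<close> past
    \<open>m\<close>, which gives the sign of \<open>length m\<close>, while the two deleted
    positions differ by \<open>length m + 1\<close>; so their terms are opposite.\<close>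
  have ab: "omit ?a v = p @ m @ c # q" "omit ?b v = p @ c # m @ q" unfolding v by auto
  have "(\<Sum>i<Suc n. neg_one_pow (int i) * seq_sign n (omit i v)) =
    (\<Sum>i\<in>{?a, ?b}. neg_one_pow (int i) * seq_sign n (omit i v))"
    using len z by (intro sum.mono_neutral_right) auto
  also have "\<dots> = neg_one_pow (int ?a) * seq_sign n (omit ?a v) + neg_one_pow (int ?b) * seq_sign n (omit ?b v)"
    by (subst sum.insert) simp_all
  also have "\<dots> = 0" unfolding ab seq_sign_move[OF len] by (simp add: neg_one_pow_def)
  finally show ?thesis .
qed

subsection \<open>The chain complexes\<close>

text \<open>In contrast to \<open>be_tuples\<close> this admits degenerate tuples and, in degree -1,
  the empty one. They arise as faces and as values of the stabilization, so formulas on generators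
  are stated for these lists.\<close>

definition perm_lists :: "nat \<Rightarrow> int \<Rightarrow> (nat \<Rightarrow> nat) list set"
  where "perm_lists n d = {r. int (length r) = d + 1 \<and> (\<forall>\<rho>\<in>set r. \<rho> permutes {1..n})}"

lemma be_tuples_perm_lists: "r \<in> be_tuples n d \<longleftrightarrow> r \<in> perm_lists n d \<and> r \<noteq> [] \<and> distinct_adj r"
  by (auto simp: be_tuples_def perm_lists_def)

lemma omit_perm_lists: "r \<in> perm_lists n d \<Longrightarrow> i < length r \<Longrightarrow> omit i r \<in> perm_lists n (d - 1)"
  using set_omit[of i r] by (auto simp: perm_lists_def)

lemma not_distinct_adj_split:
  "\<not> distinct_adj r \<Longrightarrow> \<exists>u x v. r = u @ x # x # v"
proof (induction r rule: induct_list012)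
  case (3 x y zs)
  show ?case
  proof (cases "x = y")
    case True
    then have "x # y # zs = [] @ x # x # zs" by simp
    then show ?thesis by blast
  next
    case False
    with 3 obtain u z v where "y # zs = u @ z # z # v" by auto
    then have "x # y # zs = (x # u) @ z # z # v" by simp
    then show ?thesis by blast
  qed
qed auto

lemma not_distinct_adj_append: "\<not> distinct_adj (u @ x # x # v)"
  by (simp add: distinct_adj_append_iff)

locale be_complex =
  fixes R :: "('k, 'm) ring_scheme" and n :: nat
  assumes cring: "cring R"
begin

abbreviation "B \<equiv> be_module R n"
abbreviation "bgen \<equiv> be_gen R n"
abbreviation "bdry \<equiv> dif (barratt_eccles R n)"
abbreviation "bact \<equiv> act (barratt_eccles R n)"

lemma be_module_module: "module R (B d)"
  unfolding be_module_def by (rule free_module_module[OF cring])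

lemma bgen_closed: "bgen d r \<in> carrier (B d)"
proof -
  interpret B: module R "B d" by (rule be_module_module)
  show ?thesis using free_gen_closed[OF cring, of r "be_tuples n d"] by (simp add: be_gen_def be_module_def[symmetric])
qed

lemma bgen_tuple: "r \<in> be_tuples n d \<Longrightarrow> bgen d r = free_gen R r"
  by (simp add: be_gen_def)

lemma bgen_zero: "r = [] \<or> \<not> distinct_adj r \<Longrightarrow> bgen d r = \<zero>\<^bsub>B d\<^esub>"
  by (auto simp: be_gen_def be_tuples_perm_lists)

lemma linear_map_eq_on_be:
  assumes "module R M" "linear_map R (B d) M g" "linear_map R (B d) M h"
    and "\<And>r. r \<in> be_tuples n d \<Longrightarrow> g (bgen d r) = h (bgen d r)" and "u \<in> carrier (B d)"
  shows "g u = h u"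
  by (rule linear_map_eq_on_free[OF assms(1) assms(2,3)[unfolded be_module_def] _ assms(5)[unfolded be_module_def]])
     (use assms(4) in \<open>simp add: bgen_tuple\<close>)

lemma be_lift_linear: "module R M \<Longrightarrow> (\<And>r. r \<in> be_tuples n d \<Longrightarrow> \<phi> r \<in> carrier M) \<Longrightarrow> linear_map R (B d) M (lin_ext R M \<phi>)"
  unfolding be_module_def by (rule lin_ext_linear)

lemma be_lift_gen:
  "module R M \<Longrightarrow> \<phi> r \<in> carrier M \<Longrightarrow> r \<in> be_tuples n d \<Longrightarrow> lin_ext R M \<phi> (bgen d r) = \<phi> r"
  by (simp add: bgen_tuple lin_ext_free_gen)

definition face_sum :: "int \<Rightarrow> (nat \<Rightarrow> nat) list \<Rightarrow> (nat \<Rightarrow> nat) list \<Rightarrow> 'k"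
  where "face_sum d r = (\<Oplus>\<^bsub>B (d - 1)\<^esub>i\<in>{..<length r}. [neg_one_pow (int i)] \<cdot>\<^bsub>B (d - 1)\<^esub> bgen (d - 1) (omit i r))"

lemma face_sum_closed: "face_sum d r \<in> carrier (B (d - 1))"
proof -
  interpret B: module R "B (d - 1)" by (rule be_module_module)
  show ?thesis unfolding face_sum_def by (intro B.finsum_closed Pi_I int_smult_closed[OF be_module_module] bgen_closed)
qed

lemma bdry_conv: "bdry d = lin_ext R (B (d - 1)) (face_sum d)"
  by (simp add: barratt_eccles_def face_sum_def[abs_def])

lemma bdry_linear: "e = d - 1 \<Longrightarrow> linear_map R (B d) (B e) (bdry d)"
  unfolding bdry_conv by (simp add: be_lift_linear[OF be_module_module face_sum_closed])

text \<open>Deleting either of two equal neighbours gives the same tuple with opposite signs, and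
  every other face keeps the repeated pair. Hence the boundary is well defined on normalized
  chains.\<close>

lemma face_sum_degenerate:
  assumes "\<not> distinct_adj r" shows "face_sum d r = \<zero>\<^bsub>B (d - 1)\<^esub>"
proof -
  interpret B: module R "B (d - 1)" by (rule be_module_module)
  obtain u x v where r: "r = u @ x # x # v" using not_distinct_adj_split[OF assms] by blast
  let ?f = "\<lambda>i. [neg_one_pow (int i)] \<cdot>\<^bsub>B (d - 1)\<^esub> bgen (d - 1) (omit i r)"
  let ?a = "length u" and ?b = "Suc (length u)"
  have c: "?f i \<in> carrier (B (d - 1))" for i by (intro int_smult_closed[OF be_module_module] bgen_closed)
  have z: "?f i = \<zero>\<^bsub>B (d - 1)\<^esub>" if i: "i < length r" "i \<noteq> ?a" "i \<noteq> ?b" for i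
  proof -
    have "\<exists>u' v'. omit i r = u' @ x # x # v'"
    proof (cases "i < ?a")
      case True
      then have "omit i r = omit i u @ x # x # v" by (simp add: r)
      then show ?thesis by blast
    next
      case False
      then obtain k where k: "i = length u + Suc (Suc k)" using i(2,3)
        by (metis add_Suc_right less_antisym less_natE linorder_neqE_nat not_less_eq)
      then have "omit i r = u @ x # x # omit k v" by (simp add: r One_nat_def numeral_eq_Suc)
      then show ?thesis by blast
    qed
    then have "\<not> distinct_adj (omit i r)" using not_distinct_adj_append by metis
    then show ?thesis by (simp add: bgen_zero)
  qed
  have "face_sum d r = (\<Oplus>\<^bsub>B (d - 1)\<^esub>i\<in>{?a, ?b}. ?f i)"
    unfolding face_sum_def using c z by (intro B.add.finprod_mono_neutral_cong_right) (auto simp: r)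
  also have "\<dots> = ?f ?a \<oplus>\<^bsub>B (d - 1)\<^esub> ?f ?b" by (rule B.finsum_pair[where f = ?f], simp, rule c, rule c)
  also have "omit ?b r = omit ?a r" by (simp add: r)
  also have "neg_one_pow (int ?b) = - neg_one_pow (int ?a)" by (simp add: neg_one_pow_def)
  finally show ?thesis
    using bgen_closed by (simp add: int_smult_uminus[OF be_module_module] B.r_neg)
qed

text \<open>On degenerate tuples both sides vanish. Iterated faces can thus be treated uniformly,
  whether or not they are degenerate.\<close>

lemma bdry_gen:
  assumes "r \<in> perm_lists n d" shows "bdry d (bgen d r) = face_sum d r"
proof (cases "r \<in> be_tuples n d")
  case True
  then show ?thesis unfolding bdry_conv by (intro be_lift_gen be_module_module face_sum_closed)
next
  case False
  interpret B: module R "B (d - 1)" by (rule be_module_module)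
  from False assms have r: "r = [] \<or> \<not> distinct_adj r" by (auto simp: be_tuples_perm_lists)
  then have "face_sum d r = \<zero>\<^bsub>B (d - 1)\<^esub>"
    using face_sum_degenerate by (auto simp: face_sum_def)
  then show ?thesis
    using r by (simp add: bgen_zero linear_map_zero[OF be_module_module be_module_module bdry_linear])
qed

lemma bdry_face_sum:
  assumes "r \<in> perm_lists n d"
  shows "bdry (d - 1) (face_sum d r) = \<zero>\<^bsub>B (d - 2)\<^esub>"
proof (cases "length r")
  case 0
  interpret B: module R "B (d - 1)" by (rule be_module_module)
  show ?thesis using 0 linear_map_zero[OF be_module_module be_module_module bdry_linear]
    by (simp add: face_sum_def)
next
  case (Suc m)
  interpret B: module R "B (d - 2)" by (rule be_module_module)
  have lin: "linear_map R (B (d - 1)) (B (d - 2)) (bdry (d - 1))" by (rule bdry_linear) simp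
  let ?f = "\<lambda>i j. [(neg_one_pow (int i) * neg_one_pow (int j))] \<cdot>\<^bsub>B (d - 2)\<^esub> bgen (d - 2) (omit j (omit i r))"
  have "bdry (d - 1) (face_sum d r) =
    (\<Oplus>\<^bsub>B (d - 2)\<^esub>i\<in>{..<Suc m}. bdry (d - 1) ([neg_one_pow (int i)] \<cdot>\<^bsub>B (d - 1)\<^esub> bgen (d - 1) (omit i r)))"
    unfolding face_sum_def Suc
    by (intro linear_map_finsum[OF be_module_module be_module_module lin] Pi_I int_smult_closed[OF be_module_module] bgen_closed)
  also have "\<dots> = (\<Oplus>\<^bsub>B (d - 2)\<^esub>i\<in>{..<Suc m}. \<Oplus>\<^bsub>B (d - 2)\<^esub>j\<in>{..<m}. ?f i j)"
  proof (rule B.finsum_cong'[OF refl])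
    show "(\<lambda>i. \<Oplus>\<^bsub>B (d - 2)\<^esub>j\<in>{..<m}. ?f i j) \<in> {..<Suc m} \<rightarrow> carrier (B (d - 2))"
      by (intro Pi_I B.finsum_closed int_smult_closed[OF be_module_module] bgen_closed)
    fix i assume i: "i \<in> {..<Suc m}"
    have "bdry (d - 1) ([neg_one_pow (int i)] \<cdot>\<^bsub>B (d - 1)\<^esub> bgen (d - 1) (omit i r)) =
        [neg_one_pow (int i)] \<cdot>\<^bsub>B (d - 2)\<^esub> face_sum (d - 1) (omit i r)"
      using i Suc omit_perm_lists[OF assms]
      by (simp only: linear_map_int_smult[OF be_module_module be_module_module lin bgen_closed] bdry_gen lessThan_iff)
    also have "\<dots> = (\<Oplus>\<^bsub>B (d - 2)\<^esub>j\<in>{..<m}. ?f i j)"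
    proof -
      have l: "length (omit i r) = m" and d: "d - 1 - 1 = d - 2" using i Suc by auto
      have c: "bgen (d - 2) (omit j (omit i r)) \<in> carrier (B (d - 2))" for j by (rule bgen_closed)
      show ?thesis
        unfolding face_sum_def l d
        by (subst int_smult_finsum[OF be_module_module Pi_I[OF int_smult_closed[OF be_module_module c]]])
           (simp only: int_smult_smult[OF be_module_module c])
    qed
    finally show "bdry (d - 1) ([neg_one_pow (int i)] \<cdot>\<^bsub>B (d - 1)\<^esub> bgen (d - 1) (omit i r)) = (\<Oplus>\<^bsub>B (d - 2)\<^esub>j\<in>{..<m}. ?f i j)" .
  qed
  also have "\<dots> = \<zero>\<^bsub>B (d - 2)\<^esub>"
  proof (rule B.alternating_double_sum)
    show "?f i j \<in> carrier (B (d - 2))" for i j by (intro int_smult_closed[OF be_module_module] bgen_closed)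
    fix i j assume ij: "i \<le> j" "j < m"
    then have "omit j (omit i r) = omit i (omit (Suc j) r)" using Suc by (intro omit_omit) auto
    moreover have "neg_one_pow (int (Suc j)) * neg_one_pow (int i) = - (neg_one_pow (int i) * neg_one_pow (int j))"
      by (simp add: neg_one_pow_def)
    ultimately show "?f (Suc j) i = \<ominus>\<^bsub>B (d - 2)\<^esub> ?f i j"
      by (simp only: int_smult_uminus[OF be_module_module bgen_closed])
  qed
  finally show ?thesis .
qed

lemma bdry_bdry:
  assumes "u \<in> carrier (B d)" shows "bdry (d - 1) (bdry d u) = \<zero>\<^bsub>B (d - 2)\<^esub>"
proof -
  have lin: "linear_map R (B (d - 1)) (B (d - 2)) (bdry (d - 1))" by (rule bdry_linear) simp
  have "(\<lambda>u. bdry (d - 1) (bdry d u)) u = (\<lambda>u. \<zero>\<^bsub>B (d - 2)\<^esub>) u"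
    by (rule linear_map_eq_on_be[OF be_module_module linear_map_comp[OF bdry_linear[OF refl] lin]
          linear_map_const_zero[OF be_module_module be_module_module] _ assms])
       (simp add: be_tuples_perm_lists bdry_gen bdry_face_sum)
  then show ?thesis by simp
qed

subsection \<open>The action\<close>

lemma perm_lists_map: "r \<in> perm_lists n d \<Longrightarrow> \<sigma> permutes {1..n} \<Longrightarrow> map (\<lambda>\<rho>. \<sigma> \<circ> \<rho>) r \<in> perm_lists n d"
  by (auto simp: perm_lists_def intro: permutes_compose)

lemma bact_linear: "linear_map R (B d) (B d) (bact \<sigma> d)"
  by (simp add: barratt_eccles_def be_lift_linear[OF be_module_module bgen_closed])

text \<open>Composition with \<open>\<sigma>\<close> keeps equal neighbours equal, so on degenerate
  tuples both sides vanish.\<close>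

lemma bact_gen:
  assumes "r \<in> perm_lists n d" "\<sigma> permutes {1..n}"
  shows "bact \<sigma> d (bgen d r) = bgen d (map (\<lambda>\<rho>. \<sigma> \<circ> \<rho>) r)"
proof (cases "r \<in> be_tuples n d")
  case True
  then show ?thesis
    using be_lift_gen[where \<phi> = "\<lambda>r. bgen d (map (\<lambda>\<rho>. \<sigma> \<circ> \<rho>) r)", OF be_module_module bgen_closed True]
    by (simp add: barratt_eccles_def)
next
  case False
  with assms(1) have r: "r = [] \<or> \<not> distinct_adj r" by (auto simp: be_tuples_perm_lists)
  moreover have "map (\<lambda>\<rho>. \<sigma> \<circ> \<rho>) r = [] \<or> \<not> distinct_adj (map (\<lambda>\<rho>. \<sigma> \<circ> \<rho>) r)"
    using r not_distinct_adj_split[of r] not_distinct_adj_append by fastforce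
  ultimately show ?thesis
    by (simp only: bgen_zero linear_map_zero[OF be_module_module be_module_module bact_linear])
qed

lemma bact_comp:
  assumes "\<sigma> permutes {1..n}" "\<tau> permutes {1..n}" "u \<in> carrier (B d)"
  shows "bact (\<sigma> \<circ> \<tau>) d u = bact \<sigma> d (bact \<tau> d u)"
proof (rule linear_map_eq_on_be[OF be_module_module bact_linear linear_map_comp[OF bact_linear bact_linear] _ assms(3)])
  fix r assume "r \<in> be_tuples n d"
  then have r: "r \<in> perm_lists n d" by (simp add: be_tuples_perm_lists)
  have "map (\<lambda>\<rho>. \<sigma> \<circ> \<tau> \<circ> \<rho>) r = map (\<lambda>\<rho>. \<sigma> \<circ> \<rho>) (map (\<lambda>\<rho>. \<tau> \<circ> \<rho>) r)"
    by (induction r) (simp_all add: comp_assoc)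
  then show "bact (\<sigma> \<circ> \<tau>) d (bgen d r) = bact \<sigma> d (bact \<tau> d (bgen d r))"
    by (simp only: bact_gen[OF r permutes_compose[OF assms(2,1)]] bact_gen[OF r assms(2)]
        bact_gen[OF perm_lists_map[OF r assms(2)] assms(1)])
qed

lemma bact_id: "u \<in> carrier (B d) \<Longrightarrow> bact id d u = u"
  by (rule linear_map_eq_on_be[OF be_module_module bact_linear linear_map_id])
     (simp_all add: be_tuples_perm_lists bact_gen permutes_id)

lemma bact_bdry:
  assumes s: "\<sigma> permutes {1..n}" and u: "u \<in> carrier (B d)"
  shows "bact \<sigma> (d - 1) (bdry d u) = bdry d (bact \<sigma> d u)"
proof (rule linear_map_eq_on_be[OF be_module_module linear_map_comp[OF bdry_linear[OF refl] bact_linear]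
      linear_map_comp[OF bact_linear bdry_linear[OF refl]] _ u])
  interpret B: module R "B (d - 1)" by (rule be_module_module)
  fix r assume "r \<in> be_tuples n d"
  then have r: "r \<in> perm_lists n d" by (simp add: be_tuples_perm_lists)
  have "bact \<sigma> (d - 1) (face_sum d r) =
     (\<Oplus>\<^bsub>B (d - 1)\<^esub>i\<in>{..<length r}. bact \<sigma> (d - 1) ([neg_one_pow (int i)] \<cdot>\<^bsub>B (d - 1)\<^esub> bgen (d - 1) (omit i r)))"
    unfolding face_sum_def
    by (intro linear_map_finsum[OF be_module_module be_module_module bact_linear] Pi_I int_smult_closed[OF be_module_module] bgen_closed)
  also have "\<dots> = face_sum d (map (\<lambda>\<rho>. \<sigma> \<circ> \<rho>) r)"
    unfolding face_sum_def length_map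
  proof (rule B.finsum_cong'[OF refl])
    fix i assume "i \<in> {..<length r}"
    then have "omit i r \<in> perm_lists n (d - 1)" using omit_perm_lists[OF r] by simp
    then show "bact \<sigma> (d - 1) ([neg_one_pow (int i)] \<cdot>\<^bsub>B (d - 1)\<^esub> bgen (d - 1) (omit i r)) =
      [neg_one_pow (int i)] \<cdot>\<^bsub>B (d - 1)\<^esub> bgen (d - 1) (omit i (map (\<lambda>\<rho>. \<sigma> \<circ> \<rho>) r))"
      by (simp only: linear_map_int_smult[OF be_module_module be_module_module bact_linear bgen_closed] bact_gen[OF _ s] map_omit)
  qed (intro Pi_I int_smult_closed[OF be_module_module] bgen_closed)
  finally show "bact \<sigma> (d - 1) (bdry d (bgen d r)) = bdry d (bact \<sigma> d (bgen d r))"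
    by (simp only: bdry_gen[OF r] bact_gen[OF r s] bdry_gen[OF perm_lists_map[OF r s]])
qed

end

subsection \<open>Stabilization\<close>

lemma int_smult_0: "[(0 :: int)] \<cdot>\<^bsub>M\<^esub> x = \<zero>\<^bsub>M\<^esub>"
  by (simp add: add_pow_def int_pow_def2)

lemma int_smult_sum:
  fixes m :: nat
  assumes "module R M" "x \<in> carrier M"
  shows "(\<Oplus>\<^bsub>M\<^esub>i\<in>{..<m}. [(c i :: int)] \<cdot>\<^bsub>M\<^esub> x) = [(\<Sum>i<m. c i)] \<cdot>\<^bsub>M\<^esub> x"
proof -
  interpret M: module R M by fact
  show ?thesis
    using assms(2)
    by (induction m) (simp_all add: lessThan_Suc M.add.int_pow_mult M.a_comm int_smult_0)
qed

lemma (in abelian_monoid) finsum_lessThan_add: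
  fixes m l :: nat
  assumes "\<And>i. f i \<in> carrier G"
  shows "(\<Oplus>i\<in>{..<m + l}. f i) = (\<Oplus>i\<in>{..<m}. f i) \<oplus> (\<Oplus>i\<in>{..<l}. f (m + i))"
proof (induction l)
  case 0
  then show ?case using assms by (simp add: finsum_closed)
next
  case (Suc l)
  have "(\<Oplus>i\<in>{..<m + Suc l}. f i) = f (m + l) \<oplus> ((\<Oplus>i\<in>{..<m}. f i) \<oplus> (\<Oplus>i\<in>{..<l}. f (m + i)))"
    using assms by (simp add: lessThan_Suc Suc)
  also have "\<dots> = (\<Oplus>i\<in>{..<m}. f i) \<oplus> (f (m + l) \<oplus> (\<Oplus>i\<in>{..<l}. f (m + i)))"
    using assms by (intro a_lcomm finsum_closed) auto
  also have "\<dots> = (\<Oplus>i\<in>{..<m}. f i) \<oplus> (\<Oplus>i\<in>{..<Suc l}. f (m + i))"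
    using assms by (simp add: lessThan_Suc)
  finally show ?case .
qed

lemma seq_sign_map:
  assumes s: "\<sigma> permutes {1..n}" and v: "length v = n"
  shows "seq_sign n (map \<sigma> v) = sign \<sigma> * seq_sign n v"
proof -
  have eq: "seq_map n (map \<sigma> v) = \<sigma> \<circ> seq_map n v"
    using v permutes_not_in[OF s] by (auto simp: seq_map_def fun_eq_iff)
  have "seq_map n v permutes {1..n}" if "seq_map n (map \<sigma> v) permutes {1..n}"
  proof -
    have "inv_into UNIV \<sigma> \<circ> seq_map n (map \<sigma> v) = seq_map n v"
      unfolding eq comp_assoc[symmetric] permutes_inv_o(2)[OF s] by simp
    then show ?thesis using permutes_compose[OF that permutes_inv[OF s]] by simp
  qed
  moreover have "seq_map n (map \<sigma> v) permutes {1..n}" if "seq_map n v permutes {1..n}"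
    unfolding eq by (rule permutes_compose[OF that s])
  moreover have "sign (\<sigma> \<circ> seq_map n v) = sign \<sigma> * sign (seq_map n v)" if "seq_map n v permutes {1..n}"
    using permutes_imp_permutation[OF _ s] permutes_imp_permutation[OF _ that] by (intro sign_compose) auto
  ultimately show ?thesis by (auto simp: seq_sign_def eq)
qed

lemma take_omit_less: "i < n \<Longrightarrow> n < length r \<Longrightarrow> take n (omit i r) = omit i (take (Suc n) r)"
  by (simp add: drop_take min_absorb1)

text \<open>After the deletion the old entry \<open>n\<close> has index \<open>n - 1\<close>, so the
  part that is kept starts with it.\<close>

lemma drop_omit_less: "i < n \<Longrightarrow> n < length r \<Longrightarrow> drop (n - 1) (omit i r) = drop n r"
  by (simp add: min_absorb2)

lemma take_omit_ge: "n \<le> i \<Longrightarrow> i < length r \<Longrightarrow> take n (omit i r) = take n r"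
  by (simp add: min_absorb1)

text \<open>The entry with index \<open>n - 1\<close> belongs both to the first \<open>n\<close>
  entries and to the part that is kept. Counted from there, entry \<open>n + k\<close> has index
  \<open>k + 1\<close>.\<close>

lemma drop_omit_ge:
  assumes "1 \<le> n" "i < length r" "i = n + k"
  shows "drop (n - 1) (omit i r) = omit (Suc k) (drop (n - 1) r)"
proof -
  have "Suc k + (n - 1) = i" "Suc (Suc k) + (n - 1) = Suc i" using assms by auto
  moreover have "drop (n - 1) (take i r) = take (i - (n - 1)) (drop (n - 1) r)" by (rule drop_take)
  moreover have "i - (n - 1) = Suc k" using assms by simp
  ultimately show ?thesis using assms(2,3) by (simp add: drop_append min_absorb2 drop_drop One_nat_def)
qed

context be_complex
begin

lemma be_tuples_negative: "d < 0 \<Longrightarrow> r \<notin> be_tuples n d"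
  by (cases r) (auto simp: be_tuples_def)

text \<open>In negative degrees every equation between chains is trivial; this settles the cases
  excluded by the condition \<open>0 \<le> d\<close> in the stabilization.\<close>

lemma be_module_negative: "d < 0 \<Longrightarrow> u \<in> carrier (B d) \<Longrightarrow> u = \<zero>\<^bsub>B d\<^esub>"
  by (rule linear_map_eq_on_be[OF be_module_module linear_map_id linear_map_const_zero[OF be_module_module be_module_module]])
     (simp_all add: be_tuples_negative)

abbreviation "stab \<equiv> stab_map R n"
abbreviation first_entries :: "(nat \<Rightarrow> nat) list \<Rightarrow> nat list"
  where "first_entries r \<equiv> map (\<lambda>\<rho>. \<rho> 1) (take n r)"

lemma stab_term_closed: "(if b then [(k :: int)] \<cdot>\<^bsub>B d\<^esub> bgen d r else \<zero>\<^bsub>B d\<^esub>) \<in> carrier (B d)"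
proof -
  interpret B: module R "B d" by (rule be_module_module)
  show ?thesis using bgen_closed[of d r] by simp
qed

lemma stab_linear: "e = d + int n - 1 \<Longrightarrow> linear_map R (B e) (B d) (stab d)"
  unfolding stab_map_def by (rule be_lift_linear[OF be_module_module stab_term_closed])

lemmas stab_closed = linear_map_closed[OF stab_linear]

text \<open>The coefficient is zero when the first values do not form a permutation. On degenerate
  tuples both sides vanish: a repeated pair among the first \<open>n\<close> entries repeats a first
  value, and any other repeated pair survives in the part that is kept.\<close>

lemma stab_gen:
  assumes "1 \<le> n" "r \<in> perm_lists n e" "e = d + int n - 1"
  shows "stab d (bgen e r) =
    (if 0 \<le> d then [seq_sign n (first_entries r)] \<cdot>\<^bsub>B d\<^esub> bgen d (drop (n - 1) r) else \<zero>\<^bsub>B d\<^esub>)"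
proof -
  interpret B: module R "B d" by (rule be_module_module)
  have len: "int (length r) = d + int n" using assms(2,3) by (simp add: perm_lists_def)
  show ?thesis
  proof (cases "0 \<le> d")
    case False
    have "stab d (bgen e r) \<in> carrier (B d)" by (rule stab_closed[OF assms(3) bgen_closed])
    then show ?thesis using False be_module_negative by simp
  next
    case True
    then have nr: "n \<le> length r" using len by simp
    have fv: "first_values n r = seq_map n (first_entries r)"
    proof
      fix i show "first_values n r i = seq_map n (first_entries r) i"
        using nr by (cases i) (auto simp: first_values_def seq_map_def One_nat_def)
    qed
    show ?thesis
    proof (cases "r \<in> be_tuples n e")
      case t: True
      have "stab d (bgen e r) = (if 0 \<le> d \<and> first_values n r permutes {1..n}
          then [sign (first_values n r)] \<cdot>\<^bsub>B d\<^esub> bgen d (drop (n - 1) r) else \<zero>\<^bsub>B d\<^esub>)"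
        unfolding stab_map_def by (rule be_lift_gen[OF be_module_module stab_term_closed t])
      then show ?thesis using True by (simp add: fv seq_sign_def int_smult_0)
    next
      case False
      then have deg: "r = [] \<or> \<not> distinct_adj r" using assms(2) by (auto simp: be_tuples_perm_lists)
      then have "\<not> distinct_adj r" using nr assms(1) by auto
      then obtain u x v where r: "r = u @ x # x # v" using not_distinct_adj_split by blast
      have "seq_sign n (first_entries r) = 0 \<or> bgen d (drop (n - 1) r) = \<zero>\<^bsub>B d\<^esub>"
      \<comment> \<open>The condition says that both members of the pair have index below
        \<open>n\<close>. Otherwise both have index at least \<open>n - 1\<close>, where the kept
        part starts, since that entry is shared.\<close>
      proof (cases "length u + 2 \<le> n")
        case True
        have "first_entries r ! length u = first_entries r ! Suc (length u)"
        proof -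
          have "first_entries r ! j = (r ! j) 1" if "j < n" for j using that nr by simp
          moreover have "r ! length u = x" "r ! Suc (length u) = x" by (simp_all add: r nth_append)
          ultimately show ?thesis using True by simp
        qed
        then have "\<not> distinct (first_entries r)"
          using True nr by (intro notI) (auto dest!: nth_eq_iff_index_eq[where i = "length u" and j = "Suc (length u)"])
        then show ?thesis using seq_sign_distinct[of n "first_entries r"] nr by auto
      next
        case False
        then have "drop (n - 1) r = drop (n - 1) u @ x # x # v" by (simp add: r)
        then show ?thesis using not_distinct_adj_append bgen_zero by metis
      qed
      moreover have "stab d (bgen e r) = \<zero>\<^bsub>B d\<^esub>"
        using deg linear_map_zero[OF be_module_module be_module_module stab_linear[OF assms(3)]] by (simp add: bgen_zero)
      ultimately show ?thesis using linear_map_zero[OF be_module_module be_module_module linear_map_int_scale[OF be_module_module be_module_module linear_map_id]]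
        by (auto simp: int_smult_0)
    qed
  qed
qed

text \<open>The faces that delete one of the first \<open>n\<close> entries all keep the same part,
  and their coefficients add up, by the determinant identity, to the coefficient of face 0 of the
  kept part of the original tuple. The remaining faces give its faces 1, 2 and so on. The sign of
  \<open>n - 1\<close> is the one that the suspension puts into the differential.\<close>

lemma stab_bdry:
  assumes n: "1 \<le> n" and e: "e = d + int n - 1" and u: "u \<in> carrier (B e)"
  shows "stab (d - 1) (bdry e u) = [neg_one_pow (int n - 1)] \<cdot>\<^bsub>B (d - 1)\<^esub> bdry d (stab d u)"
proof -
  interpret B: module R "B (d - 1)" by (rule be_module_module)
  have e1: "e - 1 = d - 1 + int n - 1" using e by simp
  note lin = stab_linear[OF e1]
  have l1: "linear_map R (B e) (B (d - 1)) (\<lambda>u. stab (d - 1) (bdry e u))"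
    by (rule linear_map_comp[OF bdry_linear[OF refl] lin])
  have l2: "linear_map R (B e) (B (d - 1)) (\<lambda>u. [neg_one_pow (int n - 1)] \<cdot>\<^bsub>B (d - 1)\<^esub> bdry d (stab d u))"
    by (intro linear_map_int_scale be_module_module linear_map_comp[OF stab_linear[OF e] bdry_linear[OF refl]])
  show ?thesis
  \<comment> \<open>For \<open>d \<le> 0\<close> the target is zero. For positive \<open>d\<close> a
    tuple has at least \<open>n + 1\<close> entries, as many as the determinant identity
    needs.\<close>
  proof (cases "d \<le> 0")
    case True
    then show ?thesis
      using be_module_negative[OF _ linear_map_closed[OF l1 u]] be_module_negative[OF _ linear_map_closed[OF l2 u]] by simp
  next
    case False
    show ?thesis
    proof (rule linear_map_eq_on_be[OF be_module_module l1 l2 _ u])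
      fix r assume "r \<in> be_tuples n e"
      then have r: "r \<in> perm_lists n e" by (simp add: be_tuples_perm_lists)
      obtain D where D: "d = int D" using False by (metis nonneg_int_cases linear)
      have len: "length r = n + D" using r e D by (simp add: perm_lists_def)
      have D0: "0 < D" using False D by simp
      let ?s = "seq_sign n (first_entries r)"
      let ?f = "\<lambda>i. [(neg_one_pow (int i) * seq_sign n (first_entries (omit i r)))] \<cdot>\<^bsub>B (d - 1)\<^esub>
          bgen (d - 1) (drop (n - 1) (omit i r))"
      let ?q = "drop (n - 1) r"
      let ?g = "\<lambda>i. [(neg_one_pow (int n - 1) * (?s * neg_one_pow (int i)))] \<cdot>\<^bsub>B (d - 1)\<^esub> bgen (d - 1) (omit i ?q)"
      have fc: "?f i \<in> carrier (B (d - 1))" and gc: "?g i \<in> carrier (B (d - 1))" for i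
        by (intro int_smult_closed[OF be_module_module] bgen_closed)+
      have q: "?q \<in> perm_lists n d"
        using r len n D by (auto simp: perm_lists_def dest: in_set_dropD)
      have lq: "length ?q = Suc D" using len n by simp
      have "stab (d - 1) (bdry e (bgen e r)) =
        (\<Oplus>\<^bsub>B (d - 1)\<^esub>i\<in>{..<n + D}. stab (d - 1) ([neg_one_pow (int i)] \<cdot>\<^bsub>B (e - 1)\<^esub> bgen (e - 1) (omit i r)))"
        unfolding bdry_gen[OF r] face_sum_def len
        by (intro linear_map_finsum[OF be_module_module be_module_module lin] Pi_I int_smult_closed[OF be_module_module] bgen_closed)
      also have "\<dots> = (\<Oplus>\<^bsub>B (d - 1)\<^esub>i\<in>{..<n + D}. ?f i)"
      proof (rule B.finsum_cong'[OF refl Pi_I[OF fc]])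
        fix i assume "i \<in> {..<n + D}"
        then have o: "omit i r \<in> perm_lists n (e - 1)" using omit_perm_lists[OF r] len by simp
        have "0 \<le> d - 1" using False by simp
        then show "stab (d - 1) ([neg_one_pow (int i)] \<cdot>\<^bsub>B (e - 1)\<^esub> bgen (e - 1) (omit i r)) = ?f i"
          unfolding linear_map_int_smult[OF be_module_module be_module_module lin bgen_closed] stab_gen[OF n o e1]
          by (simp only: if_True int_smult_smult[OF be_module_module bgen_closed])
      qed
      also have "\<dots> = (\<Oplus>\<^bsub>B (d - 1)\<^esub>i\<in>{..<n}. ?f i) \<oplus>\<^bsub>B (d - 1)\<^esub> (\<Oplus>\<^bsub>B (d - 1)\<^esub>i\<in>{..<D}. ?f (n + i))"
        by (rule B.finsum_lessThan_add[OF fc])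
      also have "(\<Oplus>\<^bsub>B (d - 1)\<^esub>i\<in>{..<n}. ?f i) = ?g 0"
      proof -
        let ?v = "map (\<lambda>\<rho>. \<rho> 1) (take (Suc n) r)"
        let ?c = "\<lambda>i. neg_one_pow (int i) * seq_sign n (omit i ?v)"
        have lv: "length ?v = Suc n" using len D0 by simp
        have sv: "set ?v \<subseteq> {1..n}"
        proof -
          have "\<rho> 1 \<in> {1..n}" if "\<rho> \<in> set r" for \<rho>
            using that r n permutes_in_image[of \<rho> "{1..n}" 1] by (auto simp: perm_lists_def)
          then show ?thesis using set_take_subset[of "Suc n" r] by auto
        qed
        have "?f i = [?c i] \<cdot>\<^bsub>B (d - 1)\<^esub> bgen (d - 1) (drop n r)" if "i < n" for i
        proof -
          have "take n (omit i r) = omit i (take (Suc n) r)" "drop (n - 1) (omit i r) = drop n r"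
            using that len D0 by (intro take_omit_less drop_omit_less; simp)+
          then show ?thesis by (simp only: map_omit)
        qed
        then have "(\<Oplus>\<^bsub>B (d - 1)\<^esub>i\<in>{..<n}. ?f i) = (\<Oplus>\<^bsub>B (d - 1)\<^esub>i\<in>{..<n}. [?c i] \<cdot>\<^bsub>B (d - 1)\<^esub> bgen (d - 1) (drop n r))"
          by (intro B.finsum_cong'[OF refl]) (simp_all add: int_smult_closed[OF be_module_module] bgen_closed del: append_take_drop_id)
        also have "\<dots> = [(\<Sum>i<n. ?c i)] \<cdot>\<^bsub>B (d - 1)\<^esub> bgen (d - 1) (drop n r)"
          by (rule int_smult_sum[OF be_module_module bgen_closed])
        \<comment> \<open>The determinant identity runs over \<open>n + 1\<close> deletions.
          Deleting entry \<open>n\<close> leaves the first \<open>n\<close> entries themselves, so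
          the other terms add up to minus that one.\<close>
        also have "(\<Sum>i<n. ?c i) = neg_one_pow (int n - 1) * (?s * neg_one_pow (int 0))"
        proof -
          have "omit n ?v = first_entries r" using lv by (simp add: take_map)
          moreover have "(\<Sum>i<n. ?c i) + ?c n = 0"
            using seq_sign_omit_sum[OF lv sv] by (simp only: sum.lessThan_Suc)
          ultimately have "(\<Sum>i<n. ?c i) + neg_one_pow (int n) * ?s = 0" by (simp only:)
          then have "(\<Sum>i<n. ?c i) = - (neg_one_pow (int n) * ?s)" by (simp only: eq_neg_iff_add_eq_0)
          then show ?thesis by (simp only: neg_one_pow_pred) (simp add: neg_one_pow_def[of 0])
        qed
        also have "drop n r = omit 0 ?q" using n by (simp add: Suc_diff_le One_nat_def)
        finally show ?thesis .
      qed
      also have "(\<Oplus>\<^bsub>B (d - 1)\<^esub>i\<in>{..<D}. ?f (n + i)) = (\<Oplus>\<^bsub>B (d - 1)\<^esub>i\<in>{..<D}. ?g (Suc i))"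
      proof (rule B.finsum_cong'[OF refl Pi_I[OF gc]])
        fix i assume i: "i \<in> {..<D}"
        have "take n (omit (n + i) r) = take n r" "drop (n - 1) (omit (n + i) r) = omit (Suc i) ?q"
          using i len by (intro take_omit_ge drop_omit_ge[OF n]; simp)+
        moreover have "neg_one_pow (int (n + i)) * ?s = neg_one_pow (int n - 1) * (?s * neg_one_pow (int (Suc i)))"
          by (simp add: neg_one_pow_def)
        ultimately show "?f (n + i) = ?g (Suc i)" by (simp only:)
      qed
      also have "?g 0 \<oplus>\<^bsub>B (d - 1)\<^esub> (\<Oplus>\<^bsub>B (d - 1)\<^esub>i\<in>{..<D}. ?g (Suc i)) = (\<Oplus>\<^bsub>B (d - 1)\<^esub>i\<in>{..<Suc D}. ?g i)"
        by (rule B.finsum_lessThan_Suc_shift[OF Pi_I[OF gc], symmetric])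
      also have "\<dots> = [(neg_one_pow (int n - 1) * ?s)] \<cdot>\<^bsub>B (d - 1)\<^esub> face_sum d ?q"
        unfolding face_sum_def lq
        by (subst int_smult_finsum[OF be_module_module Pi_I[OF int_smult_closed[OF be_module_module bgen_closed]]])
           (simp only: int_smult_smult[OF be_module_module bgen_closed] mult.assoc)
      also have "\<dots> = [neg_one_pow (int n - 1)] \<cdot>\<^bsub>B (d - 1)\<^esub> bdry d (stab d (bgen e r))"
        using False
        by (simp add: stab_gen[OF n r e] linear_map_int_smult[OF be_module_module be_module_module bdry_linear[OF refl] bgen_closed]
            bdry_gen[OF q] int_smult_smult[OF be_module_module face_sum_closed])
      finally show "stab (d - 1) (bdry e (bgen e r)) =
          [neg_one_pow (int n - 1)] \<cdot>\<^bsub>B (d - 1)\<^esub> bdry d (stab d (bgen e r))" .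
    qed
  qed
qed

text \<open>The action composes the sequence of first values with \<open>\<sigma>\<close> and so
  multiplies its sign by that of \<open>\<sigma>\<close>. The suspension twists the action by the
  same sign.\<close>

lemma stab_act:
  assumes n: "1 \<le> n" and e: "e = d + int n - 1" and s: "\<sigma> permutes {1..n}" and u: "u \<in> carrier (B e)"
  shows "stab d (bact \<sigma> e u) = [sign \<sigma>] \<cdot>\<^bsub>B d\<^esub> bact \<sigma> d (stab d u)"
proof (rule linear_map_eq_on_be[OF be_module_module linear_map_comp[OF bact_linear stab_linear[OF e]] _ _ u])
  show "linear_map R (B e) (B d) (\<lambda>u. [sign \<sigma>] \<cdot>\<^bsub>B d\<^esub> bact \<sigma> d (stab d u))"
    by (intro linear_map_int_scale be_module_module linear_map_comp[OF stab_linear[OF e] bact_linear])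
  fix r assume "r \<in> be_tuples n e"
  then have r: "r \<in> perm_lists n e" by (simp add: be_tuples_perm_lists)
  show "stab d (bact \<sigma> e (bgen e r)) = [sign \<sigma>] \<cdot>\<^bsub>B d\<^esub> bact \<sigma> d (stab d (bgen e r))"
  proof (cases "0 \<le> d")
    case True
    have len: "int (length r) = d + int n" using r e by (simp add: perm_lists_def)
    have q: "drop (n - 1) r \<in> perm_lists n d"
      using r len n True by (auto simp: perm_lists_def dest: in_set_dropD)
    have "length (first_entries r) = n" using len True by simp
    then have "seq_sign n (map \<sigma> (first_entries r)) = sign \<sigma> * seq_sign n (first_entries r)"
      by (rule seq_sign_map[OF s])
    moreover have "map \<sigma> (first_entries r) = first_entries (map (\<lambda>\<rho>. \<sigma> \<circ> \<rho>) r)" by (simp add: take_map)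
    ultimately show ?thesis
      using True by (simp add: bact_gen[OF r s] stab_gen[OF n r e] stab_gen[OF n perm_lists_map[OF r s] e] drop_map
          linear_map_int_smult[OF be_module_module be_module_module bact_linear bgen_closed] bact_gen[OF q s]
          int_smult_smult[OF be_module_module bgen_closed])
  next
    case False
    then show ?thesis
      using be_module_negative[OF _ stab_closed[OF e linear_map_closed[OF bact_linear bgen_closed]]]
        be_module_negative[OF _ int_smult_closed[OF be_module_module linear_map_closed[OF bact_linear stab_closed[OF e bgen_closed]]]]
      by simp
  qed
qed

subsection \<open>The last permutation\<close>

text \<open>The stabilization preserves the last permutation of a tuple, so that the tuples ending with the
  identity generate each term of the tower freely over the group ring, compatibly with the tower.\<close>

definition last_id :: "((nat \<Rightarrow> nat) list \<Rightarrow> 'k) \<Rightarrow> (nat \<Rightarrow> nat) list \<Rightarrow> 'k"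
  where "last_id u = (\<lambda>r. if r \<noteq> [] \<and> last r = id then u r else \<zero>\<^bsub>R\<^esub>)"

lemma last_id_linear: "linear_map R (B d) (B d) last_id"
proof -
  interpret R: cring R by (rule cring)
  show ?thesis
  proof (rule linear_mapI)
    fix u assume u: "u \<in> carrier (B d)"
    have "{s. last_id u s \<noteq> \<zero>\<^bsub>R\<^esub>} \<subseteq> {s. u s \<noteq> \<zero>\<^bsub>R\<^esub>}" by (auto simp: last_id_def)
    moreover from this have "finite {s. last_id u s \<noteq> \<zero>\<^bsub>R\<^esub>}"
      using u by (auto simp: be_module_def free_module_simps intro: finite_subset)
    moreover have "last_id u s \<in> carrier R" for s
      using u by (auto simp: be_module_def free_module_simps last_id_def)
    ultimately show "last_id u \<in> carrier (B d)"
      using u unfolding be_module_def free_module_simps by blast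
  qed (auto simp: last_id_def be_module_def free_module_simps)
qed

lemma last_id_gen:
  "last_id (bgen d r) = (if r \<noteq> [] \<and> last r = id then bgen d r else \<zero>\<^bsub>B d\<^esub>)"
  by (auto simp: last_id_def be_gen_def free_gen_def be_module_def free_module_simps fun_eq_iff)

lemma stab_last_id:
  assumes n: "1 \<le> n" and e: "e = d + int n - 1" and u: "u \<in> carrier (B e)"
  shows "stab d (last_id u) = last_id (stab d u)"
proof (rule linear_map_eq_on_be[OF be_module_module linear_map_comp[OF last_id_linear stab_linear[OF e]]
      linear_map_comp[OF stab_linear[OF e] last_id_linear] _ u])
  interpret B: module R "B d" by (rule be_module_module)
  fix r assume "r \<in> be_tuples n e"
  then have r: "r \<in> perm_lists n e" "r \<noteq> []" by (simp_all add: be_tuples_perm_lists)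
  note z = linear_map_zero[OF be_module_module be_module_module stab_linear[OF e]]
    linear_map_zero[OF be_module_module be_module_module last_id_linear]
  show "stab d (last_id (bgen e r)) = last_id (stab d (bgen e r))"
  proof (cases "0 \<le> d")
    case True
    \<comment> \<open>In degree \<open>d \<ge> 0\<close> there are at least \<open>n\<close>
      entries, so dropping \<open>n - 1\<close> of them leaves a non-empty tuple with the same last
      entry.\<close>
    have "int (length r) = d + int n" using r e by (simp add: perm_lists_def)
    then have "drop (n - 1) r \<noteq> []" "last (drop (n - 1) r) = last r" using True n by auto
    then show ?thesis
      using True r(2) by (simp add: last_id_gen stab_gen[OF n r(1) e] z
          linear_map_int_smult[OF be_module_module be_module_module last_id_linear bgen_closed])
  next
    case False
    then show ?thesis by (simp add: last_id_gen stab_gen[OF n r(1) e] z)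
  qed
qed

text \<open>On a single tuple exactly one summand survives, the one for the inverse of its last
  permutation: that translate ends with the identity, and translating back returns the
  tuple.\<close>

lemma last_id_sum:
  assumes u: "u \<in> carrier (B d)"
  shows "(\<Oplus>\<^bsub>B d\<^esub>\<rho>\<in>{\<rho>. \<rho> permutes {1..n}}. bact (inv_into UNIV \<rho>) d (last_id (bact \<rho> d u))) = u"
proof (rule linear_map_eq_on_be[OF be_module_module _ linear_map_id _ u])
  interpret B: module R "B d" by (rule be_module_module)
  let ?S = "{\<rho>. \<rho> permutes {1..n}}"
  have fin: "finite ?S" by (rule finite_permutations) simp
  show "linear_map R (B d) (B d) (\<lambda>u. \<Oplus>\<^bsub>B d\<^esub>\<rho>\<in>?S. bact (inv_into UNIV \<rho>) d (last_id (bact \<rho> d u)))"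
    by (intro linear_map_sum be_module_module fin linear_map_comp[OF linear_map_comp[OF bact_linear last_id_linear] bact_linear])
  fix r assume "r \<in> be_tuples n d"
  then have r: "r \<in> perm_lists n d" "r \<noteq> []" by (simp_all add: be_tuples_perm_lists)
  let ?l = "inv_into UNIV (last r)"
  have l: "last r permutes {1..n}" using r last_in_set by (auto simp: perm_lists_def)
  have "(\<Oplus>\<^bsub>B d\<^esub>\<rho>\<in>?S. bact (inv_into UNIV \<rho>) d (last_id (bact \<rho> d (bgen d r)))) =
    (\<Oplus>\<^bsub>B d\<^esub>\<rho>\<in>?S. if ?l = \<rho> then bgen d r else \<zero>\<^bsub>B d\<^esub>)"
  proof (rule B.finsum_cong'[OF refl])
    show "(\<lambda>\<rho>. if ?l = \<rho> then bgen d r else \<zero>\<^bsub>B d\<^esub>) \<in> ?S \<rightarrow> carrier (B d)" using bgen_closed by simp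
    fix \<rho> assume "\<rho> \<in> ?S"
    then have p: "\<rho> permutes {1..n}" by simp
    note m = perm_lists_map[OF r(1) p]
    have iff: "\<rho> \<circ> last r = id \<longleftrightarrow> ?l = \<rho>"
    proof
      assume "\<rho> \<circ> last r = id"
      then have "\<rho> \<circ> (last r \<circ> ?l) = ?l" by (simp add: comp_assoc[symmetric])
      then show "?l = \<rho>" by (simp add: permutes_inv_o[OF l])
    qed (use permutes_inv_o[OF l] in auto)
    have "map (\<lambda>\<tau>. inv_into UNIV \<rho> \<circ> \<tau>) (map (\<lambda>\<tau>. \<rho> \<circ> \<tau>) r) = r"
      by (simp add: comp_assoc[symmetric] permutes_inv_o[OF p] o_def[of "(\<circ>) (inv_into UNIV \<rho>)"])
    then have "bact (inv_into UNIV \<rho>) d (bgen d (map (\<lambda>\<tau>. \<rho> \<circ> \<tau>) r)) = bgen d r"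
      using bact_gen[OF m permutes_inv[OF p]] by (simp only:)
    then show "bact (inv_into UNIV \<rho>) d (last_id (bact \<rho> d (bgen d r))) = (if ?l = \<rho> then bgen d r else \<zero>\<^bsub>B d\<^esub>)"
      using r(2) linear_map_zero[OF be_module_module be_module_module bact_linear]
      by (simp add: bact_gen[OF r(1) p] last_id_gen last_map iff)
  qed
  also have "\<dots> = bgen d r"
    using B.finsum_singleton[of ?l ?S "\<lambda>_. bgen d r"] permutes_inv[OF l] fin bgen_closed by simp
  finally show "(\<Oplus>\<^bsub>B d\<^esub>\<rho>\<in>?S. bact (inv_into UNIV \<rho>) d (last_id (bact \<rho> d (bgen d r)))) = bgen d r" .
qed

end

subsection \<open>The stable complexes\<close>

lemma pointwise_module_simps:
  "carrier (pointwise_module M A) = A"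
  "\<zero>\<^bsub>pointwise_module M A\<^esub> = (\<lambda>i. \<zero>\<^bsub>M i\<^esub>)"
  "u \<oplus>\<^bsub>pointwise_module M A\<^esub> v = (\<lambda>i. u i \<oplus>\<^bsub>M i\<^esub> v i)"
  "c \<odot>\<^bsub>pointwise_module M A\<^esub> u = (\<lambda>i. c \<odot>\<^bsub>M i\<^esub> u i)"
  by (simp_all add: pointwise_module_def)

lemma pointwise_module_module:
  assumes R: "cring R" and M: "\<And>i. module R (M i)" and A: "\<And>u i. u \<in> A \<Longrightarrow> u i \<in> carrier (M i)"
    and zero: "(\<lambda>i. \<zero>\<^bsub>M i\<^esub>) \<in> A"
    and add: "\<And>u v. u \<in> A \<Longrightarrow> v \<in> A \<Longrightarrow> (\<lambda>i. u i \<oplus>\<^bsub>M i\<^esub> v i) \<in> A"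
    and smult: "\<And>c u. c \<in> carrier R \<Longrightarrow> u \<in> A \<Longrightarrow> (\<lambda>i. c \<odot>\<^bsub>M i\<^esub> u i) \<in> A"
  shows "module R (pointwise_module M A)"
proof -
  interpret R: cring R by (rule R)
  have ag: "abelian_group (M i)" for i using M[of i] by (simp add: module_def)
  have am: "abelian_monoid (M i)" for i using ag[of i] by (simp add: abelian_group_def)
  note mon = abelian_monoid.a_assoc[OF am] abelian_monoid.l_zero[OF am]
  show ?thesis
  proof (rule moduleI)
    show "abelian_group (pointwise_module M A)"
    proof (rule abelian_groupI)
      fix u v w assume "u \<in> carrier (pointwise_module M A)" "v \<in> carrier (pointwise_module M A)" "w \<in> carrier (pointwise_module M A)"
      then show "u \<oplus>\<^bsub>pointwise_module M A\<^esub> v \<oplus>\<^bsub>pointwise_module M A\<^esub> w = u \<oplus>\<^bsub>pointwise_module M A\<^esub> (v \<oplus>\<^bsub>pointwise_module M A\<^esub> w)"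
        by (simp add: pointwise_module_simps A mon)
    next
      fix u v assume "u \<in> carrier (pointwise_module M A)" "v \<in> carrier (pointwise_module M A)"
      then show "u \<oplus>\<^bsub>pointwise_module M A\<^esub> v = v \<oplus>\<^bsub>pointwise_module M A\<^esub> u"
        by (simp add: pointwise_module_simps A abelian_monoid.a_comm[OF am])
    next
      fix u assume u: "u \<in> carrier (pointwise_module M A)"
      then have uA: "u \<in> A" by (simp add: pointwise_module_simps)
      \<comment> \<open>The negative is taken as a multiple by minus one, because the set
        \<open>A\<close> is known to be closed under scalars.\<close>
      have "(\<ominus>\<^bsub>R\<^esub> \<one>\<^bsub>R\<^esub>) \<odot>\<^bsub>M i\<^esub> u i \<oplus>\<^bsub>M i\<^esub> u i = \<zero>\<^bsub>M i\<^esub>" for i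
        using A[OF uA, of i] abelian_group.l_neg[OF ag, of "u i"]
        by (simp add: module.smult_l_minus[OF M] module.smult_one[OF M])
      then show "\<exists>v\<in>carrier (pointwise_module M A). v \<oplus>\<^bsub>pointwise_module M A\<^esub> u = \<zero>\<^bsub>pointwise_module M A\<^esub>"
        using smult[OF _ uA, of "\<ominus>\<^bsub>R\<^esub> \<one>\<^bsub>R\<^esub>"] unfolding pointwise_module_simps
        by (intro bexI[of _ "\<lambda>i. (\<ominus>\<^bsub>R\<^esub> \<one>\<^bsub>R\<^esub>) \<odot>\<^bsub>M i\<^esub> u i"]) simp_all
      show "\<zero>\<^bsub>pointwise_module M A\<^esub> \<oplus>\<^bsub>pointwise_module M A\<^esub> u = u"
        using uA by (simp add: pointwise_module_simps A mon)
    qed (simp_all add: pointwise_module_simps zero add)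
  qed (simp_all add: pointwise_module_simps R A smult module.smult_l_distr[OF M] module.smult_r_distr[OF M]
      module.smult_assoc1[OF M] module.smult_one[OF M])
qed

lemma pointwise_linear:
  assumes "\<And>i. linear_map R (M i) (N i) (f i)" "\<And>u i. u \<in> A \<Longrightarrow> u i \<in> carrier (M i)"
    and "\<And>u. u \<in> A \<Longrightarrow> (\<lambda>i. f i (u i)) \<in> A'"
  shows "linear_map R (pointwise_module M A) (pointwise_module N A') (\<lambda>u i. f i (u i))"
  by (rule linear_mapI)
     (simp_all add: pointwise_module_simps assms(2,3) linear_map_add[OF assms(1)] linear_map_smult[OF assms(1)])

lemma pointwise_eval_linear:
  "(\<And>u. u \<in> A \<Longrightarrow> u i \<in> carrier (M i)) \<Longrightarrow> linear_map R (pointwise_module M A) (M i) (\<lambda>u. u i)"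
  by (rule linear_mapI) (simp_all add: pointwise_module_simps)

context be_complex
begin

text \<open>Each suspension shifts degrees by \<open>n - 1\<close>, so elements of degree
  \<open>d\<close> at stage \<open>k\<close> are chains of this degree in the unsuspended
  complex.\<close>

definition tower_deg :: "int \<Rightarrow> nat \<Rightarrow> int"
  where "tower_deg d k = d + int k * (int n - 1)"

lemma tower_deg_Suc: "tower_deg d (Suc k) = tower_deg d k + int n - 1"
  and tower_deg_shift: "tower_deg (d + int n - 1) k = tower_deg d (Suc k)"
  and tower_deg_pred: "tower_deg (d - 1) k = tower_deg d k - 1"
  by (simp_all add: tower_deg_def algebra_simps)

lemma be_tower_Suc: "be_tower R (Suc k) = suspension (be_tower R k)"
  by (simp add: be_tower_def)

lemma obj_be_tower: "obj (be_tower R k n) d = B (tower_deg d k)"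
proof (induction k arbitrary: d)
  case 0
  show ?case by (simp add: be_tower_def tower_deg_def barratt_eccles_def)
next
  case (Suc k)
  show ?case by (simp add: be_tower_Suc suspension_def Suc tower_deg_shift)
qed

text \<open>Each of the \<open>k\<close> suspensions contributes the sign of a shift by
  \<open>1 - n\<close>, and the signs multiply.\<close>

lemma dif_be_tower:
  assumes "u \<in> carrier (B (tower_deg d k))"
  shows "dif (be_tower R k n) d u =
    [neg_one_pow (int k * (1 - int n))] \<cdot>\<^bsub>B (tower_deg d k - 1)\<^esub> bdry (tower_deg d k) u"
  using assms
proof (induction k arbitrary: d)
  case 0
  then show ?case using linear_map_closed[OF bdry_linear[OF refl]] int_smult_1[OF be_module_module]
    by (simp add: be_tower_def tower_deg_def neg_one_pow_def)
next
  case (Suc k)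
  have u: "u \<in> carrier (B (tower_deg (d + int n - 1) k))" using Suc.prems by (simp add: tower_deg_shift)
  have "tower_deg (d + int n - 2) k = tower_deg d (Suc k) - 1"
    by (simp add: tower_deg_def algebra_simps)
  then have o: "obj (be_tower R k n) (d + int n - 2) = B (tower_deg d (Suc k) - 1)"
    by (simp only: obj_be_tower)
  have "dif (be_tower R (Suc k) n) d u = [neg_one_pow (1 - int n)] \<cdot>\<^bsub>B (tower_deg d (Suc k) - 1)\<^esub>
     dif (be_tower R k n) (d + int n - 1) u"
    by (simp add: be_tower_Suc suspension_def o)
  also have "\<dots> = [(neg_one_pow (1 - int n) * neg_one_pow (int k * (1 - int n)))] \<cdot>\<^bsub>B (tower_deg d (Suc k) - 1)\<^esub>
     bdry (tower_deg d (Suc k)) u"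
    unfolding Suc.IH[OF u] tower_deg_shift
    by (rule int_smult_smult[OF be_module_module linear_map_closed[OF bdry_linear[OF refl] Suc.prems]])
  also have "neg_one_pow (1 - int n) * neg_one_pow (int k * (1 - int n)) = neg_one_pow (int (Suc k) * (1 - int n))"
    unfolding neg_one_pow_add[symmetric] by (simp add: algebra_simps)
  finally show ?case .
qed

lemma act_be_tower:
  assumes "u \<in> carrier (B (tower_deg d k))"
  shows "act (be_tower R k n) \<sigma> d u = [(sign \<sigma> ^ k)] \<cdot>\<^bsub>B (tower_deg d k)\<^esub> bact \<sigma> (tower_deg d k) u"
  using assms
proof (induction k arbitrary: d)
  case 0
  then show ?case using linear_map_closed[OF bact_linear] int_smult_1[OF be_module_module]
    by (simp add: be_tower_def tower_deg_def)
next
  case (Suc k)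
  have u: "u \<in> carrier (B (tower_deg (d + int n - 1) k))" using Suc.prems by (simp add: tower_deg_shift)
  have "act (be_tower R (Suc k) n) \<sigma> d u = [sign \<sigma>] \<cdot>\<^bsub>B (tower_deg d (Suc k))\<^esub> act (be_tower R k n) \<sigma> (d + int n - 1) u"
    by (simp add: be_tower_Suc suspension_def obj_be_tower tower_deg_shift)
  also have "\<dots> = [(sign \<sigma> * sign \<sigma> ^ k)] \<cdot>\<^bsub>B (tower_deg d (Suc k))\<^esub> bact \<sigma> (tower_deg d (Suc k)) u"
    unfolding Suc.IH[OF u] tower_deg_shift
    by (rule int_smult_smult[OF be_module_module linear_map_closed[OF bact_linear Suc.prems]])
  finally show ?case by simp
qed

lemma be_tower_map_conv: "be_tower_map R k n d = stab (tower_deg d k)"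
proof (induction k arbitrary: d)
  case 0
  show ?case by (simp add: be_tower_map_def tower_deg_def)
next
  case (Suc k)
  have "be_tower_map R (Suc k) n d = be_tower_map R k n (d + int n - 1)"
    by (simp add: be_tower_map_def suspension_map_def)
  then show ?case by (simp add: Suc tower_deg_shift)
qed

section \<open>The inverse limit, stage by stage\<close>

definition stable_carrier :: "int \<Rightarrow> (nat \<Rightarrow> (nat \<Rightarrow> nat) list \<Rightarrow> 'k) set"
  where "stable_carrier d =
    (if n = 0 then {\<lambda>k. \<zero>\<^bsub>B (tower_deg d k)\<^esub>}
     else {x. (\<forall>k. x k \<in> carrier (B (tower_deg d k))) \<and> (\<forall>k. stab (tower_deg d k) (x (Suc k)) = x k)})"

abbreviation "stable_obj d \<equiv> pointwise_module (\<lambda>k. B (tower_deg d k)) (stable_carrier d)"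

lemma obj_stable: "obj (stable_barratt_eccles R n) d = stable_obj d"
  by (simp only: stable_barratt_eccles_def stable_carrier_def obj_be_tower be_tower_map_conv complex_rec.simps)

lemma stable_carrier_zero_arity: "n = 0 \<Longrightarrow> x \<in> stable_carrier d \<longleftrightarrow> x = (\<lambda>k. \<zero>\<^bsub>B (tower_deg d k)\<^esub>)"
  unfolding stable_carrier_def by (subst if_P) simp_all

lemma stable_carrier_pos_arity:
  "n \<noteq> 0 \<Longrightarrow> x \<in> stable_carrier d \<longleftrightarrow>
    (\<forall>k. x k \<in> carrier (B (tower_deg d k))) \<and> (\<forall>k. stab (tower_deg d k) (x (Suc k)) = x k)"
  unfolding stable_carrier_def by (subst if_not_P) simp_all

lemma stable_carrier_closed:
  assumes "x \<in> stable_carrier d" shows "x k \<in> carrier (B (tower_deg d k))"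
proof (cases "n = 0")
  case True
  interpret B: module R "B (tower_deg d k)" by (rule be_module_module)
  from iffD1[OF stable_carrier_zero_arity[OF True] assms] show ?thesis by (simp only: B.zero_closed)
next
  case False
  from iffD1[OF stable_carrier_pos_arity[OF False] assms] show ?thesis by blast
qed

text \<open>The differential, the action and the projection are all given by families of maps on the
  stages. This is how they descend to the limit: commuting with the stabilization preserves
  compatible sequences, and in arity 0 linearity preserves the zero sequence.\<close>

lemma stable_carrier_map:
  assumes lin: "\<And>k. linear_map R (B (tower_deg d k)) (B (tower_deg e k)) (f k)"
    and comm: "\<And>k u. 1 \<le> n \<Longrightarrow> u \<in> carrier (B (tower_deg d (Suc k))) \<Longrightarrow>
      stab (tower_deg e k) (f (Suc k) u) = f k (stab (tower_deg d k) u)"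
    and x: "x \<in> stable_carrier d"
  shows "(\<lambda>k. f k (x k)) \<in> stable_carrier e"
proof (cases "n = 0")
  case True
  from iffD1[OF stable_carrier_zero_arity[OF True] x] show ?thesis
    by (simp only: stable_carrier_zero_arity[OF True] linear_map_zero[OF be_module_module be_module_module lin])
next
  case False
  then have n: "1 \<le> n" by simp
  have "stab (tower_deg d k) (x (Suc k)) = x k" for k
    using x by (simp add: stable_carrier_pos_arity[OF False])
  then show ?thesis
    using comm[OF n stable_carrier_closed[OF x]] linear_map_closed[OF lin stable_carrier_closed[OF x]]
    by (simp add: stable_carrier_pos_arity[OF False])
qed

lemma stab_tower_linear: "linear_map R (B (tower_deg d (Suc k))) (B (tower_deg d k)) (stab (tower_deg d k))"
  by (rule stab_linear) (rule tower_deg_Suc)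

lemma stable_obj_module: "module R (stable_obj d)"
proof (rule pointwise_module_module[OF cring])
  have m: "\<zero>\<^bsub>B e\<^esub> \<in> carrier (B e)" "x \<in> carrier (B e) \<Longrightarrow> y \<in> carrier (B e) \<Longrightarrow> x \<oplus>\<^bsub>B e\<^esub> y \<in> carrier (B e)"
    "c \<in> carrier R \<Longrightarrow> x \<in> carrier (B e) \<Longrightarrow> c \<odot>\<^bsub>B e\<^esub> x \<in> carrier (B e)"
    "\<zero>\<^bsub>B e\<^esub> \<oplus>\<^bsub>B e\<^esub> \<zero>\<^bsub>B e\<^esub> = \<zero>\<^bsub>B e\<^esub>" "c \<in> carrier R \<Longrightarrow> c \<odot>\<^bsub>B e\<^esub> \<zero>\<^bsub>B e\<^esub> = \<zero>\<^bsub>B e\<^esub>"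
    for e x y c
  proof -
    interpret B: module R "B e" by (rule be_module_module)
    show "\<zero>\<^bsub>B e\<^esub> \<in> carrier (B e)" "x \<in> carrier (B e) \<Longrightarrow> y \<in> carrier (B e) \<Longrightarrow> x \<oplus>\<^bsub>B e\<^esub> y \<in> carrier (B e)"
      "c \<in> carrier R \<Longrightarrow> x \<in> carrier (B e) \<Longrightarrow> c \<odot>\<^bsub>B e\<^esub> x \<in> carrier (B e)"
      "\<zero>\<^bsub>B e\<^esub> \<oplus>\<^bsub>B e\<^esub> \<zero>\<^bsub>B e\<^esub> = \<zero>\<^bsub>B e\<^esub>" "c \<in> carrier R \<Longrightarrow> c \<odot>\<^bsub>B e\<^esub> \<zero>\<^bsub>B e\<^esub> = \<zero>\<^bsub>B e\<^esub>" by simp_all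
  qed
  show z: "(\<lambda>k. \<zero>\<^bsub>B (tower_deg d k)\<^esub>) \<in> stable_carrier d"
  proof (cases "n = 0")
    case True
    show ?thesis by (simp only: stable_carrier_zero_arity[OF True])
  next
    case False
    then show ?thesis
      using linear_map_zero[OF be_module_module be_module_module stab_tower_linear]
      by (simp add: stable_carrier_pos_arity m)
  qed
  fix u assume u: "u \<in> stable_carrier d"
  note uc = stable_carrier_closed[OF u]
  { fix v assume v: "v \<in> stable_carrier d"
    note vc = stable_carrier_closed[OF v]
    show "(\<lambda>k. u k \<oplus>\<^bsub>B (tower_deg d k)\<^esub> v k) \<in> stable_carrier d"
    proof (cases "n = 0")
      case True
      show ?thesis
        using u v z unfolding stable_carrier_zero_arity[OF True] by (simp only: m)
    next
      case False
      then show ?thesis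
        using u v linear_map_add[OF stab_tower_linear uc vc] uc vc by (simp add: stable_carrier_pos_arity m)
    qed }
  { fix c assume c: "c \<in> carrier R"
    show "(\<lambda>k. c \<odot>\<^bsub>B (tower_deg d k)\<^esub> u k) \<in> stable_carrier d"
    proof (cases "n = 0")
      case True
      show ?thesis
        using u c unfolding stable_carrier_zero_arity[OF True] by (simp only: m)
    next
      case False
      then show ?thesis
        using u linear_map_smult[OF stab_tower_linear c uc] uc c by (simp add: stable_carrier_pos_arity m)
    qed }
qed (rule be_module_module stable_carrier_closed, assumption?)+

lemma stable_linear:
  assumes "\<And>k. linear_map R (B (tower_deg d k)) (B (tower_deg e k)) (f k)"
    and "\<And>x. x \<in> stable_carrier d \<Longrightarrow> (\<lambda>k. f k (x k)) \<in> stable_carrier e"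
  shows "linear_map R (stable_obj d) (stable_obj e) (\<lambda>x k. f k (x k))"
  by (rule pointwise_linear) (use assms stable_carrier_closed in \<open>simp_all\<close>)

definition tower_dif :: "int \<Rightarrow> nat \<Rightarrow> ((nat \<Rightarrow> nat) list \<Rightarrow> 'k) \<Rightarrow> (nat \<Rightarrow> nat) list \<Rightarrow> 'k"
  where "tower_dif d k u = [neg_one_pow (int k * (1 - int n))] \<cdot>\<^bsub>B (tower_deg (d - 1) k)\<^esub> bdry (tower_deg d k) u"

definition tower_act :: "(nat \<Rightarrow> nat) \<Rightarrow> int \<Rightarrow> nat \<Rightarrow> ((nat \<Rightarrow> nat) list \<Rightarrow> 'k) \<Rightarrow> (nat \<Rightarrow> nat) list \<Rightarrow> 'k"
  where "tower_act \<sigma> d k u = [(sign \<sigma> ^ k)] \<cdot>\<^bsub>B (tower_deg d k)\<^esub> bact \<sigma> (tower_deg d k) u"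

lemma tower_dif_linear: "e = d - 1 \<Longrightarrow> linear_map R (B (tower_deg d k)) (B (tower_deg e k)) (tower_dif d k)"
  unfolding tower_dif_def by (simp add: linear_map_int_scale[OF be_module_module be_module_module bdry_linear] tower_deg_pred)

lemma tower_act_linear: "linear_map R (B (tower_deg d k)) (B (tower_deg d k)) (tower_act \<sigma> d k)"
  unfolding tower_act_def by (rule linear_map_int_scale[OF be_module_module be_module_module bact_linear])

lemma dif_stable: "x \<in> stable_carrier d \<Longrightarrow> dif (stable_barratt_eccles R n) d x = (\<lambda>k. tower_dif d k (x k))"
  by (simp add: stable_barratt_eccles_def tower_dif_def dif_be_tower stable_carrier_closed tower_deg_pred)

lemma act_stable: "x \<in> stable_carrier d \<Longrightarrow> act (stable_barratt_eccles R n) \<sigma> d x = (\<lambda>k. tower_act \<sigma> d k (x k))"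
  by (simp add: stable_barratt_eccles_def tower_act_def act_be_tower stable_carrier_closed)

text \<open>The sign of \<open>n - 1\<close> in \<open>stab_bdry\<close> turns the sign carried by
  stage \<open>k + 1\<close> into the one carried by stage \<open>k\<close>.\<close>

lemma tower_dif_stable:
  assumes x: "x \<in> stable_carrier d" and e: "e = d - 1"
  shows "(\<lambda>k. tower_dif d k (x k)) \<in> stable_carrier e"
proof (rule stable_carrier_map[OF tower_dif_linear[OF e] _ x])
  fix k u assume n: "1 \<le> n" and u: "u \<in> carrier (B (tower_deg d (Suc k)))"
  let ?D = "tower_deg d k"
  have lin: "linear_map R (B (tower_deg d (Suc k) - 1)) (B (?D - 1)) (stab (?D - 1))"
    by (rule stab_linear) (simp add: tower_deg_Suc)
  have bu: "bdry (tower_deg d (Suc k)) u \<in> carrier (B (tower_deg d (Suc k) - 1))"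
    by (rule linear_map_closed[OF bdry_linear[OF refl] u])
  have c: "bdry ?D (stab ?D u) \<in> carrier (B (?D - 1))"
    by (rule linear_map_closed[OF bdry_linear[OF refl] linear_map_closed[OF stab_tower_linear u]])
  have "neg_one_pow (int (Suc k) * (1 - int n)) * neg_one_pow (int n - 1) = neg_one_pow (int k * (1 - int n))"
    unfolding neg_one_pow_add[symmetric] by (simp add: algebra_simps)
  then show "stab (tower_deg e k) (tower_dif d (Suc k) u) = tower_dif d k (stab ?D u)"
    using stab_bdry[OF n tower_deg_Suc u] c
    by (simp add: tower_dif_def e tower_deg_pred linear_map_int_smult[OF be_module_module be_module_module lin bu]
        int_smult_smult[OF be_module_module])
qed

text \<open>Stage \<open>k + 1\<close> carries one more sign of \<open>\<sigma>\<close> than stage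
  \<open>k\<close>, and the stabilization contributes another one; the square is 1.\<close>

lemma tower_act_stable:
  assumes x: "x \<in> stable_carrier d" and s: "\<sigma> permutes {1..n}"
  shows "(\<lambda>k. tower_act \<sigma> d k (x k)) \<in> stable_carrier d"
proof (rule stable_carrier_map[OF tower_act_linear _ x])
  fix k u assume n: "1 \<le> n" and u: "u \<in> carrier (B (tower_deg d (Suc k)))"
  let ?D = "tower_deg d k"
  have bu: "bact \<sigma> (tower_deg d (Suc k)) u \<in> carrier (B (tower_deg d (Suc k)))"
    by (rule linear_map_closed[OF bact_linear u])
  have c: "bact \<sigma> ?D (stab ?D u) \<in> carrier (B ?D)"
    by (rule linear_map_closed[OF bact_linear linear_map_closed[OF stab_tower_linear u]])
  have "sign \<sigma> ^ Suc k * sign \<sigma> = sign \<sigma> ^ k * (sign \<sigma> * sign \<sigma>)" by simp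
  also have "sign \<sigma> * sign \<sigma> = 1" by (simp add: sign_def)
  finally have "sign \<sigma> ^ Suc k * sign \<sigma> = sign \<sigma> ^ k" by simp
  then show "stab ?D (tower_act \<sigma> d (Suc k) u) = tower_act \<sigma> d k (stab ?D u)"
    using stab_act[OF n tower_deg_Suc s u] c
    by (simp add: tower_act_def linear_map_int_smult[OF be_module_module be_module_module stab_tower_linear bu]
        int_smult_smult[OF be_module_module] del: power_Suc)
qed

lemma last_id_stable:
  assumes x: "x \<in> stable_carrier d"
  shows "(\<lambda>k. last_id (x k)) \<in> stable_carrier d"
  by (rule stable_carrier_map[OF last_id_linear stab_last_id[OF _ tower_deg_Suc] x])

lemma tower_dif_dif:
  assumes "u \<in> carrier (B (tower_deg d k))"
  shows "tower_dif (d - 1) k (tower_dif d k u) = \<zero>\<^bsub>B (tower_deg (d - 2) k)\<^esub>"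
proof -
  let ?D = "tower_deg d k"
  interpret B: module R "B (tower_deg (d - 2) k)" by (rule be_module_module)
  have "tower_deg (d - 1 - 1) k = ?D - 1 - 1" "?D - 1 - 1 = tower_deg (d - 2) k" "?D - 2 = tower_deg (d - 2) k"
    by (simp_all add: tower_deg_def)
  then show ?thesis
    using bdry_bdry[OF assms] linear_map_closed[OF bdry_linear[OF refl] assms]
    by (simp only: tower_dif_def tower_deg_pred linear_map_int_smult[OF be_module_module be_module_module bdry_linear[OF refl]]
        int_smult_smult[OF be_module_module] diff_diff_eq one_add_one) (simp add: B.add.int_pow_one)
qed

lemma tower_act_comp:
  assumes "\<sigma> permutes {1..n}" "\<tau> permutes {1..n}" "u \<in> carrier (B (tower_deg d k))"
  shows "tower_act (\<sigma> \<circ> \<tau>) d k u = tower_act \<sigma> d k (tower_act \<tau> d k u)"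
proof -
  have "sign (\<sigma> \<circ> \<tau>) = sign \<sigma> * sign \<tau>"
    using permutes_imp_permutation[OF _ assms(1)] permutes_imp_permutation[OF _ assms(2)] by (intro sign_compose) auto
  moreover note t = linear_map_closed[OF bact_linear assms(3)]
  ultimately show ?thesis
    by (simp add: tower_act_def linear_map_int_smult[OF be_module_module be_module_module bact_linear t]
        int_smult_smult[OF be_module_module linear_map_closed[OF bact_linear t]] bact_comp[OF assms] power_mult_distrib)
qed

lemma tower_act_dif:
  assumes "\<sigma> permutes {1..n}" "u \<in> carrier (B (tower_deg d k))"
  shows "tower_dif d k (tower_act \<sigma> d k u) = tower_act \<sigma> (d - 1) k (tower_dif d k u)"
proof -
  let ?D = "tower_deg d k"
  note b = linear_map_closed[OF bdry_linear[OF refl] assms(2)] and a = linear_map_closed[OF bact_linear assms(2)]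
  show ?thesis
    using bact_bdry[OF assms] linear_map_closed[OF bdry_linear[OF refl] a]
    by (simp add: tower_act_def tower_dif_def tower_deg_pred linear_map_int_smult[OF be_module_module be_module_module bact_linear b]
        linear_map_int_smult[OF be_module_module be_module_module bdry_linear[OF refl] a] int_smult_smult[OF be_module_module] mult.commute)
qed

abbreviation "stable_dagger \<equiv> dagger (stable_barratt_eccles R) n"

lemma stable_dagger_simps:
  "obj stable_dagger d = stable_obj (- d)"
  "x \<in> stable_carrier (- d) \<Longrightarrow> dif stable_dagger d x = (\<lambda>k. tower_dif (- d) k (x k))"
  "x \<in> stable_carrier (- d) \<Longrightarrow> act stable_dagger \<sigma> d x = (\<lambda>k. tower_act \<sigma> (- d) k (x k))"
  by (simp_all add: dagger_def obj_stable dif_stable act_stable)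

lemma stable_act_linear:
  assumes "\<sigma> permutes {1..n}"
  shows "linear_map R (stable_obj (- d)) (stable_obj (- d)) (act stable_dagger \<sigma> d)"
  by (rule linear_map_cong[OF stable_dagger_simps(3) stable_obj_module
        stable_linear[where f = "tower_act \<sigma> (- d)", OF tower_act_linear tower_act_stable[OF _ assms]]])
     (simp_all add: pointwise_module_simps)

lemma stable_dagger_sym_cochain: "sym_cochain R n stable_dagger"
  unfolding sym_cochain_def cochain_complex_def stable_dagger_simps(1)
proof (intro conjI allI impI ballI, unfold pointwise_module_simps(1))
  fix d
  show "module R (stable_obj (- d))" by (rule stable_obj_module)
  have e: "- (d + 1) = - d - 1" by simp
  show "linear_map R (stable_obj (- d)) (stable_obj (- (d + 1))) (dif stable_dagger d)"
    by (rule linear_map_cong[OF stable_dagger_simps(2) stable_obj_module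
          stable_linear[where f = "tower_dif (- d)", OF tower_dif_linear[OF e] tower_dif_stable[OF _ e]]])
       (simp_all add: pointwise_module_simps)
  fix x assume x: "x \<in> stable_carrier (- d)"
  note xc = stable_carrier_closed[OF x]
  have dx: "(\<lambda>k. tower_dif (- d) k (x k)) \<in> stable_carrier (- (d + 1))" by (rule tower_dif_stable[OF x e])
  have d2: "- (d + 2) = - d - 2" by simp
  show "dif stable_dagger (d + 1) (dif stable_dagger d x) = \<zero>\<^bsub>stable_obj (- (d + 2))\<^esub>"
    unfolding stable_dagger_simps(2)[OF x] stable_dagger_simps(2)[OF dx] pointwise_module_simps d2 e tower_dif_dif[OF xc] ..
  show "act stable_dagger id d x = x"
    using xc by (simp add: stable_dagger_simps(3)[OF x] tower_act_def bact_id int_smult_1[OF be_module_module])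
  fix \<sigma> assume s: "\<sigma> permutes {1..n}"
  have sx: "(\<lambda>k. tower_act \<sigma> (- d) k (x k)) \<in> stable_carrier (- d)" by (rule tower_act_stable[OF x s])
  show "dif stable_dagger d (act stable_dagger \<sigma> d x) = act stable_dagger \<sigma> (d + 1) (dif stable_dagger d x)"
    unfolding stable_dagger_simps(2)[OF x] stable_dagger_simps(3)[OF x] stable_dagger_simps(2)[OF sx] stable_dagger_simps(3)[OF dx]
      tower_act_dif[OF s xc] e ..
  fix \<tau> assume t: "\<tau> permutes {1..n}"
  have tx: "(\<lambda>k. tower_act \<tau> (- d) k (x k)) \<in> stable_carrier (- d)" by (rule tower_act_stable[OF x t])
  show "act stable_dagger (\<sigma> \<circ> \<tau>) d x = act stable_dagger \<sigma> d (act stable_dagger \<tau> d x)"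
    unfolding stable_dagger_simps(3)[OF x] stable_dagger_simps(3)[OF tx] tower_act_comp[OF s t xc] ..
qed (rule stable_act_linear)

definition stable_proj :: "(nat \<Rightarrow> (nat \<Rightarrow> nat) list \<Rightarrow> 'k) \<Rightarrow> nat \<Rightarrow> (nat \<Rightarrow> nat) list \<Rightarrow> 'k"
  where "stable_proj x = (\<lambda>k. last_id (x k))"

lemma stable_proj_linear: "linear_map R (stable_obj d) (stable_obj d) stable_proj"
  unfolding stable_proj_def by (rule stable_linear[where f = "\<lambda>_. last_id", OF last_id_linear last_id_stable])

text \<open>Evaluation at a stage is linear and the sum is finite, so the claim reduces to
  \<open>last_id_sum\<close> at every stage. The twists by the signs of \<open>\<rho>\<close> and of
  its inverse, each to the power \<open>k\<close>, multiply to 1.\<close>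

lemma stable_proj_sum:
  assumes x: "x \<in> carrier (obj stable_dagger d)"
  shows "(\<Oplus>\<^bsub>obj stable_dagger d\<^esub>\<rho>\<in>{\<rho>. \<rho> permutes {1..n}}.
    act stable_dagger (inv_into UNIV \<rho>) d (stable_proj (act stable_dagger \<rho> d x))) = x"
proof -
  let ?S = "{\<rho>. \<rho> permutes {1..n}}"
  let ?f = "\<lambda>\<rho>. act stable_dagger (inv_into UNIV \<rho>) d (stable_proj (act stable_dagger \<rho> d x))"
  have xs: "x \<in> stable_carrier (- d)" using x by (simp add: stable_dagger_simps pointwise_module_simps)
  have f: "?f \<in> ?S \<rightarrow> carrier (stable_obj (- d))"
  proof
    fix \<rho> assume "\<rho> \<in> ?S"
    then have p: "\<rho> permutes {1..n}" by simp
    show "?f \<rho> \<in> carrier (stable_obj (- d))"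
      using xs by (intro linear_map_closed[OF stable_act_linear[OF permutes_inv[OF p]]] linear_map_closed[OF stable_proj_linear]
          linear_map_closed[OF stable_act_linear[OF p]]) (simp add: pointwise_module_simps)
  qed
  have "(\<Oplus>\<^bsub>stable_obj (- d)\<^esub>\<rho>\<in>?S. ?f \<rho>) k = x k" for k
  proof -
    let ?D = "tower_deg (- d) k"
    interpret B: module R "B ?D" by (rule be_module_module)
    have xk: "x k \<in> carrier (B ?D)" by (rule stable_carrier_closed[OF xs])
    have ev: "linear_map R (stable_obj (- d)) (B ?D) (\<lambda>x. x k)"
      by (rule pointwise_eval_linear) (rule stable_carrier_closed)
    have "(\<Oplus>\<^bsub>stable_obj (- d)\<^esub>\<rho>\<in>?S. ?f \<rho>) k = (\<Oplus>\<^bsub>B ?D\<^esub>\<rho>\<in>?S. ?f \<rho> k)"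
      by (rule linear_map_finsum[OF stable_obj_module be_module_module ev f])
    also have "\<dots> = (\<Oplus>\<^bsub>B ?D\<^esub>\<rho>\<in>?S. bact (inv_into UNIV \<rho>) ?D (last_id (bact \<rho> ?D (x k))))"
    proof (rule B.finsum_cong'[OF refl])
      show "(\<lambda>\<rho>. bact (inv_into UNIV \<rho>) ?D (last_id (bact \<rho> ?D (x k)))) \<in> ?S \<rightarrow> carrier (B ?D)"
        by (intro Pi_I linear_map_closed[OF bact_linear] linear_map_closed[OF last_id_linear] xk)
      fix \<rho> assume "\<rho> \<in> ?S"
      then have p: "\<rho> permutes {1..n}" by simp
      have a: "(\<lambda>k. tower_act \<rho> (- d) k (x k)) \<in> stable_carrier (- d)" by (rule tower_act_stable[OF xs p])
      have l: "(\<lambda>k. last_id (tower_act \<rho> (- d) k (x k))) \<in> stable_carrier (- d)" by (rule last_id_stable[OF a])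
      have "permutation \<rho>" using permutes_imp_permutation[OF _ p] by simp
      then have "sign (inv_into UNIV \<rho>) ^ k * sign \<rho> ^ k = 1"
        by (simp add: sign_inverse power_mult_distrib[symmetric])
      moreover have "?f \<rho> k = tower_act (inv_into UNIV \<rho>) (- d) k (last_id (tower_act \<rho> (- d) k (x k)))"
        unfolding stable_proj_def stable_dagger_simps(3)[OF xs] stable_dagger_simps(3)[OF l] ..
      ultimately show "?f \<rho> k = bact (inv_into UNIV \<rho>) ?D (last_id (bact \<rho> ?D (x k)))"
        unfolding tower_act_def
        using linear_map_closed[OF bact_linear xk] linear_map_closed[OF last_id_linear linear_map_closed[OF bact_linear xk]]
          linear_map_closed[OF bact_linear linear_map_closed[OF last_id_linear linear_map_closed[OF bact_linear xk]]]
        by (simp add: linear_map_int_smult[OF be_module_module be_module_module last_id_linear]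
            linear_map_int_smult[OF be_module_module be_module_module bact_linear] int_smult_smult[OF be_module_module] int_smult_1[OF be_module_module])
    qed
    also have "\<dots> = x k" by (rule last_id_sum[OF xk])
    finally show ?thesis .
  qed
  then show ?thesis unfolding stable_dagger_simps(1) by (rule ext)
qed

end

section \<open>Quasi-isomorphisms\<close>

lemma coset_eq_iff_add:
  assumes "module R M" "submodule N R M" "x \<in> carrier M" "y \<in> carrier M"
  shows "N +>\<^bsub>M\<^esub> x = N +>\<^bsub>M\<^esub> y \<longleftrightarrow> (\<exists>b\<in>N. x = b \<oplus>\<^bsub>M\<^esub> y)"
proof -
  interpret N: abelian_subgroup N M using submodule_abelian_subgroup[OF assms(1,2)] .
  have "N +>\<^bsub>M\<^esub> x = N +>\<^bsub>M\<^esub> y \<longleftrightarrow> x \<in> N +>\<^bsub>M\<^esub> y"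
    using N.a_rcos_self[OF assms(3)] N.a_repr_independence[OF _ assms(4) N.a_subgroup, of x] by auto
  then show ?thesis by (auto simp: a_r_coset_def')
qed

lemma cocycles_simps:
  "carrier (cocycles X d) = {x \<in> carrier (obj X d). dif X d x = \<zero>\<^bsub>obj X (d + 1)\<^esub>}"
  "x \<oplus>\<^bsub>cocycles X d\<^esub> y = x \<oplus>\<^bsub>obj X d\<^esub> y"
  "c \<odot>\<^bsub>cocycles X d\<^esub> x = c \<odot>\<^bsub>obj X d\<^esub> x"
  "\<zero>\<^bsub>cocycles X d\<^esub> = \<zero>\<^bsub>obj X d\<^esub>"
  by (simp_all add: cocycles_def)

lemma cocycles_module:
  fixes X :: "('k, 'a) complex_rec"
  assumes "cochain_complex R X"
  shows "module R (cocycles X d)"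
  unfolding cocycles_def
  by (intro submodule.submodule_is_module linear_map_kernel_submodule cochain_complexD[OF assms])

lemma coboundaries_submodule:
  fixes X :: "('k, 'a) complex_rec"
  assumes "cochain_complex R X"
  shows "submodule (coboundaries X d) R (cocycles X d)" and "submodule (coboundaries X d) R (obj X d)"
proof -
  interpret cochain R X by (rule cochain.intro[OF assms])
  have lin: "linear_map R (obj X (d - 1)) (obj X d) (dif X (d - 1))" using dif_linear[of "d - 1"] by simp
  show s: "submodule (coboundaries X d) R (obj X d)"
    unfolding coboundaries_def by (rule linear_map_image_submodule[OF obj_module obj_module lin])
  have "coboundaries X d \<subseteq> carrier (cocycles X d)"
    unfolding coboundaries_def cocycles_simps
    using linear_map_closed[OF lin] dif_dif[of _ "d - 1"] by (auto simp: add.commute)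
  then show "submodule (coboundaries X d) R (cocycles X d)"
    by (intro submoduleI'[OF cocycles_module[OF assms]])
       (simp_all add: cocycles_simps(2-4) submodule_zero[OF s] submodule_add[OF s] submodule_smult[OF s])
qed

lemma coboundaryI: "v \<in> carrier (obj X (d - 1)) \<Longrightarrow> dif X (d - 1) v \<in> coboundaries X d"
  by (simp add: coboundaries_def)

lemma
  fixes X :: "('k, 'a) complex_rec" and Y :: "('k, 'b) complex_rec"
  assumes f: "cochain_map R X Y f"
  shows cochain_map_cocycles: "x \<in> carrier (cocycles X d) \<Longrightarrow> f d x \<in> carrier (cocycles Y d)"
    and cochain_map_coboundaries: "x \<in> coboundaries X d \<Longrightarrow> f d x \<in> coboundaries Y d"
proof -
  interpret X: cochain R X by (rule cochain.intro[OF cochain_mapD(1)[OF f]])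
  interpret Y: cochain R Y by (rule cochain.intro[OF cochain_mapD(2)[OF f]])
  show "x \<in> carrier (cocycles X d) \<Longrightarrow> f d x \<in> carrier (cocycles Y d)"
    using linear_map_closed[OF cochain_mapD(3)[OF f]] linear_map_zero[OF X.obj_module Y.obj_module cochain_mapD(3)[OF f]]
    by (simp add: cocycles_simps cochain_mapD(4)[OF f, symmetric])
  assume "x \<in> coboundaries X d"
  then obtain v where v: "v \<in> carrier (obj X (d - 1))" "x = dif X (d - 1) v" by (auto simp: coboundaries_def)
  then have "f d x = dif Y (d - 1) (f (d - 1) v)" using cochain_mapD(4)[OF f v(1)] by simp
  then show "f d x \<in> coboundaries Y d"
    using linear_map_closed[OF cochain_mapD(3)[OF f] v(1)] by (simp add: coboundaryI)
qed

lemma image_eq_image_iff: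
  assumes "q ` A \<subseteq> r ` B"
  shows "q ` A = r ` B \<longleftrightarrow> (\<forall>y\<in>B. \<exists>x\<in>A. r y = q x)"
proof -
  have "q ` A = r ` B \<longleftrightarrow> r ` B \<subseteq> q ` A" using assms by blast
  then show ?thesis by (simp add: image_subset_iff image_iff)
qed

text \<open>Bijectivity on cosets, expressed by representatives: injectivity becomes triviality of
  the kernel by passing to differences, and surjectivity holds up to a coboundary. Cosets are not
  mentioned after this point.\<close>

lemma quasi_isomorphism_iff:
  fixes X :: "('k, 'a) complex_rec" and Y :: "('k, 'b) complex_rec"
  assumes f: "cochain_map R X Y f"
  shows "quasi_isomorphism R X Y f \<longleftrightarrow>
    (\<forall>d. (\<forall>x\<in>carrier (cocycles X d). f d x \<in> coboundaries Y d \<longrightarrow> x \<in> coboundaries X d) \<and>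
         (\<forall>y\<in>carrier (cocycles Y d). \<exists>x\<in>carrier (cocycles X d). \<exists>b\<in>coboundaries Y d. y = b \<oplus>\<^bsub>obj Y d\<^esub> f d x))"
proof -
  have "bij_betw (cohomology_map Y f d) (carrier (cohomology X d)) (carrier (cohomology Y d)) \<longleftrightarrow>
     (\<forall>x\<in>carrier (cocycles X d). f d x \<in> coboundaries Y d \<longrightarrow> x \<in> coboundaries X d) \<and>
     (\<forall>y\<in>carrier (cocycles Y d). \<exists>x\<in>carrier (cocycles X d). \<exists>b\<in>coboundaries Y d. y = b \<oplus>\<^bsub>obj Y d\<^esub> f d x)" for d
  proof -
    note cX = cochain_mapD(1)[OF f] and cY = cochain_mapD(2)[OF f]
    note fl = cochain_mapD(3)[OF f, of d]
    interpret X: module R "obj X d" by (rule cochain_complexD(1)[OF cX])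
    interpret Y: module R "obj Y d" by (rule cochain_complexD(1)[OF cY])
    let ?ZX = "cocycles X d" and ?ZY = "cocycles Y d" and ?BX = "coboundaries X d" and ?BY = "coboundaries Y d"
    note ZX = cocycles_module[OF cX, of d] and ZY = cocycles_module[OF cY, of d]
    note BX = coboundaries_submodule(1)[OF cX, of d] and BY = coboundaries_submodule(1)[OF cY, of d]
    interpret BX: abelian_subgroup ?BX ?ZX using submodule_abelian_subgroup[OF ZX BX] .
    note fZ = cochain_map_cocycles[OF f, of _ d] and fB = cochain_map_coboundaries[OF f, of _ d]
    have ZXc: "carrier ?ZX \<subseteq> carrier (obj X d)" "carrier ?ZY \<subseteq> carrier (obj Y d)" by (auto simp: cocycles_simps)
    have BXc: "?BX \<subseteq> carrier (obj X d)" "?BY \<subseteq> carrier (obj Y d)"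
      using submodule_subset[OF BX] submodule_subset[OF BY] ZXc by auto
    have eqX: "?BX +>\<^bsub>?ZX\<^esub> x = ?BX +>\<^bsub>?ZX\<^esub> y \<longleftrightarrow> (\<exists>b\<in>?BX. x = b \<oplus>\<^bsub>obj X d\<^esub> y)"
      if "x \<in> carrier ?ZX" "y \<in> carrier ?ZX" for x y
      using coset_eq_iff_add[OF ZX BX that] by (simp add: cocycles_simps(2))
    have eqY: "?BY +>\<^bsub>?ZY\<^esub> x = ?BY +>\<^bsub>?ZY\<^esub> y \<longleftrightarrow> (\<exists>b\<in>?BY. x = b \<oplus>\<^bsub>obj Y d\<^esub> y)"
      if "x \<in> carrier ?ZY" "y \<in> carrier ?ZY" for x y
      using coset_eq_iff_add[OF ZY BY that] by (simp add: cocycles_simps(2))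
    \<comment> \<open>Coboundaries go to coboundaries, so all representatives of a class give one
      coset; this is the value that \<open>the_elem\<close> selects in
      \<open>cohomology_map\<close>.\<close>
    have map: "cohomology_map Y f d (?BX +>\<^bsub>?ZX\<^esub> x) = ?BY +>\<^bsub>?ZY\<^esub> f d x" if x: "x \<in> carrier ?ZX" for x
    proof -
      have "?BY +>\<^bsub>?ZY\<^esub> f d x' = ?BY +>\<^bsub>?ZY\<^esub> f d x" if x': "x' \<in> ?BX +>\<^bsub>?ZX\<^esub> x" for x'
      proof -
        from x' obtain b where b: "b \<in> ?BX" "x' = b \<oplus>\<^bsub>obj X d\<^esub> x" by (auto simp: a_r_coset_def' cocycles_simps(2))
        have "x' \<in> carrier ?ZX" using x' x BX.a_elemrcos_carrier by blast
        moreover have "f d x' = f d b \<oplus>\<^bsub>obj Y d\<^esub> f d x"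
          unfolding b(2) by (rule linear_map_add[OF fl subsetD[OF BXc(1) b(1)] subsetD[OF ZXc(1) x]])
        ultimately show ?thesis using eqY[OF fZ fZ[OF x]] fB[OF b(1)] by blast
      qed
      moreover have "x \<in> ?BX +>\<^bsub>?ZX\<^esub> x" by (rule BX.a_rcos_self[OF x])
      ultimately have "(\<lambda>x. ?BY +>\<^bsub>?ZY\<^esub> f d x) ` (?BX +>\<^bsub>?ZX\<^esub> x) = {?BY +>\<^bsub>?ZY\<^esub> f d x}" by blast
      then show ?thesis by (simp add: cohomology_map_def)
    qed
    have HX: "carrier (cohomology X d) = (\<lambda>x. ?BX +>\<^bsub>?ZX\<^esub> x) ` carrier ?ZX"
      and HY: "carrier (cohomology Y d) = (\<lambda>y. ?BY +>\<^bsub>?ZY\<^esub> y) ` carrier ?ZY"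
      by (simp_all add: cohomology_def quot_module_simps)
    have img: "cohomology_map Y f d ` carrier (cohomology X d) = (\<lambda>x. ?BY +>\<^bsub>?ZY\<^esub> f d x) ` carrier ?ZX"
      unfolding HX image_image by (rule image_cong[OF refl]) (rule map)
    have surj: "cohomology_map Y f d ` carrier (cohomology X d) = carrier (cohomology Y d) \<longleftrightarrow>
      (\<forall>y\<in>carrier ?ZY. \<exists>x\<in>carrier ?ZX. \<exists>b\<in>?BY. y = b \<oplus>\<^bsub>obj Y d\<^esub> f d x)"
    proof -
      have "(\<lambda>x. ?BY +>\<^bsub>?ZY\<^esub> f d x) ` carrier ?ZX \<subseteq> carrier (cohomology Y d)" unfolding HY using fZ by blast
      then have "cohomology_map Y f d ` carrier (cohomology X d) = carrier (cohomology Y d) \<longleftrightarrow>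
        (\<forall>y\<in>carrier ?ZY. \<exists>x\<in>carrier ?ZX. ?BY +>\<^bsub>?ZY\<^esub> y = ?BY +>\<^bsub>?ZY\<^esub> f d x)"
        unfolding img HY by (rule image_eq_image_iff)
      also have "\<dots> \<longleftrightarrow> (\<forall>y\<in>carrier ?ZY. \<exists>x\<in>carrier ?ZX. \<exists>b\<in>?BY. y = b \<oplus>\<^bsub>obj Y d\<^esub> f d x)"
        by (intro ball_cong bex_cong refl eqY fZ)
      finally show ?thesis .
    qed
    have inj: "inj_on (cohomology_map Y f d) (carrier (cohomology X d)) \<longleftrightarrow>
      (\<forall>x\<in>carrier ?ZX. f d x \<in> ?BY \<longrightarrow> x \<in> ?BX)"
    proof
      assume i: "inj_on (cohomology_map Y f d) (carrier (cohomology X d))"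
      show "\<forall>x\<in>carrier ?ZX. f d x \<in> ?BY \<longrightarrow> x \<in> ?BX"
      proof (intro ballI impI)
        fix x assume x: "x \<in> carrier ?ZX" and fx: "f d x \<in> ?BY"
        have z: "\<zero>\<^bsub>obj X d\<^esub> \<in> carrier ?ZX"
          using submodule_zero[OF BX] submodule_subset[OF BX] by (auto simp: cocycles_simps(4))
        have f0: "f d \<zero>\<^bsub>obj X d\<^esub> = \<zero>\<^bsub>obj Y d\<^esub>" by (rule linear_map_zero[OF X.module_axioms Y.module_axioms fl])
        have "f d x = f d x \<oplus>\<^bsub>obj Y d\<^esub> f d \<zero>\<^bsub>obj X d\<^esub>" unfolding f0 using fx BXc by auto
        then have "?BY +>\<^bsub>?ZY\<^esub> f d x = ?BY +>\<^bsub>?ZY\<^esub> f d \<zero>\<^bsub>obj X d\<^esub>" using eqY[OF fZ[OF x] fZ[OF z]] fx by blast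
        then have "?BX +>\<^bsub>?ZX\<^esub> x = ?BX +>\<^bsub>?ZX\<^esub> \<zero>\<^bsub>obj X d\<^esub>"
          using inj_onD[OF i, of "?BX +>\<^bsub>?ZX\<^esub> x" "?BX +>\<^bsub>?ZX\<^esub> \<zero>\<^bsub>obj X d\<^esub>"] x z by (simp add: map HX)
        then obtain b where "b \<in> ?BX" "x = b \<oplus>\<^bsub>obj X d\<^esub> \<zero>\<^bsub>obj X d\<^esub>" using eqX[OF x z] by blast
        then show "x \<in> ?BX" using BXc by auto
      qed
    next
      assume k: "\<forall>x\<in>carrier ?ZX. f d x \<in> ?BY \<longrightarrow> x \<in> ?BX"
      show "inj_on (cohomology_map Y f d) (carrier (cohomology X d))"
      proof (rule inj_onI)
        fix C D assume "C \<in> carrier (cohomology X d)" "D \<in> carrier (cohomology X d)" and eq: "cohomology_map Y f d C = cohomology_map Y f d D"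
        then obtain x y where x: "x \<in> carrier ?ZX" "C = ?BX +>\<^bsub>?ZX\<^esub> x" and y: "y \<in> carrier ?ZX" "D = ?BX +>\<^bsub>?ZX\<^esub> y"
          by (auto simp: HX)
        from eq obtain b where b: "b \<in> ?BY" "f d x = b \<oplus>\<^bsub>obj Y d\<^esub> f d y"
          using eqY[OF fZ[OF x(1)] fZ[OF y(1)]] by (auto simp: x y map)
        have xy: "x \<in> carrier (obj X d)" "y \<in> carrier (obj X d)" "b \<in> carrier (obj Y d)" using x y b ZXc BXc by auto
        have "x \<ominus>\<^bsub>obj X d\<^esub> y \<in> carrier ?ZX"
          using x(1) y(1) unfolding cocycles_def
          by (simp add: submodule_diff[OF linear_map_kernel_submodule[OF cochain_complexD(1)[OF cX] cochain_complexD(1)[OF cX] cochain_complexD(2)[OF cX]], simplified])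
        moreover have "f d (x \<ominus>\<^bsub>obj X d\<^esub> y) = b"
          unfolding linear_map_diff[OF X.module_axioms Y.module_axioms fl xy(1,2)] b(2)
          using linear_map_closed[OF fl xy(2)] xy(3) by (simp add: a_minus_def Y.a_assoc Y.r_neg)
        ultimately have "x \<ominus>\<^bsub>obj X d\<^esub> y \<in> ?BX" using k b(1) by blast
        moreover have "x = (x \<ominus>\<^bsub>obj X d\<^esub> y) \<oplus>\<^bsub>obj X d\<^esub> y" using xy by (simp add: a_minus_def X.a_assoc X.l_neg)
        ultimately show "C = D" unfolding x(2) y(2) eqX[OF x(1) y(1)] by blast
      qed
    qed
    show ?thesis unfolding bij_betw_def inj surj ..
  qed
  then show ?thesis using f by (simp add: quasi_isomorphism_def)
qed

lemma cochain_map_comp: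
  assumes f: "cochain_map R X Y f" and g: "cochain_map R Y Z g"
  shows "cochain_map R X Z (\<lambda>d x. g d (f d x))"
  unfolding cochain_map_def
  using cochain_mapD(1)[OF f] cochain_mapD(2)[OF g] linear_map_comp[OF cochain_mapD(3)[OF f] cochain_mapD(3)[OF g]]
    cochain_mapD(4)[OF f] cochain_mapD(4)[OF g] linear_map_closed[OF cochain_mapD(3)[OF f]]
  by simp

text \<open>\<open>E\<close> and \<open>E'\<close> play the role of projections onto cohomology; \<open>g\<close> inverts \<open>f\<close> only on their images.\<close>

lemma quasi_isomorphism_by_projections:
  fixes C :: "('k, 'a) complex_rec" and D :: "('k, 'b) complex_rec"
  assumes f: "cochain_map R C D f" and g: "cochain_map R D C g"
    and E: "\<And>d x. x \<in> carrier (obj C d) \<Longrightarrow> E d x \<in> carrier (obj C d)"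
    and E': "\<And>d y. y \<in> carrier (obj D d) \<Longrightarrow> E' d y \<in> carrier (obj D d)"
    and hE: "\<And>d x. x \<in> carrier (cocycles C d) \<Longrightarrow> x \<ominus>\<^bsub>obj C d\<^esub> E d x \<in> coboundaries C d"
    and hE': "\<And>d y. y \<in> carrier (cocycles D d) \<Longrightarrow> y \<ominus>\<^bsub>obj D d\<^esub> E' d y \<in> coboundaries D d"
    and gf: "\<And>d x. x \<in> carrier (obj C d) \<Longrightarrow> g d (f d (E d x)) = E d x"
    and fg: "\<And>d y. y \<in> carrier (obj D d) \<Longrightarrow> E' d (f d (g d y)) = E' d y"
  shows "quasi_isomorphism R C D f"
  unfolding quasi_isomorphism_iff[OF f]
proof (intro allI conjI ballI impI)
  fix d
  note cC = cochain_mapD(1)[OF f] and cD = cochain_mapD(2)[OF f]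
  note mC = cochain_complexD(1)[OF cC, of d] and mD = cochain_complexD(1)[OF cD, of d]
  interpret C: module R "obj C d" by (rule mC)
  interpret D: module R "obj D d" by (rule mD)
  note BC = coboundaries_submodule(2)[OF cC, of d] and BD = coboundaries_submodule(2)[OF cD, of d]
  note fl = cochain_mapD(3)[OF f, of d] and gl = cochain_mapD(3)[OF g, of d]
  note fB = cochain_map_coboundaries[OF f, of _ d] and gB = cochain_map_coboundaries[OF g, of _ d]
  {
    fix x assume x: "x \<in> carrier (cocycles C d)" and fx: "f d x \<in> coboundaries D d"
    have xc: "x \<in> carrier (obj C d)" using x by (simp add: cocycles_simps)
    note Ex = E[OF xc]
    let ?z = "x \<ominus>\<^bsub>obj C d\<^esub> E d x"
    \<comment> \<open>Both elements are coboundaries since cochain maps preserve these. Their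
      difference is \<open>E d x\<close>, because \<open>g f\<close> fixes the image of
      \<open>E\<close>; hence \<open>x\<close>, which is homologous to \<open>E d x\<close>, is a
      coboundary as well.\<close>
    have "g d (f d x) \<in> coboundaries C d" "g d (f d ?z) \<in> coboundaries C d"
      using gB[OF fx] gB[OF fB[OF hE[OF x]]] by auto
    moreover have "g d (f d ?z) = g d (f d x) \<ominus>\<^bsub>obj C d\<^esub> E d x"
      using linear_map_closed[OF fl xc] linear_map_closed[OF fl Ex]
      by (simp add: linear_map_diff[OF mC mD fl xc Ex] linear_map_diff[OF mD mC gl] gf[OF xc])
    ultimately have "g d (f d x) \<ominus>\<^bsub>obj C d\<^esub> (g d (f d x) \<ominus>\<^bsub>obj C d\<^esub> E d x) \<in> coboundaries C d"
      using submodule_diff[OF BC] by simp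
    moreover have "g d (f d x) \<ominus>\<^bsub>obj C d\<^esub> (g d (f d x) \<ominus>\<^bsub>obj C d\<^esub> E d x) = E d x"
      using linear_map_closed[OF gl linear_map_closed[OF fl xc]] Ex
      by (simp add: a_minus_def C.minus_add C.a_assoc[symmetric] C.r_neg)
    ultimately have "?z \<oplus>\<^bsub>obj C d\<^esub> E d x \<in> coboundaries C d"
      using submodule_add[OF BC hE[OF x]] by simp
    then show "x \<in> coboundaries C d" using xc Ex by (simp add: a_minus_def C.a_assoc C.l_neg)
  next
    fix y assume y: "y \<in> carrier (cocycles D d)"
    let ?x = "g d y"
    have yc: "y \<in> carrier (obj D d)" using y by (simp add: cocycles_simps)
    have x: "?x \<in> carrier (cocycles C d)" by (rule cochain_map_cocycles[OF g y])
    have y1: "f d ?x \<in> carrier (cocycles D d)" by (rule cochain_map_cocycles[OF f x])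
    then have y1c: "f d ?x \<in> carrier (obj D d)" by (simp add: cocycles_simps)
    note Ey = E'[OF yc]
    \<comment> \<open>\<open>y\<close> and \<open>f (g y)\<close> have the same image under
      \<open>E'\<close>, and each is homologous to it, so they are homologous to each other.\<close>
    have b: "(y \<ominus>\<^bsub>obj D d\<^esub> E' d y) \<ominus>\<^bsub>obj D d\<^esub> (f d ?x \<ominus>\<^bsub>obj D d\<^esub> E' d y) \<in> coboundaries D d"
      using submodule_diff[OF BD hE'[OF y] hE'[OF y1]] by (simp add: fg[OF yc])
    have "(y \<ominus>\<^bsub>obj D d\<^esub> E' d y) \<ominus>\<^bsub>obj D d\<^esub> (f d ?x \<ominus>\<^bsub>obj D d\<^esub> E' d y) \<oplus>\<^bsub>obj D d\<^esub> f d ?x =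
      y \<oplus>\<^bsub>obj D d\<^esub> (E' d y \<oplus>\<^bsub>obj D d\<^esub> \<ominus>\<^bsub>obj D d\<^esub> E' d y) \<oplus>\<^bsub>obj D d\<^esub> (f d ?x \<oplus>\<^bsub>obj D d\<^esub> \<ominus>\<^bsub>obj D d\<^esub> f d ?x)"
      using yc Ey y1c unfolding a_minus_def
      by (simp only: C.minus_add D.minus_add D.minus_minus D.a_ac D.M.a_closed D.M.a_inv_closed)
    also have "\<dots> = y" using yc Ey y1c by (simp add: D.r_neg)
    finally show "\<exists>x\<in>carrier (cocycles C d). \<exists>b\<in>coboundaries D d. y = b \<oplus>\<^bsub>obj D d\<^esub> f d x"
      using b x by metis
  }
qed

subsection \<open>Direct sums\<close>

lemma direct_sum_simps:
  "carrier (obj (direct_sum C) d) = {u. (\<forall>n. u n \<in> carrier (obj (C n) d)) \<and> finite {n. u n \<noteq> \<zero>\<^bsub>obj (C n) d\<^esub>}}"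
  "u \<oplus>\<^bsub>obj (direct_sum C) d\<^esub> v = (\<lambda>n. u n \<oplus>\<^bsub>obj (C n) d\<^esub> v n)"
  "c \<odot>\<^bsub>obj (direct_sum C) d\<^esub> u = (\<lambda>n. c \<odot>\<^bsub>obj (C n) d\<^esub> u n)"
  "\<zero>\<^bsub>obj (direct_sum C) d\<^esub> = (\<lambda>n. \<zero>\<^bsub>obj (C n) d\<^esub>)"
  "dif (direct_sum C) d u = (\<lambda>n. dif (C n) d (u n))"
  by (simp_all add: direct_sum_def pointwise_module_simps)

lemma direct_sum_linear:
  assumes "\<And>n. module R (obj (C n) d)" "\<And>n. module R (obj (D n) e)"
    and "\<And>n. linear_map R (obj (C n) d) (obj (D n) e) (f n)"
  shows "linear_map R (obj (direct_sum C) d) (obj (direct_sum D) e) (\<lambda>u n. f n (u n))"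
proof (rule linear_mapI)
  fix u assume u: "u \<in> carrier (obj (direct_sum C) d)"
  have "{n. f n (u n) \<noteq> \<zero>\<^bsub>obj (D n) e\<^esub>} \<subseteq> {n. u n \<noteq> \<zero>\<^bsub>obj (C n) d\<^esub>}"
    using linear_map_zero[OF assms] by auto
  then show "(\<lambda>n. f n (u n)) \<in> carrier (obj (direct_sum D) e)"
    using u linear_map_closed[OF assms(3)] by (auto simp: direct_sum_simps elim: finite_subset)
qed (simp_all add: direct_sum_simps linear_map_add[OF assms(3)] linear_map_smult[OF assms(3)])

lemma direct_sum_complex:
  fixes C :: "nat \<Rightarrow> ('k, 'a) complex_rec"
  assumes C: "\<And>n. cochain_complex R (C n)"
  shows "cochain_complex R (direct_sum C)"
proof -
  note m = cochain_complexD(1)[OF C] and dl = cochain_complexD(2)[OF C]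
  have cring: "cring R" using module.axioms(1)[OF m] .
  have "module R (obj (direct_sum C) d)" for d
  proof -
    let ?A = "{u. (\<forall>n. u n \<in> carrier (obj (C n) d)) \<and> finite {n. u n \<noteq> \<zero>\<^bsub>obj (C n) d\<^esub>}}"
    have "abelian_monoid (obj (C n) d)" for n using m[of n d] by (simp add: module_def abelian_group_def)
    note am = abelian_monoid.a_closed[OF this] abelian_monoid.zero_closed[OF this] abelian_monoid.l_zero[OF this]
    have "module R (pointwise_module (\<lambda>n. obj (C n) d) ?A)"
    proof (rule pointwise_module_module[OF cring m])
      fix u v assume uv: "u \<in> ?A" "v \<in> ?A"
      have "{n. u n \<oplus>\<^bsub>obj (C n) d\<^esub> v n \<noteq> \<zero>\<^bsub>obj (C n) d\<^esub>} \<subseteq> {n. u n \<noteq> \<zero>\<^bsub>obj (C n) d\<^esub>} \<union> {n. v n \<noteq> \<zero>\<^bsub>obj (C n) d\<^esub>}"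
        using am by auto
      then show "(\<lambda>n. u n \<oplus>\<^bsub>obj (C n) d\<^esub> v n) \<in> ?A" using uv am by (auto elim: finite_subset)
    next
      fix c u assume c: "c \<in> carrier R" and u: "u \<in> ?A"
      have "{n. c \<odot>\<^bsub>obj (C n) d\<^esub> u n \<noteq> \<zero>\<^bsub>obj (C n) d\<^esub>} \<subseteq> {n. u n \<noteq> \<zero>\<^bsub>obj (C n) d\<^esub>}"
        using module.smult_r_null[OF m c] by auto
      then show "(\<lambda>n. c \<odot>\<^bsub>obj (C n) d\<^esub> u n) \<in> ?A" using u c module.smult_closed[OF m] by (auto elim: finite_subset)
    qed (auto simp: am)
    then show ?thesis by (simp add: direct_sum_def)
  qed
  moreover have "linear_map R (obj (direct_sum C) d) (obj (direct_sum C) (d + 1)) (dif (direct_sum C) d)" for d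
    using direct_sum_linear[where C = C and D = C and d = d and e = "d + 1" and f = "\<lambda>n. dif (C n) d", OF m m dl] by (simp add: direct_sum_simps(5)[abs_def])
  ultimately show ?thesis
    unfolding cochain_complex_def by (auto simp: direct_sum_simps cochain_complexD(3)[OF C])
qed

text \<open>Preimages chosen separately in the summands might be nonzero infinitely often. Choosing
  zero wherever \<open>u\<close> vanishes keeps the support finite.\<close>

lemma direct_sum_coboundary:
  fixes A :: "nat \<Rightarrow> ('k, 'c) complex_rec"
  assumes A: "\<And>n. cochain_complex R (A n)"
    and u: "u \<in> carrier (obj (direct_sum A) d)" "\<And>n. u n \<in> coboundaries (A n) d"
  shows "u \<in> coboundaries (direct_sum A) d"
proof -
  have zA: "\<zero>\<^bsub>obj (A n) d\<^esub> \<in> carrier (obj (A n) d)" for n d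
    using abelian_monoid.zero_closed cochain_complexD(1)[OF A, of n d] by (auto simp: module_def abelian_group_def)
  have "\<exists>v\<in>carrier (obj (A n) (d - 1)). u n = dif (A n) (d - 1) v" for n
    using u(2)[of n] by (auto simp: coboundaries_def)
  then obtain w where w: "\<And>n. w n \<in> carrier (obj (A n) (d - 1))" "\<And>n. u n = dif (A n) (d - 1) (w n)" by metis
  define v where "v n = (if u n = \<zero>\<^bsub>obj (A n) d\<^esub> then \<zero>\<^bsub>obj (A n) (d - 1)\<^esub> else w n)" for n
  have "dif (A n) (d - 1) \<zero>\<^bsub>obj (A n) (d - 1)\<^esub> = \<zero>\<^bsub>obj (A n) d\<^esub>" for n
    using linear_map_zero[OF cochain_complexD(1)[OF A] cochain_complexD(1)[OF A] cochain_complexD(2)[OF A], of n "d - 1"] by simp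
  then have "u = dif (direct_sum A) (d - 1) v" using w by (auto simp: v_def direct_sum_simps)
  moreover have "{n. v n \<noteq> \<zero>\<^bsub>obj (A n) (d - 1)\<^esub>} \<subseteq> {n. u n \<noteq> \<zero>\<^bsub>obj (A n) d\<^esub>}" by (auto simp: v_def)
  then have "v \<in> carrier (obj (direct_sum A) (d - 1))"
    using u(1) w(1) zA by (auto simp: direct_sum_simps v_def elim: finite_subset)
  ultimately show ?thesis using coboundaryI by metis
qed

lemma direct_sum_quasi_isomorphism:
  fixes C :: "nat \<Rightarrow> ('k, 'a) complex_rec" and D :: "nat \<Rightarrow> ('k, 'b) complex_rec"
  assumes q: "\<And>n. quasi_isomorphism R (C n) (D n) (f n)"
  shows "quasi_isomorphism R (direct_sum C) (direct_sum D) (\<lambda>d u n. f n d (u n))"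
proof -
  have f: "cochain_map R (C n) (D n) (f n)" for n using q by (simp add: quasi_isomorphism_def)
  note cC = cochain_mapD(1)[OF f] and cD = cochain_mapD(2)[OF f]
  note mC = cochain_complexD(1)[OF cC] and mD = cochain_complexD(1)[OF cD]
  note dC = cochain_complexD(2)[OF cC] and dD = cochain_complexD(2)[OF cD]
  note fl = cochain_mapD(3)[OF f]
  have zC: "\<zero>\<^bsub>obj (C n) d\<^esub> \<in> carrier (obj (C n) d)" and zD: "\<zero>\<^bsub>obj (D n) d\<^esub> \<in> carrier (obj (D n) d)" for n d
    using abelian_monoid.zero_closed mC[of n d] mD[of n d] by (auto simp: module_def abelian_group_def)
  have sf: "cochain_map R (direct_sum C) (direct_sum D) (\<lambda>d u n. f n d (u n))"
    unfolding cochain_map_def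
    using direct_sum_complex[OF cC] direct_sum_complex[OF cD] direct_sum_linear[OF mC mD fl]
    by (auto simp: direct_sum_simps cochain_mapD(4)[OF f])
  show ?thesis unfolding quasi_isomorphism_iff[OF sf]
  proof (intro allI conjI ballI impI)
    fix d
    note qd = q[unfolded quasi_isomorphism_iff[OF f], rule_format, of _ d]
    {
      fix u assume u: "u \<in> carrier (cocycles (direct_sum C) d)" and fu: "(\<lambda>n. f n d (u n)) \<in> coboundaries (direct_sum D) d"
      then obtain v where v: "v \<in> carrier (obj (direct_sum D) (d - 1))" "(\<lambda>n. f n d (u n)) = dif (direct_sum D) (d - 1) v"
        by (auto simp: coboundaries_def)
      have "u n \<in> coboundaries (C n) d" for n
      proof -
        have "u n \<in> carrier (cocycles (C n) d)"
          using u by (auto simp: cocycles_simps direct_sum_simps fun_eq_iff)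
        moreover have "f n d (u n) \<in> coboundaries (D n) d"
          using v fun_cong[OF v(2), of n] by (auto simp: direct_sum_simps coboundaries_def)
        ultimately show ?thesis using qd[of n] by blast
      qed
      then show "u \<in> coboundaries (direct_sum C) d"
        using u by (intro direct_sum_coboundary[OF cC]) (auto simp: cocycles_simps(1))
    next
      fix y assume y: "y \<in> carrier (cocycles (direct_sum D) d)"
      have yc: "y \<in> carrier (obj (direct_sum D) d)" using y by (simp add: cocycles_simps)
      have "y n \<in> carrier (cocycles (D n) d)" for n
        using y by (auto simp: cocycles_simps direct_sum_simps fun_eq_iff)
      then have "\<exists>x\<in>carrier (cocycles (C n) d). \<exists>b\<in>coboundaries (D n) d. y n = b \<oplus>\<^bsub>obj (D n) d\<^esub> f n d x" for n
        using qd[of n] by blast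
      then obtain x b where xb: "\<And>n. x n \<in> carrier (cocycles (C n) d)" "\<And>n. b n \<in> coboundaries (D n) d"
        "\<And>n. y n = b n \<oplus>\<^bsub>obj (D n) d\<^esub> f n d (x n)" by metis
      \<comment> \<open>Again zero is chosen where \<open>y\<close> vanishes, so that both families
        have finite support.\<close>
      define x' b' where "x' n = (if y n = \<zero>\<^bsub>obj (D n) d\<^esub> then \<zero>\<^bsub>obj (C n) d\<^esub> else x n)"
        and "b' n = (if y n = \<zero>\<^bsub>obj (D n) d\<^esub> then \<zero>\<^bsub>obj (D n) d\<^esub> else b n)" for n
      have zz: "dif (C n) d \<zero>\<^bsub>obj (C n) d\<^esub> = \<zero>\<^bsub>obj (C n) (d + 1)\<^esub>" "f n d \<zero>\<^bsub>obj (C n) d\<^esub> = \<zero>\<^bsub>obj (D n) d\<^esub>"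
        "\<zero>\<^bsub>obj (D n) d\<^esub> \<oplus>\<^bsub>obj (D n) d\<^esub> \<zero>\<^bsub>obj (D n) d\<^esub> = \<zero>\<^bsub>obj (D n) d\<^esub>" for n
        using linear_map_zero[OF mC mC dC] linear_map_zero[OF mC mD fl] abelian_monoid.l_zero[OF _ zD] mD[of n d]
        by (auto simp: module_def abelian_group_def)
      have fin: "finite {n. y n \<noteq> \<zero>\<^bsub>obj (D n) d\<^esub>}" using yc by (simp add: direct_sum_simps)
      have "{n. x' n \<noteq> \<zero>\<^bsub>obj (C n) d\<^esub>} \<subseteq> {n. y n \<noteq> \<zero>\<^bsub>obj (D n) d\<^esub>}" by (auto simp: x'_def)
      then have "finite {n. x' n \<noteq> \<zero>\<^bsub>obj (C n) d\<^esub>}" using fin by (rule finite_subset)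
      then have x': "x' \<in> carrier (cocycles (direct_sum C) d)"
        using xb(1) zC zz(1) by (auto simp: cocycles_simps direct_sum_simps x'_def)
      have bB: "b' n \<in> coboundaries (D n) d" for n
        using xb(2) submodule_zero[OF coboundaries_submodule(2)[OF cD]] by (simp add: b'_def)
      have "{n. b' n \<noteq> \<zero>\<^bsub>obj (D n) d\<^esub>} \<subseteq> {n. y n \<noteq> \<zero>\<^bsub>obj (D n) d\<^esub>}" by (auto simp: b'_def)
      then have "finite {n. b' n \<noteq> \<zero>\<^bsub>obj (D n) d\<^esub>}" using fin by (rule finite_subset)
      then have "b' \<in> carrier (obj (direct_sum D) d)"
        using bB submodule_subset[OF coboundaries_submodule(2)[OF cD]] by (auto simp: direct_sum_simps)
      then have b': "b' \<in> coboundaries (direct_sum D) d" by (rule direct_sum_coboundary[OF cD _ bB])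
      have "y = b' \<oplus>\<^bsub>obj (direct_sum D) d\<^esub> (\<lambda>n. f n d (x' n))"
        using xb(3) zz by (auto simp: direct_sum_simps x'_def b'_def fun_eq_iff)
      then show "\<exists>x\<in>carrier (cocycles (direct_sum C) d). \<exists>b\<in>coboundaries (direct_sum D) d.
          y = b \<oplus>\<^bsub>obj (direct_sum D) d\<^esub> (\<lambda>n. f n d (x n))"
        using x' b' by blast
    }
  qed
qed

section \<open>Splittings over a field\<close>

lemma submodule_Union_chain:
  assumes M: "module R M" and ne: "\<C> \<noteq> {}" and sub: "\<And>S. S \<in> \<C> \<Longrightarrow> submodule S R M"
    and chain: "\<And>S T. S \<in> \<C> \<Longrightarrow> T \<in> \<C> \<Longrightarrow> S \<subseteq> T \<or> T \<subseteq> S"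
  shows "submodule (\<Union>\<C>) R M"
proof (rule submoduleI'[OF M])
  show "\<Union>\<C> \<subseteq> carrier M" using submodule_subset[OF sub] by blast
  show "\<zero>\<^bsub>M\<^esub> \<in> \<Union>\<C>" using ne submodule_zero[OF sub] by blast
  fix x y assume "x \<in> \<Union>\<C>" "y \<in> \<Union>\<C>"
  then obtain S where S: "S \<in> \<C>" "x \<in> S" "y \<in> S" using chain by blast
  then show "x \<oplus>\<^bsub>M\<^esub> y \<in> \<Union>\<C>" using submodule_add[OF sub[OF S(1)]] by blast
next
  fix c x assume "c \<in> carrier R" "x \<in> \<Union>\<C>"
  then show "c \<odot>\<^bsub>M\<^esub> x \<in> \<Union>\<C>" using submodule_smult[OF sub] by blast
qed

text \<open>Zorn's lemma gives a maximal submodule that meets \<open>N\<close> trivially. If the sum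
  with \<open>N\<close> missed a vector, adjoining this vector would give a larger such
  submodule.\<close>

lemma field_submodule_complement:
  assumes R: "field R" and M: "module R M" and N: "submodule N R M"
  obtains S where "submodule S R M" "S \<inter> N \<subseteq> {\<zero>\<^bsub>M\<^esub>}"
    "\<And>x. x \<in> carrier M \<Longrightarrow> \<exists>a\<in>N. \<exists>s\<in>S. x = a \<oplus>\<^bsub>M\<^esub> s"
proof -
  interpret R: field R by (rule R)
  interpret M: module R M by (rule M)
  define \<A> where "\<A> = {S. submodule S R M \<and> S \<inter> N \<subseteq> {\<zero>\<^bsub>M\<^esub>}}"
  have "\<exists>S\<in>\<A>. \<forall>T\<in>\<A>. S \<subseteq> T \<longrightarrow> T = S"
  proof (rule subset_Zorn_nonempty)
    show "\<A> \<noteq> {}" using submodule_trivial[OF M] by (auto simp: \<A>_def)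
    fix \<C> assume C: "\<C> \<noteq> {}" "subset.chain \<A> \<C>"
    then have CA: "S \<in> \<A>" if "S \<in> \<C>" for S using that by (auto simp: subset_chain_def)
    have "submodule (\<Union>\<C>) R M"
      using C(2) CA by (intro submodule_Union_chain[OF M C(1)]) (auto simp: \<A>_def subset_chain_def)
    moreover have "\<Union>\<C> \<inter> N \<subseteq> {\<zero>\<^bsub>M\<^esub>}" using CA by (auto simp: \<A>_def)
    ultimately show "\<Union>\<C> \<in> \<A>" by (simp add: \<A>_def)
  qed
  then obtain S where S: "S \<in> \<A>" and max: "\<And>T. T \<in> \<A> \<Longrightarrow> S \<subseteq> T \<Longrightarrow> T = S" by blast
  have sS: "submodule S R M" and SN: "S \<inter> N \<subseteq> {\<zero>\<^bsub>M\<^esub>}" using S by (auto simp: \<A>_def)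
  note Sc = submodule_subset[OF sS] and Nc = submodule_subset[OF N]
  have "\<exists>a\<in>N. \<exists>s\<in>S. x = a \<oplus>\<^bsub>M\<^esub> s" if x: "x \<in> carrier M" for x
  proof (rule ccontr)
    assume no: "\<not> (\<exists>a\<in>N. \<exists>s\<in>S. x = a \<oplus>\<^bsub>M\<^esub> s)"
    let ?T = "{s \<oplus>\<^bsub>M\<^esub> c \<odot>\<^bsub>M\<^esub> x | s c. s \<in> S \<and> c \<in> carrier R}"
    have sT: "submodule ?T R M"
    proof (rule submoduleI'[OF M])
      show "?T \<subseteq> carrier M" using Sc x by auto
      show "\<zero>\<^bsub>M\<^esub> \<in> ?T" using submodule_zero[OF sS] x
        by (intro CollectI exI[of _ "\<zero>\<^bsub>M\<^esub>"] exI[of _ "\<zero>\<^bsub>R\<^esub>"]) simp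
    next
      fix u v assume "u \<in> ?T" "v \<in> ?T"
      then obtain s c t d where u: "u = s \<oplus>\<^bsub>M\<^esub> c \<odot>\<^bsub>M\<^esub> x" "s \<in> S" "c \<in> carrier R"
        and v: "v = t \<oplus>\<^bsub>M\<^esub> d \<odot>\<^bsub>M\<^esub> x" "t \<in> S" "d \<in> carrier R" by auto
      have "u \<oplus>\<^bsub>M\<^esub> v = (s \<oplus>\<^bsub>M\<^esub> t) \<oplus>\<^bsub>M\<^esub> (c \<oplus>\<^bsub>R\<^esub> d) \<odot>\<^bsub>M\<^esub> x"
        using u v x Sc by (simp add: M.smult_l_distr M.a_ac subset_eq)
      then show "u \<oplus>\<^bsub>M\<^esub> v \<in> ?T" using u v submodule_add[OF sS] by blast
    next
      fix r u assume r: "r \<in> carrier R" and "u \<in> ?T"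
      then obtain s c where u: "u = s \<oplus>\<^bsub>M\<^esub> c \<odot>\<^bsub>M\<^esub> x" "s \<in> S" "c \<in> carrier R" by auto
      have "r \<odot>\<^bsub>M\<^esub> u = r \<odot>\<^bsub>M\<^esub> s \<oplus>\<^bsub>M\<^esub> (r \<otimes>\<^bsub>R\<^esub> c) \<odot>\<^bsub>M\<^esub> x"
        using u x r Sc by (simp add: M.smult_r_distr M.smult_assoc1 subset_eq)
      then show "r \<odot>\<^bsub>M\<^esub> u \<in> ?T" using u r submodule_smult[OF sS] by blast
    qed
    have "?T \<inter> N \<subseteq> {\<zero>\<^bsub>M\<^esub>}"
    proof
      fix u assume "u \<in> ?T \<inter> N"
      then obtain s c where u: "u = s \<oplus>\<^bsub>M\<^esub> c \<odot>\<^bsub>M\<^esub> x" "s \<in> S" "c \<in> carrier R" and uN: "u \<in> N" by auto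
      have sc: "s \<in> carrier M" using u Sc by auto
      show "u \<in> {\<zero>\<^bsub>M\<^esub>}"
      proof (cases "c = \<zero>\<^bsub>R\<^esub>")
        case True
        then have "u = s" using u x sc by simp
        then show ?thesis using SN u uN by auto
      next
        \<comment> \<open>A nonzero coefficient can be inverted, and the equation solved for
          \<open>x\<close> then puts \<open>x\<close> into the sum, against the assumption.\<close>
        case False
        then have inv: "inv\<^bsub>R\<^esub> c \<in> carrier R" "inv\<^bsub>R\<^esub> c \<otimes>\<^bsub>R\<^esub> c = \<one>\<^bsub>R\<^esub>"
          using u(3) R.field_Units by auto
        have "c \<odot>\<^bsub>M\<^esub> x = u \<ominus>\<^bsub>M\<^esub> s" unfolding u(1) using sc x u(3)
          by (simp add: a_minus_def M.a_ac M.r_neg2 M.r_neg1)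
        then have "inv\<^bsub>R\<^esub> c \<odot>\<^bsub>M\<^esub> (c \<odot>\<^bsub>M\<^esub> x) = inv\<^bsub>R\<^esub> c \<odot>\<^bsub>M\<^esub> u \<oplus>\<^bsub>M\<^esub> inv\<^bsub>R\<^esub> c \<odot>\<^bsub>M\<^esub> (\<ominus>\<^bsub>M\<^esub> s)"
          using uN Nc sc inv(1) by (simp add: a_minus_def M.smult_r_distr subset_eq)
        moreover have "inv\<^bsub>R\<^esub> c \<odot>\<^bsub>M\<^esub> (c \<odot>\<^bsub>M\<^esub> x) = x"
          using u(3) inv x by (simp add: M.smult_assoc1[symmetric])
        ultimately have "x = inv\<^bsub>R\<^esub> c \<odot>\<^bsub>M\<^esub> u \<oplus>\<^bsub>M\<^esub> inv\<^bsub>R\<^esub> c \<odot>\<^bsub>M\<^esub> (\<ominus>\<^bsub>M\<^esub> s)" by simp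
        moreover have "inv\<^bsub>R\<^esub> c \<odot>\<^bsub>M\<^esub> u \<in> N" "inv\<^bsub>R\<^esub> c \<odot>\<^bsub>M\<^esub> (\<ominus>\<^bsub>M\<^esub> s) \<in> S"
          using uN u(2) inv(1) by (auto intro: submodule_smult[OF N] submodule_smult[OF sS] submodule_neg[OF sS])
        ultimately show ?thesis using no by blast
      qed
    qed
    then have "?T \<in> \<A>" using sT by (simp add: \<A>_def)
    moreover have "S \<subseteq> ?T"
    proof
      fix s assume s: "s \<in> S"
      then have "s = s \<oplus>\<^bsub>M\<^esub> \<zero>\<^bsub>R\<^esub> \<odot>\<^bsub>M\<^esub> x" using Sc x by auto
      then show "s \<in> ?T" using s R.zero_closed by blast
    qed
    ultimately have "?T = S" by (rule max)
    moreover have "x \<in> ?T"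
      using x submodule_zero[OF sS] by (intro CollectI exI[of _ "\<zero>\<^bsub>M\<^esub>"] exI[of _ "\<one>\<^bsub>R\<^esub>"]) simp
    ultimately have "x \<in> S" by simp
    then show False using no submodule_zero[OF N] M.l_zero[OF x] by metis
  qed
  with sS SN that show thesis by blast
qed

text \<open>The projection along a complement. The component in \<open>N\<close> is selected by
  choice, but it is unique because the complement meets \<open>N\<close> trivially; linearity
  follows from this uniqueness.\<close>

lemma field_submodule_retract:
  fixes M :: "('k, 'a) module"
  assumes R: "field R" and M: "module R M" and N: "submodule N R M"
  obtains q where "linear_map R M M q" "\<And>x. x \<in> carrier M \<Longrightarrow> q x \<in> N" "\<And>x. x \<in> N \<Longrightarrow> q x = x"
proof -
  interpret M: module R M by (rule M)
  obtain S where S: "submodule S R M" and SN: "S \<inter> N \<subseteq> {\<zero>\<^bsub>M\<^esub>}"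
    and dec: "\<And>x. x \<in> carrier M \<Longrightarrow> \<exists>a\<in>N. \<exists>s\<in>S. x = a \<oplus>\<^bsub>M\<^esub> s"
    using field_submodule_complement[OF R M N] by blast
  note Sc = submodule_subset[OF S] and Nc = submodule_subset[OF N]
  define q where "q x = (SOME a. a \<in> N \<and> (\<exists>s\<in>S. x = a \<oplus>\<^bsub>M\<^esub> s))" for x
  have q_eq: "q (a \<oplus>\<^bsub>M\<^esub> s) = a" if a: "a \<in> N" and s: "s \<in> S" for a s
    unfolding q_def
  proof (rule some_equality)
    show "a \<in> N \<and> (\<exists>s'\<in>S. a \<oplus>\<^bsub>M\<^esub> s = a \<oplus>\<^bsub>M\<^esub> s')" using a s by blast
    fix b assume "b \<in> N \<and> (\<exists>s'\<in>S. a \<oplus>\<^bsub>M\<^esub> s = b \<oplus>\<^bsub>M\<^esub> s')"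
    then obtain t where b: "b \<in> N" and t: "t \<in> S" and eq: "a \<oplus>\<^bsub>M\<^esub> s = b \<oplus>\<^bsub>M\<^esub> t" by blast
    have c: "a \<in> carrier M" "b \<in> carrier M" "s \<in> carrier M" "t \<in> carrier M" using a b s t Sc Nc by auto
    have "b \<ominus>\<^bsub>M\<^esub> a = (b \<oplus>\<^bsub>M\<^esub> t) \<oplus>\<^bsub>M\<^esub> (\<ominus>\<^bsub>M\<^esub> t \<oplus>\<^bsub>M\<^esub> \<ominus>\<^bsub>M\<^esub> a)"
      using c by (simp add: a_minus_def M.a_assoc M.r_neg2)
    also have "\<dots> = (a \<oplus>\<^bsub>M\<^esub> \<ominus>\<^bsub>M\<^esub> a) \<oplus>\<^bsub>M\<^esub> (s \<oplus>\<^bsub>M\<^esub> \<ominus>\<^bsub>M\<^esub> t)"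
      unfolding eq[symmetric] using c by (simp only: M.a_ac M.M.a_closed M.M.a_inv_closed)
    also have "\<dots> = s \<ominus>\<^bsub>M\<^esub> t" using c by (simp add: a_minus_def M.r_neg)
    finally have "b \<ominus>\<^bsub>M\<^esub> a \<in> S \<inter> N"
      using submodule_diff[OF S s t] submodule_diff[OF N b a] by simp
    then have "b \<ominus>\<^bsub>M\<^esub> a = \<zero>\<^bsub>M\<^esub>" using SN by blast
    then show "b = a" by (rule module_diff_eq_zero[OF M c(2,1)])
  qed
  have "linear_map R M M q"
  proof (rule linear_mapI)
    fix x assume "x \<in> carrier M"
    then obtain a s where x: "a \<in> N" "s \<in> S" "x = a \<oplus>\<^bsub>M\<^esub> s" using dec by blast
    have xc: "a \<in> carrier M" "s \<in> carrier M" using x Sc Nc by auto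
    show "q x \<in> carrier M" using x Nc by (auto simp: q_eq)
    { fix y assume "y \<in> carrier M"
      then obtain b t where y: "b \<in> N" "t \<in> S" "y = b \<oplus>\<^bsub>M\<^esub> t" using dec by blast
      have yc: "b \<in> carrier M" "t \<in> carrier M" using y Sc Nc by auto
      have "x \<oplus>\<^bsub>M\<^esub> y = (a \<oplus>\<^bsub>M\<^esub> b) \<oplus>\<^bsub>M\<^esub> (s \<oplus>\<^bsub>M\<^esub> t)"
        unfolding x(3) y(3) using xc yc by (simp only: M.a_ac M.M.a_closed)
      then show "q (x \<oplus>\<^bsub>M\<^esub> y) = q x \<oplus>\<^bsub>M\<^esub> q y"
        using q_eq[OF submodule_add[OF N x(1) y(1)] submodule_add[OF S x(2) y(2)]] x y by (simp add: q_eq) }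
    { fix c assume c: "c \<in> carrier R"
      have "c \<odot>\<^bsub>M\<^esub> x = c \<odot>\<^bsub>M\<^esub> a \<oplus>\<^bsub>M\<^esub> c \<odot>\<^bsub>M\<^esub> s" unfolding x(3) by (rule M.smult_r_distr[OF c xc])
      then show "q (c \<odot>\<^bsub>M\<^esub> x) = c \<odot>\<^bsub>M\<^esub> q x"
        using q_eq[OF submodule_smult[OF N c x(1)] submodule_smult[OF S c x(2)]] x by (simp add: q_eq) }
  qed
  moreover have "q x \<in> N" if "x \<in> carrier M" for x using dec[OF that] q_eq by auto
  moreover have "q x = x" if "x \<in> N" for x
    using q_eq[OF that submodule_zero[OF S]] that Nc by auto
  ultimately show thesis by (rule that)
qed

text \<open>Let \<open>z\<close> and \<open>b\<close> project onto cocycles and coboundaries. Then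
  \<open>e = z - b z\<close> projects onto a complement of the coboundaries inside the cocycles. Let
  \<open>s\<close> invert the differential with values in the kernel of \<open>z\<close>, and put
  \<open>h = s b z\<close>. The differential after \<open>h\<close> is \<open>b z\<close>, and
  \<open>h\<close> after the differential is \<open>1 - z\<close>; their sum is
  \<open>1 - e\<close>. Since \<open>z h = 0\<close>, both \<open>e h\<close> and \<open>h h\<close>
  vanish.\<close>

lemma (in cochain) retraction_exists:
  assumes R: "field R"
  obtains e h where "retraction R X e h"
    and "\<And>d x. x \<in> carrier (obj X d) \<Longrightarrow> dif X d (e d x) = \<zero>\<^bsub>obj X (d + 1)\<^esub>"
    and "\<And>d x. x \<in> coboundaries X d \<Longrightarrow> e d x = \<zero>\<^bsub>obj X d\<^esub>"
    and "\<And>d x. x \<in> carrier (cocycles X d) \<Longrightarrow> x \<ominus>\<^bsub>obj X d\<^esub> e d x \<in> coboundaries X d"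
proof -
  note m = obj_module
  have Zs: "submodule (carrier (cocycles X d)) R (obj X d)" for d
    unfolding cocycles_simps by (rule linear_map_kernel_submodule[OF m m dif_linear])
  note Bs = coboundaries_submodule(2)[OF complex]
  have BZ: "coboundaries X d \<subseteq> carrier (cocycles X d)" for d
    by (rule submodule_subset[OF coboundaries_submodule(1)[OF complex]])
  have "\<exists>q. linear_map R (obj X d) (obj X d) q \<and> (\<forall>x\<in>carrier (obj X d). q x \<in> carrier (cocycles X d)) \<and>
      (\<forall>x\<in>carrier (cocycles X d). q x = x)" for d
    using field_submodule_retract[OF R m Zs[of d]] by metis
  then obtain z where z: "\<And>d. linear_map R (obj X d) (obj X d) (z d)"
    "\<And>d x. x \<in> carrier (obj X d) \<Longrightarrow> z d x \<in> carrier (cocycles X d)" "\<And>d x. x \<in> carrier (cocycles X d) \<Longrightarrow> z d x = x"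
    by metis
  have "\<exists>q. linear_map R (obj X d) (obj X d) q \<and> (\<forall>x\<in>carrier (obj X d). q x \<in> coboundaries X d) \<and>
      (\<forall>x\<in>coboundaries X d. q x = x)" for d
    using field_submodule_retract[OF R m Bs[of d]] by metis
  then obtain b where b: "\<And>d. linear_map R (obj X d) (obj X d) (b d)"
    "\<And>d x. x \<in> carrier (obj X d) \<Longrightarrow> b d x \<in> coboundaries X d" "\<And>d x. x \<in> coboundaries X d \<Longrightarrow> b d x = x"
    by metis
  note zc = linear_map_closed[OF z(1)] and bc = linear_map_closed[OF b(1)]
  define e where "e d x = z d x \<ominus>\<^bsub>obj X d\<^esub> b d (z d x)" for d x
  define s where "s d y = (let x = SOME x. x \<in> carrier (obj X (d - 1)) \<and> dif X (d - 1) x = y in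
      x \<ominus>\<^bsub>obj X (d - 1)\<^esub> z (d - 1) x)" for d y
  define h where "h d y = s d (b d (z d y))" for d y
  have dif_d: "linear_map R (obj X (d - 1)) (obj X d) (dif X (d - 1))" for d using dif_linear[of "d - 1"] by simp
  have dz: "dif X d (z d x) = \<zero>\<^bsub>obj X (d + 1)\<^esub>" if "x \<in> carrier (obj X d)" for d x
    using z(2)[OF that] by (simp add: cocycles_simps)
  \<comment> \<open>Two preimages differ by a cocycle, which \<open>z\<close> fixes; so
    \<open>x - z x\<close> does not depend on the preimage that was chosen.\<close>
  have s_eq: "s d (dif X (d - 1) x) = x \<ominus>\<^bsub>obj X (d - 1)\<^esub> z (d - 1) x" if x: "x \<in> carrier (obj X (d - 1))" for d x
  proof -
    interpret O: module R "obj X (d - 1)" by (rule m)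
    let ?y = "SOME x'. x' \<in> carrier (obj X (d - 1)) \<and> dif X (d - 1) x' = dif X (d - 1) x"
    have y: "?y \<in> carrier (obj X (d - 1)) \<and> dif X (d - 1) ?y = dif X (d - 1) x"
      by (rule someI[of _ x]) (simp add: x)
    then have yc: "?y \<in> carrier (obj X (d - 1))" by simp
    have xy: "x \<ominus>\<^bsub>obj X (d - 1)\<^esub> ?y \<in> carrier (cocycles X (d - 1))"
      using x y linear_map_diff[OF m m dif_linear x yc] module_diff_self[OF m dif_closed[OF x]]
      by (simp add: cocycles_simps)
    have "x \<ominus>\<^bsub>obj X (d - 1)\<^esub> ?y = z (d - 1) x \<ominus>\<^bsub>obj X (d - 1)\<^esub> z (d - 1) ?y"
      using z(3)[OF xy] linear_map_diff[OF m m z(1) x yc] by simp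
    then have "(x \<ominus>\<^bsub>obj X (d - 1)\<^esub> ?y) \<oplus>\<^bsub>obj X (d - 1)\<^esub> (?y \<ominus>\<^bsub>obj X (d - 1)\<^esub> z (d - 1) x) =
       (z (d - 1) x \<ominus>\<^bsub>obj X (d - 1)\<^esub> z (d - 1) ?y) \<oplus>\<^bsub>obj X (d - 1)\<^esub> (?y \<ominus>\<^bsub>obj X (d - 1)\<^esub> z (d - 1) x)" by simp
    moreover have "(x \<ominus>\<^bsub>obj X (d - 1)\<^esub> ?y) \<oplus>\<^bsub>obj X (d - 1)\<^esub> (?y \<ominus>\<^bsub>obj X (d - 1)\<^esub> z (d - 1) x) = x \<ominus>\<^bsub>obj X (d - 1)\<^esub> z (d - 1) x"
      using x yc zc[OF x] by (simp add: a_minus_def O.a_assoc O.r_neg1)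
    moreover have "(z (d - 1) x \<ominus>\<^bsub>obj X (d - 1)\<^esub> z (d - 1) ?y) \<oplus>\<^bsub>obj X (d - 1)\<^esub> (?y \<ominus>\<^bsub>obj X (d - 1)\<^esub> z (d - 1) x)
        = (?y \<ominus>\<^bsub>obj X (d - 1)\<^esub> z (d - 1) ?y) \<oplus>\<^bsub>obj X (d - 1)\<^esub> (z (d - 1) x \<ominus>\<^bsub>obj X (d - 1)\<^esub> z (d - 1) x)"
      unfolding a_minus_def using x yc zc[OF x] zc[OF yc] by (simp only: O.a_ac O.M.a_closed O.M.a_inv_closed)
    ultimately have "x \<ominus>\<^bsub>obj X (d - 1)\<^esub> z (d - 1) x = ?y \<ominus>\<^bsub>obj X (d - 1)\<^esub> z (d - 1) ?y"
      using zc[OF x] zc[OF yc] yc by (simp add: module_diff_self[OF m])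
    then show ?thesis by (simp add: s_def Let_def)
  qed
  have r_linear: "linear_map R (obj X d) (obj X d) (\<lambda>x. x \<ominus>\<^bsub>obj X d\<^esub> z d x)" for d
    by (intro linear_map_minus m linear_map_id z)
  note rc = linear_map_closed[OF r_linear]
  have s_lin: "linear_map R ((obj X d)\<lparr>carrier := coboundaries X d\<rparr>) (obj X (d - 1)) (s d)" for d
  proof (rule linear_mapI)
    fix x assume "x \<in> carrier ((obj X d)\<lparr>carrier := coboundaries X d\<rparr>)"
    then obtain u where u: "u \<in> carrier (obj X (d - 1))" "x = dif X (d - 1) u" by (auto simp: coboundaries_def)
    show "s d x \<in> carrier (obj X (d - 1))" unfolding u(2) s_eq[OF u(1)] by (rule rc[OF u(1)])
    interpret O: module R "obj X (d - 1)" by (rule m)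
    { fix y assume "y \<in> carrier ((obj X d)\<lparr>carrier := coboundaries X d\<rparr>)"
      then obtain v where v: "v \<in> carrier (obj X (d - 1))" "y = dif X (d - 1) v" by (auto simp: coboundaries_def)
      show "s d (x \<oplus>\<^bsub>(obj X d)\<lparr>carrier := coboundaries X d\<rparr>\<^esub> y) = s d x \<oplus>\<^bsub>obj X (d - 1)\<^esub> s d y"
        using s_eq[where x = "u \<oplus>\<^bsub>obj X (d - 1)\<^esub> v" and d = d] u v
        by (simp add: s_eq linear_map_add[OF dif_d] linear_map_add[OF r_linear]) }
    { fix c assume c: "c \<in> carrier R"
      show "s d (c \<odot>\<^bsub>(obj X d)\<lparr>carrier := coboundaries X d\<rparr>\<^esub> x) = c \<odot>\<^bsub>obj X (d - 1)\<^esub> s d x"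
        using s_eq[where x = "c \<odot>\<^bsub>obj X (d - 1)\<^esub> u" and d = d] u c
        by (simp add: s_eq linear_map_smult[OF dif_d] linear_map_smult[OF r_linear]) }
  qed
  have h_linear: "linear_map R (obj X d) (obj X (d - 1)) (h d)" for d
  proof -
    have "linear_map R (obj X d) ((obj X d)\<lparr>carrier := coboundaries X d\<rparr>) (\<lambda>x. b d (z d x))"
      using linear_map_comp[OF z(1) b(1), of d] b(2) zc by (auto simp: linear_map_def)
    from linear_map_comp[OF this s_lin] show ?thesis by (simp add: h_def[abs_def])
  qed
  have e_linear: "linear_map R (obj X d) (obj X d) (e d)" for d
    unfolding e_def[abs_def] by (intro linear_map_minus m z(1) linear_map_comp[OF z(1) b(1)])
  have e_cocycle: "e d x \<in> carrier (cocycles X d)" if "x \<in> carrier (obj X d)" for d x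
    unfolding e_def using z(2)[OF that] b(2)[OF zc[OF that]] BZ by (intro submodule_diff[OF Zs]) auto
  have e_Z: "e d x = x \<ominus>\<^bsub>obj X d\<^esub> b d x" if "x \<in> carrier (cocycles X d)" for d x
    using z(3)[OF that] by (simp add: e_def)
  have e_B: "e d x = \<zero>\<^bsub>obj X d\<^esub>" if "x \<in> coboundaries X d" for d x
  proof -
    have "x \<in> carrier (obj X d)" using that submodule_subset[OF Bs] by blast
    then show ?thesis unfolding e_Z[OF subsetD[OF BZ that]] b(3)[OF that] by (rule module_diff_self[OF m])
  qed
  have dif_e: "dif X d (e d x) = \<zero>\<^bsub>obj X (d + 1)\<^esub>" if "x \<in> carrier (obj X d)" for d x
    using e_cocycle[OF that] by (simp add: cocycles_simps)
  have difB: "dif X d x \<in> coboundaries X (d + 1)" if "x \<in> carrier (obj X d)" for d x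
    using that by (simp add: coboundaries_def)
  have be: "b d (e d x) = \<zero>\<^bsub>obj X d\<^esub>" if "x \<in> carrier (obj X d)" for d x
    using linear_map_diff[OF m m b(1) zc[OF that] bc[OF zc[OF that]]] b(3)[OF b(2)[OF zc[OF that]]]
      bc[OF zc[OF that]] by (simp add: e_def module_diff_self[OF m])
  have s0: "s d \<zero>\<^bsub>obj X d\<^esub> = \<zero>\<^bsub>obj X (d - 1)\<^esub>" for d
  proof -
    interpret O: module R "obj X (d - 1)" by (rule m)
    show ?thesis using s_eq[OF O.zero_closed] linear_map_zero[OF m m dif_d] linear_map_zero[OF m m r_linear] by simp
  qed
  have h_form: "\<exists>u\<in>carrier (obj X (d - 1)). h d x = u \<ominus>\<^bsub>obj X (d - 1)\<^esub> z (d - 1) u \<and> dif X (d - 1) u = b d (z d x)"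
    if x: "x \<in> carrier (obj X d)" for d x
  proof -
    have "b d (z d x) \<in> coboundaries X d" by (rule b(2)[OF zc[OF x]])
    then obtain u where u: "u \<in> carrier (obj X (d - 1))" "b d (z d x) = dif X (d - 1) u" by (auto simp: coboundaries_def)
    then show ?thesis using s_eq[OF u(1)] by (auto simp: h_def)
  qed
  have zh: "z (d - 1) (h d x) = \<zero>\<^bsub>obj X (d - 1)\<^esub>" if x: "x \<in> carrier (obj X d)" for d x
  proof -
    obtain u where u: "u \<in> carrier (obj X (d - 1))" "h d x = u \<ominus>\<^bsub>obj X (d - 1)\<^esub> z (d - 1) u" using h_form[OF x] by blast
    show ?thesis unfolding u(2) linear_map_diff[OF m m z(1) u(1) zc[OF u(1)]] z(3)[OF z(2)[OF u(1)]]
      by (rule module_diff_self[OF m zc[OF u(1)]])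
  qed
  have "retraction R X e h"
  proof (unfold_locales)
    fix j x assume x: "x \<in> carrier (obj X j)"
    interpret O: module R "obj X j" by (rule m)
    show "e (j + 1) (dif X j x) = dif X j (e j x)" using e_B[OF difB[OF x]] dif_e[OF x] by simp
    have ex: "e j x \<in> carrier (obj X j)" by (rule linear_map_closed[OF e_linear x])
    show "e j (e j x) = e j x"
      using e_Z[OF e_cocycle[OF x]] be[OF x] ex O.minus_equality[of "\<zero>\<^bsub>obj X j\<^esub>" "\<zero>\<^bsub>obj X j\<^esub>"] by (simp add: a_minus_def)
    have b0: "b (j - 1) \<zero>\<^bsub>obj X (j - 1)\<^esub> = \<zero>\<^bsub>obj X (j - 1)\<^esub>" by (rule linear_map_zero[OF m m b(1)])
    have zc0: "\<zero>\<^bsub>obj X (j - 1)\<^esub> \<in> carrier (obj X (j - 1))" by (rule submodule_zero[OF Zs, THEN subsetD[OF submodule_subset[OF Zs]]])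
    show "e (j - 1) (h j x) = \<zero>\<^bsub>obj X (j - 1)\<^esub>"
      unfolding e_def zh[OF x] b0 by (rule module_diff_self[OF m zc0])
    show "h (j - 1) (h j x) = \<zero>\<^bsub>obj X (j - 2)\<^esub>"
      using s0[of "j - 1"] by (simp add: h_def[of "j - 1"] zh[OF x] b0)
    obtain u where u: "u \<in> carrier (obj X (j - 1))" "h j x = u \<ominus>\<^bsub>obj X (j - 1)\<^esub> z (j - 1) u" "dif X (j - 1) u = b j (z j x)"
      using h_form[OF x] by blast
    have dh: "dif X (j - 1) (h j x) = b j (z j x)"
      using dz[OF u(1)] bc[OF zc[OF x]] O.minus_equality[of "\<zero>\<^bsub>obj X j\<^esub>" "\<zero>\<^bsub>obj X j\<^esub>"]
      unfolding u(2) linear_map_diff[OF m m dif_d u(1) zc[OF u(1)]] u(3) by (simp add: a_minus_def)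
    have "b (j + 1) (z (j + 1) (dif X j x)) = dif X j x"
      unfolding z(3)[OF subsetD[OF BZ difB[OF x]]] by (rule b(3)[OF difB[OF x]])
    then have hd: "h (j + 1) (dif X j x) = x \<ominus>\<^bsub>obj X j\<^esub> z j x"
      using s_eq[where x = x and d = "j + 1"] x by (simp add: h_def)
    show "dif X (j - 1) (h j x) \<oplus>\<^bsub>obj X j\<^esub> h (j + 1) (dif X j x) = x \<ominus>\<^bsub>obj X j\<^esub> e j x"
      unfolding dh hd e_def a_minus_def using x zc[OF x] bc[OF zc[OF x]]
      by (simp add: O.minus_add O.a_ac)
  qed (rule e_linear h_linear)+
  moreover have "x \<ominus>\<^bsub>obj X d\<^esub> e d x \<in> coboundaries X d" if x: "x \<in> carrier (cocycles X d)" for d x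
  proof -
    interpret O: module R "obj X d" by (rule m)
    have xc: "x \<in> carrier (obj X d)" using x by (simp add: cocycles_simps)
    have "x \<ominus>\<^bsub>obj X d\<^esub> e d x = b d x"
      unfolding e_Z[OF x] a_minus_def using xc bc[OF xc] by (simp add: O.minus_add O.r_neg2)
    then show ?thesis using b(2)[OF xc] by simp
  qed
  ultimately show thesis using that dif_e e_B by blast
qed

section \<open>Invariance under quasi-isomorphisms\<close>

text \<open>On representatives chosen by the projections, a quasi-isomorphism becomes bijective and can be inverted.\<close>

lemma quasi_inverse:
  fixes X :: "('k, 'a) complex_rec" and Y :: "('k, 'b) complex_rec"
  assumes q: "quasi_isomorphism R X Y f"
    and X: "retraction R X e h" and Y: "retraction R Y e' h'"
    and Xd: "\<And>d x. x \<in> carrier (obj X d) \<Longrightarrow> dif X d (e d x) = \<zero>\<^bsub>obj X (d + 1)\<^esub>"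
    and Yd: "\<And>d y. y \<in> carrier (obj Y d) \<Longrightarrow> dif Y d (e' d y) = \<zero>\<^bsub>obj Y (d + 1)\<^esub>"
    and XB: "\<And>d x. x \<in> coboundaries X d \<Longrightarrow> e d x = \<zero>\<^bsub>obj X d\<^esub>"
    and YB: "\<And>d y. y \<in> coboundaries Y d \<Longrightarrow> e' d y = \<zero>\<^bsub>obj Y d\<^esub>"
    and XZ: "\<And>d x. x \<in> carrier (cocycles X d) \<Longrightarrow> x \<ominus>\<^bsub>obj X d\<^esub> e d x \<in> coboundaries X d"
    and YZ: "\<And>d y. y \<in> carrier (cocycles Y d) \<Longrightarrow> y \<ominus>\<^bsub>obj Y d\<^esub> e' d y \<in> coboundaries Y d"
  obtains g where "cochain_map R Y X g"
    and "\<And>d x. x \<in> carrier (obj X d) \<Longrightarrow> g d (f d (e d x)) = e d x"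
    and "\<And>d y. y \<in> carrier (obj Y d) \<Longrightarrow> e' d (f d (g d y)) = e' d y"
proof -
  interpret X: retraction R X e h by (rule X)
  interpret Y: retraction R Y e' h' by (rule Y)
  have f: "cochain_map R X Y f" using q by (simp add: quasi_isomorphism_def)
  note fl = cochain_mapD(3)[OF f]
  note qd = q[unfolded quasi_isomorphism_iff[OF f], rule_format]
  note mX = X.obj_module and mY = Y.obj_module
  note fc = linear_map_closed[OF fl] and ec = linear_map_closed[OF X.e_linear] and ec' = linear_map_closed[OF Y.e_linear]
  have eZ: "e d x \<in> carrier (cocycles X d)" if "x \<in> carrier (obj X d)" for d x
    using that Xd ec by (simp add: cocycles_simps)
  have eZ': "e' d y \<in> carrier (cocycles Y d)" if "y \<in> carrier (obj Y d)" for d y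
    using that Yd ec' by (simp add: cocycles_simps)
  \<comment> \<open>The inverse sends \<open>y\<close> to the unique element fixed by
    \<open>e\<close> whose image under \<open>f\<close> has the same projection as
    \<open>y\<close>.\<close>
  let ?P = "\<lambda>d y x. x \<in> carrier (obj X d) \<and> e d x = x \<and> e' d (f d x) = e' d y"
  have ex: "\<exists>x. ?P d y x" if y: "y \<in> carrier (obj Y d)" for d y
  proof -
    interpret Yd: module R "obj Y d" by (rule mY)
    obtain x b where x: "x \<in> carrier (cocycles X d)" and b: "b \<in> coboundaries Y d"
      and eq: "e' d y = b \<oplus>\<^bsub>obj Y d\<^esub> f d x"
      using qd[of d] eZ'[OF y] by blast
    have xc: "x \<in> carrier (obj X d)" using x by (simp add: cocycles_simps)
    have bc: "b \<in> carrier (obj Y d)" using b submodule_subset[OF coboundaries_submodule(2)[OF Y.complex]] by blast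
    have "e' d y = e' d (e' d y)" using Y.e_e[OF y] by simp
    also have "\<dots> = e' d (f d x)"
      unfolding eq linear_map_add[OF Y.e_linear bc fc[OF xc]] YB[OF b] using ec'[OF fc[OF xc]] by simp
    finally have 1: "e' d (f d x) = e' d y" by simp
    have "e' d (f d (x \<ominus>\<^bsub>obj X d\<^esub> e d x)) = \<zero>\<^bsub>obj Y d\<^esub>"
      by (rule YB[OF cochain_map_coboundaries[OF f XZ[OF x]]])
    then have "e' d (f d x) \<ominus>\<^bsub>obj Y d\<^esub> e' d (f d (e d x)) = \<zero>\<^bsub>obj Y d\<^esub>"
      unfolding linear_map_diff[OF mX mY fl xc ec[OF xc]] linear_map_diff[OF mY mY Y.e_linear fc[OF xc] fc[OF ec[OF xc]]] .
    then have "e' d (f d x) = e' d (f d (e d x))"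
      by (rule module_diff_eq_zero[OF mY ec'[OF fc[OF xc]] ec'[OF fc[OF ec[OF xc]]]])
    then show ?thesis using 1 ec[OF xc] X.e_e[OF xc] by (intro exI[of _ "e d x"]) simp
  qed
  \<comment> \<open>The difference of two candidates is a cocycle fixed by \<open>e\<close>, and its
    image under \<open>f\<close> is a coboundary because \<open>e'\<close> kills it. Injectivity on
    cohomology makes it a coboundary, and \<open>e\<close> kills coboundaries.\<close>
  have uniq: "x = x'" if x: "?P d y x" and x': "?P d y x'" for d y x x'
  proof -
    let ?w = "x \<ominus>\<^bsub>obj X d\<^esub> x'"
    interpret Xd: module R "obj X d" by (rule mX)
    interpret Yd: module R "obj Y d" by (rule mY)
    have xc: "x \<in> carrier (obj X d)" "x' \<in> carrier (obj X d)" using x x' by auto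
    have wc: "?w \<in> carrier (obj X d)" using xc by simp
    have ew: "e d ?w = ?w" using x x' linear_map_diff[OF mX mX X.e_linear xc] by simp
    have wZ: "?w \<in> carrier (cocycles X d)" using eZ[OF wc] by (simp add: ew)
    have "e' d (f d ?w) = \<zero>\<^bsub>obj Y d\<^esub>"
      unfolding linear_map_diff[OF mX mY fl xc] linear_map_diff[OF mY mY Y.e_linear fc[OF xc(1)] fc[OF xc(2)]]
      using x x' module_diff_self[OF mY ec'[OF fc[OF xc(1)]]] by simp
    then have "f d ?w \<in> coboundaries Y d"
      using YZ[OF cochain_map_cocycles[OF f wZ]] fc[OF wc] Yd.minus_equality[of "\<zero>\<^bsub>obj Y d\<^esub>" "\<zero>\<^bsub>obj Y d\<^esub>"]
      by (simp add: a_minus_def)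
    then have "?w \<in> coboundaries X d" using qd[of d] wZ by blast
    then have "?w = \<zero>\<^bsub>obj X d\<^esub>" using XB ew by simp
    then show ?thesis by (rule module_diff_eq_zero[OF mX xc])
  qed
  define g where "g d y = (SOME x. ?P d y x)" for d y
  have g: "?P d y (g d y)" if "y \<in> carrier (obj Y d)" for d y
    unfolding g_def using ex[OF that] by (rule someI_ex)
  have g_eq: "g d y = x" if "y \<in> carrier (obj Y d)" "?P d y x" for d y x
    using uniq[OF g[OF that(1)] that(2)] .
  have g_linear: "linear_map R (obj Y d) (obj X d) (g d)" for d
  proof (rule linear_mapI)
    interpret Xd: module R "obj X d" by (rule mX)
    interpret Yd: module R "obj Y d" by (rule mY)
    fix y assume y: "y \<in> carrier (obj Y d)"
    then show "g d y \<in> carrier (obj X d)" using g by blast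
    { fix y' assume y': "y' \<in> carrier (obj Y d)"
      show "g d (y \<oplus>\<^bsub>obj Y d\<^esub> y') = g d y \<oplus>\<^bsub>obj X d\<^esub> g d y'"
        using g[OF y] g[OF y'] fc y y'
        by (intro g_eq) (simp_all add: linear_map_add[OF X.e_linear] linear_map_add[OF fl] linear_map_add[OF Y.e_linear]) }
    { fix c assume c: "c \<in> carrier R"
      show "g d (c \<odot>\<^bsub>obj Y d\<^esub> y) = c \<odot>\<^bsub>obj X d\<^esub> g d y"
        using g[OF y] fc y c
        by (intro g_eq) (simp_all add: linear_map_smult[OF X.e_linear] linear_map_smult[OF fl] linear_map_smult[OF Y.e_linear]) }
  qed
  have "cochain_map R Y X g"
    unfolding cochain_map_def
  proof (intro conjI allI ballI X.complex Y.complex g_linear)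
    fix d y assume y: "y \<in> carrier (obj Y d)"
    interpret Xd: module R "obj X (d + 1)" by (rule mX)
    \<comment> \<open>\<open>g\<close> commutes with the differentials because both composites are
      zero: \<open>e'\<close> kills coboundaries, and the values of \<open>g\<close> are fixed by
      \<open>e\<close>, hence are cocycles.\<close>
    have dy: "dif Y d y \<in> coboundaries Y (d + 1)" using y by (simp add: coboundaries_def)
    have "?P (d + 1) (dif Y d y) \<zero>\<^bsub>obj X (d + 1)\<^esub>"
      using YB[OF dy] linear_map_zero[OF mX mX X.e_linear] linear_map_zero[OF mX mY fl] linear_map_zero[OF mY mY Y.e_linear]
      by simp
    then have "g (d + 1) (dif Y d y) = \<zero>\<^bsub>obj X (d + 1)\<^esub>" by (rule g_eq[OF Y.dif_closed[OF y]])
    also have "\<dots> = dif X d (g d y)" using Xd[of "g d y" d] g[OF y] by simp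
    finally show "g (d + 1) (dif Y d y) = dif X d (g d y)" .
  qed
  moreover have "g d (f d (e d x)) = e d x" if "x \<in> carrier (obj X d)" for d x
    using that ec fc X.e_e by (intro g_eq) simp_all
  moreover have "e' d (f d (g d y)) = e' d y" if "y \<in> carrier (obj Y d)" for d y
    using g[OF that] by blast
  ultimately show thesis by (rule that)
qed

lemma tensor_power_map_equivariant:
  fixes X :: "('k, 'a) complex_rec" and Y :: "('k, 'b) complex_rec"
  assumes f: "cochain_map R X Y f"
  shows "equivariant R n (tensor_power R X n) (tensor_power R Y n) (tensor_power_map R Y f n)"
proof -
  interpret X: cochain R X by (rule cochain.intro[OF cochain_mapD(1)[OF f]])
  interpret Y: cochain R Y by (rule cochain.intro[OF cochain_mapD(2)[OF f]])
  note lin = tensor_power_map_linear[OF X.graded_module_axioms Y.graded_module_axioms cochain_mapD(3)[OF f]]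
  show ?thesis
    unfolding equivariant_def X.obj_tensor_power Y.obj_tensor_power
    using lin tensor_power_map_act[OF X.graded_module_axioms Y.graded_module_axioms cochain_mapD(3)[OF f]]
      tensor_power_map_tdif[OF f] linear_map_closed[OF lin]
    by (simp add: X.tensor_dif Y.tensor_dif)
qed

text \<open>This isolates what is used of the operad: in a fixed arity, a complex with an action and
  a linear projection whose translates decompose it.\<close>

locale split_sym_cochain =
  fixes R :: "('k, 'm) ring_scheme" and n :: nat and P :: "('k, 'e) sym_complex" and proj :: "int \<Rightarrow> 'e \<Rightarrow> 'e"
  assumes P: "sym_cochain R n P"
    and proj_linear: "linear_map R (obj P i) (obj P i) (proj i)"
    and proj_sum: "a \<in> carrier (obj P i) \<Longrightarrow>
      (\<Oplus>\<^bsub>obj P i\<^esub>\<rho>\<in>{\<rho>. \<rho> permutes {1..n}}. act P (inv_into UNIV \<rho>) i (proj i (act P \<rho> i a))) = a"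
begin

abbreviation extended_power where
  "extended_power X \<equiv> bal_tensor R n P (tensor_power R X n)"

abbreviation extended_power_map where
  "extended_power_map Y f \<equiv> bal_tensor_map R n P (tensor_power R Y n) (tensor_power_map R Y f n)"

lemma extended_power_map_cochain:
  fixes X :: "('k, 'a) complex_rec" and Y :: "('k, 'b) complex_rec"
  assumes f: "cochain_map R X Y f"
  shows "cochain_map R (extended_power X) (extended_power Y) (extended_power_map Y f)"
  by (rule bal_tensor_map_cochain[OF P _ _ tensor_power_map_equivariant[OF f]])
     (intro cochain.tensor_power_sym_cochain cochain.intro cochain_mapD[OF f])+

lemma extended_power_map_comp:
  fixes X :: "('k, 'a) complex_rec" and Y :: "('k, 'b) complex_rec" and Z :: "('k, 'c) complex_rec"
  assumes f: "cochain_map R X Y f" and g: "cochain_map R Y Z g" and h: "cochain_map R X Z h"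
    and gf: "\<And>d x. x \<in> carrier (obj X d) \<Longrightarrow> g d (f d x) = h d x"
    and z: "z \<in> carrier (obj (extended_power X) d)"
  shows "extended_power_map Z g d (extended_power_map Y f d z) = extended_power_map Z h d z"
proof (rule bal_tensor_map_comp[OF P _ _ _ tensor_power_map_equivariant[OF f] tensor_power_map_equivariant[OF g] tensor_power_map_equivariant[OF h]])
  interpret X: cochain R X by (rule cochain.intro[OF cochain_mapD(1)[OF f]])
  interpret Y: cochain R Y by (rule cochain.intro[OF cochain_mapD(2)[OF f]])
  interpret Z: cochain R Z by (rule cochain.intro[OF cochain_mapD(2)[OF g]])
  show "sym_cochain R n (tensor_power R X n)" "sym_cochain R n (tensor_power R Y n)" "sym_cochain R n (tensor_power R Z n)"
    by (rule X.tensor_power_sym_cochain Y.tensor_power_sym_cochain Z.tensor_power_sym_cochain)+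
  show "z \<in> carrier (bal_module R n P (tensor_power R X n) d)" using z by (simp add: bal_tensor_def)
  fix d t assume "t \<in> carrier (obj (tensor_power R X n) d)"
  then have t: "t \<in> carrier (tensor_module R X n d)" by (simp add: X.obj_tensor_power)
  note gm = X.graded_module_axioms Y.graded_module_axioms Z.graded_module_axioms
  show "tensor_power_map R Z g n d (tensor_power_map R Y f n d t) = tensor_power_map R Z h n d t"
    unfolding tensor_power_map_comp[OF gm cochain_mapD(3)[OF f] cochain_mapD(3)[OF g] t]
    by (rule tensor_power_map_cong[OF gm(1,3) cochain_mapD(3)[OF h] gf t])
qed

text \<open>The projection \<open>e\<close> induces the identity on the cohomology of the extended
  power, although the homotopy on the tensor power is not equivariant.\<close>

lemma extended_power_cocycle:
  fixes X :: "('k, 'a) complex_rec"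
  assumes r: "retraction R X e h" and z: "z \<in> carrier (cocycles (extended_power X) d)"
  shows "z \<ominus>\<^bsub>obj (extended_power X) d\<^esub> extended_power_map X e d z \<in> coboundaries (extended_power X) d"
proof -
  interpret X: retraction R X e h by (rule r)
  \<comment> \<open>The filtration counts letters from the image of \<open>h\<close> and reaches
    zero at level \<open>Suc n\<close>, as a word has \<open>n\<close> letters.\<close>
  interpret balanced_retraction R n P "tensor_power R X n" proj "tensor_power_map R X e n" "X.thom n" "\<lambda>N. X.hom_filtration N n" "Suc n"
  proof (unfold_locales, unfold X.obj_tensor_power)
    show "equivariant R n (tensor_power R X n) (tensor_power R X n) (tensor_power_map R X e n)"
      by (rule tensor_power_map_equivariant[OF X.e_cochain_map])
    fix j x assume x: "x \<in> carrier (tensor_module R X n j)"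
    show "tensor_power_map R X e n j (tensor_power_map R X e n j x) = tensor_power_map R X e n j x"
      unfolding tensor_power_map_comp[OF X.graded_module_axioms X.graded_module_axioms X.graded_module_axioms X.e_linear X.e_linear x]
      by (rule tensor_power_map_cong[OF X.graded_module_axioms X.graded_module_axioms X.e_linear X.e_e x])
    show "tensor_power_map R X e n (j - 1) (X.thom n j x) = \<zero>\<^bsub>tensor_module R X n (j - 1)\<^esub>"
      by (rule X.tproj_thom[OF x])
    have "X.thom n j x \<in> carrier (tensor_module R X n (j - 1))" by (rule X.thom_closed[OF _ x]) simp
    then show "dif (tensor_power R X n) (j - 1) (X.thom n j x) \<oplus>\<^bsub>tensor_module R X n j\<^esub> X.thom n (j + 1) (dif (tensor_power R X n) j x) =
        x \<ominus>\<^bsub>tensor_module R X n j\<^esub> tensor_power_map R X e n j x"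
      using X.tensor_homotopy[OF x] x by (simp add: X.tensor_dif)
  next
    fix j show "linear_map R (tensor_module R X n j) (tensor_module R X n (j - 1)) (X.thom n j)"
      by (rule X.thom_linear) simp
    show "X.hom_filtration 0 n j = carrier (tensor_module R X n j)" by (rule X.hom_filtration_0)
    show "X.hom_filtration (Suc n) n j \<subseteq> {\<zero>\<^bsub>tensor_module R X n j\<^esub>}" by (rule X.hom_filtration_gt) simp
    fix N show "X.hom_filtration N n j \<subseteq> carrier (tensor_module R X n j)"
      by (rule submodule_subset[OF X.hom_filtration_submodule])
    fix x assume x: "x \<in> X.hom_filtration N n j"
    then show "X.thom n j x \<in> X.hom_filtration (Suc N) n (j - 1)" by (rule X.thom_hom_filtration)
    fix \<sigma> assume "\<sigma> permutes {1..n}"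
    then show "act (tensor_power R X n) \<sigma> j x \<in> X.hom_filtration N n j" using x by (rule X.tact_hom_filtration)
  qed (rule P X.tensor_power_sym_cochain proj_linear proj_sum, assumption?)+
  have "z \<in> carrier (bal_module R n P (tensor_power R X n) d)"
    "dif (extended_power X) d z = \<zero>\<^bsub>bal_module R n P (tensor_power R X n) (d + 1)\<^esub>"
    using z by (simp_all add: cocycles_simps) (simp_all add: bal_tensor_def)
  from cocycle_homologous_to_projection[OF this] show ?thesis
    by (auto simp: bal_tensor_def coboundaries_def)
qed

text \<open>A map \<open>g\<close> in the other direction inverts \<open>f\<close> only in the
  presence of the projections \<open>e\<close> and \<open>e'\<close>. By functoriality the same
  holds on extended powers, and there the projections act as the identity on cohomology.\<close>

lemma extended_power_quasi_isomorphism: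
  fixes X :: "('k, 'a) complex_rec" and Y :: "('k, 'b) complex_rec"
  assumes R: "field R" and q: "quasi_isomorphism R X Y f"
  shows "quasi_isomorphism R (extended_power X) (extended_power Y) (extended_power_map Y f)"
proof -
  have f: "cochain_map R X Y f" using q by (simp add: quasi_isomorphism_def)
  interpret X: cochain R X by (rule cochain.intro[OF cochain_mapD(1)[OF f]])
  interpret Y: cochain R Y by (rule cochain.intro[OF cochain_mapD(2)[OF f]])
  obtain e h where X: "retraction R X e h"
    and X': "\<And>d x. x \<in> carrier (obj X d) \<Longrightarrow> dif X d (e d x) = \<zero>\<^bsub>obj X (d + 1)\<^esub>"
      "\<And>d x. x \<in> coboundaries X d \<Longrightarrow> e d x = \<zero>\<^bsub>obj X d\<^esub>"
      "\<And>d x. x \<in> carrier (cocycles X d) \<Longrightarrow> x \<ominus>\<^bsub>obj X d\<^esub> e d x \<in> coboundaries X d"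
    using X.retraction_exists[OF R] by blast
  obtain e' h' where Y: "retraction R Y e' h'"
    and Y': "\<And>d y. y \<in> carrier (obj Y d) \<Longrightarrow> dif Y d (e' d y) = \<zero>\<^bsub>obj Y (d + 1)\<^esub>"
      "\<And>d y. y \<in> coboundaries Y d \<Longrightarrow> e' d y = \<zero>\<^bsub>obj Y d\<^esub>"
      "\<And>d y. y \<in> carrier (cocycles Y d) \<Longrightarrow> y \<ominus>\<^bsub>obj Y d\<^esub> e' d y \<in> coboundaries Y d"
    using Y.retraction_exists[OF R] by blast
  obtain g where g: "cochain_map R Y X g"
    and gf: "\<And>d x. x \<in> carrier (obj X d) \<Longrightarrow> g d (f d (e d x)) = e d x"
    and fg: "\<And>d y. y \<in> carrier (obj Y d) \<Longrightarrow> e' d (f d (g d y)) = e' d y"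
    using quasi_inverse[OF q X Y X'(1) Y'(1) X'(2) Y'(2) X'(3) Y'(3)] by blast
  have e: "cochain_map R X X e" and e': "cochain_map R Y Y e'"
    by (rule retraction.e_cochain_map[OF X], rule retraction.e_cochain_map[OF Y])
  note fe = cochain_map_comp[OF e f] and fg' = cochain_map_comp[OF g f]
  note ep = extended_power_map_cochain
  show ?thesis
  proof (rule quasi_isomorphism_by_projections[OF ep[OF f] ep[OF g], where E = "extended_power_map X e" and E' = "extended_power_map Y e'"])
    show "x \<in> carrier (obj (extended_power X) d) \<Longrightarrow> extended_power_map X e d x \<in> carrier (obj (extended_power X) d)" for d x
      by (rule linear_map_closed[OF cochain_mapD(3)[OF ep[OF e]]])
    show "y \<in> carrier (obj (extended_power Y) d) \<Longrightarrow> extended_power_map Y e' d y \<in> carrier (obj (extended_power Y) d)" for d y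
      by (rule linear_map_closed[OF cochain_mapD(3)[OF ep[OF e']]])
    show "x \<in> carrier (cocycles (extended_power X) d) \<Longrightarrow>
        x \<ominus>\<^bsub>obj (extended_power X) d\<^esub> extended_power_map X e d x \<in> coboundaries (extended_power X) d" for d x
      by (rule extended_power_cocycle[OF X])
    show "y \<in> carrier (cocycles (extended_power Y) d) \<Longrightarrow>
        y \<ominus>\<^bsub>obj (extended_power Y) d\<^esub> extended_power_map Y e' d y \<in> coboundaries (extended_power Y) d" for d y
      by (rule extended_power_cocycle[OF Y])
    fix d
    show "extended_power_map X g d (extended_power_map Y f d (extended_power_map X e d x)) = extended_power_map X e d x"
      if x: "x \<in> carrier (obj (extended_power X) d)" for x
      unfolding extended_power_map_comp[OF e f fe refl x] by (rule extended_power_map_comp[OF fe g e gf x])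
    show "extended_power_map Y e' d (extended_power_map Y f d (extended_power_map X g d y)) = extended_power_map Y e' d y"
      if y: "y \<in> carrier (obj (extended_power Y) d)" for y
      unfolding extended_power_map_comp[OF g f fg' refl y] by (rule extended_power_map_comp[OF fg' e' e' fg y])
  qed
qed

end

text \<open>The projection has the same formula in every degree, since it only reads the last
  permutation of the tuples at each stage.\<close>

lemma stable_barratt_eccles_split:
  assumes "cring R"
  shows "split_sym_cochain R n (dagger (stable_barratt_eccles R) n) (\<lambda>i. be_complex.stable_proj R)"
proof -
  interpret be_complex R n by (rule be_complex.intro[OF assms])
  show ?thesis
    by (rule split_sym_cochain.intro)
       (simp_all add: stable_dagger_sym_cochain stable_dagger_simps(1) stable_proj_linear stable_proj_sum[unfolded stable_dagger_simps(1)])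
qed

theorem operad_monad_stable_quasi_isomorphism:
  fixes X :: "('k, 'a) complex_rec" and Y :: "('k, 'b) complex_rec"
  assumes "field R" "quasi_isomorphism R X Y f"
  shows "quasi_isomorphism R (operad_monad R (dagger (stable_barratt_eccles R)) X)
    (operad_monad R (dagger (stable_barratt_eccles R)) Y) (operad_monad_map R (dagger (stable_barratt_eccles R)) Y f)"
proof -
  have "cring R" using assms(1) by (simp add: field_def domain_def)
  note split = split_sym_cochain.extended_power_quasi_isomorphism[OF stable_barratt_eccles_split[OF this] assms]
  show ?thesis
    unfolding operad_monad_def operad_monad_map_def[abs_def]
    by (rule direct_sum_quasi_isomorphism[OF split])
qed

theorem theorem1p1:
  fixes p :: nat
    and X :: "(int, 'a) complex_rec"
    and Y :: "(int, 'b) complex_rec"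
    and f :: "int \<Rightarrow> 'a \<Rightarrow> 'b"
  assumes "prime p"
    and "quasi_isomorphism (residue_ring (int p)) X Y f"
  shows "quasi_isomorphism (residue_ring (int p))
           (operad_monad (residue_ring (int p)) (dagger (stable_barratt_eccles (residue_ring (int p)))) X)
           (operad_monad (residue_ring (int p)) (dagger (stable_barratt_eccles (residue_ring (int p)))) Y)
           (operad_monad_map (residue_ring (int p)) (dagger (stable_barratt_eccles (residue_ring (int p)))) Y f)"
  using residues_prime.is_field[OF residues_prime.intro[OF assms(1)]] assms(2)
  by (rule operad_monad_stable_quasi_isomorphism)

end
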